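(* Fix $\theta\in\mathbb{R}$. There exists $a_0>0$ such that for every $0<a<a_0$ the following holds. Under the stationary measure $\mu^n_{\rm ss}$ of the Markov process with generator $L_n=n^2L_n^{\rm ex}+aL_n^{\rm G}$, the fields $y^n$ converge weakly, as $n\to\infty$, to a (centered) Gaussian field $y$ on $\{H\in L^2(\mathbb{T}):\langle H\rangle=0\}$ with covariance $$\mathbb{E}[y(H)y(G)]=\frac14\langle H,G\rangle+\frac a2\big\langle H,(-\Delta)^{-1}G\big\rangle .$$ Here weak convergence means that for all finite families $H_1,\dots,H_k$ of smooth functions $\mathbb{T}\to\mathbb{R}$ with $\langle H_i\rangle=0$, the vector $(y^n(H_1),\dots,y^n(H_k))$ under $\mu^n_{\rm ss}$ converges in distribution to $(y(H_1),\dots,y(H_k))$.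
   Context: Throughout $n$ ranges over positive integers with $n>\theta^2$. $\mathbb{T}_n=\mathbb{Z}/n\mathbb{Z}$, $\Omega_n=\{0,1\}^{\mathbb{T}_n}$ with elements $\eta=(\eta(x))_{x\in\mathbb{T}_n}$, and $\sigma(x)=2\eta(x)-1$. Let $\gamma=\gamma_n=\frac12\left(1-\frac{\theta}{\sqrt n}\right)\in(0,1)$. For $f:\Omega_n\to\mathbb{R}$, $$L_n^{\rm ex}f(\eta)=\sum_{x\in\mathbb{T}_n}\{f(\eta^{x,x+1})-f(\eta)\},\qquad L_n^{\rm G}f(\eta)=\sum_{x\in\mathbb{T}_n}c_x(\eta)\{f(\eta^x)-f(\eta)\},$$ where $\eta^{x,x+1}$ is $\eta$ with the values at $x$ and $x+1$ exchanged, $\eta^x$ is $\eta$ with the value at $x$ replaced by $1-\eta(x)$, and $$c_x(\eta)=1-\gamma\sigma(x)(\sigma(x-1)+\sigma(x+1))+\gamma^2\sigma(x-1)\sigma(x+1).$$ For $a>0$, $L_n=n^2L_n^{\rm ex}+aL_n^{\rm G}$ generates an irreducible continuous-time Markov chain on the finite set $\Omega_n$; $\mu^n_{\rm ss}$ denotes its unique invariant probability measure. $\mathbb{T}=\mathbb{R}/\mathbb{Z}$ is the continuous torus, $\langle\cdot,\cdot\rangle$ the scalar product of $L^2(\mathbb{T})$, $\langle H\rangle=\int_{\mathbb{T}}H(u)\,du$, and $\Delta$ the Laplacian (second derivative) on $\mathbb{T}$, so that $(-\Delta)^{-1}$ is well defined on mean-zero functions. For smooth $H:\mathbb{T}\to\mathbb{R}$,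 $$y^n(H)=\frac1{\sqrt n}\sum_{x\in\mathbb{T}_n}H(x/n)\,[\eta(x)-1/2].$$ *)

theory Defs
  imports "HOL-Probability.Probability"
begin

text \<open>The discrete torus \<open>\<int>/n\<int>\<close> is represented by \<open>{0..<n}\<close> with arithmetic modulo \<open>n\<close>.\<close>

definition torus :: "nat \<Rightarrow> int set" where
  "torus n = {0..<int n}"

definition Omega :: "nat \<Rightarrow> (int \<Rightarrow> nat) set" where
  "Omega n = torus n \<rightarrow>\<^sub>E {0, 1}"

definition spin :: "nat \<Rightarrow> (int \<Rightarrow> nat) \<Rightarrow> int \<Rightarrow> real" where
  "spin n \<eta> x = 2 * real (\<eta> (x mod int n)) - 1"

definition exchange :: "(int \<Rightarrow> nat) \<Rightarrow> int \<Rightarrow> int \<Rightarrow> (int \<Rightarrow> nat)" where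
  "exchange \<eta> x y = \<eta>(x := \<eta> y, y := \<eta> x)"

definition flip :: "(int \<Rightarrow> nat) \<Rightarrow> int \<Rightarrow> (int \<Rightarrow> nat)" where
  "flip \<eta> x = \<eta>(x := 1 - \<eta> x)"

definition gam :: "real \<Rightarrow> nat \<Rightarrow> real" where
  "gam \<theta> n = (1 - \<theta> / sqrt (real n)) / 2"

definition flip_rate :: "real \<Rightarrow> nat \<Rightarrow> int \<Rightarrow> (int \<Rightarrow> nat) \<Rightarrow> real" where
  "flip_rate \<theta> n x \<eta> =
     1 - gam \<theta> n * spin n \<eta> x * (spin n \<eta> (x - 1) + spin n \<eta> (x + 1))
       + (gam \<theta> n)\<^sup>2 * spin n \<eta> (x - 1) * spin n \<eta> (x + 1)"

definition L_ex :: "nat \<Rightarrow> ((int \<Rightarrow> nat) \<Rightarrow> real) \<Rightarrow> (int \<Rightarrow> nat) \<Rightarrow> real" where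
  "L_ex n f \<eta> = (\<Sum>x\<in>torus n. f (exchange \<eta> x ((x + 1) mod int n)) - f \<eta>)"

definition L_G :: "real \<Rightarrow> nat \<Rightarrow> ((int \<Rightarrow> nat) \<Rightarrow> real) \<Rightarrow> (int \<Rightarrow> nat) \<Rightarrow> real" where
  "L_G \<theta> n f \<eta> = (\<Sum>x\<in>torus n. flip_rate \<theta> n x \<eta> * (f (flip \<eta> x) - f \<eta>))"

definition gen :: "real \<Rightarrow> real \<Rightarrow> nat \<Rightarrow> ((int \<Rightarrow> nat) \<Rightarrow> real) \<Rightarrow> (int \<Rightarrow> nat) \<Rightarrow> real" where
  "gen \<theta> a n f \<eta> = (real n)\<^sup>2 * L_ex n f \<eta> + a * L_G \<theta> n f \<eta>"

text \<open>The transition semigroup \<open>exp (t L)\<close> of the continuous-time Markov chain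
  with generator \<open>L\<close> on a finite set.\<close>

definition semigroup_of :: "(('s \<Rightarrow> real) \<Rightarrow> 's \<Rightarrow> real) \<Rightarrow> real \<Rightarrow> ('s \<Rightarrow> real) \<Rightarrow> 's \<Rightarrow> real" where
  "semigroup_of L t f \<eta> = (\<Sum>k. t ^ k / fact k * (L ^^ k) f \<eta>)"

definition invariant_pmf :: "'s set \<Rightarrow> (('s \<Rightarrow> real) \<Rightarrow> 's \<Rightarrow> real) \<Rightarrow> 's pmf \<Rightarrow> bool" where
  "invariant_pmf S L \<mu> \<longleftrightarrow> set_pmf \<mu> \<subseteq> S \<and>
     (\<forall>t\<ge>0. \<forall>f. measure_pmf.expectation \<mu> (semigroup_of L t f) = measure_pmf.expectation \<mu> f)"

definition mu_ss :: "real \<Rightarrow> real \<Rightarrow> nat \<Rightarrow> (int \<Rightarrow> nat) pmf" where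
  "mu_ss \<theta> a n = (THE \<mu>. invariant_pmf (Omega n) (gen \<theta> a n) \<mu>)"

definition fluct_field :: "nat \<Rightarrow> (real \<Rightarrow> real) \<Rightarrow> (int \<Rightarrow> nat) \<Rightarrow> real" where
  "fluct_field n H \<eta> =
     1 / sqrt (real n) * (\<Sum>x\<in>torus n. H (of_int x / real n) * (real (\<eta> x) - 1 / 2))"

text \<open>Functions on \<open>\<real>/\<int>\<close> are represented by \<open>1\<close>-periodic functions on \<open>\<real>\<close>.\<close>

definition periodic1 :: "(real \<Rightarrow> real) \<Rightarrow> bool" where
  "periodic1 H \<longleftrightarrow> (\<forall>u. H (u + 1) = H u)"

definition torus_mean :: "(real \<Rightarrow> real) \<Rightarrow> real" where
  "torus_mean H = set_lebesgue_integral lborel {0..1} H"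

definition torus_inner :: "(real \<Rightarrow> real) \<Rightarrow> (real \<Rightarrow> real) \<Rightarrow> real" where
  "torus_inner H G = set_lebesgue_integral lborel {0..1} (\<lambda>u. H u * G u)"

text \<open>Elements of \<open>L\<^sup>2\<close> are represented by Borel functions rather than by classes modulo
  null sets.\<close>

definition L2_mean_zero :: "(real \<Rightarrow> real) set" where
  "L2_mean_zero = {H. H \<in> borel_measurable borel \<and> periodic1 H \<and>
     set_integrable lborel {0..1} (\<lambda>u. (H u)\<^sup>2) \<and> torus_mean H = 0}"

definition smooth_mean_zero :: "(real \<Rightarrow> real) set" where
  "smooth_mean_zero = {H. periodic1 H \<and> (\<forall>k x. (deriv ^^ k) H differentiable (at x)) \<and> torus_mean H = 0}"

text \<open>\<open>F\<close> solves \<open>-F'' = G\<close> on the torus, with \<open>F\<close> in the Sobolev space \<open>H\<^sup>2\<close> and mean zero: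
  \<open>F\<close> is differentiable and \<open>F'\<close> is an indefinite integral of \<open>-G\<close>. For continuous \<open>G\<close>
  this is the classical equation. Such \<open>F\<close> is continuous, hence unique as a function and
  not only up to null sets.\<close>

definition solves_poisson :: "(real \<Rightarrow> real) \<Rightarrow> (real \<Rightarrow> real) \<Rightarrow> bool" where
  "solves_poisson G F \<longleftrightarrow> periodic1 F \<and> torus_mean F = 0 \<and>
     (\<forall>x. F differentiable (at x)) \<and>
     (\<forall>x y. x \<le> y \<longrightarrow> deriv F y - deriv F x = set_lebesgue_integral lborel {x..y} (\<lambda>u. - G u))"

definition inv_neg_laplacian :: "(real \<Rightarrow> real) \<Rightarrow> (real \<Rightarrow> real)" where
  "inv_neg_laplacian G = (THE F. solves_poisson G F)"

text \<open>Real Gaussian variables; the degenerate case of zero variance (\<open>s = 0\<close>) is included.\<close>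

definition gaussian_rv :: "'w measure \<Rightarrow> ('w \<Rightarrow> real) \<Rightarrow> bool" where
  "gaussian_rv M X \<longleftrightarrow> X \<in> borel_measurable M \<and>
     (\<exists>m s. distr M borel X = distr std_normal_distribution borel (\<lambda>z. m + s * z))"

definition centered_gaussian_field ::
  "'w measure \<Rightarrow> 'h set \<Rightarrow> ('h \<Rightarrow> 'w \<Rightarrow> real) \<Rightarrow> ('h \<Rightarrow> 'h \<Rightarrow> real) \<Rightarrow> bool" where
  "centered_gaussian_field M V y C \<longleftrightarrow> prob_space M \<and>
     (\<forall>F c. finite F \<and> F \<subseteq> V \<longrightarrow> gaussian_rv M (\<lambda>\<omega>. \<Sum>H\<in>F. c H * y H \<omega>)) \<and>
     (\<forall>H\<in>V. prob_space.expectation M (y H) = 0) \<and>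
     (\<forall>H\<in>V. \<forall>G\<in>V. prob_space.expectation M (\<lambda>\<omega>. y H \<omega> * y G \<omega>) = C H G)"

definition limit_cov :: "real \<Rightarrow> (real \<Rightarrow> real) \<Rightarrow> (real \<Rightarrow> real) \<Rightarrow> real" where
  "limit_cov a H G = 1 / 4 * torus_inner H G + a / 2 * torus_inner H (inv_neg_laplacian G)"

text \<open>Points of \<open>Euclidean_space k\<close> are the sequences that vanish from index \<open>k\<close> on.\<close>

definition vec :: "nat \<Rightarrow> (nat \<Rightarrow> real) \<Rightarrow> (nat \<Rightarrow> real)" where
  "vec k v = (\<lambda>i. if i < k then v i else 0)"

definition conv_in_distr ::
  "nat \<Rightarrow> (nat \<Rightarrow> 's measure) \<Rightarrow> (nat \<Rightarrow> 's \<Rightarrow> nat \<Rightarrow> real) \<Rightarrow>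
   'w measure \<Rightarrow> ('w \<Rightarrow> nat \<Rightarrow> real) \<Rightarrow> bool" where
  "conv_in_distr k M X N Y \<longleftrightarrow>
     (\<forall>\<phi>. continuous_map (Euclidean_space k) euclideanreal \<phi> \<and>
          bounded (\<phi> ` topspace (Euclidean_space k)) \<longrightarrow>
        (\<lambda>n. \<integral>\<omega>. \<phi> (vec k (X n \<omega>)) \<partial>M n) \<longlonglongrightarrow> (\<integral>\<omega>. \<phi> (vec k (Y \<omega>)) \<partial>N))"

end

theory Submission
 imports Defs
begin

text \<open>
 Write \<open>m\<close> for the magnetization density and \<open>D\<close> for the exchange Dirichlet form of the square
 root of the stationary weight. Testing stationarity with the logarithm of the weight relative to
 \<open>exp (n m^2 / 2)\<close>, for which the term of order \<open>n m^2\<close> of the Glauber drift cancels, bounds \<open>D\<close> by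
 \<open>a\<close> times a drift. An integration by parts along exchanges replaces spins by block averages, so that
 the drift is at most a constant times \<open>1 + D + n E m^4\<close>; the test function \<open>m^2\<close> gives
 \<open>n E m^4 = O(1 + D)\<close>. Hence \<open>D \<le> 1\<close> for small \<open>a\<close>.

 With these bounds, stationarity applied to \<open>cis (y (p'))\<close> shows that
 \<open>E (cis (y (p'))) * exp (C (p) / 2)\<close>, \<open>C (p)\<close> being the limiting variance, is almost invariant
 under a step of the discrete heat equation for \<open>p\<close>. Following the heat flow for time \<open>T n^2\<close>, along
 which \<open>p\<close> tends to \<open>0\<close>, the product is close to \<open>1\<close>: the characteristic functions converge
 to Gaussian ones. Trigonometric approximation turns this into convergence in distribution, and
 Kolmogorov's theorem provides the limit field.
\<close>

section \<open>Sums over the discrete torus\<close>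

text \<open>No formula for the stationary weight is used: every estimate is stationarity tested on a
  suitable function. The chain is critical. Since \<open>1 - 2 * gam\<close> is \<theta> / sqrt n,
  the linear restoring force on \<open>m\<close> vanishes to leading order and a cubic one takes
  over; hence \<open>m\<close> lives on the scale n^(-1/4), and n E m^4 is its natural moment. That
  is too large for a central limit theorem, whence the test functions of mean zero, which do not see
  \<open>m\<close>. Such an H is p' with p periodic, and <H, (-Laplacian)^(-1) H> = <p, p>. So the
  limiting variance is the local expression 1/4 |p'|^2 + a/2 |p|^2, and its decay along the heat
  flow of p matches the quadratic terms that the generator produces.

  Windows have length l of order n^(3/4): a replacement costs l^2 / n times E m^2, the blocks left
  over cost n / l times E |m|, and for m of order n^(-1/4) both are then bounded. Smallness of
  \<open>a\<close> enters once, to close D <= a c (D + 1).\<close>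

definition periodic_mod :: "nat => (int => 'b) => bool" where
 "periodic_mod n F \<longleftrightarrow> (\<forall>x. F (x mod int n) = F x)"

lemma periodic_modD: "periodic_mod n F ==> F (x mod int n) = F x"
 by (simp add: periodic_mod_def)

lemma periodic_mod_shift: "periodic_mod n F ==> periodic_mod n (\<lambda>x. F (x + k))"
 unfolding periodic_mod_def by (metis mod_add_left_eq)

lemma periodic_mod_shift_diff: "periodic_mod n F ==> periodic_mod n (\<lambda>x. F (x - k))"
 unfolding periodic_mod_def by (metis mod_diff_left_eq)

lemma periodic_mod_const: "periodic_mod n (\<lambda>x. c)"
 by (simp add: periodic_mod_def)

lemma periodic_mod_comp: "periodic_mod n F ==> periodic_mod n (\<lambda>x. f (F x))"
 by (simp add: periodic_mod_def)

lemma periodic_mod_comp2: "periodic_mod n F ==> periodic_mod n G ==> periodic_mod n (\<lambda>x. f (F x) (G x))"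
 by (simp add: periodic_mod_def)

lemma periodic_mod_sum: "(\<And>j. j \<in> J ==> periodic_mod n (F j)) ==> periodic_mod n (\<lambda>x. \<Sum>j\<in>J. F j x)"
 unfolding periodic_mod_def by (auto intro!: sum.cong)

lemma periodic_mod_spin: "periodic_mod n (spin n s)"
 by (simp add: periodic_mod_def spin_def)

lemmas periodic_mod_intros = periodic_mod_const
 periodic_mod_sum periodic_mod_comp2[of _ _ _ "(+)"] periodic_mod_comp2[of _ _ _ "(-)"] periodic_mod_comp2[of _ _ _ "(*)"]
 periodic_mod_comp2[of _ _ _ "(*\<^sub>R)"] periodic_mod_comp2[of _ _ _ "(/)"]

lemma finite_torus [simp, intro]: "finite (torus n)"
 by (simp add: torus_def)

lemma card_torus [simp]: "card (torus n) = n"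
 by (simp add: torus_def)

lemma torus_mod: "n > 0 ==> x mod int n \<in> torus n"
 by (simp add: torus_def)

lemma torus_mod_self: "x \<in> torus n ==> x mod int n = x"
 by (simp add: torus_def)

lemma torus_empty: "\<not> n > 0 ==> torus n = {}"
 by (simp add: torus_def)

lemma sum_torus_shift:
 fixes F :: "int => 'b::comm_monoid_add"
 assumes "periodic_mod n F"
 shows "(\<Sum>x\<in>torus n. F (x + k)) = (\<Sum>x\<in>torus n. F x)"
proof (cases "n > 0")
 case True
 have "(\<Sum>x\<in>torus n. F (x + k)) = (\<Sum>x\<in>torus n. F ((x + k) mod int n))"
  using assms by (simp add: periodic_mod_def)
 also have "... = (\<Sum>x\<in>torus n. F x)"
  by (rule sum.reindex_bij_witness[where i = "\<lambda>y. (y - k) mod int n" and j = "\<lambda>x. (x + k) mod int n"])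
    (use True in \<open>auto simp: torus_def mod_simps\<close>)
 finally show ?thesis .
qed (simp add: torus_empty)

lemma sum_torus_shift_diff:
 fixes F :: "int => 'b::comm_monoid_add"
 assumes "periodic_mod n F"
 shows "(\<Sum>x\<in>torus n. F (x - k)) = (\<Sum>x\<in>torus n. F x)"
 using sum_torus_shift[OF assms, of "- k"] by simp

text \<open>Any \<open>n\<close> consecutive sites run through the torus once. A window average of
  length \<open>n\<close> is therefore the magnetization, so the window identities below also
  produce the centred spin.\<close>

lemma sum_torus_window:
 fixes F :: "int => 'b::comm_monoid_add"
 assumes "periodic_mod n F"
 shows "(\<Sum>j=1..n. F (x + int j)) = (\<Sum>x\<in>torus n. F x)"
proof -
 have "(\<Sum>x\<in>torus n. F x) = (\<Sum>z\<in>torus n. F (z + (x + 1)))"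
  using sum_torus_shift[OF assms] by simp
 also have "... = (\<Sum>j=1..n. F (x + int j))"
  by (rule sum.reindex_bij_witness[where i = "\<lambda>j. int j - 1" and j = "\<lambda>z. nat (z + 1)"])
    (auto simp: torus_def algebra_simps)
 finally show ?thesis by simp
qed

lemma sum_torus_window_left:
 fixes F :: "int => 'b::comm_monoid_add"
 assumes "periodic_mod n F"
 shows "(\<Sum>j=1..n. F (x - int j)) = (\<Sum>x\<in>torus n. F x)"
proof -
 have "(\<Sum>j=1..n. F (x - int j)) = (\<Sum>j=1..n. F ((x - int n - 1) + int j))"
  by (rule sum.reindex_bij_witness[where i = "\<lambda>j. n + 1 - j" and j = "\<lambda>j. n + 1 - j"]) (auto simp: of_nat_diff algebra_simps)
 then show ?thesis using sum_torus_window[OF assms] by simp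
qed

text \<open>Real-valued, so that the effect of an exchange on the spins is linear in it
  (\<open>spin_exch\<close>) and can be summed by parts.\<close>

definition site :: "nat => int => int => real" where
 "site n y x = of_bool (x mod int n = y mod int n)"

lemma site_nonneg [simp]: "0 \<le> site n y x"
 by (simp add: site_def)

lemma periodic_mod_site: "periodic_mod n (site n y)"
 by (simp add: periodic_mod_def site_def)

lemma sum_site: "n > 0 ==> (\<Sum>x\<in>torus n. site n y x) = 1"
proof -
 assume n: "n > 0"
 have "(\<Sum>x\<in>torus n. site n y x) = (\<Sum>x\<in>torus n. if x = y mod int n then 1 else 0)"
  by (rule sum.cong) (auto simp: site_def torus_mod_self)
 also have "... = 1" using torus_mod[OF n] by simp
 finally show ?thesis .
qed

lemma sum_site_shift: "n > 0 ==> (\<Sum>x\<in>torus n. site n y (x + k)) = 1"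
 using sum_torus_shift[OF periodic_mod_site] sum_site by metis

lemma window_abel:
 fixes u :: "nat => real"
 shows "(\<Sum>i=1..l. (real l - real i) * (u i - u (i + 1))) = real l * u 1 - (\<Sum>j=1..l. u j)"
proof (induction l)
 case (Suc l)
 have tel: "(\<Sum>i=1..l. u i - u (i + 1)) = u 1 - u (l + 1)"
  by (induction l) auto
 have "(\<Sum>i=1..Suc l. (real (Suc l) - real i) * (u i - u (i + 1)))
   = (\<Sum>i=1..l. (real (Suc l) - real i) * (u i - u (i + 1)))"
  by simp
 also have "... = (\<Sum>i=1..l. (real l - real i) * (u i - u (i + 1))) + (\<Sum>i=1..l. u i - u (i + 1))"
  by (simp add: sum.distrib[symmetric] algebra_simps)
 also have "... = real (Suc l) * u 1 - (\<Sum>j=1..Suc l. u j)"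
  unfolding Suc.IH tel by (simp add: algebra_simps)
 finally show ?case .
qed simp

text \<open>Summation by parts. The point is that only nearest-neighbour differences occur on the
  right: these are what the exchange across a bond can be paired with.\<close>

lemma window_abel':
 fixes u :: "nat => real"
 assumes "l > 0"
 shows "u 1 - (\<Sum>j=1..l. u j) / real l = (\<Sum>i=1..l. (1 - real i / real l) * (u i - u (i + 1)))"
proof -
 have "(\<Sum>i=1..l. (1 - real i / real l) * (u i - u (i + 1)))
   = (\<Sum>i=1..l. (real l - real i) * (u i - u (i + 1))) / real l"
  unfolding sum_divide_distrib using assms by (intro sum.cong) (auto simp: field_simps)
 then show ?thesis unfolding window_abel using assms by (simp add: field_simps)
qed

text \<open>The adjoint of passing to a window average: the factor left at the bond (y, y + 1) after
  summation by parts. It sees \<open>F\<close> only at y - 1, ..., y - l, off that bond;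
  \<open>ramp_right\<close> starts at y + 2 for the same reason.\<close>

definition ramp_left :: "nat => (int => 'b::real_vector) => int => 'b" where
 "ramp_left l F y = (\<Sum>i=1..l. (1 - real i / real l) *\<^sub>R F (y - int i))"

definition ramp_right :: "nat => (int => 'b::real_vector) => int => 'b" where
 "ramp_right l F y = (\<Sum>i=1..l. (1 - real i / real l) *\<^sub>R F (y + 1 + int i))"

lemma tele_right:
 fixes F :: "int => 'b::real_vector" and s :: "int => real"
 assumes F: "periodic_mod n F" and s: "periodic_mod n s" and l: "l > 0"
 shows "(\<Sum>x\<in>torus n. (s (x + 1) - (\<Sum>j=1..l. s (x + int j)) / real l) *\<^sub>R F x)
   = (\<Sum>y\<in>torus n. (s y - s (y + 1)) *\<^sub>R ramp_left l F y)"
proof -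
 have "(\<Sum>x\<in>torus n. (s (x + 1) - (\<Sum>j=1..l. s (x + int j)) / real l) *\<^sub>R F x)
   = (\<Sum>x\<in>torus n. \<Sum>i=1..l. ((1 - real i / real l) * (s (x + int i) - s (x + int i + 1))) *\<^sub>R F x)"
  using window_abel'[OF l, of "\<lambda>j. s (x + int j)" for x]
  by (intro sum.cong refl) (simp add: scaleR_sum_left[symmetric] add_ac)
 also have "... = (\<Sum>i=1..l. \<Sum>x\<in>torus n. ((1 - real i / real l) * (s (x + int i) - s (x + int i + 1))) *\<^sub>R F x)"
  by (rule sum.swap)
 also have "... = (\<Sum>i=1..l. \<Sum>y\<in>torus n. ((1 - real i / real l) * (s y - s (y + 1))) *\<^sub>R F (y - int i))"
 proof (rule sum.cong[OF refl])
  fix i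
  let ?H = "\<lambda>y. ((1 - real i / real l) * (s y - s (y + 1))) *\<^sub>R F (y - int i)"
  have "periodic_mod n ?H" by (intro periodic_mod_intros periodic_mod_shift_diff[OF F] s periodic_mod_shift[OF s])
  from sum_torus_shift[OF this, of "int i"]
  show "(\<Sum>x\<in>torus n. ((1 - real i / real l) * (s (x + int i) - s (x + int i + 1))) *\<^sub>R F x) = sum ?H (torus n)"
   by simp
 qed
 also have "... = (\<Sum>y\<in>torus n. (s y - s (y + 1)) *\<^sub>R ramp_left l F y)"
  unfolding ramp_left_def scaleR_sum_right by (subst sum.swap) (simp add: mult.commute)
 finally show ?thesis .
qed

lemma tele_left:
 fixes F :: "int => 'b::real_vector" and s :: "int => real"
 assumes F: "periodic_mod n F" and s: "periodic_mod n s" and l: "l > 0"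
 shows "(\<Sum>x\<in>torus n. (s (x - 1) - (\<Sum>j=1..l. s (x - int j)) / real l) *\<^sub>R F x)
   = - (\<Sum>y\<in>torus n. (s y - s (y + 1)) *\<^sub>R ramp_right l F y)"
proof -
 have "(\<Sum>x\<in>torus n. (s (x - 1) - (\<Sum>j=1..l. s (x - int j)) / real l) *\<^sub>R F x)
   = (\<Sum>x\<in>torus n. \<Sum>i=1..l. ((1 - real i / real l) * (s (x - int i) - s (x - int i - 1))) *\<^sub>R F x)"
  using window_abel'[OF l, of "\<lambda>j. s (x - int j)" for x]
  by (intro sum.cong refl) (simp add: scaleR_sum_left[symmetric] diff_diff_eq add_ac)
 also have "... = (\<Sum>i=1..l. \<Sum>x\<in>torus n. ((1 - real i / real l) * (s (x - int i) - s (x - int i - 1))) *\<^sub>R F x)"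
  by (rule sum.swap)
 also have "... = (\<Sum>i=1..l. \<Sum>y\<in>torus n. ((1 - real i / real l) * (s (y + 1) - s y)) *\<^sub>R F (y + 1 + int i))"
 proof (rule sum.cong[OF refl])
  fix i
  let ?H = "\<lambda>y. ((1 - real i / real l) * (s (y + 1) - s y)) *\<^sub>R F (y + 1 + int i)"
  have "periodic_mod n ?H"
   using periodic_mod_shift[OF F, of "1 + int i"]
   by (intro periodic_mod_intros s periodic_mod_shift[OF s]) (simp add: add.assoc)
  from sum_torus_shift_diff[OF this, of "int i + 1"]
  show "(\<Sum>x\<in>torus n. ((1 - real i / real l) * (s (x - int i) - s (x - int i - 1))) *\<^sub>R F x) = sum ?H (torus n)"
   by (simp add: algebra_simps)
 qed
 also have "... = (\<Sum>y\<in>torus n. (s (y + 1) - s y) *\<^sub>R ramp_right l F y)"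
  unfolding ramp_right_def scaleR_sum_right by (subst sum.swap) (simp add: mult.commute)
 also have "... = - (\<Sum>y\<in>torus n. (s y - s (y + 1)) *\<^sub>R ramp_right l F y)"
  unfolding sum_negf[symmetric] by (intro sum.cong refl) (simp add: scaleR_left_diff_distrib)
 finally show ?thesis .
qed

section \<open>Integration by parts along exchanges\<close>

text \<open>Reduces both sites, so that bonds may be indexed by any integer; on representatives it
  is the exchange in \<open>L_ex\<close> (\<open>exch_torus\<close>).\<close>

definition exch :: "nat => int => (int => nat) => int => nat" where
 "exch n y s = exchange s (y mod int n) ((y + 1) mod int n)"

definition mag :: "nat => (int => nat) => real" where
 "mag n s = (\<Sum>x\<in>torus n. spin n s x) / real n"

definition cspin :: "nat => (int => nat) => int => real" where
 "cspin n s x = spin n s x - mag n s"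

lemma periodic_mod_cspin: "periodic_mod n (cspin n s)"
 unfolding cspin_def [abs_def] by (intro periodic_mod_intros periodic_mod_spin)

lemma sum_spin: "n > 0 ==> (\<Sum>x\<in>torus n. spin n s x) = real n * mag n s"
 by (simp add: mag_def)

lemma sum_cspin: "(\<Sum>x\<in>torus n. cspin n s x) = 0"
 by (cases "n > 0") (simp_all add: cspin_def sum_subtractf sum_spin torus_empty)

lemma mod_succ_ne: "n \<ge> 2 ==> (y + 1) mod int n \<noteq> y mod int n"
proof
 assume n: "n \<ge> 2" and e: "(y + 1) mod int n = y mod int n"
 then have "int n dvd (y + 1) - y" by (simp only: mod_eq_dvd_iff)
 then show False using n by (simp add: zdvd_not_zless)
qed

lemma mod_pred_iff: "(x - 1) mod int n = y mod int n \<longleftrightarrow> x mod int n = (y + 1) mod int n"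
 by (simp add: mod_eq_dvd_iff algebra_simps)

lemma Omega_val: "s \<in> Omega n ==> n > 0 ==> s (x mod int n) = 0 \<or> s (x mod int n) = 1"
 unfolding Omega_def using torus_mod[of n x] by (auto simp: PiE_iff)

lemma spin_cases: "s \<in> Omega n ==> n > 0 ==> spin n s x = 1 \<or> spin n s x = -1"
 using Omega_val[of s n x] by (auto simp: spin_def)

lemma abs_spin: "s \<in> Omega n ==> n > 0 ==> \<bar>spin n s x\<bar> = 1"
 using spin_cases[of s n x] by auto

lemma spin_sq: "s \<in> Omega n ==> n > 0 ==> spin n s x * spin n s x = 1"
 using spin_cases[of s n x] by auto

lemma abs_mag: assumes "s \<in> Omega n" "n > 0" shows "\<bar>mag n s\<bar> \<le> 1"
proof -
 have "\<bar>\<Sum>x\<in>torus n. spin n s x\<bar> \<le> (\<Sum>x\<in>torus n. \<bar>spin n s x\<bar>)" by (rule sum_abs)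
 also have "... = real n" using assms by (simp add: abs_spin)
 finally show ?thesis using assms by (simp add: mag_def)
qed

lemma abs_cspin: "s \<in> Omega n ==> n > 0 ==> \<bar>cspin n s x\<bar> \<le> 2"
 unfolding cspin_def using abs_mag[of s n] abs_spin[of s n x] by linarith

lemma finite_Omega [simp, intro]: "finite (Omega n)"
 unfolding Omega_def by (intro finite_PiE) auto

lemma exch_in: assumes "s \<in> Omega n" "n > 0" shows "exch n y s \<in> Omega n"
proof -
 have a: "y mod int n \<in> torus n" "(y + 1) mod int n \<in> torus n" using assms(2) by (auto intro: torus_mod)
 show ?thesis
  using assms a unfolding Omega_def exch_def exchange_def
  by (auto simp: PiE_iff extensional_def)
qed

lemma exch_exch: "n > 0 ==> exch n y (exch n y s) = s"
 unfolding exch_def exchange_def by auto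

lemma spin_exch:
 assumes "n \<ge> 2"
 shows "spin n (exch n y s) x
  = spin n s x + (spin n s (y + 1) - spin n s y) * (site n y x - site n y (x - 1))"
 using mod_succ_ne[OF assms, of y]
 by (auto simp: spin_def exch_def exchange_def site_def mod_pred_iff algebra_simps)

lemma mag_exch: assumes "n \<ge> 2" shows "mag n (exch n y s) = mag n s"
 using assms sum_site_shift[of n y "-1"] sum_site[of n y]
 by (simp add: mag_def spin_exch sum.distrib sum_distrib_left[symmetric] sum_subtractf)

lemma cspin_exch:
 assumes "n \<ge> 2"
 shows "cspin n (exch n y s) x
  = cspin n s x + (spin n s (y + 1) - spin n s y) * (site n y x - site n y (x - 1))"
 by (simp add: cspin_def spin_exch[OF assms] mag_exch[OF assms])

lemma spin_exch_eq:
 assumes "n \<ge> 2" "x mod int n \<noteq> y mod int n" "x mod int n \<noteq> (y + 1) mod int n"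
 shows "spin n (exch n y s) x = spin n s x"
 unfolding spin_exch[OF assms(1)] using assms(2,3) by (simp add: site_def mod_pred_iff)

lemma cspin_exch_eq:
 assumes "n \<ge> 2" "x mod int n \<noteq> y mod int n" "x mod int n \<noteq> (y + 1) mod int n"
 shows "cspin n (exch n y s) x = cspin n s x"
 by (simp add: cspin_def spin_exch_eq[OF assms] mag_exch[OF assms(1)])

lemma exch_torus: "y \<in> torus n ==> exch n y s = exchange s y ((y + 1) mod int n)"
 by (simp add: exch_def torus_mod_self)

lemma sum_Omega_exch:
 fixes F :: "(int => nat) => 'b::comm_monoid_add"
 assumes "n > 0"
 shows "(\<Sum>s\<in>Omega n. F (exch n y s)) = (\<Sum>s\<in>Omega n. F s)"
 by (rule sum.reindex_bij_witness[where i = "exch n y" and j = "exch n y"])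
   (use assms in \<open>auto simp: exch_in exch_exch\<close>)

lemma flip_in: "s \<in> Omega n ==> x \<in> torus n ==> flip s x \<in> Omega n"
 unfolding Omega_def flip_def by (auto simp: PiE_iff extensional_def)

lemma flip_flip: "s \<in> Omega n ==> x \<in> torus n ==> flip (flip s x) x = s"
 unfolding Omega_def flip_def by (force simp: PiE_iff)

lemma spin_flip:
 assumes "s \<in> Omega n" "x \<in> torus n"
 shows "spin n (flip s x) z = spin n s z * (1 - 2 * site n x z)"
proof -
 have "s x = 0 \<or> s x = 1" using assms unfolding Omega_def by (auto simp: PiE_iff)
 then show ?thesis using torus_mod_self[OF assms(2)]
  by (auto simp: spin_def flip_def site_def)
qed

lemma sum_Omega_flip:
 fixes F :: "(int => nat) => 'b::comm_monoid_add"
 assumes "x \<in> torus n"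
 shows "(\<Sum>s\<in>Omega n. F (flip s x)) = (\<Sum>s\<in>Omega n. F s)"
 by (rule sum.reindex_bij_witness[where i = "\<lambda>s. flip s x" and j = "\<lambda>s. flip s x"])
   (use assms in \<open>auto simp: flip_in flip_flip\<close>)

text \<open>Values in any real vector space: the same integration by parts serves real observables
  and characteristic functions.\<close>

definition expect :: "nat => ((int => nat) => real) => ((int => nat) => 'b::real_vector) => 'b" where
 "expect n \<mu> G = (\<Sum>s\<in>Omega n. \<mu> s *\<^sub>R G s)"

text \<open>The quadratic form of the exchange dynamics at the square root of the weight; n^2 is the
  speed of the exchanges in \<open>gen\<close>.\<close>

definition dirichlet :: "nat => ((int => nat) => real) => real" where
 "dirichlet n \<mu> = (real n)^2 * (\<Sum>y\<in>torus n. \<Sum>s\<in>Omega n. (sqrt (\<mu> (exch n y s)) - sqrt (\<mu> s))^2)"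

lemma dirichlet_nonneg: "0 \<le> dirichlet n \<mu>"
 unfolding dirichlet_def by (intro mult_nonneg_nonneg sum_nonneg) auto

locale config_weight =
 fixes n :: nat and \<mu> :: "(int => nat) => real"
 assumes n_ge: "n \<ge> 2"
  and weight_nonneg: "\<And>s. s \<in> Omega n ==> 0 \<le> \<mu> s"
  and weight_sum: "(\<Sum>s\<in>Omega n. \<mu> s) = 1"
begin

abbreviation "E \<equiv> expect n \<mu>"
abbreviation "D \<equiv> dirichlet n \<mu>"

lemma n_pos: "n > 0" using n_ge by simp

lemma E_const: "E (\<lambda>_. c) = c"
 by (simp add: expect_def scaleR_sum_left[symmetric] weight_sum)

lemma E_add: "E (\<lambda>s. F s + G s) = E F + E G"
 by (simp add: expect_def scaleR_add_right sum.distrib)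

lemma E_diff: "E (\<lambda>s. F s - G s) = E F - E G"
 by (simp add: expect_def scaleR_diff_right sum_subtractf)

lemma E_sum: "E (\<lambda>s. \<Sum>j\<in>J. F j s) = (\<Sum>j\<in>J. E (F j))"
 by (simp add: expect_def scaleR_sum_right) (rule sum.swap)

lemma E_cmult: "E (\<lambda>s. (c::real) * F s) = c * E F"
 by (simp add: expect_def sum_distrib_left mult_ac)

lemma E_cong: "(\<And>s. s \<in> Omega n ==> F s = G s) ==> E F = E G"
 by (simp add: expect_def)

lemma E_mono: "(\<And>s. s \<in> Omega n ==> F s \<le> G s) ==> E F \<le> (E G :: real)"
 unfolding expect_def by (auto intro!: sum_mono mult_left_mono weight_nonneg)

lemma E_nonneg: "(\<And>s. s \<in> Omega n ==> 0 \<le> F s) ==> 0 \<le> (E F :: real)"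
 unfolding expect_def by (auto intro!: sum_nonneg mult_nonneg_nonneg weight_nonneg)

lemma norm_E: "norm (E G) \<le> E (\<lambda>s. norm (G s))"
proof -
 have "norm (E G) \<le> (\<Sum>s\<in>Omega n. norm (\<mu> s *\<^sub>R G s))" unfolding expect_def by (rule norm_sum)
 also have "... = E (\<lambda>s. norm (G s))" unfolding expect_def by (simp add: weight_nonneg)
 finally show ?thesis .
qed

lemma E_le_const: "(\<And>s. s \<in> Omega n ==> F s \<le> c) ==> E F \<le> (c::real)"
 using E_mono[of F "\<lambda>_. c"] by (simp add: E_const)

lemma norm_E_le: "(\<And>s. s \<in> Omega n ==> norm (G s) \<le> c s) ==> norm (E G) \<le> E c"
 by (rule order_trans[OF norm_E]) (rule E_mono)

lemma E_cauchy_schwarz: "E (\<lambda>s. F s * G s) \<le> sqrt (E (\<lambda>s. (F s)^2)) * sqrt (E (\<lambda>s. (G s)^2))"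
proof -
 have "E (\<lambda>s. F s * G s) = (\<Sum>s\<in>Omega n. (sqrt (\<mu> s) * F s) * (sqrt (\<mu> s) * G s))"
  unfolding expect_def using weight_nonneg by (intro sum.cong refl) (simp add: algebra_simps)
 also have "... \<le> \<bar>...\<bar>" by simp
 also have "... \<le> sqrt (\<Sum>s\<in>Omega n. (sqrt (\<mu> s) * F s)^2) * sqrt (\<Sum>s\<in>Omega n. (sqrt (\<mu> s) * G s)^2)"
  using Cauchy_Schwarz_ineq_sum[of "\<lambda>s. sqrt (\<mu> s) * F s" "\<lambda>s. sqrt (\<mu> s) * G s" "Omega n"]
  by (simp add: real_sqrt_mult[symmetric] real_le_rsqrt)
 also have "... = sqrt (E (\<lambda>s. (F s)^2)) * sqrt (E (\<lambda>s. (G s)^2))"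
  unfolding expect_def by (simp add: power_mult_distrib weight_nonneg)
 finally show ?thesis .
qed

text \<open>Exchanging the two sites in one half of the expectation produces the difference
 \<open>\<mu> - \<mu>(exch)\<close>, which Young's inequality splits into the Dirichlet form and a second moment.\<close>

lemma ibp_site:
 fixes G :: "(int => nat) => 'b::real_normed_vector"
 assumes B: "B > 0"
 shows "norm (E (\<lambda>s. (spin n s y - spin n s (y + 1)) *\<^sub>R G s))
  \<le> B / 2 * (\<Sum>s\<in>Omega n. (sqrt (\<mu> (exch n y s)) - sqrt (\<mu> s))^2)
   + 1 / B * E (\<lambda>s. 4 * (norm (G s))^2 + (norm (G (exch n y s) - G s))^2)
   + E (\<lambda>s. norm (G (exch n y s) - G s))"
proof -
 let ?e = "exch n y"
 let ?s = "\<lambda>s. spin n s y - spin n s (y + 1)"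
 define Gb where "Gb s = (1/2) *\<^sub>R (G s + G (?e s))" for s
 define Dl where "Dl s = G (?e s) - G s" for s
 define d where "d s = sqrt (\<mu> (?e s)) - sqrt (\<mu> s)" for s
 have ne: "n > 0" using n_pos .
 have s_e: "?s (?e s) = - ?s s" for s
  using mod_succ_ne[OF n_ge, of y] mod_pred_iff[of y n y]
  by (simp add: spin_exch[OF n_ge] site_def)
 have sym1: "(\<Sum>s\<in>Omega n. \<mu> s * f s) = (\<Sum>s\<in>Omega n. \<mu> (?e s) * f (?e s))" for f :: "_ => real"
  using sum_Omega_exch[OF ne, of "\<lambda>s. \<mu> s * f s" y] by simp
 have "E (\<lambda>s. ?s s *\<^sub>R G s) = (\<Sum>s\<in>Omega n. \<mu> (?e s) *\<^sub>R ?s (?e s) *\<^sub>R G (?e s))"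
  unfolding expect_def using sum_Omega_exch[OF ne, of "\<lambda>s. \<mu> s *\<^sub>R ?s s *\<^sub>R G s" y] by simp
 also have "... = - (\<Sum>s\<in>Omega n. \<mu> (?e s) *\<^sub>R ?s s *\<^sub>R G (?e s))"
  unfolding s_e by (simp only: scaleR_minus_left scaleR_minus_right sum_negf)
 finally have e2: "E (\<lambda>s. ?s s *\<^sub>R G s) = - (\<Sum>s\<in>Omega n. \<mu> (?e s) *\<^sub>R ?s s *\<^sub>R G (?e s))" .
 have "2 *\<^sub>R E (\<lambda>s. ?s s *\<^sub>R G s)
   = (\<Sum>s\<in>Omega n. \<mu> s *\<^sub>R ?s s *\<^sub>R G s) - (\<Sum>s\<in>Omega n. \<mu> (?e s) *\<^sub>R ?s s *\<^sub>R G (?e s))"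
  unfolding scaleR_2 by (subst (2) e2) (simp add: expect_def)
 also have "... = (\<Sum>s\<in>Omega n. ?s s *\<^sub>R (\<mu> s *\<^sub>R G s - \<mu> (?e s) *\<^sub>R G (?e s)))"
  by (simp add: sum_subtractf[symmetric] scaleR_diff_right mult.commute)
 finally have e3: "2 *\<^sub>R E (\<lambda>s. ?s s *\<^sub>R G s)
   = (\<Sum>s\<in>Omega n. ?s s *\<^sub>R (\<mu> s *\<^sub>R G s - \<mu> (?e s) *\<^sub>R G (?e s)))" .
 \<comment> \<open>Symmetrization over the pair \<open>s\<close>, \<open>?e s\<close>: a difference
   of products is the difference of the weights times the mean of \<open>G\<close>, minus the mean
   of the weights times the increment of \<open>G\<close>. Only the first part calls for the
   Dirichlet form.\<close>
 have split: "\<mu> s *\<^sub>R G s - \<mu> (?e s) *\<^sub>R G (?e s)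
   = (\<mu> s - \<mu> (?e s)) *\<^sub>R Gb s - ((\<mu> s + \<mu> (?e s)) / 2) *\<^sub>R Dl s" for s
 proof -
  define p q where "p = (\<mu> s - \<mu> (?e s)) / 2" and "q = (\<mu> s + \<mu> (?e s)) / 2"
  have "(p + q) *\<^sub>R G s - (q - p) *\<^sub>R G (?e s) = (2 * p) *\<^sub>R Gb s - q *\<^sub>R Dl s"
   unfolding Gb_def Dl_def by (simp add: algebra_simps)
  moreover have "p + q = \<mu> s" "q - p = \<mu> (?e s)" "2 * p = \<mu> s - \<mu> (?e s)"
   unfolding p_def q_def by (simp_all add: field_simps)
  ultimately show ?thesis unfolding q_def by simp
 qed
 have bound: "norm (?s s *\<^sub>R (\<mu> s *\<^sub>R G s - \<mu> (?e s) *\<^sub>R G (?e s)))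
   \<le> B * (d s)^2 + 2 / B * ((\<mu> s + \<mu> (?e s)) * (norm (Gb s))^2) + (\<mu> s + \<mu> (?e s)) * norm (Dl s)"
  if h: "s \<in> Omega n" for s
 proof -
  let ?u = "sqrt (\<mu> s)" and ?v = "sqrt (\<mu> (?e s))" and ?g = "norm (Gb s)"
  have m: "0 \<le> \<mu> s" "0 \<le> \<mu> (?e s)" using h by (auto intro: weight_nonneg exch_in ne)
  have s2: "\<bar>?s s\<bar> \<le> 2" using abs_spin[OF h ne, of y] abs_spin[OF h ne, of "y+1"] by linarith
  have mm: "\<mu> s - \<mu> (?e s) = - (d s) * (?u + ?v)"
   using m by (simp add: d_def algebra_simps)
  have uv: "(?u + ?v)^2 \<le> 2 * (\<mu> s + \<mu> (?e s))"
  proof -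
   have "0 \<le> (?u - ?v)^2" by simp
   then show ?thesis using m by (simp add: power2_eq_square algebra_simps)
  qed
  have young: "2 * (\<bar>d s\<bar> * ((?u + ?v) * ?g)) \<le> B * (d s)^2 + 1 / B * ((?u + ?v) * ?g)^2"
  proof -
   have "0 \<le> (sqrt B * \<bar>d s\<bar> - ((?u + ?v) * ?g) / sqrt B)^2" by simp
   also have "... = B * (d s)^2 + 1 / B * ((?u + ?v) * ?g)^2 - 2 * (\<bar>d s\<bar> * ((?u + ?v) * ?g))"
    using B by (simp add: power2_diff power_mult_distrib power_divide)
   finally show ?thesis by linarith
  qed
  have "norm (\<mu> s *\<^sub>R G s - \<mu> (?e s) *\<^sub>R G (?e s))
    \<le> \<bar>d s\<bar> * ((?u + ?v) * ?g) + (\<mu> s + \<mu> (?e s)) / 2 * norm (Dl s)"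
   unfolding split
   by (rule order_trans[OF norm_triangle_ineq4]) (use m in \<open>simp add: mm abs_mult mult_ac\<close>)
  then have "norm (?s s *\<^sub>R (\<mu> s *\<^sub>R G s - \<mu> (?e s) *\<^sub>R G (?e s)))
    \<le> 2 * (\<bar>d s\<bar> * ((?u + ?v) * ?g) + (\<mu> s + \<mu> (?e s)) / 2 * norm (Dl s))"
   unfolding norm_scaleR using s2 by (intro mult_mono) auto
  also have "... \<le> B * (d s)^2 + 1 / B * ((?u + ?v) * ?g)^2 + (\<mu> s + \<mu> (?e s)) * norm (Dl s)"
  proof -
   have "2 * (P + m / 2 * N) = 2 * P + m * N" for P m N :: real by (simp add: algebra_simps)
   then show ?thesis using young by simp
  qed
  also have "1 / B * ((?u + ?v) * ?g)^2 \<le> 2 / B * ((\<mu> s + \<mu> (?e s)) * ?g^2)"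
   using uv B by (simp add: power_mult_distrib divide_right_mono mult_right_mono mult.assoc[symmetric])
  finally show ?thesis by simp
 qed
 have Gb_e: "Gb (?e s) = Gb s" for s unfolding Gb_def exch_exch[OF ne] by (simp add: add.commute)
 have Dl_e: "norm (Dl (?e s)) = norm (Dl s)" for s unfolding Dl_def exch_exch[OF ne] by (simp add: norm_minus_commute)
 have sym2: "(\<Sum>s\<in>Omega n. (\<mu> s + \<mu> (?e s)) * f s) = 2 * E f" if "\<And>s. f (?e s) = f s" for f :: "_ => real"
  using sym1[of f] that by (simp add: expect_def distrib_right sum.distrib)
 have "2 * norm (E (\<lambda>s. ?s s *\<^sub>R G s)) = norm (2 *\<^sub>R E (\<lambda>s. ?s s *\<^sub>R G s))" by simp
 also have "... \<le> (\<Sum>s\<in>Omega n. norm (?s s *\<^sub>R (\<mu> s *\<^sub>R G s - \<mu> (?e s) *\<^sub>R G (?e s))))"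
  unfolding e3 by (rule norm_sum)
 also have "... \<le> (\<Sum>s\<in>Omega n. B * (d s)^2 + 2 / B * ((\<mu> s + \<mu> (?e s)) * (norm (Gb s))^2) + (\<mu> s + \<mu> (?e s)) * norm (Dl s))"
  by (rule sum_mono) (rule bound)
 also have "... = B * (\<Sum>s\<in>Omega n. (d s)^2) + 2 / B * (2 * E (\<lambda>s. (norm (Gb s))^2)) + 2 * E (\<lambda>s. norm (Dl s))"
  unfolding sum.distrib sum_distrib_left[symmetric]
  using sym2[of "\<lambda>s. (norm (Gb s))^2"] sym2[of "\<lambda>s. norm (Dl s)"] Gb_e Dl_e by simp
 finally have main: "norm (E (\<lambda>s. ?s s *\<^sub>R G s))
   \<le> B / 2 * (\<Sum>s\<in>Omega n. (d s)^2) + 2 / B * E (\<lambda>s. (norm (Gb s))^2) + E (\<lambda>s. norm (Dl s))"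
  by simp
 have gb: "2 * (norm (Gb s))^2 \<le> 4 * (norm (G s))^2 + (norm (Dl s))^2" for s
 proof -
  have "Gb s = G s + (1/2) *\<^sub>R Dl s"
   unfolding Gb_def Dl_def by (simp add: algebra_simps) (simp flip: scaleR_add_left)
  then have "norm (Gb s) \<le> norm (G s) + norm (Dl s) / 2"
   using norm_triangle_ineq[of "G s" "(1/2) *\<^sub>R Dl s"] by simp
  then have "(norm (Gb s))^2 \<le> (norm (G s) + norm (Dl s) / 2)^2" by (simp add: power_mono)
  also have "... \<le> 2 * (norm (G s))^2 + (norm (Dl s))^2 / 2"
   using sum_squares_bound[of "norm (G s)" "norm (Dl s) / 2"]
   by (simp add: power2_sum power_divide)
  finally show ?thesis by simp
 qed
 have "2 / B * E (\<lambda>s. (norm (Gb s))^2) = 1 / B * E (\<lambda>s. 2 * (norm (Gb s))^2)" by (simp add: E_cmult)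
 also have "... \<le> 1 / B * E (\<lambda>s. 4 * (norm (G s))^2 + (norm (Dl s))^2)"
  using B gb by (intro mult_left_mono E_mono) auto
 finally show ?thesis using main unfolding d_def Dl_def by linarith
qed

lemma ibp:
 fixes G :: "int => (int => nat) => 'b::real_normed_vector"
 assumes A: "A > 0"
 shows "norm (E (\<lambda>s. \<Sum>y\<in>torus n. (spin n s y - spin n s (y + 1)) *\<^sub>R G y s))
  \<le> A * D / 2 + 1 / (A * (real n)^2) * (\<Sum>y\<in>torus n. E (\<lambda>s. 4 * (norm (G y s))^2 + (norm (G y (exch n y s) - G y s))^2))
   + (\<Sum>y\<in>torus n. E (\<lambda>s. norm (G y (exch n y s) - G y s)))"
proof -
 \<comment> \<open>With this choice in \<open>ibp_site\<close> the bond terms add up to A * D /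
   2.\<close>
 have B: "A * (real n)^2 > 0" using A n_pos by simp
 have "norm (E (\<lambda>s. \<Sum>y\<in>torus n. (spin n s y - spin n s (y + 1)) *\<^sub>R G y s))
   \<le> (\<Sum>y\<in>torus n. norm (E (\<lambda>s. (spin n s y - spin n s (y + 1)) *\<^sub>R G y s)))"
  unfolding E_sum by (rule norm_sum)
 also have "... \<le> (\<Sum>y\<in>torus n. A * (real n)^2 / 2 * (\<Sum>s\<in>Omega n. (sqrt (\<mu> (exch n y s)) - sqrt (\<mu> s))^2)
   + 1 / (A * (real n)^2) * E (\<lambda>s. 4 * (norm (G y s))^2 + (norm (G y (exch n y s) - G y s))^2)
   + E (\<lambda>s. norm (G y (exch n y s) - G y s)))"
  by (intro sum_mono ibp_site B)
 also have "... = A * D / 2 + 1 / (A * (real n)^2) * (\<Sum>y\<in>torus n. E (\<lambda>s. 4 * (norm (G y s))^2 + (norm (G y (exch n y s) - G y s))^2))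
   + (\<Sum>y\<in>torus n. E (\<lambda>s. norm (G y (exch n y s) - G y s)))"
  unfolding dirichlet_def sum.distrib sum_distrib_left[symmetric] by simp
 finally show ?thesis .
qed

text \<open>The form used throughout: it is enough to control, for each configuration, the sum of
  squares of \<open>G\<close> over the bonds and the change of each \<open>G y\<close> under the
  exchange of its own bond. \<open>A\<close> stays free to balance the Dirichlet form against the
  second moment.\<close>

lemma ibp_bound:
 fixes G :: "int => (int => nat) => 'b::real_normed_vector"
 assumes A: "A > 0"
  and sq: "\<And>s. s \<in> Omega n ==> (\<Sum>y\<in>torus n. (norm (G y s))^2) \<le> S s"
  and inc: "\<And>s y. s \<in> Omega n ==> y \<in> torus n ==> norm (G y (exch n y s) - G y s) \<le> d s"
 shows "norm (E (\<lambda>s. \<Sum>y\<in>torus n. (spin n s y - spin n s (y + 1)) *\<^sub>R G y s))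
  \<le> A * D / 2 + 1 / (A * (real n)^2) * (4 * E S + real n * E (\<lambda>s. (d s)^2)) + real n * E d"
proof -
 have "(\<Sum>y\<in>torus n. E (\<lambda>s. 4 * (norm (G y s))^2 + (norm (G y (exch n y s) - G y s))^2))
   = 4 * E (\<lambda>s. \<Sum>y\<in>torus n. (norm (G y s))^2) + (\<Sum>y\<in>torus n. E (\<lambda>s. (norm (G y (exch n y s) - G y s))^2))"
  by (simp add: E_add E_cmult E_sum sum.distrib sum_distrib_left)
 also have "... \<le> 4 * E S + (\<Sum>y\<in>torus n. E (\<lambda>s. (d s)^2))"
  by (intro add_mono mult_left_mono E_mono sum_mono sq power_mono inc) auto
 finally have 1: "(\<Sum>y\<in>torus n. E (\<lambda>s. 4 * (norm (G y s))^2 + (norm (G y (exch n y s) - G y s))^2))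
   \<le> 4 * E S + real n * E (\<lambda>s. (d s)^2)" by simp
 have 2: "(\<Sum>y\<in>torus n. E (\<lambda>s. norm (G y (exch n y s) - G y s))) \<le> real n * E d"
  using sum_mono[of "torus n" "\<lambda>y. E (\<lambda>s. norm (G y (exch n y s) - G y s))" "\<lambda>_. E d"] inc
  by (simp add: E_mono)
 have "1 / (A * (real n)^2) * (\<Sum>y\<in>torus n. E (\<lambda>s. 4 * (norm (G y s))^2 + (norm (G y (exch n y s) - G y s))^2))
   \<le> 1 / (A * (real n)^2) * (4 * E S + real n * E (\<lambda>s. (d s)^2))"
  using 1 A by (intro mult_left_mono) auto
 then show ?thesis using ibp[OF A, of G] 2 by linarith
qed

end

section \<open>Ramps and block averages\<close>

lemma norm_ramp_left: "norm (ramp_left l F y) \<le> (\<Sum>i=1..l. norm (F (y - int i)))"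
 unfolding ramp_left_def
 by (rule order_trans[OF norm_sum], rule sum_mono) (auto intro!: mult_left_le_one_le)

lemma norm_ramp_right: "norm (ramp_right l F y) \<le> (\<Sum>i=1..l. norm (F (y + 1 + int i)))"
 unfolding ramp_right_def
 by (rule order_trans[OF norm_sum], rule sum_mono) (auto intro!: mult_left_le_one_le)

lemma norm_ramp_left_le:
 assumes "\<And>x. norm (F x) \<le> c" shows "norm (ramp_left l F y) \<le> c * real l"
proof -
 have "norm (ramp_left l F y) \<le> (\<Sum>i=1..l. c)"
  by (rule order_trans[OF norm_ramp_left]) (intro sum_mono assms)
 then show ?thesis by (simp add: mult.commute)
qed

lemma norm_ramp_right_le:
 assumes "\<And>x. norm (F x) \<le> c" shows "norm (ramp_right l F y) \<le> c * real l"
proof -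
 have "norm (ramp_right l F y) \<le> (\<Sum>i=1..l. c)"
  by (rule order_trans[OF norm_ramp_right]) (intro sum_mono assms)
 then show ?thesis by (simp add: mult.commute)
qed

lemma ramp_left_diff: "ramp_left l F y - ramp_left l G y = ramp_left l (\<lambda>x. F x - G x) y"
 by (simp add: ramp_left_def sum_subtractf scaleR_diff_right)

lemma norm_ramp_left_torus:
 assumes "periodic_mod n F" shows "norm (ramp_left n F y) \<le> (\<Sum>x\<in>torus n. norm (F x))"
 using norm_ramp_left[of n F y] sum_torus_window_left[of n "\<lambda>x. norm (F x)" y]
  periodic_mod_comp[OF assms, of norm] by simp

lemma sum_ramp_left_sq:
 fixes F :: "int => real"
 assumes "periodic_mod n F"
 shows "(\<Sum>y\<in>torus n. (ramp_left n F y)^2) \<le> (real n)^2 * (\<Sum>x\<in>torus n. (F x)^2)"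
proof -
 have "(ramp_left n F y)^2 \<le> real n * (\<Sum>x\<in>torus n. (F x)^2)" for y
 proof -
  have "(ramp_left n F y)^2 \<le> (\<Sum>x\<in>torus n. \<bar>F x\<bar>)^2"
   using power_mono[OF norm_ramp_left_torus[OF assms, of y], of 2] by simp
  also have "... \<le> (\<Sum>x\<in>torus n. \<bar>F x\<bar>^2) * real (card (torus n))"
   by (rule sum_squared_le_sum_of_squares)
  finally show ?thesis by (simp add: mult.commute)
 qed
 then have "(\<Sum>y\<in>torus n. (ramp_left n F y)^2) \<le> (\<Sum>y\<in>torus n. real n * (\<Sum>x\<in>torus n. (F x)^2))"
  by (intro sum_mono)
 then show ?thesis by (simp add: power2_eq_square mult.assoc)
qed

text \<open>The window is x + 1, ..., x + L. A general kernel is allowed because two occur: the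
  constant one of the averages, and the linear (j - 1) / l into which \<open>ramp_left\<close> of a
  shifted centred spin turns when read backwards.\<close>

definition block :: "nat => (nat => real) => nat => (int => nat) => int => real" where
 "block n q L s x = (\<Sum>j=1..L. q j * cspin n s (x + int j))"

abbreviation "avg_block n l \<equiv> block n (\<lambda>_. 1 / real l) l"

lemma periodic_mod_block: "periodic_mod n (block n q L s)"
 unfolding block_def [abs_def] by (intro periodic_mod_intros periodic_mod_shift[OF periodic_mod_cspin])

lemma avg_block_right:
 assumes "l > 0"
 shows "avg_block n l s x = (\<Sum>j=1..l. spin n s (x + int j)) / real l - mag n s"
 using assms by (simp add: block_def cspin_def sum_subtractf diff_divide_distrib sum_divide_distrib[symmetric])

lemma avg_block_left:
 assumes "l > 0"
 shows "avg_block n l s (x - int l - 1) = (\<Sum>j=1..l. spin n s (x - int j)) / real l - mag n s"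
proof -
 have "(\<Sum>j=1..l. spin n s (x - int l - 1 + int j)) = (\<Sum>j=1..l. spin n s (x - int j))"
  by (rule sum.reindex_bij_witness[where i = "\<lambda>j. l + 1 - j" and j = "\<lambda>j. l + 1 - j"]) (auto simp: of_nat_diff algebra_simps)
 then show ?thesis using avg_block_right[OF assms, of n s "x - int l - 1"] by simp
qed

lemma abs_avg_block:
 assumes "s \<in> Omega n" "n > 0" "l > 0" shows "\<bar>avg_block n l s x\<bar> \<le> 2"
proof -
 have "\<bar>avg_block n l s x\<bar> \<le> (\<Sum>j=1..l. 2 / real l)"
  unfolding block_def
  by (rule order_trans[OF sum_abs], rule sum_mono)
    (use abs_cspin[OF assms(1,2)] assms(3) in \<open>simp add: abs_mult divide_right_mono\<close>)
 then show ?thesis using assms(3) by simp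
qed

lemma kernel_abel:
 fixes q e :: "nat => real"
 assumes "L \<ge> 1"
 shows "(\<Sum>j=1..L. q j * (e j - e (j - 1))) = q L * e L - q 1 * e 0 + (\<Sum>j=1..<L. (q j - q (j + 1)) * e j)"
 using assms
proof (induction L rule: nat_induct_at_least)
 case base then show ?case by (simp add: algebra_simps)
next
 case (Suc L)
 have "(\<Sum>j=1..Suc L. q j * (e j - e (j - 1))) = (\<Sum>j=1..L. q j * (e j - e (j - 1))) + q (Suc L) * (e (Suc L) - e L)"
  by simp
 also have "... = q (Suc L) * e (Suc L) - q 1 * e 0 + ((\<Sum>j=1..<L. (q j - q (j + 1)) * e j) + (q L - q (L + 1)) * e L)"
  unfolding Suc.IH by (simp add: algebra_simps)
 also have "(\<Sum>j=1..<L. (q j - q (j + 1)) * e j) + (q L - q (L + 1)) * e L = (\<Sum>j=1..<Suc L. (q j - q (j + 1)) * e j)"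
  using Suc.hyps by simp
 finally show ?case .
qed

text \<open>The last condition bounds the total variation of \<open>q\<close> extended by 0 on both
  sides, which is what an exchange feels when it moves a spin by one site.\<close>

definition kernel_bound :: "(nat => real) => nat => real => bool" where
 "kernel_bound q L c \<longleftrightarrow> L \<ge> 1 \<and> c > 0 \<and> (\<forall>j\<in>{1..L}. \<bar>q j\<bar> \<le> c)
   \<and> \<bar>q 1\<bar> + \<bar>q L\<bar> + (\<Sum>j=1..<L. \<bar>q j - q (j + 1)\<bar>) \<le> 2 * c"

lemma kernel_bound_const: "l \<ge> 1 ==> kernel_bound (\<lambda>_. 1 / real l) l (1 / real l)"
 by (simp add: kernel_bound_def)

lemma kernel_bound_ramp: "l \<ge> 1 ==> kernel_bound (\<lambda>j. (real j - 1) / real l) l 1"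
proof -
 assume l: "l \<ge> 1"
 have "(\<Sum>j=1..<l. \<bar>(real j - 1) / real l - (real (j + 1) - 1) / real l\<bar>) = (\<Sum>j=1..<l. 1 / real l)"
  by (intro sum.cong refl) (simp add: diff_divide_distrib[symmetric])
 also have "... = real (l - 1) / real l" by simp
 finally show ?thesis using l by (auto simp: kernel_bound_def field_simps of_nat_diff)
qed

context config_weight
begin

text \<open>The case of interest is a function of the magnetization: exchanges conserve it, so it
  passes through the integration by parts without an increment.\<close>

definition exch_invariant :: "((int => nat) => 'b) => bool" where
 "exch_invariant k \<longleftrightarrow> (\<forall>s y. k (exch n y s) = k s)"

lemma exch_invariantD: "exch_invariant k ==> k (exch n y s) = k s"
 by (simp add: exch_invariant_def)

lemma exch_invariant_mag: "exch_invariant (\<lambda>s. f (mag n s))"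
 by (simp add: exch_invariant_def mag_exch n_ge)

text \<open>With a window of length \<open>n\<close> the average is \<open>mag\<close>, so summation
  by parts turns the sum of \<open>U\<close> times \<open>cspin\<close> exactly into a sum over
  bonds. The ramp of \<open>U\<close> has at most n^2 times the sum of squares of \<open>U\<close>,
  and this n^2 is compensated by the speed of the exchanges.\<close>

lemma linear_field_bound:
 assumes A: "A > 0" and U: "\<And>s. periodic_mod n (U s)" and k: "exch_invariant k" and t: "t \<ge> 0"
  and inc: "\<And>s y. s \<in> Omega n ==> (\<Sum>x\<in>torus n. \<bar>U (exch n y s) x - U s x\<bar>) \<le> t"
 shows "\<bar>E (\<lambda>s. k s * (\<Sum>x\<in>torus n. U s x * cspin n s x))\<bar>
  \<le> A * D / 2 + 4 / A * E (\<lambda>s. (k s)^2 * (\<Sum>x\<in>torus n. (U s x)^2)) + t^2 / (A * real n) * E (\<lambda>s. (k s)^2)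
   + real n * t * E (\<lambda>s. \<bar>k s\<bar>)"
proof -
 define G where "G y s = k s * ramp_left n (\<lambda>x. U s (x + 1)) y" for y s
 have id: "k s * (\<Sum>x\<in>torus n. U s x * cspin n s x) = (\<Sum>y\<in>torus n. (spin n s y - spin n s (y + 1)) *\<^sub>R G y s)" for s
 proof -
  have "(\<Sum>y\<in>torus n. (spin n s y - spin n s (y + 1)) *\<^sub>R ramp_left n (\<lambda>x. U s (x + 1)) y)
    = (\<Sum>x\<in>torus n. (spin n s (x + 1) - (\<Sum>j=1..n. spin n s (x + int j)) / real n) *\<^sub>R U s (x + 1))"
   by (rule tele_right[symmetric]) (auto intro: periodic_mod_shift U periodic_mod_spin simp: n_pos)
  also have "... = (\<Sum>x\<in>torus n. cspin n s (x + 1) * U s (x + 1))"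
   unfolding cspin_def mag_def sum_torus_window[OF periodic_mod_spin] by simp
  also have "... = (\<Sum>x\<in>torus n. cspin n s x * U s x)"
   using sum_torus_shift[OF periodic_mod_comp2[OF periodic_mod_cspin U, of "(*)"]] .
  finally have "k s * (\<Sum>y\<in>torus n. (spin n s y - spin n s (y + 1)) *\<^sub>R ramp_left n (\<lambda>x. U s (x + 1)) y)
   = k s * (\<Sum>x\<in>torus n. U s x * cspin n s x)" by (simp add: mult.commute)
  then show ?thesis unfolding G_def sum_distrib_left[of "k s" "\<lambda>y. (spin n s y - spin n s (y + 1)) *\<^sub>R ramp_left n (\<lambda>x. U s (x + 1)) y"]
   by (simp add: mult_ac)
 qed
 have "norm (E (\<lambda>s. k s * (\<Sum>x\<in>torus n. U s x * cspin n s x)))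
   \<le> A * D / 2 + 1 / (A * (real n)^2) * (4 * E (\<lambda>s. (k s)^2 * ((real n)^2 * (\<Sum>x\<in>torus n. (U s x)^2))) + real n * E (\<lambda>s. (\<bar>k s\<bar> * t)^2))
    + real n * E (\<lambda>s. \<bar>k s\<bar> * t)"
  unfolding id
 proof (rule ibp_bound[OF A, where G = G])
  fix s assume "s \<in> Omega n"
  have p: "periodic_mod n (\<lambda>x. U s (x + 1))" by (rule periodic_mod_shift[OF U])
  have "(\<Sum>y\<in>torus n. (norm (G y s))^2) = (k s)^2 * (\<Sum>y\<in>torus n. (ramp_left n (\<lambda>x. U s (x + 1)) y)^2)"
   by (simp add: G_def power_mult_distrib sum_distrib_left)
  also have "... \<le> (k s)^2 * ((real n)^2 * (\<Sum>x\<in>torus n. (U s (x + 1))^2))"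
   by (intro mult_left_mono sum_ramp_left_sq p) auto
  also have "(\<Sum>x\<in>torus n. (U s (x + 1))^2) = (\<Sum>x\<in>torus n. (U s x)^2)"
   by (rule sum_torus_shift) (rule periodic_mod_comp[OF U])
  finally show "(\<Sum>y\<in>torus n. (norm (G y s))^2) \<le> (k s)^2 * ((real n)^2 * (\<Sum>x\<in>torus n. (U s x)^2))" .
 next
  fix s y assume h: "s \<in> Omega n"
  have p: "periodic_mod n (\<lambda>x. U (exch n y s) (x + 1) - U s (x + 1))"
   by (intro periodic_mod_intros periodic_mod_shift U)
  have "norm (ramp_left n (\<lambda>x. U (exch n y s) (x + 1) - U s (x + 1)) y) \<le> (\<Sum>x\<in>torus n. \<bar>U (exch n y s) (x + 1) - U s (x + 1)\<bar>)"
   using norm_ramp_left_torus[OF p, of y] by simp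
  also have "... = (\<Sum>x\<in>torus n. \<bar>U (exch n y s) x - U s x\<bar>)"
   by (rule sum_torus_shift) (intro periodic_mod_comp2[OF U U])
  also have "... \<le> t" by (rule inc[OF h])
  finally show "norm (G y (exch n y s) - G y s) \<le> \<bar>k s\<bar> * t"
   unfolding G_def exch_invariantD[OF k] right_diff_distrib[symmetric] ramp_left_diff
   by (simp add: abs_mult mult_left_mono)
 qed
 also have "... = A * D / 2 + 4 / A * E (\<lambda>s. (k s)^2 * (\<Sum>x\<in>torus n. (U s x)^2)) + t^2 / (A * real n) * E (\<lambda>s. (k s)^2)
   + real n * t * E (\<lambda>s. \<bar>k s\<bar>)"
 proof -
  have "E (\<lambda>s. (k s)^2 * ((real n)^2 * (\<Sum>x\<in>torus n. (U s x)^2))) = (real n)^2 * E (\<lambda>s. (k s)^2 * (\<Sum>x\<in>torus n. (U s x)^2))"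
   using E_cmult[of "(real n)^2" "\<lambda>s. (k s)^2 * (\<Sum>x\<in>torus n. (U s x)^2)"] by (simp add: mult_ac)
  moreover have "E (\<lambda>s. (\<bar>k s\<bar> * t)^2) = t^2 * E (\<lambda>s. (k s)^2)"
   using E_cmult[of "t^2" "\<lambda>s. (k s)^2"] by (simp add: mult_ac power_mult_distrib)
  moreover have "E (\<lambda>s. \<bar>k s\<bar> * t) = t * E (\<lambda>s. \<bar>k s\<bar>)"
   using E_cmult[of t "\<lambda>s. \<bar>k s\<bar>"] by (simp add: mult_ac)
  ultimately show ?thesis using A n_pos by (simp add: field_simps power2_eq_square)
 qed
 finally show ?thesis by simp
qed

text \<open>An exchange shifts a spin difference of size at most 2 by one site. By
  \<open>kernel_abel\<close> a block then changes by differences of \<open>q\<close> only, and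
  summing over \<open>x\<close> yields at most twice the total variation.\<close>

lemma block_increment:
 assumes q: "kernel_bound q L c" and h: "s \<in> Omega n"
 shows "(\<Sum>x\<in>torus n. \<bar>block n q L (exch n y s) x - block n q L s x\<bar>) \<le> 4 * c"
proof -
 let ?d = "spin n s (y + 1) - spin n s y"
 have d: "\<bar>?d\<bar> \<le> 2" using abs_spin[OF h n_pos, of y] abs_spin[OF h n_pos, of "y+1"] by linarith
 have L: "L \<ge> 1" using q by (simp add: kernel_bound_def)
 let ?e = "\<lambda>x j. site n y (x + int j)"
 have eq: "block n q L (exch n y s) x - block n q L s x = ?d * (\<Sum>j=1..L. q j * (?e x j - ?e x (j - 1)))" for x
 proof -
  have "block n q L (exch n y s) x - block n q L s x = (\<Sum>j=1..L. q j * (?d * (site n y (x + int j) - site n y (x + int j - 1))))"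
   unfolding block_def sum_subtractf[symmetric] cspin_exch[OF n_ge] by (simp add: algebra_simps)
  also have "... = ?d * (\<Sum>j=1..L. q j * (?e x j - ?e x (j - 1)))"
   unfolding sum_distrib_left by (intro sum.cong refl) (simp add: of_nat_diff algebra_simps)
  finally show ?thesis .
 qed
 have "\<bar>block n q L (exch n y s) x - block n q L s x\<bar>
   \<le> 2 * (\<bar>q L\<bar> * ?e x L + \<bar>q 1\<bar> * ?e x 0 + (\<Sum>j=1..<L. \<bar>q j - q (j + 1)\<bar> * ?e x j))" for x
 proof -
  have "\<bar>\<Sum>j=1..<L. (q j - q (j + 1)) * ?e x j\<bar> \<le> (\<Sum>j=1..<L. \<bar>q j - q (j + 1)\<bar> * ?e x j)"
   by (rule order_trans[OF sum_abs]) (simp add: abs_mult)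
  moreover have "\<bar>q L * ?e x L\<bar> = \<bar>q L\<bar> * ?e x L" "\<bar>q 1 * ?e x 0\<bar> = \<bar>q 1\<bar> * ?e x 0" by (simp_all add: abs_mult)
  ultimately have "\<bar>\<Sum>j=1..L. q j * (?e x j - ?e x (j - 1))\<bar> \<le> \<bar>q L\<bar> * ?e x L + \<bar>q 1\<bar> * ?e x 0 + (\<Sum>j=1..<L. \<bar>q j - q (j + 1)\<bar> * ?e x j)"
   unfolding kernel_abel[OF L, of q "?e x"] by linarith
  then show ?thesis unfolding eq abs_mult using d by (intro mult_mono) auto
 qed
 then have "(\<Sum>x\<in>torus n. \<bar>block n q L (exch n y s) x - block n q L s x\<bar>)
   \<le> (\<Sum>x\<in>torus n. 2 * (\<bar>q L\<bar> * ?e x L + \<bar>q 1\<bar> * ?e x 0 + (\<Sum>j=1..<L. \<bar>q j - q (j + 1)\<bar> * ?e x j)))"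
  by (intro sum_mono)
 also have "... = 2 * (\<bar>q L\<bar> * (\<Sum>x\<in>torus n. ?e x L) + \<bar>q 1\<bar> * (\<Sum>x\<in>torus n. ?e x 0) + (\<Sum>j=1..<L. \<bar>q j - q (j + 1)\<bar> * (\<Sum>x\<in>torus n. ?e x j)))"
 proof -
  have "(\<Sum>x\<in>torus n. \<Sum>j=1..<L. \<bar>q j - q (j + 1)\<bar> * ?e x j) = (\<Sum>j=1..<L. \<bar>q j - q (j + 1)\<bar> * (\<Sum>x\<in>torus n. ?e x j))"
   by (subst sum.swap) (simp add: sum_distrib_left)
  then show ?thesis by (simp only: sum_distrib_left[symmetric] sum.distrib)
 qed
 also have "... = 2 * (\<bar>q L\<bar> + \<bar>q 1\<bar> + (\<Sum>j=1..<L. \<bar>q j - q (j + 1)\<bar>))"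
  by (simp only: sum_site_shift[OF n_pos]) simp
 also have "... \<le> 4 * c" using q by (simp add: kernel_bound_def)
 finally show ?thesis .
qed

text \<open>A self-bounding estimate: moving the kernel to the other factor writes the sum of
  squared blocks as a linear field whose coefficients \<open>U\<close> are averages of blocks again,
  and \<open>linear_field_bound\<close> returns half of the quantity to be estimated.\<close>

lemma block_energy:
 assumes q: "kernel_bound q L c" and k: "exch_invariant k"
  and k01: "\<And>s. s \<in> Omega n ==> 0 \<le> k s \<and> k s \<le> 1"
 shows "E (\<lambda>s. k s * (\<Sum>x\<in>torus n. (block n q L s x)^2))
  \<le> c^2 * (8 * (real L)^2 * D + 12 * real L * real n * E k)"
proof -
 define b where "b = block n q L"
 define U where "U s x = (\<Sum>j=1..L. q j * b s (x - int j))" for s x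
 have bp: "periodic_mod n (b s)" for s unfolding b_def by (rule periodic_mod_block)
 have Up: "periodic_mod n (U s)" for s
  unfolding U_def [abs_def] by (intro periodic_mod_intros periodic_mod_shift_diff[OF bp])
 have L: "L \<ge> 1" and c: "c > 0" and qc: "\<And>j. j \<in> {1..L} ==> \<bar>q j\<bar> \<le> c" using q by (auto simp: kernel_bound_def)
 have id: "(\<Sum>x\<in>torus n. (b s x)^2) = (\<Sum>x\<in>torus n. U s x * cspin n s x)" for s
 proof -
  have "(\<Sum>x\<in>torus n. (b s x)^2) = (\<Sum>x\<in>torus n. \<Sum>j=1..L. q j * b s x * cspin n s (x + int j))"
   unfolding power2_eq_square by (subst (2) b_def) (simp add: block_def sum_distrib_left mult_ac)
  also have "... = (\<Sum>j=1..L. \<Sum>x\<in>torus n. q j * b s x * cspin n s (x + int j))" by (rule sum.swap)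
  also have "... = (\<Sum>j=1..L. \<Sum>x\<in>torus n. q j * b s (x - int j) * cspin n s x)"
  proof (rule sum.cong[OF refl])
   fix j
   have "periodic_mod n (\<lambda>x. q j * b s (x - int j) * cspin n s x)"
    by (intro periodic_mod_intros periodic_mod_shift_diff[OF bp] periodic_mod_cspin)
   from sum_torus_shift[OF this, of "int j"]
   show "(\<Sum>x\<in>torus n. q j * b s x * cspin n s (x + int j)) = (\<Sum>x\<in>torus n. q j * b s (x - int j) * cspin n s x)" by simp
  qed
  also have "... = (\<Sum>x\<in>torus n. U s x * cspin n s x)"
   unfolding U_def sum_distrib_right by (rule sum.swap)
  finally show ?thesis .
 qed
 have Usq: "(\<Sum>x\<in>torus n. (U s x)^2) \<le> c^2 * (real L)^2 * (\<Sum>x\<in>torus n. (b s x)^2)" for s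
 proof -
  have "(U s x)^2 \<le> real L * c^2 * (\<Sum>j=1..L. (b s (x - int j))^2)" for x
  proof -
   have "(U s x)^2 \<le> (\<Sum>j=1..L. (q j * b s (x - int j))^2) * real (card {1..L})"
    unfolding U_def by (rule sum_squared_le_sum_of_squares)
   also have "... \<le> (\<Sum>j=1..L. c^2 * (b s (x - int j))^2) * real (card {1..L})"
    unfolding power_mult_distrib
    by (intro mult_right_mono sum_mono) (use power_mono[OF qc, of _ 2] in auto)
   finally show ?thesis by (simp add: sum_distrib_left mult_ac)
  qed
  then have "(\<Sum>x\<in>torus n. (U s x)^2) \<le> (\<Sum>x\<in>torus n. real L * c^2 * (\<Sum>j=1..L. (b s (x - int j))^2))"
   by (intro sum_mono)
  also have "... = real L * c^2 * (\<Sum>j=1..L. \<Sum>x\<in>torus n. (b s (x - int j))^2)"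
   unfolding sum_distrib_left[symmetric] by (subst sum.swap) simp
  also have "... = real L * c^2 * (\<Sum>j=1..L. \<Sum>x\<in>torus n. (b s x)^2)"
   using sum_torus_shift_diff[OF periodic_mod_comp[OF bp, of "\<lambda>z. z^2"]] by simp
  finally show ?thesis by (simp add: power2_eq_square mult_ac)
 qed
 have Uinc: "(\<Sum>x\<in>torus n. \<bar>U (exch n y s) x - U s x\<bar>) \<le> 4 * c^2 * real L" if h: "s \<in> Omega n" for s y
 proof -
  have "\<bar>U (exch n y s) x - U s x\<bar> \<le> (\<Sum>j=1..L. c * \<bar>b (exch n y s) (x - int j) - b s (x - int j)\<bar>)" for x
   unfolding U_def sum_subtractf[symmetric] right_diff_distrib[symmetric]
   by (rule order_trans[OF sum_abs], rule sum_mono) (use qc in \<open>auto simp: abs_mult intro!: mult_right_mono\<close>)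
  then have "(\<Sum>x\<in>torus n. \<bar>U (exch n y s) x - U s x\<bar>) \<le> (\<Sum>x\<in>torus n. \<Sum>j=1..L. c * \<bar>b (exch n y s) (x - int j) - b s (x - int j)\<bar>)"
   by (intro sum_mono)
  also have "... = (\<Sum>j=1..L. c * (\<Sum>x\<in>torus n. \<bar>b (exch n y s) (x - int j) - b s (x - int j)\<bar>))"
   by (subst sum.swap) (simp add: sum_distrib_left)
  also have "... = (\<Sum>j=1..L. c * (\<Sum>x\<in>torus n. \<bar>b (exch n y s) x - b s x\<bar>))"
   using sum_torus_shift_diff[OF periodic_mod_comp2[OF bp bp, of "\<lambda>u v. \<bar>u - v\<bar>"]] by simp
  also have "... \<le> (\<Sum>j=1..L. c * (4 * c))"
   using block_increment[OF q h, of y] c unfolding b_def by (intro sum_mono mult_left_mono) auto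
  finally show ?thesis by (simp add: power2_eq_square mult_ac)
 qed
 let ?B = "E (\<lambda>s. k s * (\<Sum>x\<in>torus n. (b s x)^2))"
 \<comment> \<open>Makes 4 / A * (c * L)^2 equal to 1 / 2, so that the second term of
   \<open>linear_field_bound\<close> is absorbed on the left.\<close>
 let ?A = "8 * c^2 * (real L)^2"
 have A: "?A > 0" using c L by simp
 have "?B \<le> \<bar>E (\<lambda>s. k s * (\<Sum>x\<in>torus n. U s x * cspin n s x))\<bar>" unfolding id by simp
 also have "... \<le> ?A * D / 2 + 4 / ?A * E (\<lambda>s. (k s)^2 * (\<Sum>x\<in>torus n. (U s x)^2)) + (4 * c^2 * real L)^2 / (?A * real n) * E (\<lambda>s. (k s)^2)
   + real n * (4 * c^2 * real L) * E (\<lambda>s. \<bar>k s\<bar>)"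
  by (rule linear_field_bound[OF A Up k _ Uinc]) auto
 also have "... \<le> 4 * c^2 * (real L)^2 * D + ?B / 2 + 2 * c^2 * E k + 4 * c^2 * real L * real n * E k"
 proof -
  have kk: "(k s)^2 \<le> k s" if "s \<in> Omega n" for s
   using k01[OF that] by (simp add: power2_eq_square mult_left_le)
  have "E (\<lambda>s. (k s)^2 * (\<Sum>x\<in>torus n. (U s x)^2)) \<le> E (\<lambda>s. c^2 * (real L)^2 * (k s * (\<Sum>x\<in>torus n. (b s x)^2)))"
  proof (rule E_mono)
   fix s assume h: "s \<in> Omega n"
   have "(k s)^2 * (\<Sum>x\<in>torus n. (U s x)^2) \<le> k s * (c^2 * (real L)^2 * (\<Sum>x\<in>torus n. (b s x)^2))"
    using kk[OF h] k01[OF h] Usq[of s] by (intro mult_mono) (auto intro: sum_nonneg)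
   then show "(k s)^2 * (\<Sum>x\<in>torus n. (U s x)^2) \<le> c^2 * (real L)^2 * (k s * (\<Sum>x\<in>torus n. (b s x)^2))"
    by (simp add: mult_ac)
  qed
  then have 1: "4 / ?A * E (\<lambda>s. (k s)^2 * (\<Sum>x\<in>torus n. (U s x)^2)) \<le> 4 / ?A * (c^2 * (real L)^2 * ?B)"
   unfolding E_cmult using A by (intro mult_left_mono) auto
  have 2: "4 / ?A * (c^2 * (real L)^2 * ?B) = ?B / 2" using c L by (simp add: field_simps)
  have Ek: "E (\<lambda>s. (k s)^2) \<le> E k" by (rule E_mono[OF kk])
  have Ek0: "0 \<le> E k" using k01 by (intro E_nonneg) auto
  have "(4 * c^2 * real L)^2 / (?A * real n) = 2 * c^2 / real n" using c L n_pos by (simp add: field_simps power2_eq_square)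
  also have "... \<le> 2 * c^2" using n_pos by (simp add: divide_le_eq mult_le_cancel_left1)
  finally have 3: "(4 * c^2 * real L)^2 / (?A * real n) * E (\<lambda>s. (k s)^2) \<le> 2 * c^2 * E k"
   using Ek Ek0 E_nonneg[of "\<lambda>s. (k s)^2"] by (intro mult_mono) auto
  have 4: "E (\<lambda>s. \<bar>k s\<bar>) = E k" by (rule E_cong) (use k01 in auto)
  show ?thesis using 1 2 3 unfolding 4 by (simp add: mult_ac)
 qed
 finally have "?B \<le> 8 * c^2 * (real L)^2 * D + 4 * c^2 * E k + 8 * c^2 * real L * real n * E k" by simp
 moreover have "4 * c^2 * E k \<le> 4 * c^2 * real L * real n * E k"
 proof -
  have "1 * 1 \<le> real L * real n" using L n_pos by (intro mult_mono) auto
  moreover have "0 \<le> 4 * c^2 * E k" using k01 by (intro mult_nonneg_nonneg E_nonneg) auto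
  ultimately have "4 * c^2 * E k * 1 \<le> 4 * c^2 * E k * (real L * real n)" by (intro mult_left_mono) auto
  then show ?thesis by (simp add: mult_ac)
 qed
 ultimately show ?thesis unfolding b_def by (simp add: algebra_simps)
qed

lemma avg_block_energy:
 assumes l: "l \<ge> 1" and k: "exch_invariant k"
  and k01: "\<And>s. s \<in> Omega n ==> 0 \<le> k s \<and> k s \<le> 1"
 shows "E (\<lambda>s. k s * (\<Sum>x\<in>torus n. (avg_block n l s x)^2)) \<le> 8 * D + 12 * (real n / real l) * E k"
proof -
 have "(1 / real l)^2 * (8 * (real l)^2 * D + 12 * real l * real n * E k) = 8 * D + 12 * (real n / real l) * E k"
  using l by (simp add: power2_eq_square field_simps)
 then show ?thesis using block_energy[OF kernel_bound_const[OF l] k k01] by simp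
qed

end

section \<open>Replacing spins by block averages in local sums\<close>

lemma mod_ne_if_between:
 assumes "x < y" "y < x + int n" shows "x mod int n \<noteq> y mod int n"
proof
 assume "x mod int n = y mod int n"
 then have "int n dvd y - x" by (metis mod_eq_dvd_iff)
 then show False using assms by (simp add: zdvd_not_zless)
qed

context config_weight
begin

text \<open>On the torus y - (n - 1) is the site y + 1 again, whence the upper bound n - 2 on
  \<open>k\<close>.\<close>

lemma cspin_exch_left:
 assumes "0 < k" "k + 2 \<le> int n" shows "cspin n (exch n y s) (y - k) = cspin n s (y - k)"
 using assms by (intro cspin_exch_eq n_ge mod_ne_if_between) auto

lemma cspin_exch_right:
 assumes "2 \<le> k" "k + 1 \<le> int n" shows "cspin n (exch n y s) (y + k) = cspin n s (y + k)"
 using assms by (intro cspin_exch_eq n_ge mod_ne_if_between[symmetric]) auto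

text \<open>The common error of all replacements. \<open>R s y\<close> does not feel the exchange
  across its own bond, so the increment falls on \<Phi> alone; this is what the position of the
  ramps off the bond is for.\<close>

lemma replace_bound:
 fixes \<Phi> :: "(int => nat) => 'b::real_normed_vector"
 assumes A: "A > 0" and c: "c \<ge> 0" and d: "\<delta> \<ge> 0"
  and R: "\<And>s y. s \<in> Omega n ==> \<bar>R s y\<bar> \<le> c * real l"
  and loc: "\<And>s y. s \<in> Omega n ==> R (exch n y s) y = R s y"
  and w: "\<And>s. s \<in> Omega n ==> norm (\<Phi> s) \<le> w s"
  and inc: "\<And>s y. s \<in> Omega n ==> norm (\<Phi> (exch n y s) - \<Phi> s) \<le> \<delta>"
 shows "norm (E (\<lambda>s. (\<Sum>y\<in>torus n. (spin n s y - spin n s (y + 1)) * R s y) *\<^sub>R \<Phi> s))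
  \<le> A * D / 2 + 4 * (c * real l)^2 / (A * real n) * E (\<lambda>s. (w s)^2) + (c * real l * \<delta>)^2 / (A * real n) + real n * (c * real l * \<delta>)"
proof -
 define G where "G y s = R s y *\<^sub>R \<Phi> s" for y s
 have id: "(\<Sum>y\<in>torus n. (spin n s y - spin n s (y + 1)) * R s y) *\<^sub>R \<Phi> s
   = (\<Sum>y\<in>torus n. (spin n s y - spin n s (y + 1)) *\<^sub>R G y s)" for s
  by (simp add: G_def scaleR_sum_left)
 have "norm (E (\<lambda>s. (\<Sum>y\<in>torus n. (spin n s y - spin n s (y + 1)) * R s y) *\<^sub>R \<Phi> s))
  \<le> A * D / 2 + 1 / (A * (real n)^2) * (4 * E (\<lambda>s. real n * (c * real l)^2 * (w s)^2) + real n * E (\<lambda>s. (c * real l * \<delta>)^2))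
    + real n * E (\<lambda>s. c * real l * \<delta>)"
  unfolding id
 proof (rule ibp_bound[OF A, where G = G])
  fix s assume h: "s \<in> Omega n"
  have "norm (G y s) \<le> c * real l * w s" for y
   unfolding G_def using R[OF h, of y] w[OF h] c by (simp add: mult_mono)
  then have "(norm (G y s))^2 \<le> (c * real l)^2 * (w s)^2" for y
   unfolding power_mult_distrib[symmetric] by (intro power_mono) auto
  then have "(\<Sum>y\<in>torus n. (norm (G y s))^2) \<le> (\<Sum>y\<in>torus n. (c * real l)^2 * (w s)^2)" by (intro sum_mono)
  then show "(\<Sum>y\<in>torus n. (norm (G y s))^2) \<le> real n * (c * real l)^2 * (w s)^2" by simp
 next
  fix s y assume h: "s \<in> Omega n"
  have "G y (exch n y s) - G y s = R s y *\<^sub>R (\<Phi> (exch n y s) - \<Phi> s)"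
   by (simp add: G_def loc[OF h] scaleR_diff_right)
  then show "norm (G y (exch n y s) - G y s) \<le> c * real l * \<delta>"
   using R[OF h, of y] inc[OF h, of y] c by (simp add: mult_mono)
 qed
 also have "... = A * D / 2 + 4 * (c * real l)^2 / (A * real n) * E (\<lambda>s. (w s)^2) + (c * real l * \<delta>)^2 / (A * real n) + real n * (c * real l * \<delta>)"
  unfolding E_cmult E_const using A n_pos by (simp add: field_simps power2_eq_square)
 finally show ?thesis .
qed

lemma replace_right:
 fixes \<Phi> :: "(int => nat) => 'b::real_normed_vector"
 assumes A: "A > 0" and l: "l \<ge> 1" and d: "\<delta> \<ge> 0"
  and F: "\<And>s. periodic_mod n (F s)"
  and Fc: "\<And>s x. s \<in> Omega n ==> \<bar>F s x\<bar> \<le> c"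
  and loc: "\<And>s y i. i \<in> {1..l} ==> F (exch n y s) (y - int i) = F s (y - int i)"
  and w: "\<And>s. s \<in> Omega n ==> norm (\<Phi> s) \<le> w s"
  and inc: "\<And>s y. s \<in> Omega n ==> norm (\<Phi> (exch n y s) - \<Phi> s) \<le> \<delta>"
 shows "norm (E (\<lambda>s. (\<Sum>x\<in>torus n. (cspin n s (x + 1) - avg_block n l s x) * F s x) *\<^sub>R \<Phi> s))
  \<le> A * D / 2 + 4 * (c * real l)^2 / (A * real n) * E (\<lambda>s. (w s)^2) + (c * real l * \<delta>)^2 / (A * real n) + real n * (c * real l * \<delta>)"
proof -
 obtain s0 where "s0 \<in> Omega n" using weight_sum by fastforce
 then have c: "c \<ge> 0" using Fc[of s0 0] by linarith
 have l0: "l > 0" using l by simp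
 have "(\<Sum>x\<in>torus n. (cspin n s (x + 1) - avg_block n l s x) * F s x)
   = (\<Sum>y\<in>torus n. (spin n s y - spin n s (y + 1)) * ramp_left l (F s) y)" for s
  using tele_right[OF F[of s] periodic_mod_spin[of n s] l0]
  unfolding avg_block_right[OF l0] by (simp add: cspin_def)
 then show ?thesis
 proof (simp only:, intro replace_bound A c d w inc)
  show "\<bar>ramp_left l (F s) y\<bar> \<le> c * real l" if "s \<in> Omega n" for s y
   using norm_ramp_left_le[of "F s" c l y] Fc[OF that] by simp
  show "ramp_left l (F (exch n y s)) y = ramp_left l (F s) y" for s y
   unfolding ramp_left_def using loc by (intro sum.cong refl) simp
 qed
qed

lemma replace_left:
 fixes \<Phi> :: "(int => nat) => 'b::real_normed_vector"
 assumes A: "A > 0" and l: "l \<ge> 1" and d: "\<delta> \<ge> 0"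
  and F: "\<And>s. periodic_mod n (F s)"
  and Fc: "\<And>s x. s \<in> Omega n ==> \<bar>F s x\<bar> \<le> c"
  and loc: "\<And>s y i. i \<in> {1..l} ==> F (exch n y s) (y + 1 + int i) = F s (y + 1 + int i)"
  and w: "\<And>s. s \<in> Omega n ==> norm (\<Phi> s) \<le> w s"
  and inc: "\<And>s y. s \<in> Omega n ==> norm (\<Phi> (exch n y s) - \<Phi> s) \<le> \<delta>"
 shows "norm (E (\<lambda>s. (\<Sum>x\<in>torus n. (cspin n s (x - 1) - avg_block n l s (x - int l - 1)) * F s x) *\<^sub>R \<Phi> s))
  \<le> A * D / 2 + 4 * (c * real l)^2 / (A * real n) * E (\<lambda>s. (w s)^2) + (c * real l * \<delta>)^2 / (A * real n) + real n * (c * real l * \<delta>)"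
proof -
 obtain s0 where "s0 \<in> Omega n" using weight_sum by fastforce
 then have c: "c \<ge> 0" using Fc[of s0 0] by linarith
 have l0: "l > 0" using l by simp
 have "(\<Sum>x\<in>torus n. (cspin n s (x - 1) - avg_block n l s (x - int l - 1)) * F s x)
   = (\<Sum>y\<in>torus n. (spin n s y - spin n s (y + 1)) * (- ramp_right l (F s) y))" for s
  using tele_left[OF F[of s] periodic_mod_spin[of n s] l0]
  unfolding avg_block_left[OF l0] by (simp add: cspin_def sum_negf)
 then show ?thesis
 proof (simp only:, intro replace_bound A c d w inc)
  show "\<bar>- ramp_right l (F s) y\<bar> \<le> c * real l" if "s \<in> Omega n" for s y
   using norm_ramp_right_le[of "F s" c l y] Fc[OF that] by simp
  show "- ramp_right l (F (exch n y s)) y = - ramp_right l (F s) y" for s y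
   unfolding ramp_right_def using loc by (simp only: neg_equal_iff_equal, intro sum.cong refl) simp
 qed
qed

text \<open>Nothing has to become small here, so windows of macroscopic length do. Replacing the
  second spin by a block leaves a ramp, which is a block with linear kernel and has energy O(n^2 (D
  + 1)), and a linear field with block coefficients.\<close>

lemma quadratic_field_bound:
 assumes n: "n \<ge> 8" and r: "r \<in> {1, 2}" and k: "exch_invariant k"
  and k1: "\<And>s. s \<in> Omega n ==> \<bar>k s\<bar> \<le> 1"
 shows "\<bar>E (\<lambda>s. k s * (\<Sum>x\<in>torus n. cspin n s x * cspin n s (x + int r)))\<bar> \<le> 600 * (D + 1)"
proof -
 \<comment> \<open>A fixed fraction of \<open>n\<close> keeps n / l bounded; a quarter is short
   enough that window and shift together do not wrap around to the bond.\<close>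
 define l where "l = n div 4"
 have l1: "l \<ge> 1" and ln: "real n \<le> 8 * real l" and ln': "int l + int r + 1 \<le> int n" and lle: "real l \<le> real n"
  using n r unfolding l_def by auto
 have l0: "l > 0" using l1 by simp
 define b where "b s = avg_block n l s" for s
 define Q where "Q s = (\<Sum>x\<in>torus n. cspin n s x * cspin n s (x + int r))" for s
 define F where "F s x = cspin n s (x + 1 - int r)" for s x
 have Fp: "periodic_mod n (F s)" for s
  unfolding F_def [abs_def] using periodic_mod_shift_diff[OF periodic_mod_shift[OF periodic_mod_cspin, of n s 1], of "int r"]
  by (simp add: algebra_simps)
 have bp: "periodic_mod n (b s)" for s unfolding b_def by (rule periodic_mod_block)
 have split: "Q s = (\<Sum>y\<in>torus n. (spin n s y - spin n s (y + 1)) *\<^sub>R ramp_left l (F s) y)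
    + (\<Sum>x\<in>torus n. b s (x + int r - 1) * cspin n s x)" for s
 proof -
  have "(\<Sum>y\<in>torus n. (spin n s y - spin n s (y + 1)) *\<^sub>R ramp_left l (F s) y)
    = (\<Sum>x\<in>torus n. (cspin n s (x + 1) - b s x) * F s x)"
   using tele_right[OF Fp[of s] periodic_mod_spin[of n s] l0]
   unfolding b_def avg_block_right[OF l0] by (simp add: cspin_def)
  also have "... = (\<Sum>x\<in>torus n. (cspin n s (x + (int r - 1) + 1) - b s (x + (int r - 1))) * F s (x + (int r - 1)))"
   by (rule sum_torus_shift[symmetric])
     (intro periodic_mod_intros periodic_mod_shift periodic_mod_cspin bp Fp)
  also have "... = Q s - (\<Sum>x\<in>torus n. b s (x + int r - 1) * cspin n s x)"
  proof -
   have "x + (int r - 1) + 1 = x + int r" "x + (int r - 1) = x + int r - 1" "x + int r - 1 + 1 - int r = x" for x :: int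
    by simp_all
   then show ?thesis unfolding Q_def F_def by (simp add: sum_subtractf left_diff_distrib right_diff_distrib add_diff_eq mult.commute)
  qed
  finally show ?thesis by simp
 qed
 define G where "G y s = k s *\<^sub>R ramp_left l (F s) y" for y s
 have ramp_block: "ramp_left l (F s) y = block n (\<lambda>j. (real j - 1) / real l) l s (y - int r - int l)" for s y
  unfolding ramp_left_def block_def F_def
  by (rule sum.reindex_bij_witness[where i = "\<lambda>j. l + 1 - j" and j = "\<lambda>j. l + 1 - j"])
    (use l0 in \<open>auto simp: of_nat_diff field_simps\<close>)
 have one: "exch_invariant (\<lambda>_. 1::real)" by (simp add: exch_invariant_def)
 have "norm (E (\<lambda>s. \<Sum>y\<in>torus n. (spin n s y - spin n s (y + 1)) *\<^sub>R G y s))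
  \<le> 1 * D / 2 + 1 / (1 * (real n)^2) * (4 * E (\<lambda>s. 1 * (\<Sum>x\<in>torus n. (block n (\<lambda>j. (real j - 1) / real l) l s x)^2)) + real n * E (\<lambda>s. 0^2)) + real n * E (\<lambda>_. 0)"
 proof (rule ibp_bound[where G = G])
  fix s assume h: "s \<in> Omega n"
  have "(norm (G y s))^2 \<le> (block n (\<lambda>j. (real j - 1) / real l) l s (y - (int r + int l)))^2" for y
  proof -
   have "(k s)^2 \<le> 1" using power_mono[OF k1[OF h], of 2] by simp
   then show ?thesis unfolding G_def ramp_block by (simp add: power_mult_distrib mult_left_le_one_le diff_diff_eq)
  qed
  then have "(\<Sum>y\<in>torus n. (norm (G y s))^2) \<le> (\<Sum>y\<in>torus n. (block n (\<lambda>j. (real j - 1) / real l) l s (y - (int r + int l)))^2)"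
   by (intro sum_mono)
  also have "... = (\<Sum>y\<in>torus n. (block n (\<lambda>j. (real j - 1) / real l) l s y)^2)"
   by (rule sum_torus_shift_diff) (rule periodic_mod_comp[OF periodic_mod_block])
  finally show "(\<Sum>y\<in>torus n. (norm (G y s))^2) \<le> 1 * (\<Sum>x\<in>torus n. (block n (\<lambda>j. (real j - 1) / real l) l s x)^2)" by simp
 next
  fix s y
  have "F (exch n y s) (y - int i) = F s (y - int i)" if "i \<in> {1..l}" for i
   using cspin_exch_left[of "int i - 1 + int r" y s] that r ln' by (auto simp: F_def algebra_simps)
  then have "ramp_left l (F (exch n y s)) y = ramp_left l (F s) y"
   unfolding ramp_left_def by (intro sum.cong refl) simp
  then show "norm (G y (exch n y s) - G y s) \<le> 0" by (simp add: G_def exch_invariantD[OF k])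
 qed simp
 also have "... \<le> D / 2 + 1 / (real n)^2 * (4 * (8 * (real l)^2 * D + 12 * real l * real n))"
 proof -
  have "E (\<lambda>s. 1 * (\<Sum>x\<in>torus n. (block n (\<lambda>j. (real j - 1) / real l) l s x)^2)) \<le> 8 * (real l)^2 * D + 12 * real l * real n"
   using block_energy[OF kernel_bound_ramp[OF l1] one] by (simp add: E_const)
  then have "1 / (real n)^2 * (4 * E (\<lambda>s. 1 * (\<Sum>x\<in>torus n. (block n (\<lambda>j. (real j - 1) / real l) l s x)^2)))
    \<le> 1 / (real n)^2 * (4 * (8 * (real l)^2 * D + 12 * real l * real n))" by (intro mult_left_mono) auto
  then show ?thesis by (simp add: E_const)
 qed
 also have "... \<le> D / 2 + (32 * D + 48)"
 proof -
  have "(real l)^2 * D \<le> (real n)^2 * D" using lle dirichlet_nonneg[of n \<mu>] by (intro mult_right_mono power_mono) auto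
  moreover have "real l * real n \<le> (real n)^2" using lle by (simp add: power2_eq_square mult_right_mono)
  ultimately have "4 * (8 * (real l)^2 * D + 12 * real l * real n) \<le> (real n)^2 * (32 * D + 48)" by (simp add: algebra_simps)
  then have "1 / (real n)^2 * (4 * (8 * (real l)^2 * D + 12 * real l * real n)) \<le> 32 * D + 48"
   using n_pos by (simp add: divide_le_eq mult.commute)
  then show ?thesis by simp
 qed
 finally have P1: "\<bar>E (\<lambda>s. k s * (\<Sum>y\<in>torus n. (spin n s y - spin n s (y + 1)) *\<^sub>R ramp_left l (F s) y))\<bar> \<le> D / 2 + (32 * D + 48)"
  by (simp add: G_def sum_distrib_left mult_ac)
 have "\<bar>E (\<lambda>s. k s * (\<Sum>x\<in>torus n. b s (x + int r - 1) * cspin n s x))\<bar>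
  \<le> 1 * D / 2 + 4 / 1 * E (\<lambda>s. (k s)^2 * (\<Sum>x\<in>torus n. (b s (x + int r - 1))^2)) + (4 / real l)^2 / (1 * real n) * E (\<lambda>s. (k s)^2)
   + real n * (4 / real l) * E (\<lambda>s. \<bar>k s\<bar>)"
 proof (rule linear_field_bound[OF _ _ k])
  fix s show "periodic_mod n (\<lambda>x. b s (x + int r - 1))"
   using periodic_mod_shift[OF bp, of s "int r - 1"] by (simp add: algebra_simps)
 next
  fix s y assume h: "s \<in> Omega n"
  have "(\<Sum>x\<in>torus n. \<bar>b (exch n y s) (x + int r - 1) - b s (x + int r - 1)\<bar>) = (\<Sum>x\<in>torus n. \<bar>b (exch n y s) x - b s x\<bar>)"
   using sum_torus_shift[OF periodic_mod_comp2[OF bp[of "exch n y s"] bp[of s], of "\<lambda>u v. \<bar>u - v\<bar>"], where k = "int r - 1"] by (simp add: algebra_simps)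
  also have "... \<le> 4 * (1 / real l)" unfolding b_def by (rule block_increment[OF kernel_bound_const[OF l1] h])
  finally show "(\<Sum>x\<in>torus n. \<bar>b (exch n y s) (x + int r - 1) - b s (x + int r - 1)\<bar>) \<le> 4 / real l" by simp
 qed auto
 also have "... \<le> D / 2 + 4 * (8 * D + 96) + 16 + 32"
 proof -
  have k2: "(k s)^2 \<le> 1" if "s \<in> Omega n" for s using power_mono[OF k1[OF that], of 2] by simp
  have "E (\<lambda>s. (k s)^2 * (\<Sum>x\<in>torus n. (b s (x + int r - 1))^2)) \<le> E (\<lambda>s. 1 * (\<Sum>x\<in>torus n. (b s x)^2))"
  proof (rule E_mono)
   fix s assume h: "s \<in> Omega n"
   have "(\<Sum>x\<in>torus n. (b s (x + int r - 1))^2) = (\<Sum>x\<in>torus n. (b s x)^2)"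
    using sum_torus_shift[OF periodic_mod_comp[OF bp[of s], of "\<lambda>z. z^2"], where k = "int r - 1"] by (simp add: algebra_simps)
   then show "(k s)^2 * (\<Sum>x\<in>torus n. (b s (x + int r - 1))^2) \<le> 1 * (\<Sum>x\<in>torus n. (b s x)^2)"
    using k2[OF h] by (simp add: mult_left_le_one_le sum_nonneg)
  qed
  also have "... \<le> 8 * D + 12 * (real n / real l)"
   unfolding b_def using avg_block_energy[OF l1 one] by (simp add: E_const)
  also have "... \<le> 8 * D + 96" using ln l0 by (simp add: divide_le_eq)
  finally have 1: "E (\<lambda>s. (k s)^2 * (\<Sum>x\<in>torus n. (b s (x + int r - 1))^2)) \<le> 8 * D + 96" .
  have "(4 / real l)^2 / (1 * real n) \<le> 16"
  proof -
   have "(4 / real l)^2 \<le> 4^2" using l1 by (intro power_mono) (auto simp: divide_le_eq)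
   moreover have "(4 / real l)^2 / real n \<le> (4 / real l)^2" using n_pos by (simp add: divide_le_eq mult_le_cancel_left1)
   ultimately show ?thesis by simp
  qed
  then have 2: "(4 / real l)^2 / (1 * real n) * E (\<lambda>s. (k s)^2) \<le> 16 * 1"
   by (intro mult_mono E_le_const k2 E_nonneg) auto
  have "real n * (4 / real l) \<le> 32" using ln l0 by (simp add: field_simps)
  then have 3: "real n * (4 / real l) * E (\<lambda>s. \<bar>k s\<bar>) \<le> 32 * 1"
   by (intro mult_mono E_le_const k1 E_nonneg) auto
  show ?thesis using 1 2 3 by simp
 qed
 finally have P2: "\<bar>E (\<lambda>s. k s * (\<Sum>x\<in>torus n. b s (x + int r - 1) * cspin n s x))\<bar> \<le> D / 2 + 4 * (8 * D + 96) + 16 + 32" .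
 have "E (\<lambda>s. k s * Q s) = E (\<lambda>s. k s * (\<Sum>y\<in>torus n. (spin n s y - spin n s (y + 1)) *\<^sub>R ramp_left l (F s) y))
   + E (\<lambda>s. k s * (\<Sum>x\<in>torus n. b s (x + int r - 1) * cspin n s x))"
  unfolding split distrib_left E_add ..
 then show ?thesis using P1 P2 dirichlet_nonneg[of n \<mu>] unfolding Q_def by (simp add: algebra_simps)
qed

text \<open>The right neighbour is replaced first. The left one then has as cofactor the middle spin
  and a block further right, which stay off the bonds on the left, so the second replacement is
  local too. What remains is two blocks times a bounded spin, paid by block energies with weight
  |mag|.\<close>

lemma cubic_field_bound:
 assumes l1: "l \<ge> 1" and ln: "2 * l + 2 \<le> n" and k: "exch_invariant k"
  and k1: "\<And>s. s \<in> Omega n ==> \<bar>k s\<bar> \<le> \<bar>mag n s\<bar>"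
 shows "\<bar>E (\<lambda>s. k s * (\<Sum>x\<in>torus n. cspin n s (x - 1) * cspin n s x * cspin n s (x + 1)))\<bar>
  \<le> 33 * D + 128 * ((real l)^2 / real n) * E (\<lambda>s. (mag n s)^2) + 48 * (real n / real l) * E (\<lambda>s. \<bar>mag n s\<bar>)"
proof -
 define b where "b s = avg_block n l s" for s
 have l0: "l > 0" using l1 by simp
 have bp: "periodic_mod n (b s)" for s unfolding b_def by (rule periodic_mod_block)
 have cp: "periodic_mod n (cspin n s)" for s by (rule periodic_mod_cspin)
 have b2: "\<bar>b s x\<bar> \<le> 2" if "s \<in> Omega n" for s x unfolding b_def by (rule abs_avg_block[OF that n_pos l0])
 have c2: "\<bar>cspin n s x\<bar> \<le> 2" if "s \<in> Omega n" for s x by (rule abs_cspin[OF that n_pos])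
 have prod4: "\<bar>u * v\<bar> \<le> 4" if "\<bar>u\<bar> \<le> 2" "\<bar>v\<bar> \<le> 2" for u v :: real
  using mult_mono[OF that] by (simp add: abs_mult)
 define w where "w s = \<bar>mag n s\<bar>" for s
 have kinc: "norm (k (exch n y s) - k s) \<le> 0" for s y by (simp add: exch_invariantD[OF k])
 define S1 where "S1 s = (\<Sum>x\<in>torus n. (cspin n s (x + 1) - b s x) * (cspin n s (x - 1) * cspin n s x))" for s
 define S2 where "S2 s = (\<Sum>x\<in>torus n. (cspin n s (x - 1) - b s (x - int l - 1)) * (cspin n s x * b s x))" for s
 define S3 where "S3 s = (\<Sum>x\<in>torus n. b s (x - int l - 1) * (cspin n s x * b s x))" for s
 have "norm (E (\<lambda>s. S1 s *\<^sub>R k s)) \<le> 1 * D / 2 + 4 * (4 * real l)^2 / (1 * real n) * E (\<lambda>s. (w s)^2) + (4 * real l * 0)^2 / (1 * real n) + real n * (4 * real l * 0)"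
  unfolding S1_def b_def
 proof (rule replace_right[OF _ l1])
  show "periodic_mod n (\<lambda>x. cspin n s (x - 1) * cspin n s x)" for s
   by (intro periodic_mod_intros cp periodic_mod_shift_diff[OF cp])
  show "\<bar>cspin n s (x - 1) * cspin n s x\<bar> \<le> 4" if "s \<in> Omega n" for s x
   using c2[OF that] by (intro prod4) auto
  show "cspin n (exch n y s) (y - int i - 1) * cspin n (exch n y s) (y - int i) = cspin n s (y - int i - 1) * cspin n s (y - int i)"
   if "i \<in> {1..l}" for s y i
   using cspin_exch_left[of "int i + 1" y s] cspin_exch_left[of "int i" y s] that ln by (simp add: algebra_simps)
  show "norm (k s) \<le> w s" if "s \<in> Omega n" for s using k1[OF that] by (simp add: w_def)
 qed (use kinc in auto)
 then have P1: "\<bar>E (\<lambda>s. k s * S1 s)\<bar> \<le> D / 2 + 64 * ((real l)^2 / real n) * E (\<lambda>s. (mag n s)^2)"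
  by (simp add: w_def mult.commute power_mult_distrib)
 have "norm (E (\<lambda>s. S2 s *\<^sub>R k s)) \<le> 1 * D / 2 + 4 * (4 * real l)^2 / (1 * real n) * E (\<lambda>s. (w s)^2) + (4 * real l * 0)^2 / (1 * real n) + real n * (4 * real l * 0)"
  unfolding S2_def b_def
 proof (rule replace_left[OF _ l1])
  show "periodic_mod n (\<lambda>x. cspin n s x * avg_block n l s x)" for s
   by (intro periodic_mod_intros cp bp[unfolded b_def])
  show "\<bar>cspin n s x * avg_block n l s x\<bar> \<le> 4" if "s \<in> Omega n" for s x
   using c2[OF that] b2[OF that] unfolding b_def by (intro prod4) auto
  show "cspin n (exch n y s) (y + 1 + int i) * avg_block n l (exch n y s) (y + 1 + int i)
    = cspin n s (y + 1 + int i) * avg_block n l s (y + 1 + int i)" if i: "i \<in> {1..l}" for s y i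
  proof -
   have "cspin n (exch n y s) (y + 1 + int i + int j) = cspin n s (y + 1 + int i + int j)" if "j \<le> l" for j
    using cspin_exch_right[of "1 + int i + int j" y s] that i ln by (simp add: algebra_simps)
   from this[of 0] this show ?thesis unfolding block_def by simp
  qed
  show "norm (k s) \<le> w s" if "s \<in> Omega n" for s using k1[OF that] by (simp add: w_def)
 qed (use kinc in auto)
 then have P2: "\<bar>E (\<lambda>s. k s * S2 s)\<bar> \<le> D / 2 + 64 * ((real l)^2 / real n) * E (\<lambda>s. (mag n s)^2)"
  by (simp add: w_def mult.commute power_mult_distrib)
 have S3b: "\<bar>S3 s\<bar> \<le> 2 * (\<Sum>x\<in>torus n. (b s x)^2)" if h: "s \<in> Omega n" for s
 proof -
  have "\<bar>b s (x - int l - 1) * (cspin n s x * b s x)\<bar> \<le> (b s (x - (int l + 1)))^2 + (b s x)^2" for x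
  proof -
   have "\<bar>b s (x - int l - 1) * (cspin n s x * b s x)\<bar> \<le> 2 * (\<bar>b s (x - int l - 1)\<bar> * \<bar>b s x\<bar>)"
    using mult_right_mono[OF c2[OF h, of x], of "\<bar>b s (x - int l - 1)\<bar> * \<bar>b s x\<bar>"] by (simp add: abs_mult mult_ac)
   also have "... \<le> (b s (x - int l - 1))^2 + (b s x)^2"
    using sum_squares_bound[of "\<bar>b s (x - int l - 1)\<bar>" "\<bar>b s x\<bar>"] by simp
   finally show ?thesis by (simp add: algebra_simps)
  qed
  then have "\<bar>S3 s\<bar> \<le> (\<Sum>x\<in>torus n. (b s (x - (int l + 1)))^2 + (b s x)^2)"
   unfolding S3_def by (intro order_trans[OF sum_abs] sum_mono)
  also have "... = 2 * (\<Sum>x\<in>torus n. (b s x)^2)"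
   using sum_torus_shift_diff[OF periodic_mod_comp[OF bp[of s], of "\<lambda>z. z^2"], where k = "int l + 1"] by (simp add: sum.distrib)
  finally show ?thesis .
 qed
 have "norm (E (\<lambda>s. k s * S3 s)) \<le> E (\<lambda>s. 2 * (w s * (\<Sum>x\<in>torus n. (b s x)^2)))"
 proof (rule norm_E_le)
  fix s assume h: "s \<in> Omega n"
  have "\<bar>k s\<bar> * \<bar>S3 s\<bar> \<le> w s * (2 * (\<Sum>x\<in>torus n. (b s x)^2))"
   using k1[OF h] S3b[OF h] unfolding w_def by (intro mult_mono) (auto intro!: sum_nonneg)
  then show "norm (k s * S3 s) \<le> 2 * (w s * (\<Sum>x\<in>torus n. (b s x)^2))" by (simp add: abs_mult mult_ac)
 qed
 also have "... = 2 * E (\<lambda>s. w s * (\<Sum>x\<in>torus n. (b s x)^2))" by (rule E_cmult)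
 also have "... \<le> 2 * (8 * D + 12 * (real n / real l) * E w)"
  unfolding b_def using abs_mag n_pos
  by (intro mult_left_mono avg_block_energy l1) (auto simp: w_def exch_invariant_def mag_exch n_ge)
 finally have P3: "\<bar>E (\<lambda>s. k s * S3 s)\<bar> \<le> 16 * D + 24 * (real n / real l) * E (\<lambda>s. \<bar>mag n s\<bar>)"
  by (simp add: w_def[abs_def])
 have "k s * (\<Sum>x\<in>torus n. cspin n s (x - 1) * cspin n s x * cspin n s (x + 1)) = k s * S1 s + k s * S2 s + k s * S3 s" for s
  unfolding distrib_left[symmetric] S1_def S2_def S3_def sum.distrib[symmetric]
  by (intro arg_cong2[where f = "(*)"] sum.cong refl) (simp add: algebra_simps)
 then have "E (\<lambda>s. k s * (\<Sum>x\<in>torus n. cspin n s (x - 1) * cspin n s x * cspin n s (x + 1)))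
   = E (\<lambda>s. k s * S1 s) + E (\<lambda>s. k s * S2 s) + E (\<lambda>s. k s * S3 s)" by (simp add: E_add)
 moreover have "0 \<le> real n / real l * E (\<lambda>s. \<bar>mag n s\<bar>)" by (intro mult_nonneg_nonneg E_nonneg) auto
 ultimately show ?thesis using P1 P2 P3 dirichlet_nonneg[of n \<mu>] by linarith
qed

end

section \<open>Drift of the entropy\<close>

definition pair_sum :: "nat => nat => (int => nat) => real" where
 "pair_sum n r s = (\<Sum>x\<in>torus n. cspin n s x * cspin n s (x + int r))"

definition triple_sum :: "nat => (int => nat) => real" where
 "triple_sum n s = (\<Sum>x\<in>torus n. cspin n s (x - 1) * cspin n s x * cspin n s (x + 1))"

lemma sum_cspin_shift: "(\<Sum>x\<in>torus n. cspin n s (x + k)) = 0"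
 using sum_torus_shift[OF periodic_mod_cspin] sum_cspin by metis

lemma sum_spin_shift: "n > 0 ==> (\<Sum>x\<in>torus n. spin n s (x + k)) = real n * mag n s"
 using sum_torus_shift[OF periodic_mod_spin] sum_spin by metis

lemma spin_eq: "spin n s x = mag n s + cspin n s x"
 by (simp add: cspin_def)

lemma pair_spin_sum:
 "(\<Sum>x\<in>torus n. spin n s x * spin n s (x + int r)) = real n * (mag n s)^2 + pair_sum n r s"
proof -
 have "(\<Sum>x\<in>torus n. spin n s x * spin n s (x + int r))
   = (\<Sum>x\<in>torus n. (mag n s)^2 + mag n s * cspin n s x + mag n s * cspin n s (x + int r) + cspin n s x * cspin n s (x + int r))"
  unfolding spin_eq by (intro sum.cong refl) (simp add: algebra_simps power2_eq_square)
 then show ?thesis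
  by (simp add: sum.distrib sum_distrib_left[symmetric] sum_cspin sum_cspin_shift pair_sum_def)
qed

lemma pair_spin_sum_sym: "(\<Sum>x\<in>torus n. spin n s (x - 1) * spin n s (x + 1)) = real n * (mag n s)^2 + pair_sum n 2 s"
proof -
 have "(\<Sum>x\<in>torus n. spin n s (x - 1) * spin n s (x + 1)) = (\<Sum>x\<in>torus n. (\<lambda>x. spin n s x * spin n s (x + 2)) (x - 1))" by (simp add: algebra_simps)
 also have "... = (\<Sum>x\<in>torus n. spin n s x * spin n s (x + int 2))"
  by (subst sum_torus_shift_diff) (auto intro!: periodic_mod_intros periodic_mod_shift periodic_mod_spin)
 finally show ?thesis unfolding pair_spin_sum .
qed

lemma pair_spin_sum_left: "(\<Sum>x\<in>torus n. spin n s x * spin n s (x - 1)) = real n * (mag n s)^2 + pair_sum n 1 s"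
proof -
 have "(\<Sum>x\<in>torus n. spin n s x * spin n s (x - 1)) = (\<Sum>x\<in>torus n. (\<lambda>x. spin n s x * spin n s (x + 1)) (x - 1))" by (simp add: algebra_simps)
 also have "... = (\<Sum>x\<in>torus n. spin n s x * spin n s (x + int 1))"
  by (subst sum_torus_shift_diff) (auto intro!: periodic_mod_intros periodic_mod_shift periodic_mod_spin)
 finally show ?thesis unfolding pair_spin_sum .
qed

lemma triple_spin_sum:
 "(\<Sum>x\<in>torus n. spin n \<eta> (x - 1) * spin n \<eta> x * spin n \<eta> (x + 1))
  = real n * (mag n \<eta>) ^ 3 + mag n \<eta> * (2 * pair_sum n 1 \<eta> + pair_sum n 2 \<eta>) + triple_sum n \<eta>"
proof -
 let ?m = "mag n \<eta>" and ?c = "cspin n \<eta>"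
 have p: "periodic_mod n (\<lambda>x. ?c x * ?c (x + int r))" for r
  by (intro periodic_mod_intros periodic_mod_shift periodic_mod_cspin)
 have s: "(\<Sum>x\<in>torus n. ?c (x - 1)) = 0" using sum_cspin_shift[of n \<eta> "-1"] by simp
 have 1: "(\<Sum>x\<in>torus n. ?c (x - 1) * ?c x) = pair_sum n 1 \<eta>"
  using sum_torus_shift_diff[OF p[of 1], of 1] by (simp add: pair_sum_def)
 have 2: "(\<Sum>x\<in>torus n. ?c (x - 1) * ?c (x + 1)) = pair_sum n 2 \<eta>"
  using sum_torus_shift_diff[OF p[of 2], of 1] by (simp add: pair_sum_def add.commute)
 have 3: "(\<Sum>x\<in>torus n. ?c x * ?c (x + 1)) = pair_sum n 1 \<eta>" by (simp add: pair_sum_def)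
 have "(\<Sum>x\<in>torus n. spin n \<eta> (x - 1) * spin n \<eta> x * spin n \<eta> (x + 1))
  = (\<Sum>x\<in>torus n. ?m ^ 3 + ?m^2 * ?c (x - 1) + ?m^2 * ?c x + ?m^2 * ?c (x + 1) + ?m * (?c (x - 1) * ?c x) + ?m * (?c (x - 1) * ?c (x + 1))
    + ?m * (?c x * ?c (x + 1)) + ?c (x - 1) * ?c x * ?c (x + 1))"
  unfolding spin_eq by (intro sum.cong refl) (simp add: algebra_simps power2_eq_square power3_eq_cube)
 also have "... = real n * ?m ^ 3 + ?m * (pair_sum n 1 \<eta>) + ?m * (pair_sum n 2 \<eta>) + ?m * pair_sum n 1 \<eta> + triple_sum n \<eta>"
  unfolding sum.distrib sum_distrib_left[symmetric] s sum_cspin sum_cspin_shift 1 2 3 triple_sum_def by simp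
 finally show ?thesis by (simp add: algebra_simps)
qed

lemma sum_flip_rate:
 assumes "s \<in> Omega n" "n > 0"
 shows "(\<Sum>x\<in>torus n. flip_rate \<theta> n x s)
  = real n - 2 * gam \<theta> n * (real n * (mag n s)^2 + pair_sum n 1 s) + (gam \<theta> n)^2 * (real n * (mag n s)^2 + pair_sum n 2 s)"
proof -
 have "(\<Sum>x\<in>torus n. flip_rate \<theta> n x s) = (\<Sum>x\<in>torus n. 1 - gam \<theta> n * (spin n s x * spin n s (x - 1)) - gam \<theta> n * (spin n s x * spin n s (x + int 1))
   + (gam \<theta> n)^2 * (spin n s (x - 1) * spin n s (x + 1)))"
  unfolding flip_rate_def by (intro sum.cong refl) (simp add: algebra_simps)
 then show ?thesis
  unfolding sum.distrib sum_subtractf sum_distrib_left[symmetric] pair_spin_sum pair_spin_sum_sym pair_spin_sum_left by simp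
qed

lemma sum_spin_flip_rate:
 assumes h: "s \<in> Omega n" and n: "n > 0"
 shows "(\<Sum>x\<in>torus n. spin n s x * flip_rate \<theta> n x s)
  = (1 - 2 * gam \<theta> n) * (real n * mag n s) + (gam \<theta> n)^2 * (real n * (mag n s) ^ 3 + mag n s * (2 * pair_sum n 1 s + pair_sum n 2 s) + triple_sum n s)"
proof -
 have "(\<Sum>x\<in>torus n. spin n s x * flip_rate \<theta> n x s) = (\<Sum>x\<in>torus n. spin n s x - gam \<theta> n * spin n s (x - 1) - gam \<theta> n * spin n s (x + 1)
   + (gam \<theta> n)^2 * (spin n s (x - 1) * spin n s x * spin n s (x + 1)))"
 proof (intro sum.cong refl)
  fix x
  show "spin n s x * flip_rate \<theta> n x s = spin n s x - gam \<theta> n * spin n s (x - 1) - gam \<theta> n * spin n s (x + 1)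
   + (gam \<theta> n)^2 * (spin n s (x - 1) * spin n s x * spin n s (x + 1))"
   using spin_cases[OF h n, of x] unfolding flip_rate_def by (auto simp: algebra_simps)
 qed
 moreover have "(\<Sum>x\<in>torus n. spin n s (x - 1)) = real n * mag n s" using sum_spin_shift[OF n, of s "-1"] by simp
 ultimately show ?thesis
  unfolding sum.distrib sum_subtractf sum_distrib_left[symmetric] triple_spin_sum
  by (simp add: sum_spin[OF n] sum_spin_shift[OF n] algebra_simps)
qed

lemma mag_flip:
 assumes "s \<in> Omega n" "x \<in> torus n" "n > 0"
 shows "mag n (flip s x) = mag n s - 2 * spin n s x / real n"
proof -
 have "(\<Sum>z\<in>torus n. spin n (flip s x) z) = (\<Sum>z\<in>torus n. spin n s z - 2 * (if z = x then spin n s z else 0))"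
  by (intro sum.cong refl) (use assms in \<open>auto simp: spin_flip site_def torus_mod_self\<close>)
 also have "... = (\<Sum>z\<in>torus n. spin n s z) - 2 * spin n s x"
  using assms(2) by (simp add: sum_subtractf sum_distrib_left[symmetric])
 finally show ?thesis by (simp add: mag_def diff_divide_distrib)
qed

lemma flip_rate_flip:
 assumes h: "s \<in> Omega n" and x: "x \<in> torus n" and n: "n \<ge> 2"
 shows "flip_rate \<theta> n x (flip s x)
  = 1 + gam \<theta> n * spin n s x * (spin n s (x - 1) + spin n s (x + 1)) + (gam \<theta> n)^2 * spin n s (x - 1) * spin n s (x + 1)"
proof -
 have "(x + 1) mod int n \<noteq> x mod int n" "(x - 1) mod int n \<noteq> x mod int n"
  using mod_succ_ne[OF n, of x] mod_succ_ne[OF n, of "x - 1"] by auto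
 then show ?thesis unfolding flip_rate_def spin_flip[OF h x] by (simp add: site_def)
qed

text \<open>Holds because the spin at \<open>x\<close> squares to 1. Positivity and the upper bound
  4 of the rates are read off from the product.\<close>

lemma flip_rate_factor: "flip_rate \<theta> n x s = (1 - gam \<theta> n * spin n s x * spin n s (x - 1)) * (1 - gam \<theta> n * spin n s x * spin n s (x + 1))"
 if "s \<in> Omega n" "n > 0"
 using spin_cases[OF that, of x] unfolding flip_rate_def by (auto simp: algebra_simps power2_eq_square)

lemma flip_rate_pos:
 assumes "s \<in> Omega n" "n > 0" "\<bar>gam \<theta> n\<bar> < 1" shows "flip_rate \<theta> n x s > 0"
 unfolding flip_rate_factor[OF assms(1,2)]
 by (rule mult_pos_pos)
   (use spin_cases[OF assms(1,2), of x] spin_cases[OF assms(1,2), of "x-1"] spin_cases[OF assms(1,2), of "x+1"] assms(3) in auto)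

section \<open>Taylor bounds and coefficients for the drift\<close>

lemma sinh_approx: assumes "\<bar>x\<bar> \<le> (1::real)" shows "\<bar>sinh x - x\<bar> \<le> 2 * \<bar>x\<bar> ^ 3"
proof -
 have T: "\<bar>exp y - (1 + y + y^2 / 2)\<bar> \<le> exp \<bar>y\<bar> * \<bar>y\<bar> ^ 3 / 2" for y :: real
  using Taylor_exp_field[of y 2] by (simp add: eval_nat_numeral field_simps)
 have e: "exp \<bar>x\<bar> \<le> 3" using exp_le assms by (meson exp_le_cancel_iff order_trans)
 have "exp \<bar>x\<bar> * \<bar>x\<bar> ^ 3 / 2 \<le> 2 * \<bar>x\<bar> ^ 3"
  using mult_right_mono[OF e, of "\<bar>x\<bar> ^ 3"] zero_le_power[of "\<bar>x\<bar>" 3] by linarith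
 then show ?thesis using T[of x] T[of "-x"] by (simp add: sinh_field_def field_simps) linarith
qed

lemma sinh_lin: assumes "\<bar>x\<bar> \<le> (1::real)" shows "\<bar>sinh x\<bar> \<le> 3 * \<bar>x\<bar>"
proof -
 have "\<bar>x\<bar> ^ 3 \<le> \<bar>x\<bar> ^ 1" using assms by (intro power_decreasing) auto
 then show ?thesis using sinh_approx[OF assms] by simp
qed

text \<open>The difference is 2 (sinh m - m) (sinh m + m), so the cubic error of sinh gives order
  4.\<close>

lemma cosh_approx2: assumes "\<bar>m\<bar> \<le> (1::real)" shows "\<bar>cosh (2 * m) - (1 + 2 * m^2)\<bar> \<le> 16 * m ^ 4"
proof -
 have "cosh (2 * m) - (1 + 2 * m^2) = 2 * ((sinh m - m) * (sinh m + m))"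
  unfolding cosh_double cosh_square_eq by (simp add: algebra_simps power2_eq_square)
 moreover have "\<bar>(sinh m - m) * (sinh m + m)\<bar> \<le> (2 * \<bar>m\<bar> ^ 3) * (4 * \<bar>m\<bar>)"
  unfolding abs_mult using sinh_approx[OF assms] sinh_lin[OF assms] by (intro mult_mono) auto
 moreover have "(2 * \<bar>m\<bar> ^ 3) * (4 * \<bar>m\<bar>) = 8 * m ^ 4" by (simp add: power_abs[symmetric] eval_nat_numeral abs_mult)
 ultimately show ?thesis by simp
qed

lemma sinh_approx2: assumes m: "\<bar>m\<bar> \<le> (1::real)" shows "\<bar>sinh (2 * m) - 2 * m\<bar> \<le> 31 * \<bar>m\<bar> ^ 3"
proof -
 have c: "cosh m - 1 = 2 * (sinh (m / 2))^2"
  using cosh_double[of "m / 2"] cosh_square_eq[of "m/2"] by simp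
 have "(sinh (m / 2))^2 \<le> (3 * (\<bar>m\<bar> / 2))^2"
  using sinh_lin[of "m / 2"] m by (intro abs_le_square_iff[THEN iffD1]) auto
 then have "\<bar>cosh m - 1\<bar> \<le> 9 / 2 * m^2" unfolding c by (simp add: power_mult_distrib power_divide)
 then have "\<bar>sinh m * (cosh m - 1)\<bar> \<le> (3 * \<bar>m\<bar>) * (9 / 2 * m^2)"
  unfolding abs_mult using sinh_lin[OF m] by (intro mult_mono) auto
 also have "... = 27 / 2 * \<bar>m\<bar> ^ 3" by (simp add: eval_nat_numeral abs_mult_self_eq mult_ac)
 finally have 1: "\<bar>sinh m * (cosh m - 1)\<bar> \<le> 27 / 2 * \<bar>m\<bar> ^ 3" .
 have "sinh (2 * m) - 2 * m = 2 * (sinh m - m) + 2 * (sinh m * (cosh m - 1))"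
  unfolding sinh_double by (simp add: algebra_simps)
 also have "\<bar>...\<bar> \<le> 2 * \<bar>sinh m - m\<bar> + 2 * \<bar>sinh m * (cosh m - 1)\<bar>"
 proof -
  have "\<bar>2 * a + 2 * b\<bar> \<le> 2 * \<bar>a\<bar> + 2 * \<bar>b\<bar>" for a b :: real by linarith
  then show ?thesis .
 qed
 also have "... \<le> 2 * (2 * \<bar>m\<bar> ^ 3) + 2 * (27 / 2 * \<bar>m\<bar> ^ 3)"
  using 1 sinh_approx[OF m] by (intro add_mono mult_left_mono) auto
 finally show ?thesis by simp
qed

text \<open>The drift term of the entropy estimate for the reference weight \<open>exp (n m^2 / 2)\<close>. With this
 choice the coefficient of \<open>n m^2\<close> vanishes identically.\<close>

definition drift :: "real => nat => (int => nat) => real" where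
 "drift \<theta> n s = (\<Sum>x\<in>torus n. flip_rate \<theta> n x (flip s x) * exp (real n * ((mag n (flip s x))^2 - (mag n s)^2) / 2) - flip_rate \<theta> n x s)"

text \<open>Write \<sigma> for the spin at \<open>x\<close>. Flipping it changes n m^2 / 2 by 2 / n
  - 2 \<sigma> m, and exp (- 2 \<sigma> m) = cosh (2 m) - \<sigma> sinh (2 m) because \<sigma> is 1
  or -1. The summand is thus a polynomial in the spins, and the sum is exact.\<close>

lemma drift_eq:
 fixes \<theta> :: real
 assumes h: "\<eta> \<in> Omega n" and n: "n \<ge> 2"
 defines "m \<equiv> mag n \<eta>" and "g \<equiv> gam \<theta> n"
 defines "S1 \<equiv> real n * m^2 + pair_sum n 1 \<eta>" and "S2 \<equiv> real n * m^2 + pair_sum n 2 \<eta>"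
  and "T \<equiv> real n * m ^ 3 + m * (2 * pair_sum n 1 \<eta> + pair_sum n 2 \<eta>) + triple_sum n \<eta>"
 shows "drift \<theta> n \<eta> = exp (2 / real n) * (cosh (2 * m) * (real n + g^2 * S2 + 2 * g * S1) - sinh (2 * m) * (real n * m + g^2 * T + 2 * g * (real n * m)))
   - (real n - 2 * g * S1 + g^2 * S2)"
proof -
 have n0: "n > 0" using n by simp
 let ?s = "spin n \<eta>" and ?e = "exp (2 / real n)" and ?ch = "cosh (2 * m)" and ?sh = "sinh (2 * m)"
 have "flip_rate \<theta> n x (flip \<eta> x) * exp (real n * ((mag n (flip \<eta> x))^2 - (mag n \<eta>)^2) / 2)
   = ?e * (?ch * (1 + g^2 * (?s (x - 1) * ?s (x + 1)) + g * (?s x * ?s (x - 1)) + g * (?s x * ?s (x + int 1)))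
    - ?sh * (?s x + g^2 * (?s (x - 1) * ?s x * ?s (x + 1)) + g * ?s (x - 1) + g * ?s (x + 1)))" if x: "x \<in> torus n" for x
 proof -
  have "real n * ((m - 2 * ?s x / real n)^2 - m^2) / 2 = 2 * (?s x * ?s x) / real n - 2 * (?s x * m)"
   using n0 by (simp add: power2_eq_square field_simps)
  then have "exp (real n * ((mag n (flip \<eta> x))^2 - (mag n \<eta>)^2) / 2) = ?e * exp (- (2 * (?s x * m)))"
   unfolding mag_flip[OF h x n0] m_def[symmetric] spin_sq[OF h n0] by (simp add: exp_add[symmetric])
  also have "exp (- (2 * (?s x * m))) = ?ch - ?s x * ?sh"
   using spin_cases[OF h n0, of x] by (auto simp: cosh_minus_sinh cosh_plus_sinh)
  finally have ee: "exp (real n * ((mag n (flip \<eta> x))^2 - (mag n \<eta>)^2) / 2) = ?e * (?ch - ?s x * ?sh)" .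
  have gen: "(1 + g * s * (p + q) + g^2 * p * q) * (e * (ch - s * sh))
    = e * (ch * (1 + g^2 * (p * q) + g * (s * p) + g * (s * q)) - sh * (s + g^2 * (p * s * q) + g * p + g * q))"
   if "s = 1 \<or> s = -1" for s p q e ch sh :: real
   using that by (auto simp: algebra_simps)
  show ?thesis
   unfolding flip_rate_flip[OF h x n] g_def[symmetric] ee of_nat_1
   by (rule gen) (rule spin_cases[OF h n0])
 qed
 then have "drift \<theta> n \<eta> = (\<Sum>x\<in>torus n. ?e * (?ch * (1 + g^2 * (?s (x - 1) * ?s (x + 1)) + g * (?s x * ?s (x - 1)) + g * (?s x * ?s (x + int 1)))
    - ?sh * (?s x + g^2 * (?s (x - 1) * ?s x * ?s (x + 1)) + g * ?s (x - 1) + g * ?s (x + 1)))) - (\<Sum>x\<in>torus n. flip_rate \<theta> n x \<eta>)"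
  unfolding drift_def sum_subtractf by simp
 moreover have "(\<Sum>x\<in>torus n. ?s (x - 1)) = real n * m" using sum_spin_shift[OF n0, of \<eta> "-1"] by (simp add: m_def)
 ultimately show ?thesis
  unfolding sum_flip_rate[OF h n0] sum_distrib_left[symmetric] sum_subtractf sum.distrib pair_spin_sum pair_spin_sum_sym pair_spin_sum_left triple_spin_sum
   sum_spin_shift[OF n0] sum_spin[OF n0] g_def[symmetric] m_def[symmetric] S1_def[symmetric] S2_def[symmetric] T_def[symmetric]
  by (simp add: algebra_simps)
qed

text \<open>The first three are the coefficients of \<open>pair_sum n 1\<close>,
  \<open>pair_sum n 2\<close> and \<open>triple_sum n\<close> in \<open>drift_eq\<close>, the fourth
  is the part that depends on \<open>m\<close> alone.\<close>

lemma drift_coefficients: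
 fixes m g N :: real
 assumes m: "\<bar>m\<bar> \<le> 1" and g: "0 \<le> g" "g \<le> 1" and N: "N \<ge> 8"
 defines "e \<equiv> exp (2 / N)" and "ch \<equiv> cosh (2 * m)" and "sh \<equiv> sinh (2 * m)"
 shows "\<bar>e * (2 * g * ch - 2 * g^2 * m * sh) + 2 * g\<bar> \<le> 210"
  and "\<bar>e * (g^2 * ch - g^2 * m * sh) - g^2\<bar> \<le> 105"
  and "\<bar>e * g^2 * sh\<bar> \<le> 66 * \<bar>m\<bar>"
  and "e * (ch * (N + g^2 * N * m^2 + 2 * g * N * m^2) - sh * (N * m + g^2 * N * m ^ 3 + 2 * g * N * m)) - N - g^2 * N * m^2 + 2 * g * N * m^2
    \<le> 832 + 200 * (N * m ^ 4)"
proof -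
 have mp: "\<bar>m\<bar> ^ k \<le> 1" for k using m by (intro power_le_one) auto
 have m2: "m^2 \<le> 1" using mp[of 2] by simp
 have m4: "m ^ 4 \<le> 1" using mp[of 4] by (simp add: power_even_abs)
 have m3: "\<bar>m\<bar> ^ 3 \<le> \<bar>m\<bar>" using power_decreasing[of 1 3 "\<bar>m\<bar>"] m by simp
 have g2: "0 \<le> g^2" "g^2 \<le> 1" using g by (auto simp: power_le_one)
 have e0: "0 \<le> e" by (simp add: e_def)
 have "e \<le> 1 + 2 * (2 / N)" unfolding e_def
  using exp_bound_lemma[of "2 / N"] N by simp
 then have e1: "e - 1 \<le> 4 / N" by simp
 have "4 / N \<le> 1" using N by simp
 with e1 have e2: "e \<le> 2" by linarith
 have e1': "1 \<le> e" unfolding e_def using N by simp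
 define r1 where "r1 = ch - (1 + 2 * m^2)"
 define r2 where "r2 = sh - 2 * m"
 have r1: "\<bar>r1\<bar> \<le> 16 * m ^ 4" unfolding r1_def ch_def by (rule cosh_approx2[OF m])
 have r2: "\<bar>r2\<bar> \<le> 31 * \<bar>m\<bar> ^ 3" unfolding r2_def sh_def by (rule sinh_approx2[OF m])
 have ch: "\<bar>ch\<bar> \<le> 19" using r1 m2 m4 zero_le_power2[of m] unfolding r1_def by linarith
 have sh: "\<bar>sh\<bar> \<le> 33 * \<bar>m\<bar>" using r2 m3 unfolding r2_def by linarith
 have sh33: "\<bar>sh\<bar> \<le> 33" using sh m by linarith
 have msh: "\<bar>m * sh\<bar> \<le> 33" using mult_mono[OF m sh33] by (simp add: abs_mult)
 have gch: "\<bar>g * ch\<bar> \<le> 19" using mult_mono[OF g(2) ch] g by (simp add: abs_mult)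
 have g2ch: "\<bar>g^2 * ch\<bar> \<le> 19" using mult_mono[OF g2(2) ch] g2 by (simp add: abs_mult)
 have g2msh: "\<bar>g^2 * (m * sh)\<bar> \<le> 33" using mult_mono[OF g2(2) msh] g2 by (simp add: abs_mult)
 have emul: "\<bar>e * z\<bar> \<le> 2 * \<bar>z\<bar>" for z using e0 e2 by (simp add: abs_mult mult_right_mono)
 have "\<bar>2 * (g * ch) - 2 * (g^2 * (m * sh))\<bar> \<le> 104" using gch g2msh by linarith
 then have "\<bar>e * (2 * (g * ch) - 2 * (g^2 * (m * sh)))\<bar> \<le> 208" by (intro order_trans[OF emul]) simp
 then have "\<bar>e * (2 * (g * ch) - 2 * (g^2 * (m * sh))) + 2 * g\<bar> \<le> 210" using g by linarith
 then show "\<bar>e * (2 * g * ch - 2 * g^2 * m * sh) + 2 * g\<bar> \<le> 210" by (simp only: mult.assoc)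
 have "\<bar>g^2 * ch - g^2 * (m * sh)\<bar> \<le> 52" using g2ch g2msh by linarith
 then have "\<bar>e * (g^2 * ch - g^2 * (m * sh))\<bar> \<le> 104" by (intro order_trans[OF emul]) simp
 then have "\<bar>e * (g^2 * ch - g^2 * (m * sh)) - g^2\<bar> \<le> 105" using g2 by linarith
 then show "\<bar>e * (g^2 * ch - g^2 * m * sh) - g^2\<bar> \<le> 105" by (simp only: mult.assoc)
 have "\<bar>g^2 * sh\<bar> \<le> 33 * \<bar>m\<bar>" using mult_mono[OF g2(2) sh] g2 by (simp add: abs_mult)
 then show "\<bar>e * g^2 * sh\<bar> \<le> 66 * \<bar>m\<bar>" using emul[of "g^2 * sh"] by (simp add: mult.assoc)
 define P where "P = ch * (1 + g^2 * m^2 + 2 * g * m^2) - sh * (m + g^2 * m ^ 3 + 2 * g * m)"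
 define u where "u = 1 + g^2 * m^2 + 2 * (g * m^2)"
 define v where "v = 1 + g^2 * m^2 + 2 * g"
 have gm: "0 \<le> g^2 * m^2" "g^2 * m^2 \<le> 1" "0 \<le> g * m^2" "g * m^2 \<le> 1"
  using mult_mono[OF g2(2) m2] mult_mono[OF g(2) m2] g g2 by auto
 have u: "0 \<le> u" "u \<le> 4" and v: "0 \<le> v" "v \<le> 4" using gm g unfolding u_def v_def by linarith+
 have Puv: "P = ch * u - sh * (m * v)"
  unfolding P_def u_def v_def by (simp add: algebra_simps power2_eq_square power3_eq_cube)
 have chu: "\<bar>ch * u\<bar> \<le> 19 * 4" unfolding abs_mult using ch u by (intro mult_mono) auto
 have mv: "\<bar>m * v\<bar> \<le> 1 * 4" unfolding abs_mult using m v by (intro mult_mono) auto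
 have "\<bar>sh * (m * v)\<bar> \<le> 33 * (1 * 4)" unfolding abs_mult[of sh] using sh33 mv by (intro mult_mono) auto
 then have P: "\<bar>P\<bar> \<le> 208" unfolding Puv using chu by linarith
 have 1: "(e - 1) * (N * P) \<le> 832"
 proof -
  have "(e - 1) * (N * P) \<le> \<bar>(e - 1) * (N * P)\<bar>" by simp
  also have "... = (e - 1) * (N * \<bar>P\<bar>)" using e1' N by (simp add: abs_mult)
  also have "... \<le> 4 / N * (N * 208)" using e1 e1' P N by (intro mult_mono) auto
  finally show ?thesis using N by simp
 qed
 have m4': "\<bar>m\<bar> ^ 3 * \<bar>m\<bar> = m ^ 4" by (simp add: eval_nat_numeral abs_mult_self_eq mult.assoc[symmetric])
 have 2: "P - 1 - g^2 * m^2 + 2 * g * m^2 \<le> 200 * m ^ 4"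
 proof -
  \<comment> \<open>At order m^2, with cosh (2 m) near 1 + 2 m^2 and sinh (2 m) near 2 m, the first
    product contributes 2 + g^2 + 2 g, the second - 2 - 4 g, and the last two terms - g^2 + 2 g: the
    sum is 0 for every \<open>g\<close>.\<close>
  have id: "P - 1 - g^2 * m^2 + 2 * g * m^2 = r1 * u - r2 * (m * v) + 4 * g * m ^ 4"
   unfolding Puv r1_def r2_def u_def v_def by (simp add: algebra_simps eval_nat_numeral)
  have "r1 * u \<le> \<bar>r1\<bar> * u" using u by (intro mult_right_mono) auto
  also have "... \<le> (16 * m ^ 4) * 4" using r1 u by (intro mult_mono) auto
  finally have a: "r1 * u \<le> 64 * m ^ 4" by simp
  have "- (r2 * (m * v)) \<le> \<bar>r2 * (m * v)\<bar>" by simp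
  also have "... = \<bar>r2\<bar> * (\<bar>m\<bar> * v)" using v by (simp add: abs_mult)
  also have "... \<le> (31 * \<bar>m\<bar> ^ 3) * (\<bar>m\<bar> * 4)" using r2 v by (intro mult_mono) auto
  also have "... = 124 * m ^ 4" using m4' by simp
  finally have b: "- (r2 * (m * v)) \<le> 124 * m ^ 4" .
  have "4 * g * m ^ 4 \<le> 4 * m ^ 4" using g by (intro mult_right_mono) auto
  then have "r1 * u + - (r2 * (m * v)) + 4 * g * m ^ 4 \<le> 64 * m ^ 4 + 124 * m ^ 4 + 4 * m ^ 4"
   by (intro add_mono a b)
  also have "... \<le> 200 * m ^ 4" by simp
  finally show ?thesis unfolding id by simp
 qed
 have "e * (ch * (N + g^2 * N * m^2 + 2 * g * N * m^2) - sh * (N * m + g^2 * N * m ^ 3 + 2 * g * N * m)) - N - g^2 * N * m^2 + 2 * g * N * m^2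
   = (e - 1) * (N * P) + N * (P - 1 - g^2 * m^2 + 2 * g * m^2)"
  unfolding P_def by (simp add: algebra_simps)
 also have "... \<le> 832 + N * (200 * m ^ 4)" using 1 2 N by (intro add_mono mult_left_mono) auto
 finally show "e * (ch * (N + g^2 * N * m^2 + 2 * g * N * m^2) - sh * (N * m + g^2 * N * m ^ 3 + 2 * g * N * m)) - N - g^2 * N * m^2 + 2 * g * N * m^2
    \<le> 832 + 200 * (N * m ^ 4)" by (simp add: mult_ac)
qed

text \<open>A window of length about n^(3/4). The two bounds are the factors of E m^2 and of E |m|
  in \<open>cubic_field_bound\<close>.\<close>

lemma window_exists:
 assumes "n \<ge> 10000"
 shows "\<exists>l. l \<ge> 1 \<and> 2 * l + 2 \<le> n \<and> (real l)^2 / real n \<le> 4 * sqrt (real n) \<and> real n / real l \<le> sqrt (sqrt (real n))"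
proof -
 define r where "r = sqrt (sqrt (real n))"
 have r4: "r ^ 4 = real n" using power_mult[of r 2 2] unfolding r_def by simp
 have r10: "r \<ge> 10"
 proof (rule ccontr)
  assume "\<not> r \<ge> 10"
  then have "r ^ 4 < 10 ^ 4" unfolding r_def by (intro power_strict_mono) auto
  then show False using assms unfolding r4 by simp
 qed
 have r2: "r ^ 2 = sqrt (real n)" unfolding r_def by simp
 define l where "l = nat \<lceil>r ^ 3\<rceil>"
 have r3: "r ^ 3 \<ge> 1" using r10 by (intro one_le_power) auto
 have l: "r ^ 3 \<le> real l" "real l \<le> r ^ 3 + 1" unfolding l_def using r3 by linarith+
 have l1: "1 \<le> real l" using l r3 by linarith
 have l2: "real l \<le> 2 * r ^ 3" using l r3 by linarith
 have "2 * real l + 2 \<le> 6 * r ^ 3" using l2 r3 by linarith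
 also have "... \<le> r * r ^ 3" using r10 by (intro mult_right_mono) auto
 finally have "2 * real l + 2 \<le> real n" unfolding r4[symmetric] by (simp add: eval_nat_numeral)
 then have a: "2 * l + 2 \<le> n" by linarith
 have "(real l)^2 \<le> (2 * r ^ 3)^2" using l2 by (intro power_mono) auto
 also have "... = 4 * r ^ 2 * r ^ 4" by (simp add: power_mult_distrib eval_nat_numeral)
 finally have b: "(real l)^2 / real n \<le> 4 * sqrt (real n)" unfolding r4 r2 using assms by (simp add: divide_le_eq)
 have "real n = r * r ^ 3" unfolding r4[symmetric] by (simp add: eval_nat_numeral)
 also have "... \<le> r * real l" using l r10 by (intro mult_left_mono) auto
 finally have c: "real n / real l \<le> r" using l1 by (simp add: divide_le_eq)
 show ?thesis using a b c l1 unfolding r_def by (intro exI[of _ l]) auto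
qed

section \<open>Finite-state Markov chains\<close>

lemma finite_convergent_subsequence:
 fixes F :: "nat => 's => real"
 assumes "finite S" "\<And>k s. s \<in> S ==> \<bar>F k s\<bar> \<le> 1"
 shows "\<exists>r l. strict_mono r \<and> (\<forall>s\<in>S. (\<lambda>k. F (r k) s) \<longlonglongrightarrow> l s)"
 using assms
proof (induction S)
 case empty
 show ?case by (intro exI[of _ id]) (auto simp: strict_mono_def)
next
 case (insert x S)
 then obtain r l where r: "strict_mono r" and l: "\<forall>s\<in>S. (\<lambda>k. F (r k) s) \<longlonglongrightarrow> l s" by auto
 have "\<forall>k. F (r k) x \<in> {-1..1}" using insert.prems[of x] by (auto simp: abs_le_iff)
 moreover have "seq_compact {-1..1::real}" using compact_Icc compact_imp_seq_compact by blast
 ultimately obtain y r' where r': "strict_mono r'" and y: "((\<lambda>k. F (r k) x) \<circ> r') \<longlonglongrightarrow> y" by (metis seq_compactE)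
 have "(\<lambda>k. F ((r \<circ> r') k) s) \<longlonglongrightarrow> (l(x := y)) s" if "s \<in> insert x S" for s
 proof (cases "s = x")
  case True then show ?thesis using y by (simp add: o_def)
 next
  case False
  then have "(\<lambda>k. F (r k) s) \<longlonglongrightarrow> l s" using l that by auto
  from LIMSEQ_subseq_LIMSEQ[OF this r'] show ?thesis using False by (simp add: o_def)
 qed
 then show ?case using strict_mono_o[OF r r'] by blast
qed

text \<open>Jumps are indexed by \<open>J\<close> rather than by their target: several indices may
  lead to the same state, and a jump may fix the state, as the exchange of equal spins does.\<close>

locale finite_chain =
 fixes S :: "'s set" and J :: "'k set" and rate :: "'k => 's => real" and T :: "'k => 's => 's"
  and L :: "('s => real) => 's => real"
 assumes fin_S: "finite S" and S_ne: "S \<noteq> {}" and fin_J: "finite J"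
  and rate_nonneg: "\<And>k s. k \<in> J ==> s \<in> S ==> 0 \<le> rate k s"
  and T_in: "\<And>k s. k \<in> J ==> s \<in> S ==> T k s \<in> S"
  and L_eq: "\<And>f s. s \<in> S ==> L f s = (\<Sum>k\<in>J. rate k s * (f (T k s) - f s))"
begin

text \<open>Uniformization: \<Lambda> exceeds every total jump rate, so \<open>P\<close>, the
  identity plus \<open>L\<close> / \<Lambda>, is a stochastic matrix. The summand 1 keeps \<Lambda>
  positive even if all rates vanish.\<close>

definition \<Lambda> :: real where "\<Lambda> = 1 + (\<Sum>s\<in>S. \<Sum>k\<in>J. rate k s)"

lemma total_rate: "s \<in> S ==> (\<Sum>k\<in>J. rate k s) \<le> \<Lambda>"
proof -
 assume h: "s \<in> S"
 have "(\<Sum>k\<in>J. rate k s) \<le> (\<Sum>s\<in>S. \<Sum>k\<in>J. rate k s)"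
  by (rule member_le_sum[OF h]) (auto intro!: sum_nonneg rate_nonneg fin_S)
 then show ?thesis by (simp add: \<Lambda>_def)
qed

lemma \<Lambda>_pos: "\<Lambda> > 0"
 unfolding \<Lambda>_def by (intro add_pos_nonneg sum_nonneg rate_nonneg) auto

definition stat :: "('s => real) => bool" where
 "stat w \<longleftrightarrow> (\<forall>f. (\<Sum>s\<in>S. w s * L f s) = 0)"

definition P :: "('s => real) => 's => real" where "P f s = f s + L f s / \<Lambda>"

lemma L_cong: "s \<in> S ==> (\<And>\<zeta>. \<zeta> \<in> S ==> f \<zeta> = g \<zeta>) ==> L f s = L g s"
 by (simp add: L_eq T_in)

lemma P_cong: "s \<in> S ==> (\<And>\<zeta>. \<zeta> \<in> S ==> f \<zeta> = g \<zeta>) ==> P f s = P g s"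
 using L_cong[of s f g] by (simp add: P_def)

lemma P_eq: "s \<in> S ==> P f s = (1 - (\<Sum>k\<in>J. rate k s) / \<Lambda>) * f s + (\<Sum>k\<in>J. rate k s / \<Lambda> * f (T k s))"
proof -
 assume h: "s \<in> S"
 define R where "R = (\<Sum>k\<in>J. rate k s)"
 have "L f s = (\<Sum>k\<in>J. rate k s * f (T k s)) - R * f s"
  unfolding L_eq[OF h] R_def by (simp add: right_diff_distrib sum_subtractf sum_distrib_right)
 moreover have "(\<Sum>k\<in>J. rate k s / \<Lambda> * f (T k s)) = (\<Sum>k\<in>J. rate k s * f (T k s)) / \<Lambda>"
  by (simp add: sum_divide_distrib)
 ultimately show ?thesis unfolding P_def R_def[symmetric] by (simp add: diff_divide_distrib left_diff_distrib)
qed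

lemma P_range:
 assumes "s \<in> S" "\<And>\<zeta>. \<zeta> \<in> S ==> 0 \<le> f \<zeta> \<and> f \<zeta> \<le> c"
 shows "0 \<le> P f s \<and> P f s \<le> c"
proof -
 let ?q = "(\<Sum>k\<in>J. rate k s) / \<Lambda>"
 have q: "0 \<le> 1 - ?q" using total_rate[OF assms(1)] \<Lambda>_pos by simp
 have r: "0 \<le> rate k s / \<Lambda>" if "k \<in> J" for k using rate_nonneg[OF that assms(1)] \<Lambda>_pos by simp
 have "(\<Sum>k\<in>J. rate k s / \<Lambda> * f (T k s)) \<le> (\<Sum>k\<in>J. rate k s / \<Lambda> * c)"
  using assms r T_in by (intro sum_mono mult_left_mono) auto
 also have "... = ?q * c" by (simp add: sum_distrib_right sum_divide_distrib)
 moreover have "(1 - ?q) * f s \<le> (1 - ?q) * c" using q assms by (intro mult_left_mono) auto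
 ultimately have "P f s \<le> c" unfolding P_eq[OF assms(1)] by (simp add: left_diff_distrib)
 moreover have "0 \<le> P f s" unfolding P_eq[OF assms(1)]
  using q r assms T_in by (intro add_nonneg_nonneg mult_nonneg_nonneg sum_nonneg) auto
 ultimately show ?thesis by simp
qed

lemma P_pow_range: "(\<And>\<zeta>. \<zeta> \<in> S ==> 0 \<le> f \<zeta> \<and> f \<zeta> \<le> c) ==> s \<in> S ==> 0 \<le> (P ^^ k) f s \<and> (P ^^ k) f s \<le> c"
proof (induction k arbitrary: s)
 case (Suc k)
 show ?case using P_range[OF Suc.prems(2), of "(P ^^ k) f" c] Suc.IH[OF Suc.prems(1)] by simp
qed simp

lemma P_pow_cong: "(\<And>\<zeta>. \<zeta> \<in> S ==> f \<zeta> = g \<zeta>) ==> s \<in> S ==> (P ^^ k) f s = (P ^^ k) g s"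
 by (induction k arbitrary: s) (auto intro: P_cong)

lemma P_sum: "s \<in> S ==> P (\<lambda>\<xi>. \<Sum>z\<in>S. c z * F z \<xi>) s = (\<Sum>z\<in>S. c z * P (F z) s)"
proof -
 assume h: "s \<in> S"
 have "(\<Sum>k\<in>J. rate k s / \<Lambda> * (\<Sum>z\<in>S. c z * F z (T k s))) = (\<Sum>z\<in>S. c z * (\<Sum>k\<in>J. rate k s / \<Lambda> * F z (T k s)))"
  unfolding sum_distrib_left by (subst sum.swap) (simp add: mult_ac)
 moreover have "q * (\<Sum>z\<in>S. c z * F z s) = (\<Sum>z\<in>S. c z * (q * F z s))" for q
  by (simp add: sum_distrib_left mult_ac)
 ultimately show ?thesis unfolding P_eq[OF h] distrib_left sum.distrib by simp
qed

lemma P_pow_sum: "s \<in> S ==> (P ^^ k) (\<lambda>\<xi>. \<Sum>z\<in>S. c z * F z \<xi>) s = (\<Sum>z\<in>S. c z * (P ^^ k) (F z) s)"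
proof (induction k arbitrary: s)
 case (Suc k)
 have "(P ^^ Suc k) (\<lambda>\<xi>. \<Sum>z\<in>S. c z * F z \<xi>) s = P (\<lambda>\<xi>. \<Sum>z\<in>S. c z * (P ^^ k) (F z) \<xi>) s"
  using Suc.prems by (auto intro!: P_cong Suc.IH)
 then show ?case using P_sum[OF Suc.prems] by simp
qed simp

text \<open>Krylov-Bogolyubov argument: for the time averages of the powers of \<open>P\<close> from
  a fixed state, the mean of \<open>L f\<close> telescopes to O(1 / N), so a limit along a
  subsequence is stationary.\<close>

lemma stationary_exists: "\<exists>w. (\<forall>\<eta>\<in>S. 0 \<le> w \<eta>) \<and> (\<Sum>\<eta>\<in>S. w \<eta>) = 1 \<and> stat w"
proof -
 obtain \<eta>0 where \<eta>0: "\<eta>0 \<in> S" using S_ne by auto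
 define ind where "ind z = (\<lambda>\<xi>. if \<xi> = z then 1 else 0 :: real)" for z :: 's
 define \<nu> where "\<nu> N z = (\<Sum>k<Suc N. (P ^^ k) (ind z) \<eta>0) / real (Suc N)" for N z
 have ind01: "0 \<le> (P ^^ k) (ind z) \<eta>0 \<and> (P ^^ k) (ind z) \<eta>0 \<le> 1" for k z
  by (rule P_pow_range) (auto simp: ind_def \<eta>0)
 have \<nu>0: "0 \<le> \<nu> N z" for N z unfolding \<nu>_def using ind01 by (intro divide_nonneg_nonneg sum_nonneg) auto
 have \<nu>1: "\<nu> N z \<le> 1" for N z
 proof -
  have "(\<Sum>k<Suc N. (P ^^ k) (ind z) \<eta>0) \<le> (\<Sum>k<Suc N. 1)" using ind01 by (intro sum_mono) auto
  then show ?thesis unfolding \<nu>_def by (simp add: divide_le_eq)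
 qed
 have avg: "(\<Sum>z\<in>S. \<nu> N z * f z) = (\<Sum>k<Suc N. (P ^^ k) f \<eta>0) / real (Suc N)" for N f
 proof -
  have "(P ^^ k) f \<eta>0 = (\<Sum>z\<in>S. f z * (P ^^ k) (ind z) \<eta>0)" for k
  proof -
   have "(P ^^ k) f \<eta>0 = (P ^^ k) (\<lambda>\<xi>. \<Sum>z\<in>S. f z * ind z \<xi>) \<eta>0"
    by (rule P_pow_cong) (use fin_S in \<open>auto simp: ind_def \<eta>0 if_distrib[of "(*) _"] cong: if_cong\<close>)
   then show ?thesis using P_pow_sum[OF \<eta>0] by simp
  qed
  then have "(\<Sum>k<Suc N. (P ^^ k) f \<eta>0) = (\<Sum>z\<in>S. f z * (\<Sum>k<Suc N. (P ^^ k) (ind z) \<eta>0))"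
   unfolding sum_distrib_left by (subst sum.swap) simp
  then show ?thesis unfolding \<nu>_def times_divide_eq_left sum_divide_distrib[symmetric]
   by (simp add: mult.commute del: sum.lessThan_Suc)
 qed
 obtain r l where r: "strict_mono r" and l: "\<And>s. s \<in> S ==> (\<lambda>k. \<nu> (r k) s) \<longlonglongrightarrow> l s"
  using finite_convergent_subsequence[OF fin_S, of \<nu>] \<nu>0 \<nu>1 by (metis abs_of_nonneg)
 have lim: "(\<lambda>k. \<Sum>z\<in>S. \<nu> (r k) z * f z) \<longlonglongrightarrow> (\<Sum>z\<in>S. l z * f z)" for f
  by (intro tendsto_sum tendsto_mult l tendsto_const)
 have "(\<Sum>z\<in>S. \<nu> N z * 1) = 1" for N
 proof -
  have "(P ^^ k) (\<lambda>_. 1) \<eta>0 = 1" for k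
  proof -
   have "(P ^^ k) (\<lambda>_. 1) \<eta> = 1" if "\<eta> \<in> S" for \<eta>
    using that
   proof (induction k arbitrary: \<eta>)
    case (Suc k)
    have "(P ^^ Suc k) (\<lambda>_. 1) \<eta> = P (\<lambda>_. 1) \<eta>" using Suc by (auto intro!: P_cong)
    moreover have "P (\<lambda>_. 1) \<eta> = 1" using Suc.prems by (simp add: P_def L_eq)
    ultimately show ?case by simp
   qed simp
   then show ?thesis using \<eta>0 by simp
  qed
  then show ?thesis unfolding avg by simp
 qed
 then have "(\<Sum>z\<in>S. l z * 1) = 1" using lim[of "\<lambda>_. 1"] by (simp add: LIMSEQ_const_iff)
 moreover have "0 \<le> l z" if "z \<in> S" for z using l[OF that] \<nu>0 by (meson LIMSEQ_le_const)
 moreover have "stat l"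
  unfolding stat_def
 proof
  fix f :: "'s => real"
  \<comment> \<open>\<open>P_pow_range\<close> speaks of non-negative functions, so \<open>f\<close>
    is shifted by a bound on its absolute value.\<close>
  define M where "M = (\<Sum>z\<in>S. \<bar>f z\<bar>)"
  have fM: "\<bar>f z\<bar> \<le> M" if "z \<in> S" for z unfolding M_def using fin_S that by (intro member_le_sum) auto
  have Pf: "\<bar>(P ^^ k) f \<eta>0\<bar> \<le> M" for k
  proof -
   have "(P ^^ k) f \<eta> = (P ^^ k) (\<lambda>z. f z + M) \<eta> - M" if "\<eta> \<in> S" for \<eta>
    using that
   proof (induction k arbitrary: \<eta>)
    case (Suc k)
    have "(P ^^ Suc k) f \<eta> = P (\<lambda>z. (P ^^ k) (\<lambda>z. f z + M) z - M) \<eta>" using Suc by (auto intro!: P_cong)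
    moreover have "P (\<lambda>z. F z - M) \<eta> = P F \<eta> - M" for F using Suc.prems by (simp add: P_def L_eq)
    ultimately show ?case by simp
   qed simp
   moreover have "0 \<le> (P ^^ k) (\<lambda>z. f z + M) \<eta>0 \<and> (P ^^ k) (\<lambda>z. f z + M) \<eta>0 \<le> 2 * M"
   proof (rule P_pow_range[OF _ \<eta>0])
    fix z assume "z \<in> S" then show "0 \<le> f z + M \<and> f z + M \<le> 2 * M" using fM[of z] by linarith
   qed
   ultimately show ?thesis using \<eta>0 by (simp add: abs_le_iff)
  qed
  have LP: "L f \<eta> = \<Lambda> * (P f \<eta> - f \<eta>)" for \<eta> using \<Lambda>_pos by (simp add: P_def)
  have "(\<Sum>z\<in>S. \<nu> N z * L f z) = \<Lambda> * ((P ^^ Suc N) f \<eta>0 - f \<eta>0) / real (Suc N)" for N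
  proof -
   have "(\<Sum>z\<in>S. \<nu> N z * L f z) = \<Lambda> * ((\<Sum>z\<in>S. \<nu> N z * P f z) - (\<Sum>z\<in>S. \<nu> N z * f z))"
    unfolding LP by (simp add: sum_subtractf[symmetric] sum_distrib_left algebra_simps)
   also have "(\<Sum>z\<in>S. \<nu> N z * P f z) - (\<Sum>z\<in>S. \<nu> N z * f z) = ((\<Sum>k<Suc N. (P ^^ Suc k) f \<eta>0) - (\<Sum>k<Suc N. (P ^^ k) f \<eta>0)) / real (Suc N)"
    unfolding avg by (simp add: funpow_swap1 diff_divide_distrib del: sum.lessThan_Suc)
   also have "(\<Sum>k<Suc N. (P ^^ Suc k) f \<eta>0) - (\<Sum>k<Suc N. (P ^^ k) f \<eta>0) = (P ^^ Suc N) f \<eta>0 - f \<eta>0"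
    unfolding sum_subtractf[symmetric] using sum_lessThan_telescope[of "\<lambda>k. (P ^^ k) f \<eta>0" "Suc N"] by simp
   finally show ?thesis by simp
  qed
  then have "\<bar>\<Sum>z\<in>S. \<nu> N z * L f z\<bar> \<le> \<Lambda> * (2 * M) / real (Suc N)" for N
  proof -
   assume e: "\<And>N. (\<Sum>z\<in>S. \<nu> N z * L f z) = \<Lambda> * ((P ^^ Suc N) f \<eta>0 - f \<eta>0) / real (Suc N)"
   have "\<bar>(P ^^ Suc N) f \<eta>0 - f \<eta>0\<bar> \<le> 2 * M" using Pf[of "Suc N"] Pf[of 0] by (simp only: funpow_0)
   then show ?thesis unfolding e abs_divide abs_mult abs_of_nat abs_of_pos[OF \<Lambda>_pos]
    using \<Lambda>_pos by (intro divide_right_mono mult_left_mono) auto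
  qed
  moreover have "(\<lambda>N. \<Lambda> * (2 * M) / real (Suc N)) \<longlonglongrightarrow> 0" using LIMSEQ_Suc lim_const_over_n by blast
  ultimately have "(\<lambda>N. \<Sum>z\<in>S. \<nu> N z * L f z) \<longlonglongrightarrow> 0"
   by (intro Lim_null_comparison[of "\<lambda>N. \<Sum>z\<in>S. \<nu> N z * L f z" "\<lambda>N. \<Lambda> * (2 * M) / real (Suc N)"]) (auto intro: always_eventually)
  from LIMSEQ_subseq_LIMSEQ[OF this r] have "(\<lambda>k. \<Sum>z\<in>S. \<nu> (r k) z * L f z) \<longlonglongrightarrow> 0" by (simp add: o_def)
  then show "(\<Sum>z\<in>S. l z * L f z) = 0" using lim[of "L f"] LIMSEQ_unique by blast
 qed
 ultimately show ?thesis by (intro exI[of _ l]) auto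
qed

text \<open>Tested on the indicator of \<open>z\<close>, stationarity is a vanishing sum of
  non-negative terms, since the only negative value of \<open>L f\<close> is at \<open>z\<close>,
  where \<open>u\<close> is 0. Hence there is no mass at a state from which \<open>z\<close> can be
  reached in one jump.\<close>

lemma stat_zero_closed:
 assumes u: "\<And>s. s \<in> S ==> 0 \<le> u s" and st: "stat u" and z: "z \<in> S" "u z = 0"
  and s: "s \<in> S" "k \<in> J" "rate k s > 0" "T k s = z"
 shows "u s = 0"
proof (cases "s = z")
 case True then show ?thesis using z by simp
next
 case False
 define f where "f \<xi> = (if \<xi> = z then 1 else 0 :: real)" for \<xi>
 have t0: "0 \<le> u \<xi> * L f \<xi>" if "\<xi> \<in> S" for \<xi>
 proof (cases "\<xi> = z")
  case False
  then show ?thesis using u that rate_nonneg by (auto simp: L_eq f_def intro!: mult_nonneg_nonneg sum_nonneg)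
 qed (use z in simp)
 have "(\<Sum>\<xi>\<in>S. u \<xi> * L f \<xi>) = 0" using st by (simp add: stat_def)
 then have "u s * L f s = 0" using t0 fin_S s(1) by (subst (asm) sum_nonneg_eq_0_iff) auto
 moreover have "L f s > 0"
 proof -
  have "rate k s * (f (T k s) - f s) \<le> L f s"
   unfolding L_eq[OF s(1)] using False rate_nonneg s(1) fin_J by (intro member_le_sum[OF s(2)]) (auto simp: f_def)
  moreover have "rate k s * (f (T k s) - f s) > 0" using s False by (simp add: f_def)
  ultimately show ?thesis by linarith
 qed
 ultimately show ?thesis by simp
qed

lemma L_pow_bound:
 assumes "\<And>\<zeta>. \<zeta> \<in> S ==> \<bar>f \<zeta>\<bar> \<le> M" "s \<in> S"
 shows "\<bar>(L ^^ k) f s\<bar> \<le> M * (2 * \<Lambda>) ^ k"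
 using assms(2)
proof (induction k arbitrary: s)
 case (Suc k)
 let ?B = "M * (2 * \<Lambda>) ^ k"
 have B0: "0 \<le> ?B" using Suc.IH[OF Suc.prems] by (rule order_trans[OF abs_ge_zero])
 have "\<bar>(L ^^ Suc k) f s\<bar> \<le> (\<Sum>j\<in>J. rate j s * (2 * ?B))"
  unfolding funpow.simps o_def L_eq[OF Suc.prems]
 proof (rule order_trans[OF sum_abs], rule sum_mono)
  fix j assume j: "j \<in> J"
  have "\<bar>(L ^^ k) f (T j s) - (L ^^ k) f s\<bar> \<le> 2 * ?B"
   using Suc.IH[OF T_in[OF j Suc.prems]] Suc.IH[OF Suc.prems] by linarith
  then show "\<bar>rate j s * ((L ^^ k) f (T j s) - (L ^^ k) f s)\<bar> \<le> rate j s * (2 * ?B)"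
   unfolding abs_mult using rate_nonneg[OF j Suc.prems] by (simp add: mult_left_mono)
 qed
 also have "... = (\<Sum>j\<in>J. rate j s) * (2 * ?B)" by (simp add: sum_distrib_right)
 also have "... \<le> \<Lambda> * (2 * ?B)" using total_rate[OF Suc.prems] B0 by (intro mult_right_mono) auto
 finally show ?case by (simp add: mult_ac)
qed (use assms(1) in simp)

lemma semigroup_summable: "s \<in> S ==> summable (\<lambda>k. t ^ k / fact k * (L ^^ k) f s)"
proof -
 assume h: "s \<in> S"
 define M where "M = (\<Sum>z\<in>S. \<bar>f z\<bar>)"
 have fM: "\<bar>f z\<bar> \<le> M" if "z \<in> S" for z unfolding M_def using fin_S that by (intro member_le_sum) auto
 show ?thesis
 proof (rule summable_comparison_test)
  show "summable (\<lambda>k. M * (inverse (fact k) * (2 * \<Lambda> * \<bar>t\<bar>) ^ k))" by (intro summable_mult summable_exp)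
  show "\<exists>N. \<forall>k\<ge>N. norm (t ^ k / fact k * (L ^^ k) f s) \<le> M * (inverse (fact k) * (2 * \<Lambda> * \<bar>t\<bar>) ^ k)"
  proof (intro exI allI impI)
   fix k :: nat
   have "\<bar>t\<bar> ^ k / fact k * \<bar>(L ^^ k) f s\<bar> \<le> \<bar>t\<bar> ^ k / fact k * (M * (2 * \<Lambda>) ^ k)"
    using L_pow_bound[OF fM h] by (intro mult_left_mono) auto
   then show "norm (t ^ k / fact k * (L ^^ k) f s) \<le> M * (inverse (fact k) * (2 * \<Lambda> * \<bar>t\<bar>) ^ k)"
    by (simp add: abs_mult power_abs power_mult_distrib field_simps)
  qed
 qed
qed

text \<open>The mean of the semigroup is a power series in \<open>t\<close> whose coefficients are
  the means of the powers of \<open>L\<close> over factorials. If it is constant for non-negative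
  \<open>t\<close>, its right derivative at 0 kills the linear coefficient; conversely stationarity
  kills every coefficient of positive order.\<close>

lemma invariant_pmf_iff: "invariant_pmf S L \<mu> \<longleftrightarrow> set_pmf \<mu> \<subseteq> S \<and> stat (pmf \<mu>)"
proof (cases "set_pmf \<mu> \<subseteq> S")
 case sub: True
 have Ex: "measure_pmf.expectation \<mu> g = (\<Sum>s\<in>S. pmf \<mu> s * g s)" for g :: "'s => real"
  using integral_measure_pmf_real[OF fin_S, of \<mu> g] sub by (auto simp: mult.commute)
 define c where "c f k = (\<Sum>s\<in>S. pmf \<mu> s * (L ^^ k) f s) / fact k" for f k
 have series: "(\<lambda>k. c f k * t ^ k) sums (\<Sum>s\<in>S. pmf \<mu> s * semigroup_of L t f s)" for f t
 proof -
  have "(\<lambda>k. \<Sum>s\<in>S. pmf \<mu> s * (t ^ k / fact k * (L ^^ k) f s)) sums (\<Sum>s\<in>S. pmf \<mu> s * semigroup_of L t f s)"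
   unfolding semigroup_of_def by (intro sums_sum sums_mult summable_sums semigroup_summable)
  moreover have "(\<Sum>s\<in>S. pmf \<mu> s * (t ^ k / fact k * (L ^^ k) f s)) = c f k * t ^ k" for k
   unfolding c_def sum_divide_distrib sum_distrib_right by (intro sum.cong refl) simp
  ultimately show ?thesis by simp
 qed
 have c0: "c f 0 = (\<Sum>s\<in>S. pmf \<mu> s * f s)" for f by (simp add: c_def)
 show ?thesis
 proof
  assume inv: "invariant_pmf S L \<mu>"
  have "(\<Sum>s\<in>S. pmf \<mu> s * L f s) = 0" for f
  proof -
   define G where "G t = (\<Sum>k. c f k * t ^ k)" for t
   have Gt: "G t = c f 0" if "t \<ge> 0" for t
    using inv that series[of f t, THEN sums_unique] unfolding invariant_pmf_def Ex c0 G_def by simp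
   have "DERIV G 0 :> (\<Sum>k. diffs (c f) k * 0 ^ k)"
    unfolding G_def by (rule termdiffs_strong[of _ 1]) (use series[of f 1, THEN sums_summable] in auto)
   also have "(\<Sum>k. diffs (c f) k * 0 ^ k) = c f 1" by (simp add: powser_zero diffs_def)
   finally have "((\<lambda>t. (G t - G 0) / (t - 0)) \<longlongrightarrow> c f 1) (at 0)" by (simp add: has_field_derivative_iff)
   then have "((\<lambda>t. (G t - G 0) / (t - 0)) \<longlongrightarrow> c f 1) (at_right 0)" by (rule filterlim_at_split[THEN iffD1, THEN conjunct2])
   moreover have "((\<lambda>t. (G t - G 0) / (t - 0)) \<longlongrightarrow> 0) (at_right 0)"
    by (rule tendsto_eventually) (auto simp: eventually_at_filter Gt)
   ultimately have "c f 1 = 0" using tendsto_unique trivial_limit_at_right_real by blast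
   then show ?thesis by (simp add: c_def)
  qed
  then show "set_pmf \<mu> \<subseteq> S \<and> stat (pmf \<mu>)" using sub by (simp add: stat_def)
 next
  assume st: "set_pmf \<mu> \<subseteq> S \<and> stat (pmf \<mu>)"
  have ck: "c f (Suc k) = 0" for f k using st by (simp add: c_def stat_def)
  have "(\<Sum>s\<in>S. pmf \<mu> s * semigroup_of L t f s) = c f 0" for f t
  proof -
   have "(\<lambda>k. c f k * t ^ k) = (\<lambda>k. if k = 0 then c f 0 else 0)" using ck by (auto simp: fun_eq_iff gr0_conv_Suc)
   then show ?thesis using series[of f t] sums_single[of 0 "\<lambda>_. c f 0"] sums_unique2 by fastforce
  qed
  then show "invariant_pmf S L \<mu>" unfolding invariant_pmf_def Ex c0 using sub by simp
 qed
qed (simp add: invariant_pmf_def)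

text \<open>Irreducibility is stated backwards, for sets containing every state from which they can
  be entered, because this is how zeros of a stationary weight spread. For uniqueness, subtract from
  one law the largest multiple of the other that keeps the difference non-negative: the difference
  then has a zero and vanishes.\<close>

lemma unique_invariant:
 assumes irr: "\<And>A. A \<subseteq> S ==> A \<noteq> {} ==> (\<And>z s k. z \<in> A ==> s \<in> S ==> k \<in> J ==> rate k s > 0 ==> T k s = z ==> s \<in> A) ==> A = S"
 shows "\<exists>!\<mu>. invariant_pmf S L \<mu>" and "invariant_pmf S L \<mu> ==> s \<in> S ==> pmf \<mu> s > 0"
proof -
 have zero: "\<forall>s\<in>S. u s = 0" if "\<And>s. s \<in> S ==> 0 \<le> u s" "stat u" "z \<in> S" "u z = 0" for u z
 proof -
  have "{s \<in> S. u s = 0} = S"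
   by (rule irr) (use that in \<open>auto intro: stat_zero_closed\<close>)
  then show ?thesis by blast
 qed
 have sum1: "(\<Sum>s\<in>S. pmf \<mu> s) = 1" if "invariant_pmf S L \<mu>" for \<mu>
  using sum_pmf_eq_1[OF fin_S] that by (simp add: invariant_pmf_iff)
 show pos: "pmf \<mu> s > 0" if "invariant_pmf S L \<mu>" "s \<in> S" for \<mu> s
 proof (rule ccontr)
  assume "\<not> pmf \<mu> s > 0"
  then have "pmf \<mu> s = 0" using pmf_nonneg[of \<mu> s] by linarith
  then have "\<forall>\<xi>\<in>S. pmf \<mu> \<xi> = 0" using that by (intro zero) (auto simp: invariant_pmf_iff)
  then show False using sum1[OF that(1)] by simp
 qed
 obtain w where w: "\<forall>s\<in>S. 0 \<le> w s" "(\<Sum>s\<in>S. w s) = 1" "stat w" using stationary_exists by blast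
 define w' where "w' s = (if s \<in> S then w s else 0)" for s
 have w'0: "0 \<le> w' s" for s using w by (simp add: w'_def)
 have "(\<integral>\<^sup>+s. ennreal (w' s) \<partial>count_space UNIV) = (\<integral>\<^sup>+s. ennreal (w' s) \<partial>count_space S)"
  by (rule nn_integral_count_space_eq) (auto simp: w'_def)
 also have "... = ennreal (\<Sum>s\<in>S. w s)"
  using fin_S w by (simp add: nn_integral_count_space_finite w'_def sum_ennreal)
 finally have int1: "(\<integral>\<^sup>+s. ennreal (w' s) \<partial>count_space UNIV) = 1" using w by simp
 define \<mu>0 where "\<mu>0 = embed_pmf w'"
 have p0: "pmf \<mu>0 s = w' s" for s unfolding \<mu>0_def by (rule pmf_embed_pmf[OF w'0 int1])
 have ex: "invariant_pmf S L \<mu>0"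
  unfolding invariant_pmf_iff using w by (auto simp: set_pmf_iff p0 w'_def stat_def split: if_splits)
 have "\<mu>1 = \<mu>2" if i: "invariant_pmf S L \<mu>1" "invariant_pmf S L \<mu>2" for \<mu>1 \<mu>2
 proof -
  define t where "t = Min ((\<lambda>s. pmf \<mu>1 s / pmf \<mu>2 s) ` S)"
  have tmin: "t \<le> pmf \<mu>1 s / pmf \<mu>2 s" if "s \<in> S" for s unfolding t_def using fin_S that by (intro Min_le) auto
  have "t \<in> (\<lambda>s. pmf \<mu>1 s / pmf \<mu>2 s) ` S" unfolding t_def using fin_S S_ne by (intro Min_in) auto
  then obtain z where z: "z \<in> S" "t = pmf \<mu>1 z / pmf \<mu>2 z" by auto
  define u where "u s = pmf \<mu>1 s - t * pmf \<mu>2 s" for s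
  have "\<forall>s\<in>S. u s = 0"
  proof (rule zero[OF _ _ z(1)])
   show "0 \<le> u s" if "s \<in> S" for s using tmin[OF that] pos[OF i(2) that] by (simp add: u_def pos_le_divide_eq)
   show "stat u" using i unfolding invariant_pmf_iff stat_def u_def
    by (simp add: left_diff_distrib sum_subtractf mult.assoc sum_distrib_left[symmetric])
   show "u z = 0" using z pos[OF i(2) z(1)] by (simp add: u_def)
  qed
  then have eq: "pmf \<mu>1 s = t * pmf \<mu>2 s" if "s \<in> S" for s using that by (simp add: u_def)
  then have "(\<Sum>s\<in>S. pmf \<mu>1 s) = t * (\<Sum>s\<in>S. pmf \<mu>2 s)" by (simp add: sum_distrib_left)
  then have "t = 1" using sum1 i by simp
  show ?thesis
  proof (rule pmf_eqI)
   fix s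
   show "pmf \<mu>1 s = pmf \<mu>2 s"
   proof (cases "s \<in> S")
    case True then show ?thesis using eq \<open>t = 1\<close> by simp
   next
    case False
    then have "s \<notin> set_pmf \<mu>1" "s \<notin> set_pmf \<mu>2" using i by (auto simp: invariant_pmf_iff)
    then show ?thesis by (simp add: set_pmf_iff)
   qed
  qed
 qed
 then show "\<exists>!\<mu>. invariant_pmf S L \<mu>" using ex by blast
qed

end

lemma gen_finite_chain:
 assumes n: "n > 0" and g: "\<bar>gam \<theta> n\<bar> < 1" and a: "a > 0"
 shows "finite_chain (Omega n) (UNIV \<times> torus n)
  (\<lambda>(b, x) s. if b then (real n)^2 else a * flip_rate \<theta> n x s)
  (\<lambda>(b, x) s. if b then exch n x s else flip s x) (gen \<theta> a n)"
proof
 have "restrict (\<lambda>_. 0) (torus n) \<in> Omega n" by (auto simp: Omega_def)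
 then show "Omega n \<noteq> {}" by blast
 show "gen \<theta> a n f s = (\<Sum>k\<in>UNIV \<times> torus n. (case k of (b, x) => \<lambda>s. if b then (real n)^2 else a * flip_rate \<theta> n x s) s
   * (f ((case k of (b, x) => \<lambda>s. if b then exch n x s else flip s x) s) - f s))" for f s
 proof -
  have prod: "(\<Sum>k\<in>UNIV \<times> torus n. F k) = (\<Sum>x\<in>torus n. F (False, x)) + (\<Sum>x\<in>torus n. F (True, x))" for F :: "bool \<times> int => real"
   using sum.cartesian_product[of "\<lambda>b x. F (b, x)" "torus n" UNIV] by (simp add: UNIV_bool)
  show ?thesis unfolding prod gen_def L_ex_def L_G_def
   by (simp add: sum_distrib_left exch_torus mult.assoc add.commute)
 qed
qed (use assms less_imp_le[OF flip_rate_pos[OF _ n g]] in \<open>auto simp: exch_in flip_in intro!: mult_nonneg_nonneg split: if_splits\<close>)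

text \<open>Induction on the number of sites at which a configuration differs from a fixed member of
  \<open>A\<close>.\<close>

lemma flip_closed_imp_all:
 assumes A: "A \<subseteq> Omega n" "A \<noteq> {}" and cl: "\<And>s x. s \<in> A ==> x \<in> torus n ==> flip s x \<in> A"
 shows "A = Omega n"
proof -
 obtain s where s: "s \<in> A" using A by blast
 have "\<xi> \<in> A" if "\<xi> \<in> Omega n" "card {x \<in> torus n. \<xi> x \<noteq> s x} = d" for \<xi> d
  using that
 proof (induction d arbitrary: \<xi>)
  case 0
  have "finite {x \<in> torus n. \<xi> x \<noteq> s x}" by simp
  with 0 have "\<And>x. x \<in> torus n ==> \<xi> x = s x" by auto
  moreover have "\<xi> \<in> torus n \<rightarrow>\<^sub>E {0, 1}" "s \<in> torus n \<rightarrow>\<^sub>E {0, 1}" using 0 s A unfolding Omega_def by blast+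
  ultimately have "\<xi> = s" by (rule PiE_ext[rotated 2])
  then show ?case using s by simp
 next
  case (Suc d)
  then obtain x where x: "x \<in> torus n" "\<xi> x \<noteq> s x" by (metis (mono_tags, lifting) card_gt_0_iff empty_Collect_eq zero_less_Suc)
  have "\<xi> \<in> torus n \<rightarrow>\<^sub>E {0, 1}" "s \<in> torus n \<rightarrow>\<^sub>E {0, 1}" using Suc.prems s A unfolding Omega_def by blast+
  then have v: "\<xi> x \<in> {0,1}" "s x \<in> {0,1}" using x by (simp_all only: PiE_iff)
  have "{z \<in> torus n. flip \<xi> x z \<noteq> s z} = {z \<in> torus n. \<xi> z \<noteq> s z} - {x}"
   using x v by (auto simp: flip_def)
  then have "card {z \<in> torus n. flip \<xi> x z \<noteq> s z} = d" using Suc.prems x by simp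
  then have "flip \<xi> x \<in> A" using Suc.IH flip_in Suc.prems x by blast
  then have "flip (flip \<xi> x) x \<in> A" using cl x by blast
  then show ?case using flip_flip Suc.prems x by simp
 qed
 then show ?thesis using A by blast
qed

text \<open>Resolves the definite description in \<open>mu_ss\<close>; the spin flips alone already
  make the chain irreducible.\<close>

lemma mu_ss_stationary:
 assumes n: "n > 0" and g: "\<bar>gam \<theta> n\<bar> < 1" and a: "a > 0"
 shows "set_pmf (mu_ss \<theta> a n) \<subseteq> Omega n"
  and "\<And>s. s \<in> Omega n ==> pmf (mu_ss \<theta> a n) s > 0"
  and "\<And>f. expect n (pmf (mu_ss \<theta> a n)) (gen \<theta> a n f) = 0"
proof -
 interpret finite_chain "Omega n" "UNIV \<times> torus n" "\<lambda>(b, x) s. if b then (real n)^2 else a * flip_rate \<theta> n x s"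
  "\<lambda>(b, x) s. if b then exch n x s else flip s x" "gen \<theta> a n"
  by (rule gen_finite_chain[OF assms])
 have irr: "A = Omega n" if A: "A \<subseteq> Omega n" "A \<noteq> {}"
  and cl: "\<And>z s k. z \<in> A ==> s \<in> Omega n ==> k \<in> UNIV \<times> torus n ==> (case k of (b, x) => \<lambda>s. if b then (real n)^2 else a * flip_rate \<theta> n x s) s > 0
    ==> (case k of (b, x) => \<lambda>s. if b then exch n x s else flip s x) s = z ==> s \<in> A" for A
 proof (rule flip_closed_imp_all[OF A])
  fix s x assume h: "s \<in> A" "x \<in> torus n"
  then have s: "s \<in> Omega n" using A by blast
  show "flip s x \<in> A"
   by (rule cl[OF h(1), of _ "(False, x)"]) (use h s a in \<open>auto simp: flip_in flip_flip intro!: mult_pos_pos flip_rate_pos n g\<close>)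
 qed
 have inv: "invariant_pmf (Omega n) (gen \<theta> a n) (mu_ss \<theta> a n)"
  unfolding mu_ss_def by (rule theI'[OF unique_invariant(1)[OF irr]])
 show "set_pmf (mu_ss \<theta> a n) \<subseteq> Omega n" using inv by (simp add: invariant_pmf_def)
 show "pmf (mu_ss \<theta> a n) s > 0" if "s \<in> Omega n" for s
  by (rule unique_invariant(2)[OF irr inv that])
 show "expect n (pmf (mu_ss \<theta> a n)) (gen \<theta> a n f) = 0" for f
  using inv by (simp add: invariant_pmf_iff stat_def expect_def)
qed

section \<open>A priori bounds\<close>

text \<open>The condition on \<theta> puts \<open>gam\<close> into [1/4, 3/4], away from both 0 and
  1; 10000 is what \<open>window_exists\<close> asks for.\<close>

locale stationary_weight = config_weight +
 fixes \<theta> a :: real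
 assumes a_pos: "a > 0"
  and weight_pos: "\<And>s. s \<in> Omega n ==> \<mu> s > 0"
  and stationary: "\<And>f :: (int => nat) => real. expect n \<mu> (gen \<theta> a n f) = 0"
  and n_large: "n \<ge> 10000"
  and \<theta>_small: "2 * \<bar>\<theta>\<bar> \<le> sqrt (real n)"
begin

abbreviation "g \<equiv> gam \<theta> n"

lemma g_bounds: "1 / 4 \<le> g" "g \<le> 3 / 4"
proof -
 have "\<bar>\<theta> / sqrt (real n)\<bar> \<le> 1 / 2" using \<theta>_small n_pos by (simp add: divide_le_eq)
 moreover have "1 / 4 \<le> (1 - t) / 2 \<and> (1 - t) / 2 \<le> 3 / 4" if "\<bar>t\<bar> \<le> 1 / 2" for t :: real
  using that by (auto simp: abs_le_iff field_simps)
 ultimately show "1 / 4 \<le> g" "g \<le> 3 / 4" unfolding gam_def by blast+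
qed

lemma one_minus_g: "1 - 2 * g = \<theta> / sqrt (real n)"
proof -
 have "1 - 2 * ((1 - t) / 2) = t" for t :: real by (simp add: field_simps)
 then show ?thesis unfolding gam_def .
qed

lemma L_ex_exch: "L_ex n f s = (\<Sum>y\<in>torus n. f (exch n y s) - f s)"
 unfolding L_ex_def by (intro sum.cong refl) (simp add: exch_torus)

lemma rate_pos: "s \<in> Omega n ==> flip_rate \<theta> n x s > 0"
 using g_bounds by (intro flip_rate_pos n_pos) auto

text \<open>The inequality ln z <= z - 1 is used in two ways. Exchanges preserve the reference
  weight; there it is applied to a ratio of square roots and produces - D. For flips it is applied
  to the ratio of the densities, and the substitution of \<open>flip s x\<close> for
  \<open>s\<close> turns the result into \<open>drift\<close>.\<close>

lemma dirichlet_le_drift: "D \<le> a * E (drift \<theta> n)"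
proof -
 define f where "f s = ln (\<mu> s) - real n * (mag n s)^2 / 2" for s
 have ex: "(real n)^2 * E (L_ex n f) \<le> - D"
 proof -
  have site: "(\<Sum>s\<in>Omega n. \<mu> s * (f (exch n y s) - f s)) \<le> - (\<Sum>s\<in>Omega n. (sqrt (\<mu> (exch n y s)) - sqrt (\<mu> s))^2)" for y
  proof -
   have "\<mu> s * (f (exch n y s) - f s) \<le> 2 * (sqrt (\<mu> s) * sqrt (\<mu> (exch n y s))) - 2 * \<mu> s" if h: "s \<in> Omega n" for s
   proof -
    let ?u = "sqrt (\<mu> s)" and ?v = "sqrt (\<mu> (exch n y s))"
    have p: "\<mu> s > 0" "\<mu> (exch n y s) > 0" using h by (auto intro: weight_pos exch_in n_pos)
    then have uv: "?u > 0" "?v > 0" by auto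
    have "f (exch n y s) - f s = ln (\<mu> (exch n y s)) - ln (\<mu> s)" by (simp add: f_def mag_exch n_ge)
    also have "... = 2 * ln (?v / ?u)" using p by (simp add: ln_div ln_sqrt)
    also have "... \<le> 2 * (?v / ?u - 1)" using uv by (intro mult_left_mono ln_le_minus_one) auto
    finally have "\<mu> s * (f (exch n y s) - f s) \<le> \<mu> s * (2 * (?v / ?u - 1))" using p by (intro mult_left_mono) auto
    also have "... = (?u * ?u) * (2 * (?v / ?u - 1))" using p by simp
    also have "... = 2 * (?u * ?v) - 2 * (?u * ?u)" using uv by (simp add: field_simps)
    also have "... = 2 * (?u * ?v) - 2 * \<mu> s" using p by simp
    finally show ?thesis .
   qed
   then have "(\<Sum>s\<in>Omega n. \<mu> s * (f (exch n y s) - f s)) \<le> (\<Sum>s\<in>Omega n. 2 * (sqrt (\<mu> s) * sqrt (\<mu> (exch n y s))) - 2 * \<mu> s)"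
    by (rule sum_mono)
   also have "... = (\<Sum>s\<in>Omega n. 2 * (sqrt (\<mu> s) * sqrt (\<mu> (exch n y s))) - \<mu> s - \<mu> (exch n y s))"
    using sum_Omega_exch[OF n_pos, of \<mu> y] by (simp add: sum_subtractf sum_distrib_left[symmetric])
   also have "... = - (\<Sum>s\<in>Omega n. (sqrt (\<mu> (exch n y s)) - sqrt (\<mu> s))^2)"
    unfolding sum_negf[symmetric]
    by (intro sum.cong refl) (simp add: power2_diff weight_nonneg exch_in n_pos)
   finally show ?thesis .
  qed
  have "E (L_ex n f) = (\<Sum>y\<in>torus n. \<Sum>s\<in>Omega n. \<mu> s * (f (exch n y s) - f s))"
   unfolding expect_def L_ex_exch by (simp add: sum_distrib_left) (rule sum.swap)
  also have "... \<le> (\<Sum>y\<in>torus n. - (\<Sum>s\<in>Omega n. (sqrt (\<mu> (exch n y s)) - sqrt (\<mu> s))^2))"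
   by (intro sum_mono site)
  finally have "(real n)^2 * E (L_ex n f) \<le> (real n)^2 * (\<Sum>y\<in>torus n. - (\<Sum>s\<in>Omega n. (sqrt (\<mu> (exch n y s)) - sqrt (\<mu> s))^2))"
   by (intro mult_left_mono) auto
  then show ?thesis by (simp add: dirichlet_def sum_negf)
 qed
 have gl: "E (L_G \<theta> n f) \<le> E (drift \<theta> n)"
 proof -
  let ?w = "\<lambda>s x. exp (real n * ((mag n (flip s x))^2 - (mag n s)^2) / 2)"
  have site: "(\<Sum>s\<in>Omega n. \<mu> s * (flip_rate \<theta> n x s * (f (flip s x) - f s)))
    \<le> (\<Sum>s\<in>Omega n. \<mu> s * (flip_rate \<theta> n x (flip s x) * ?w s x - flip_rate \<theta> n x s))" if x: "x \<in> torus n" for x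
  proof -
   have "\<mu> s * (flip_rate \<theta> n x s * (f (flip s x) - f s)) \<le> flip_rate \<theta> n x s * (\<mu> (flip s x) / ?w s x) - \<mu> s * flip_rate \<theta> n x s" if h: "s \<in> Omega n" for s
   proof -
    have p: "\<mu> s > 0" "\<mu> (flip s x) > 0" using h x by (auto intro: weight_pos flip_in)
    have c: "flip_rate \<theta> n x s > 0" by (rule rate_pos[OF h])
    have "f (flip s x) - f s = ln (\<mu> (flip s x) / \<mu> s / ?w s x)"
    proof -
     have "ln (\<mu> (flip s x) / \<mu> s / ?w s x) = ln (\<mu> (flip s x) / \<mu> s) - ln (?w s x)"
      using p by (intro ln_divide_pos divide_pos_pos exp_gt_zero) auto
     also have "ln (\<mu> (flip s x) / \<mu> s) = ln (\<mu> (flip s x)) - ln (\<mu> s)" using p by (intro ln_divide_pos) auto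
     finally show ?thesis by (simp add: f_def right_diff_distrib diff_divide_distrib)
    qed
    also have "... \<le> \<mu> (flip s x) / \<mu> s / ?w s x - 1" using p by (intro ln_le_minus_one) auto
    finally have "\<mu> s * flip_rate \<theta> n x s * (f (flip s x) - f s) \<le> \<mu> s * flip_rate \<theta> n x s * (\<mu> (flip s x) / \<mu> s / ?w s x - 1)"
     using p c by (intro mult_left_mono) auto
    also have "... = flip_rate \<theta> n x s * (\<mu> (flip s x) / ?w s x) - \<mu> s * flip_rate \<theta> n x s"
     using p by (simp add: right_diff_distrib)
    finally show ?thesis by (simp add: mult.assoc)
   qed
   then have "(\<Sum>s\<in>Omega n. \<mu> s * (flip_rate \<theta> n x s * (f (flip s x) - f s)))
    \<le> (\<Sum>s\<in>Omega n. flip_rate \<theta> n x s * (\<mu> (flip s x) / ?w s x)) - (\<Sum>s\<in>Omega n. \<mu> s * flip_rate \<theta> n x s)"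
    unfolding sum_subtractf[symmetric] by (rule sum_mono)
   also have "(\<Sum>s\<in>Omega n. flip_rate \<theta> n x s * (\<mu> (flip s x) / ?w s x))
     = (\<Sum>s\<in>Omega n. flip_rate \<theta> n x (flip s x) * (\<mu> (flip (flip s x) x) / ?w (flip s x) x))"
    by (rule sum_Omega_flip[OF x, symmetric])
   also have "... = (\<Sum>s\<in>Omega n. \<mu> s * (flip_rate \<theta> n x (flip s x) * ?w s x))"
   proof (intro sum.cong refl)
    fix s assume h: "s \<in> Omega n"
    have w: "inverse (exp (real n * (u - v) / 2)) = exp (real n * (v - u) / 2)" for u v
     unfolding exp_minus[symmetric] by (simp add: algebra_simps diff_divide_distrib)
    show "flip_rate \<theta> n x (flip s x) * (\<mu> (flip (flip s x) x) / ?w (flip s x) x) = \<mu> s * (flip_rate \<theta> n x (flip s x) * ?w s x)"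
     unfolding flip_flip[OF h x] divide_inverse[of "\<mu> s"] w by simp
   qed
   finally show ?thesis by (simp add: right_diff_distrib sum_subtractf)
  qed
  have "E (L_G \<theta> n f) = (\<Sum>x\<in>torus n. \<Sum>s\<in>Omega n. \<mu> s * (flip_rate \<theta> n x s * (f (flip s x) - f s)))"
   unfolding expect_def L_G_def by (simp add: sum_distrib_left) (rule sum.swap)
  also have "... \<le> (\<Sum>x\<in>torus n. \<Sum>s\<in>Omega n. \<mu> s * (flip_rate \<theta> n x (flip s x) * ?w s x - flip_rate \<theta> n x s))"
   by (intro sum_mono site)
  also have "... = E (drift \<theta> n)"
   unfolding expect_def drift_def by (simp add: sum_distrib_left) (rule sum.swap)
  finally show ?thesis .
 qed
 have "0 = (real n)^2 * E (L_ex n f) + a * E (L_G \<theta> n f)"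
  using stationary[of f] unfolding gen_def [abs_def] E_add E_cmult by simp
 moreover have "a * E (L_G \<theta> n f) \<le> a * E (drift \<theta> n)" using gl a_pos by (intro mult_left_mono) auto
 ultimately show ?thesis using ex by linarith
qed

abbreviation "q4 \<equiv> real n * E (\<lambda>s. (mag n s) ^ 4)"

text \<open>Young's inequality, because sqrt n m^2 squares to n m^4; \<open>e\<close> stays free so
  that the fourth moment can be absorbed later.\<close>

lemma E_mag_sq: "e > 0 ==> sqrt (real n) * E (\<lambda>s. (mag n s)^2) \<le> e * q4 + 1 / (4 * e)"
proof -
 assume e: "e > 0"
 have "sqrt (real n) * z^2 \<le> e * (real n * z ^ 4) + 1 / (4 * e)" for z :: real
 proof -
  let ?y = "sqrt (real n) * z^2"
  have "0 \<le> (2 * e * ?y - 1)^2 / (4 * e)" using e by simp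
  also have "... = e * ?y^2 - ?y + 1 / (4 * e)" using e by (simp add: power2_eq_square field_simps)
  also have "?y^2 = real n * z ^ 4" by (simp add: power_mult_distrib power_mult[symmetric])
  finally show ?thesis by linarith
 qed
 then have "E (\<lambda>s. sqrt (real n) * (mag n s)^2) \<le> E (\<lambda>s. e * (real n * mag n s ^ 4) + 1 / (4 * e))" by (intro E_mono)
 then show ?thesis by (simp add: E_cmult E_add E_const)
qed

lemma E_abs_mag: "sqrt (sqrt (real n)) * E (\<lambda>s. \<bar>mag n s\<bar>) \<le> 1 + sqrt (real n) * E (\<lambda>s. (mag n s)^2)"
proof -
 have "sqrt (sqrt (real n)) * \<bar>z\<bar> \<le> 1 + sqrt (real n) * z^2" for z :: real
 proof -
  let ?y = "sqrt (sqrt (real n)) * \<bar>z\<bar>"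
  have "?y \<le> 1 + ?y^2"
  proof -
   have "0 \<le> (?y - 1/2)^2" by simp
   then show ?thesis by (simp only: power2_diff power_divide) (simp add: field_simps)
  qed
  then show ?thesis by (simp add: power_mult_distrib)
 qed
 then have "E (\<lambda>s. sqrt (sqrt (real n)) * \<bar>mag n s\<bar>) \<le> E (\<lambda>s. 1 + sqrt (real n) * (mag n s)^2)" by (intro E_mono)
 then show ?thesis by (simp add: E_cmult E_add E_const)
qed

text \<open>\<open>cubic_field_bound\<close> at the window n^(3/4), where both of its error terms
  reduce to sqrt n E m^2.\<close>

lemma triple_bound:
 assumes k: "exch_invariant k" and k1: "\<And>s. s \<in> Omega n ==> \<bar>k s\<bar> \<le> \<bar>mag n s\<bar>"
 shows "\<bar>E (\<lambda>s. k s * triple_sum n s)\<bar> \<le> 33 * D + 48 + 560 * (sqrt (real n) * E (\<lambda>s. (mag n s)^2))"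
proof -
 obtain l where l: "l \<ge> 1" "2 * l + 2 \<le> n" and l1: "(real l)^2 / real n \<le> 4 * sqrt (real n)"
  and l2: "real n / real l \<le> sqrt (sqrt (real n))" using window_exists[OF n_large] by blast
 have "\<bar>E (\<lambda>s. k s * triple_sum n s)\<bar>
  \<le> 33 * D + 128 * ((real l)^2 / real n) * E (\<lambda>s. (mag n s)^2) + 48 * (real n / real l) * E (\<lambda>s. \<bar>mag n s\<bar>)"
  unfolding triple_sum_def by (rule cubic_field_bound[OF l k k1])
 also have "... \<le> 33 * D + 128 * (4 * sqrt (real n)) * E (\<lambda>s. (mag n s)^2) + 48 * sqrt (sqrt (real n)) * E (\<lambda>s. \<bar>mag n s\<bar>)"
  using l1 l2 by (intro add_mono mult_right_mono mult_left_mono order_refl E_nonneg) auto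
 finally show ?thesis using E_abs_mag by simp
qed

text \<open>The test function (n m)^2 is blind to exchanges. After division by 4 n, its Glauber
  drift has the damping g^2 n m^4, a term \<theta> sqrt n m^2 (since 1 - 2 g is \<theta> / sqrt n)
  and a bounded source from the total rate; the pair and triple sums cost O(1 + D) and a multiple of
  sqrt n E m^2.\<close>

lemma moment_bound: "q4 \<le> 2 * (2000 + 1900 * D + (16 * \<bar>\<theta>\<bar> + 560)^2)"
proof -
 define f where "f s = (real n * mag n s)^2" for s
 define Y where "Y = sqrt (real n) * E (\<lambda>s. (mag n s)^2)"
 have Lex: "L_ex n f s = 0" for s unfolding L_ex_exch f_def by (simp add: mag_exch n_ge)
 let ?A = "\<lambda>s. mag n s * (real n * mag n s ^ 3 + mag n s * (2 * pair_sum n 1 s + pair_sum n 2 s) + triple_sum n s)"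
 have LG: "L_G \<theta> n f s = 4 * (\<Sum>x\<in>torus n. flip_rate \<theta> n x s) - 4 * (real n * ((1 - 2 * g) * real n * (mag n s)^2 + g^2 * ?A s))" if h: "s \<in> Omega n" for s
 proof -
  have "L_G \<theta> n f s = (\<Sum>x\<in>torus n. 4 * flip_rate \<theta> n x s - 4 * (real n * mag n s) * (spin n s x * flip_rate \<theta> n x s))"
   unfolding L_G_def
  proof (intro sum.cong refl)
   fix x assume x: "x \<in> torus n"
   have "f (flip s x) - f s = 4 * (spin n s x * spin n s x) - 4 * (real n * mag n s) * spin n s x"
    unfolding f_def mag_flip[OF h x n_pos] using n_pos by (simp add: power2_eq_square field_simps)
   then have d: "f (flip s x) - f s = 4 - 4 * (real n * mag n s) * spin n s x" unfolding spin_sq[OF h n_pos] by simp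
   show "flip_rate \<theta> n x s * (f (flip s x) - f s) = 4 * flip_rate \<theta> n x s - 4 * (real n * mag n s) * (spin n s x * flip_rate \<theta> n x s)"
    unfolding d by (simp add: algebra_simps)
  qed
  then show ?thesis unfolding sum_subtractf sum_distrib_left[symmetric] sum_spin_flip_rate[OF h n_pos]
   by (simp add: algebra_simps power2_eq_square)
 qed
 have rates: "(\<Sum>x\<in>torus n. flip_rate \<theta> n x s) \<le> 4 * real n" if h: "s \<in> Omega n" for s
 proof -
  have "flip_rate \<theta> n x s \<le> 4" for x
  proof -
   have "\<bar>g * spin n s x * spin n s z\<bar> \<le> 1" for z using g_bounds by (simp add: abs_mult abs_spin[OF h n_pos])
   then have "\<bar>1 - g * spin n s x * spin n s z\<bar> \<le> 2" for z
    using abs_triangle_ineq4[of 1 "g * spin n s x * spin n s z"] by (smt (verit, best) \<open>\<And>z. \<bar>g * spin n s x * spin n s z\<bar> \<le> 1\<close> abs_one)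
   then have "\<bar>flip_rate \<theta> n x s\<bar> \<le> 2 * 2"
    unfolding flip_rate_factor[OF h n_pos] abs_mult[of "1 - g * spin n s x * spin n s (x - 1)"] by (intro mult_mono) auto
   then show ?thesis by simp
  qed
  then have "(\<Sum>x\<in>torus n. flip_rate \<theta> n x s) \<le> (\<Sum>x\<in>torus n. 4)" by (intro sum_mono)
  then show ?thesis by simp
 qed
 have "0 = a * E (L_G \<theta> n f)"
  using stationary[of f] unfolding gen_def [abs_def] Lex by (simp add: E_cmult)
 then have "0 = E (L_G \<theta> n f)" using a_pos by simp
 also have "... = 4 * E (\<lambda>s. \<Sum>x\<in>torus n. flip_rate \<theta> n x s) - 4 * (real n * ((1 - 2 * g) * real n * E (\<lambda>s. (mag n s)^2) + g^2 * E ?A))"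
  by (subst E_cong[OF LG]) (auto simp: E_diff E_cmult E_add mult.assoc)
 finally have "real n * ((1 - 2 * g) * real n * E (\<lambda>s. (mag n s)^2) + g^2 * E ?A) = E (\<lambda>s. \<Sum>x\<in>torus n. flip_rate \<theta> n x s)" by simp
 also have "... \<le> real n * 4" using E_le_const[of "\<lambda>s. \<Sum>x\<in>torus n. flip_rate \<theta> n x s", OF rates] by simp
 finally have m1: "(1 - 2 * g) * real n * E (\<lambda>s. (mag n s)^2) + g^2 * E ?A \<le> 4" using n_pos by simp
 have "(1 - 2 * g) * real n = \<theta> * sqrt (real n)"
  unfolding one_minus_g using n_pos by (simp add: real_div_sqrt field_simps)
 then have m2: "\<theta> * Y + g^2 * E ?A \<le> 4" using m1 unfolding Y_def by (simp add: mult.assoc)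
 have Y0: "Y \<ge> 0" unfolding Y_def by (intro mult_nonneg_nonneg E_nonneg) auto
 have "- \<theta> * Y \<le> \<bar>\<theta>\<bar> * Y" using Y0 by (intro mult_right_mono) auto
 then have m3: "g^2 * E ?A \<le> 4 + \<bar>\<theta>\<bar> * Y" using m2 by linarith
 have g16: "1 / 16 \<le> g^2" using power_mono[OF g_bounds(1), of 2] by (simp add: power_divide)
 have EA: "E ?A \<le> 16 * (4 + \<bar>\<theta>\<bar> * Y)"
 proof (cases "E ?A \<ge> 0")
  case True
  have "1 / 16 * E ?A \<le> g^2 * E ?A" by (rule mult_right_mono[OF g16 True])
  also note m3
  finally show ?thesis by simp
 next
  case False
  then have "E ?A \<le> 0" by simp
  also have "0 \<le> 16 * (4 + \<bar>\<theta>\<bar> * Y)" using Y0 by simp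
  finally show ?thesis .
 qed
 have EA2: "E ?A = q4 + 2 * E (\<lambda>s. (mag n s)^2 * pair_sum n 1 s) + E (\<lambda>s. (mag n s)^2 * pair_sum n 2 s) + E (\<lambda>s. mag n s * triple_sum n s)"
 proof -
  have "?A = (\<lambda>s. real n * mag n s ^ 4 + 2 * ((mag n s)^2 * pair_sum n 1 s) + (mag n s)^2 * pair_sum n 2 s + mag n s * triple_sum n s)"
   by (intro ext) (simp add: algebra_simps eval_nat_numeral)
  then show ?thesis by (simp only: E_add E_cmult)
 qed
 have m2le: "\<bar>(mag n s)^2\<bar> \<le> 1" if "s \<in> Omega n" for s
  using power_le_one[of "\<bar>mag n s\<bar>" 2] abs_mag[OF that n_pos] by simp
 have p1: "\<bar>E (\<lambda>s. (mag n s)^2 * pair_sum n r s)\<bar> \<le> 600 * (D + 1)" if "r \<in> {1, 2}" for r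
  unfolding pair_sum_def
  by (rule quadratic_field_bound[OF _ that exch_invariant_mag[of "\<lambda>m. m^2"] m2le]) (use n_large in auto)
 have p2: "\<bar>E (\<lambda>s. mag n s * triple_sum n s)\<bar> \<le> 33 * D + 48 + 560 * Y"
  unfolding Y_def by (rule triple_bound[OF exch_invariant_mag[of "\<lambda>m. m"]]) auto
 have "q4 \<le> 64 + 16 * (\<bar>\<theta>\<bar> * Y) + 1800 * (D + 1) + 33 * D + 48 + 560 * Y"
  using EA EA2 p1[of 1] p1[of 2] p2 by (simp add: abs_le_iff)
 also have "... \<le> 2000 + 1900 * D + (16 * \<bar>\<theta>\<bar> + 560) * Y" using dirichlet_nonneg[of n \<mu>] by (simp add: algebra_simps)
 finally have q1: "q4 \<le> 2000 + 1900 * D + (16 * \<bar>\<theta>\<bar> + 560) * Y" .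
 let ?c = "16 * \<bar>\<theta>\<bar> + 560"
 have c: "?c > 0" by (simp add: add_nonneg_pos)
 \<comment> \<open>The parameter e = 1 / (2 c) makes c * Y return exactly half of
   \<open>q4\<close>.\<close>
 have "Y \<le> 1 / (2 * ?c) * q4 + 1 / (4 * (1 / (2 * ?c)))" unfolding Y_def using c by (intro E_mag_sq) auto
 then have "?c * Y \<le> ?c * (1 / (2 * ?c) * q4 + 1 / (4 * (1 / (2 * ?c))))" using c by (intro mult_left_mono) auto
 also have "... = q4 / 2 + ?c^2 / 2" using c by (simp add: field_simps power2_eq_square)
 finally have "q4 \<le> 2000 + 1900 * D + q4 / 2 + ?c^2 / 2" using q1 by linarith
 then show ?thesis using zero_le_power2[of ?c] by argo
qed

text \<open>The divisors 210, 105 and 66 are the bounds from \<open>drift_coefficients\<close>. They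
  normalize the multipliers to |k| <= 1 for the pair sums and |k| <= |mag| for the triple
  sum.\<close>

lemma drift_bound: "E (drift \<theta> n) \<le> 300000 * (D + 1) + 40000 * q4"
proof -
 define Y where "Y = sqrt (real n) * E (\<lambda>s. (mag n s)^2)"
 let ?e = "exp (2 / real n)"
 define k1 where "k1 m = ?e * (2 * g * cosh (2 * m) - 2 * g^2 * m * sinh (2 * m)) + 2 * g" for m
 define k2 where "k2 m = ?e * (g^2 * cosh (2 * m) - g^2 * m * sinh (2 * m)) - g^2" for m
 define k3 where "k3 m = ?e * g^2 * sinh (2 * m)" for m
 have gb: "0 \<le> g" "g \<le> 1" and N: "real n \<ge> 8" using g_bounds n_large by auto
 have m1: "\<bar>mag n s\<bar> \<le> 1" if "s \<in> Omega n" for s by (rule abs_mag[OF that n_pos])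
 note co = drift_coefficients[OF m1 gb N]
 have le: "drift \<theta> n s \<le> 832 + 200 * (real n * mag n s ^ 4) + 210 * (k1 (mag n s) / 210 * pair_sum n 1 s)
   + 105 * (k2 (mag n s) / 105 * pair_sum n 2 s) - 66 * (k3 (mag n s) / 66 * triple_sum n s)" if h: "s \<in> Omega n" for s
 proof -
  define m where "m = mag n s"
  have "drift \<theta> n s = (?e * (cosh (2 * m) * (real n + g^2 * real n * m^2 + 2 * g * real n * m^2) - sinh (2 * m) * (real n * m + g^2 * real n * m ^ 3 + 2 * g * real n * m))
    - real n - g^2 * real n * m^2 + 2 * g * real n * m^2) + k1 m * pair_sum n 1 s + k2 m * pair_sum n 2 s - k3 m * triple_sum n s"
   unfolding drift_eq[OF h n_ge] k1_def k2_def k3_def m_def[symmetric] by (simp add: algebra_simps)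
  also have "... \<le> (832 + 200 * (real n * m ^ 4)) + k1 m * pair_sum n 1 s + k2 m * pair_sum n 2 s - k3 m * triple_sum n s"
   using co(4)[OF h] unfolding m_def by (intro diff_right_mono add_right_mono) auto
  finally show ?thesis unfolding m_def by simp
 qed
 have "E (drift \<theta> n) \<le> E (\<lambda>s. 832 + 200 * (real n * mag n s ^ 4) + 210 * (k1 (mag n s) / 210 * pair_sum n 1 s)
   + 105 * (k2 (mag n s) / 105 * pair_sum n 2 s) - 66 * (k3 (mag n s) / 66 * triple_sum n s))"
  by (rule E_mono[OF le])
 also have "... = 832 + 200 * q4 + 210 * E (\<lambda>s. k1 (mag n s) / 210 * pair_sum n 1 s) + 105 * E (\<lambda>s. k2 (mag n s) / 105 * pair_sum n 2 s)
   - 66 * E (\<lambda>s. k3 (mag n s) / 66 * triple_sum n s)"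
  by (simp only: E_add E_diff E_cmult E_const)
 also have "... \<le> 832 + 200 * q4 + 210 * (600 * (D + 1)) + 105 * (600 * (D + 1)) + 66 * (33 * D + 48 + 560 * Y)"
 proof -
  have "\<bar>E (\<lambda>s. k1 (mag n s) / 210 * pair_sum n 1 s)\<bar> \<le> 600 * (D + 1)"
   unfolding pair_sum_def
   by (rule quadratic_field_bound[OF _ _ exch_invariant_mag[of "\<lambda>m. k1 m / 210"]]) (use n_large co(1) in \<open>auto simp: k1_def\<close>)
  moreover have "\<bar>E (\<lambda>s. k2 (mag n s) / 105 * pair_sum n 2 s)\<bar> \<le> 600 * (D + 1)"
   unfolding pair_sum_def
   by (rule quadratic_field_bound[OF _ _ exch_invariant_mag[of "\<lambda>m. k2 m / 105"]]) (use n_large co(2) in \<open>auto simp: k2_def\<close>)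
  moreover have k3: "\<bar>k3 (mag n s) / 66\<bar> \<le> \<bar>mag n s\<bar>" if "s \<in> Omega n" for s
   using co(3)[OF that] by (simp add: k3_def mult.commute[of _ 66])
  moreover have "\<bar>E (\<lambda>s. k3 (mag n s) / 66 * triple_sum n s)\<bar> \<le> 33 * D + 48 + 560 * Y"
   unfolding Y_def by (rule triple_bound[OF exch_invariant_mag[of "\<lambda>m. k3 m / 66"] k3])
  ultimately show ?thesis by (simp add: abs_le_iff)
 qed
 also have "... \<le> 300000 * (D + 1) + 40000 * q4"
 proof -
  have "Y \<le> 1 * q4 + 1 / (4 * 1)" unfolding Y_def by (rule E_mag_sq) simp
  moreover have "q4 \<ge> 0" by (intro mult_nonneg_nonneg E_nonneg) auto
  ultimately show ?thesis using dirichlet_nonneg[of n \<mu>] by (simp add: algebra_simps)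
 qed
 finally show ?thesis .
qed

text \<open>A factor of D + 1 that dominates the mean drift, read off with room to spare from
  \<open>drift_bound\<close> after inserting \<open>moment_bound\<close>.\<close>

definition rate_const :: real where
 "rate_const = 1000000000 + 100000 * (16 * \<bar>\<theta>\<bar> + 560)^2"

lemma dirichlet_apriori: "D \<le> a * (rate_const * (D + 1))"
proof -
 have "E (drift \<theta> n) \<le> rate_const * (D + 1)"
 proof -
  define X where "X = (16 * \<bar>\<theta>\<bar> + 560)^2"
  have X: "0 \<le> X" "0 \<le> X * D" using dirichlet_nonneg[of n \<mu>] by (auto simp: X_def)
  have "rate_const * (D + 1) = 1000000000 * D + 100000 * (X * D) + 1000000000 + 100000 * X"
   unfolding rate_const_def X_def by (simp add: algebra_simps)
  then show ?thesis
   using drift_bound moment_bound[folded X_def] dirichlet_nonneg[of n \<mu>] X by argo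
 qed
 then show ?thesis using dirichlet_le_drift a_pos by (meson mult_left_mono less_imp_le order_trans)
qed

end

section \<open>The generator on characteristic functions\<close>

text \<open>The fluctuation field in terms of spins, with the test function given on sites:
  occupation minus 1/2 is half a spin.\<close>

definition lfield :: "nat => (int => real) => (int => nat) => real" where
 "lfield n h s = (\<Sum>x\<in>torus n. h x * spin n s x) / (2 * sqrt (real n))"

lemma lfield_exch:
 assumes n: "n \<ge> 2" and h: "periodic_mod n h" and y: "y \<in> torus n"
 shows "lfield n h (exch n y \<eta>) - lfield n h \<eta> = (spin n \<eta> (y + 1) - spin n \<eta> y) * (h y - h (y + 1)) / (2 * sqrt (real n))"
proof -
 have n0: "n > 0" using n by simp
 have s: "(\<Sum>x\<in>torus n. h (x + k) * site n y x) = h (y + k)" for k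
 proof -
  have "(\<Sum>x\<in>torus n. h (x + k) * site n y x) = (\<Sum>x\<in>torus n. if x = y then h (x + k) else 0)"
   using y by (intro sum.cong refl) (auto simp: site_def torus_mod_self)
  then show ?thesis using y by simp
 qed
 have s1: "(\<Sum>x\<in>torus n. h x * site n y (x - 1)) = h (y + 1)"
 proof -
  have "(\<Sum>x\<in>torus n. h x * site n y (x - 1)) = (\<Sum>x\<in>torus n. (\<lambda>x. h x * site n y (x - 1)) (x + 1))"
   by (rule sum_torus_shift[symmetric]) (intro periodic_mod_intros h periodic_mod_shift_diff periodic_mod_site)
  then show ?thesis using s[of 1] by simp
 qed
 let ?d = "spin n \<eta> (y + 1) - spin n \<eta> y"
 have "(\<Sum>x\<in>torus n. h x * spin n (exch n y \<eta>) x)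
   = (\<Sum>x\<in>torus n. h x * spin n \<eta> x + ?d * (h x * site n y x) - ?d * (h x * site n y (x - 1)))"
  unfolding spin_exch[OF n] by (intro sum.cong refl) (simp add: algebra_simps)
 also have "... = (\<Sum>x\<in>torus n. h x * spin n \<eta> x) + ?d * (h y - h (y + 1))"
  unfolding sum_subtractf sum.distrib sum_distrib_left[symmetric] s1 using s[of 0] by (simp add: right_diff_distrib)
 finally show ?thesis unfolding lfield_def diff_divide_distrib[symmetric] by simp
qed

lemma lfield_flip:
 assumes h: "s \<in> Omega n" and x: "x \<in> torus n"
 shows "lfield n f (flip s x) - lfield n f s = - (f x * spin n s x / sqrt (real n))"
proof -
 have "(\<Sum>z\<in>torus n. f z * spin n (flip s x) z) = (\<Sum>z\<in>torus n. f z * spin n s z - 2 * (if z = x then f z * spin n s z else 0))"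
  by (intro sum.cong refl) (use x in \<open>auto simp: spin_flip[OF h x] site_def torus_mod_self\<close>)
 also have "... = (\<Sum>z\<in>torus n. f z * spin n s z) - 2 * (f x * spin n s x)"
  using x by (simp add: sum_subtractf sum_distrib_left[symmetric])
 finally show ?thesis unfolding lfield_def by (simp add: diff_divide_distrib)
qed

lemma cis_diff_le: "cmod (cis u - cis v) \<le> \<bar>u - v\<bar>"
proof -
 have "cis u - cis v = cis v * (iexp (u - v) - 1)"
  by (simp add: cis_conv_exp exp_diff[symmetric] exp_add[symmetric] algebra_simps)
 moreover have "cmod (iexp (u - v) - 1) \<le> \<bar>u - v\<bar>" using iexp_approx1[of "u - v" 0] by simp
 ultimately show ?thesis by (simp add: norm_mult)
qed

lemma cis_taylor2: "cmod (cis (u + v) - cis u - cis u * (\<i> * complex_of_real v - complex_of_real (v^2 / 2))) \<le> \<bar>v\<bar> ^ 3"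
proof -
 have e: "cis (u + v) = cis u * iexp v" by (simp add: cis_conv_exp exp_add[symmetric] algebra_simps)
 have "cis (u + v) - cis u - cis u * (\<i> * complex_of_real v - complex_of_real (v^2 / 2))
   = cis u * (iexp v - (\<Sum>k\<le>2. (\<i> * complex_of_real v) ^ k / fact k))"
  unfolding e by (simp add: eval_nat_numeral algebra_simps)
 moreover have "cmod (iexp v - (\<Sum>k\<le>2. (\<i> * complex_of_real v) ^ k / fact k)) \<le> \<bar>v\<bar> ^ 3 / fact 3"
  using iexp_approx1[of v 2] by (simp add: eval_nat_numeral)
 moreover have "\<bar>v\<bar> ^ 3 / fact 3 \<le> \<bar>v\<bar> ^ 3" using zero_le_power[of "\<bar>v\<bar>" 3] by (simp add: fact_numeral)
 ultimately show ?thesis by (simp add: norm_mult)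
qed

text \<open>Collects the outcome of the a priori bounds: \<open>K\<close> bounds the fourth moment
  on its natural scale and \<open>l\<close> is the window of \<open>window_exists\<close>. Smallness
  of \<open>a\<close> is already spent on \<open>D_le\<close>.\<close>

locale controlled_weight = stationary_weight +
 fixes K :: real and l :: nat
 assumes D_le: "dirichlet n \<mu> \<le> 1"
  and q4_le: "real n * expect n \<mu> (\<lambda>s. (mag n s) ^ 4) \<le> K"
  and K_ge: "K \<ge> 1"
  and l_ge: "l \<ge> 1" and l_n: "2 * l + 2 \<le> n" and l_sq: "(real l)^2 / real n \<le> 4 * sqrt (real n)"
  and n_l: "real n / real l \<le> sqrt (sqrt (real n))"
begin

text \<open>The scale n^(1/4): the magnetization is of order 1 / r, the window of order r^3, one
  exchange moves the field by O(r^(-6)).\<close>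

definition r :: real where "r = sqrt (sqrt (real n))"

lemma r_facts: "r \<ge> 1" "r ^ 4 = real n" "r^2 = sqrt (real n)" "r > 0"
proof -
 show r2: "r^2 = sqrt (real n)" by (simp add: r_def)
 show "r ^ 4 = real n" using power_mult[of r 2 2] r2 by simp
 show "r \<ge> 1" using n_large by (simp add: r_def)
 then show "r > 0" by simp
qed

lemma r_pow_mono: "i \<le> j ==> r ^ i \<le> r ^ j"
 using r_facts by (intro power_increasing) auto

lemma l_le: "real l \<le> 2 * r ^ 3"
proof -
 have "(real l)^2 \<le> 4 * r^2 * r ^ 4" using l_sq n_pos unfolding r_facts(2,3) by (simp add: divide_le_eq)
 also have "... = (2 * r ^ 3)^2" by (simp add: power_mult_distrib power_add[symmetric] power_mult[symmetric])
 finally show ?thesis by (rule power2_le_imp_le) (use r_facts(1) in simp)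
qed

lemma E_mag2: "r^2 * E (\<lambda>s. (mag n s)^2) \<le> K + 1"
 using E_mag_sq[of 1] q4_le unfolding r_facts(3) by simp

lemma E_mag1: "r * E (\<lambda>s. \<bar>mag n s\<bar>) \<le> K + 2"
 using E_abs_mag E_mag2 unfolding r_def[symmetric] r_facts(3) by linarith

abbreviation "b \<equiv> avg_block n l"

lemma bp: "periodic_mod n (b s)" by (rule periodic_mod_block)

section \<open>Mean size of the blocks at the window n^(3/4)\<close>

lemma E_block_sq: "E (\<lambda>s. \<Sum>x\<in>torus n. (b s x)^2) \<le> 20 * r"
proof -
 have "E (\<lambda>s. 1 * (\<Sum>x\<in>torus n. (b s x)^2)) \<le> 8 * D + 12 * (real n / real l) * E (\<lambda>_. 1)"
  by (rule avg_block_energy[OF l_ge]) (auto simp: exch_invariant_def)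
 also have "... \<le> 8 * r + 12 * r" using D_le n_l r_facts(1) unfolding E_const r_def[symmetric] by linarith
 finally show ?thesis by simp
qed

lemma E_block_abs: "E (\<lambda>s. \<Sum>x\<in>torus n. \<bar>b s x\<bar>) \<le> 11 * r ^ 3"
proof -
 have y: "\<bar>z\<bar> \<le> 1 / (2 * r) + r / 2 * z^2" for z
 proof -
  have "0 \<le> (r * \<bar>z\<bar> - 1)^2 / (2 * r)" using r_facts(1,4) by simp
  also have "... = 1 / (2 * r) + r / 2 * z^2 - \<bar>z\<bar>" using r_facts(1,4) by (simp add: power2_diff power_mult_distrib field_simps power2_eq_square)
  finally show ?thesis by simp
 qed
 have "E (\<lambda>s. \<Sum>x\<in>torus n. \<bar>b s x\<bar>) \<le> E (\<lambda>s. real n / (2 * r) + r / 2 * (\<Sum>x\<in>torus n. (b s x)^2))"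
 proof (rule E_mono)
  fix s
  have "(\<Sum>x\<in>torus n. \<bar>b s x\<bar>) \<le> (\<Sum>x\<in>torus n. 1 / (2 * r) + r / 2 * (b s x)^2)" by (intro sum_mono y)
  then show "(\<Sum>x\<in>torus n. \<bar>b s x\<bar>) \<le> real n / (2 * r) + r / 2 * (\<Sum>x\<in>torus n. (b s x)^2)"
   by (simp add: sum.distrib sum_distrib_left)
 qed
 also have "... = r ^ 3 / 2 + r / 2 * E (\<lambda>s. \<Sum>x\<in>torus n. (b s x)^2)"
  using r_facts(4) unfolding E_add E_const E_cmult r_facts(2)[symmetric] by (simp add: eval_nat_numeral)
 also have "... \<le> r ^ 3 / 2 + r / 2 * (20 * r)" using E_block_sq r_facts(1,4) by (intro add_left_mono mult_left_mono) auto
 also have "... = r ^ 3 / 2 + 10 * r^2" by (simp add: power2_eq_square)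
 also have "... \<le> 11 * r ^ 3" using r_pow_mono[of 2 3] zero_le_power[of r 3] r_facts(1) by linarith
 finally show ?thesis .
qed

lemma E_cmult_complex: "E (\<lambda>s. (c::complex) * F s) = c * E F"
 by (simp add: expect_def sum_distrib_left mult_scaleR_right)

end

text \<open>\<open>h\<close> is p' sampled on the grid; \<open>hL\<close> says that it varies on the
  macroscopic scale only.\<close>

locale test_function = controlled_weight +
 fixes h :: "int => real" and C :: real
 assumes hp: "periodic_mod n h" and h0: "(\<Sum>x\<in>torus n. h x) = 0"
  and hC: "\<And>x. \<bar>h x\<bar> \<le> C" and hL: "\<And>x. \<bar>h (x + 1) - h x\<bar> \<le> C / real n" and C1: "C \<ge> 1"
begin

definition \<Phi> :: "(int => nat) => complex" where "\<Phi> s = cis (lfield n h s)"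

lemma norm_\<Phi>: "cmod (\<Phi> s) = 1" by (simp add: \<Phi>_def)

lemma C_pow: "i \<le> j ==> C ^ i \<le> C ^ j" using C1 by (intro power_increasing) auto

lemma exch_torus_mod: "exch n (y mod int n) s = exch n y s"
 unfolding exch_def by (simp add: mod_simps)

lemma field_increment:
 assumes h: "s \<in> Omega n"
 shows "\<bar>lfield n h (exch n y s) - lfield n h s\<bar> \<le> C / r ^ 6"
proof -
 let ?y = "y mod int n"
 have "\<bar>spin n s (?y + 1) - spin n s ?y\<bar> * \<bar>h ?y - h (?y + 1)\<bar> \<le> 2 * (C / real n)"
  using abs_spin[OF h n_pos, of ?y] abs_spin[OF h n_pos, of "?y + 1"] hL[of ?y] by (intro mult_mono) auto
 then have "\<bar>spin n s (?y + 1) - spin n s ?y\<bar> * \<bar>h ?y - h (?y + 1)\<bar> / (2 * sqrt (real n)) \<le> 2 * (C / real n) / (2 * sqrt (real n))"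
  by (rule divide_right_mono) simp
 then have "\<bar>lfield n h (exch n ?y s) - lfield n h s\<bar> \<le> 2 * (C / real n) / (2 * sqrt (real n))"
  unfolding lfield_exch[OF n_ge hp torus_mod[OF n_pos]] abs_divide abs_mult by simp
 also have "... = C / r ^ 6" unfolding r_facts(3)[symmetric] unfolding r_facts(2)[symmetric] by (simp add: eval_nat_numeral)
 finally show ?thesis by (simp add: exch_torus_mod)
qed

lemma \<Phi>_increment:
 assumes "s \<in> Omega n" shows "cmod (\<Phi> (exch n y s) - \<Phi> s) \<le> C / r ^ 6"
 unfolding \<Phi>_def by (rule order_trans[OF cis_diff_le field_increment[OF assms]])

text \<open>The error of \<open>replace_bound\<close> for a factor of modulus 1 with the increment C
  / r^6 of a macroscopic field. Quadratic sums will use \<open>A\<close> = 1, cubic ones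
  \<open>A\<close> = r, which balances A against r^2 / A.\<close>

lemma replace_error:
 assumes A: "A > 0" and c: "c \<ge> 0"
 shows "A * D / 2 + 4 * (c * real l)^2 / (A * real n) * E (\<lambda>s. 1^2) + (c * real l * (C / r ^ 6))^2 / (A * real n) + real n * (c * real l * (C / r ^ 6))
  \<le> A / 2 + 16 * c^2 * r^2 / A + 4 * c^2 * C^2 / A + 2 * c * C * r"
proof -
 have 1: "A * D / 2 \<le> A / 2" using D_le A by (simp add: mult_left_le)
 have "4 * (c * real l)^2 / (A * real n) = 4 * c^2 / A * ((real l)^2 / real n)" by (simp add: power_mult_distrib)
 also have "... \<le> 4 * c^2 / A * (4 * r^2)" using l_sq A unfolding r_facts(3) by (intro mult_left_mono) auto
 finally have 2: "4 * (c * real l)^2 / (A * real n) * E (\<lambda>s. 1^2) \<le> 16 * c^2 * r^2 / A" by (simp add: E_const)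
 have d: "real l * (C / r ^ 6) \<le> 2 * C / r ^ 3"
 proof -
  have "real l * (C / r ^ 6) \<le> 2 * r ^ 3 * (C / r ^ 6)" using l_le C1 r_facts(1,4) by (intro mult_right_mono) auto
  also have "... = 2 * C / r ^ 3" using r_facts(1,4) by (simp add: field_simps eval_nat_numeral)
  finally show ?thesis .
 qed
 have d0: "0 \<le> real l * (C / r ^ 6)" using C1 r_facts(1,4) by simp
 have d1: "c * (real l * (C / r ^ 6)) \<le> c * (2 * C / r ^ 3)" by (rule mult_left_mono[OF d c])
 have "c * (2 * C / r ^ 3) \<le> c * (2 * C)"
 proof -
  have "1 \<le> r ^ 3" using r_facts(1) by simp
  then have "2 * C / r ^ 3 \<le> 2 * C" using C1 r_facts(1) by (simp add: divide_le_eq mult_le_cancel_left1)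
  then show ?thesis using c by (intro mult_left_mono)
 qed
 then have "(c * (real l * (C / r ^ 6)))^2 \<le> (c * (2 * C))^2" using order_trans[OF d1] mult_nonneg_nonneg[OF c d0] by (intro power_mono)
 then have "(c * (real l * (C / r ^ 6)))^2 / (A * real n) \<le> (c * (2 * C))^2 / (A * real n)" using A by (intro divide_right_mono) auto
 also have "... \<le> (c * (2 * C))^2 / A" using A n_pos by (intro divide_left_mono) (auto simp: mult_le_cancel_left1)
 finally have 3: "(c * real l * (C / r ^ 6))^2 / (A * real n) \<le> 4 * c^2 * C^2 / A" by (simp add: power_mult_distrib mult.assoc mult_ac)
 have "real n * (c * (real l * (C / r ^ 6))) \<le> real n * (c * (2 * C / r ^ 3))" using d1 by (rule mult_left_mono) simp
 also have "... = 2 * c * C * r" unfolding r_facts(2)[symmetric] using r_facts(1,4) by (simp add: field_simps eval_nat_numeral)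
 finally have 4: "real n * (c * real l * (C / r ^ 6)) \<le> 2 * c * C * r" by (simp add: mult.assoc)
 show ?thesis using 1 2 3 4 by linarith
qed

text \<open>Quadratic sums enter with a factor 1 / n, so order n^(3/4) is small enough. The spin at
  x + 1 becomes magnetization plus block, and both are estimated in absolute value.\<close>

lemma quadratic_average:
 assumes F: "\<And>s. periodic_mod n (F s)"
  and Fc: "\<And>s x. s \<in> Omega n ==> \<bar>F s x\<bar> \<le> c" and c1: "c \<ge> 1"
  and loc: "\<And>s y i. i \<in> {1..l} ==> F (exch n y s) (y - int i) = F s (y - int i)"
 shows "cmod (E (\<lambda>s. (\<Sum>x\<in>torus n. F s x * spin n s (x + 1)) *\<^sub>R \<Phi> s)) \<le> r ^ 3 * (c^2 * C^2 * (K + 36))"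
proof -
 have 1: "cmod (E (\<lambda>s. (\<Sum>x\<in>torus n. (cspin n s (x + 1) - b s x) * F s x) *\<^sub>R \<Phi> s))
   \<le> 1 / 2 + 16 * c^2 * r^2 / 1 + 4 * c^2 * C^2 / 1 + 2 * c * C * r"
  by (rule order_trans[OF replace_right[where w = "\<lambda>_. 1" and A = 1 and c = c and \<delta> = "C / r ^ 6"] replace_error])
    (use l_ge F Fc loc norm_\<Phi> \<Phi>_increment C1 c1 r_facts(1,4) in auto)
 have 2: "cmod (E (\<lambda>s. (\<Sum>x\<in>torus n. (mag n s + b s x) * F s x) *\<^sub>R \<Phi> s)) \<le> E (\<lambda>s. (c * real n) * \<bar>mag n s\<bar> + c * (\<Sum>x\<in>torus n. \<bar>b s x\<bar>))"
 proof (rule norm_E_le)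
  fix s assume h: "s \<in> Omega n"
  have "\<bar>\<Sum>x\<in>torus n. (mag n s + b s x) * F s x\<bar> \<le> (\<Sum>x\<in>torus n. (\<bar>mag n s\<bar> + \<bar>b s x\<bar>) * c)"
   unfolding abs_mult[symmetric]
   by (rule order_trans[OF sum_abs], rule sum_mono) (use Fc[OF h] in \<open>auto simp: abs_mult intro!: mult_mono\<close>)
  also have "... = (c * real n) * \<bar>mag n s\<bar> + c * (\<Sum>x\<in>torus n. \<bar>b s x\<bar>)"
   unfolding sum_distrib_right[symmetric] sum.distrib by (simp add: algebra_simps)
  finally show "cmod ((\<Sum>x\<in>torus n. (mag n s + b s x) * F s x) *\<^sub>R \<Phi> s) \<le> (c * real n) * \<bar>mag n s\<bar> + c * (\<Sum>x\<in>torus n. \<bar>b s x\<bar>)"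
   by (simp add: norm_\<Phi>)
 qed
 have 3: "E (\<lambda>s. (c * real n) * \<bar>mag n s\<bar> + c * (\<Sum>x\<in>torus n. \<bar>b s x\<bar>)) \<le> c * r ^ 3 * (K + 2) + c * (11 * r ^ 3)"
 proof -
  have "(c * real n) * E (\<lambda>s. \<bar>mag n s\<bar>) = c * r ^ 3 * (r * E (\<lambda>s. \<bar>mag n s\<bar>))"
   unfolding r_facts(2)[symmetric] by (simp add: eval_nat_numeral)
  also have "... \<le> c * r ^ 3 * (K + 2)" using E_mag1 c1 r_facts(1,4) by (intro mult_left_mono) auto
  finally show ?thesis unfolding E_add E_cmult using E_block_abs c1 by (intro add_mono mult_left_mono) auto
 qed
 have "E (\<lambda>s. (\<Sum>x\<in>torus n. F s x * spin n s (x + 1)) *\<^sub>R \<Phi> s)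
   = E (\<lambda>s. (\<Sum>x\<in>torus n. (cspin n s (x + 1) - b s x) * F s x) *\<^sub>R \<Phi> s) + E (\<lambda>s. (\<Sum>x\<in>torus n. (mag n s + b s x) * F s x) *\<^sub>R \<Phi> s)"
  unfolding E_add[symmetric] scaleR_add_left[symmetric] sum.distrib[symmetric] by (simp add: cspin_def algebra_simps)
 then have "cmod (E (\<lambda>s. (\<Sum>x\<in>torus n. F s x * spin n s (x + 1)) *\<^sub>R \<Phi> s))
   \<le> (1 / 2 + 16 * c^2 * r^2 / 1 + 4 * c^2 * C^2 / 1 + 2 * c * C * r) + (c * r ^ 3 * (K + 2) + c * (11 * r ^ 3))"
  using 1 2 3 norm_triangle_ineq order_trans by (smt (verit, best))
 also have "... \<le> r ^ 3 * (c^2 * C^2 * (K + 36))"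
 proof -
  let ?X = "r ^ 3 * (c^2 * C^2)"
  have c2: "1 \<le> c^2" "c \<le> c^2" using power_increasing[OF _ c1, of 0 2] power_increasing[OF _ c1, of 1 2] by auto
  have C2: "1 \<le> C^2" "C \<le> C^2" using C_pow[of 0 2] C_pow[of 1 2] by auto
  have r3: "1 \<le> r ^ 3" "r \<le> r ^ 3" "r^2 \<le> r ^ 3" using r_facts(1) r_pow_mono[of 1 3] r_pow_mono[of 2 3] by auto
  have m: "u * (v * w) \<le> ?X" if "0 \<le> u" "0 \<le> v" "0 \<le> w" "u \<le> r ^ 3" "v \<le> c^2" "w \<le> C^2" for u v w
   using that r_facts(1) by (intro mult_mono) auto
  have "1 \<le> ?X" using m[of 1 1 1] c2 C2 r3 by simp
  moreover have "c^2 * r^2 \<le> ?X" using m[of "r^2" "c^2" 1] c2 C2 r3 by (simp add: mult_ac)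
  moreover have "c^2 * C^2 \<le> ?X" using m[of 1 "c^2" "C^2"] r3 by simp
  moreover have "c * C * r \<le> ?X" using m[of r c C] c1 C1 c2 C2 r3 r_facts(1) by (simp add: mult_ac)
  moreover have X2: "c * r ^ 3 \<le> ?X" using m[of "r ^ 3" c 1] c1 c2 C2 r_facts(1,4) by (simp add: mult_ac)
  moreover have "c * r ^ 3 * (K + 2) \<le> ?X * (K + 2)" using X2 K_ge by (intro mult_right_mono) auto
  ultimately show ?thesis by (simp add: algebra_simps)
 qed
 finally show ?thesis .
qed

text \<open>The field on the scale of a density, 2 * \<open>lfield\<close> / sqrt n.\<close>

definition zf :: "(int => nat) => real" where "zf s = (\<Sum>x\<in>torus n. h x * spin n s x) / real n"

lemma h_shift: "\<bar>h x - h (x - int j)\<bar> \<le> real j * (C / real n)"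
proof (induction j)
 case (Suc j)
 have "\<bar>h (x - int j) - h (x - int (Suc j))\<bar> \<le> C / real n" using hL[of "x - int (Suc j)"] by simp
 then have "\<bar>h x - h (x - int (Suc j))\<bar> \<le> real j * (C / real n) + C / real n" using Suc by linarith
 then show ?case by (simp only: of_nat_Suc distrib_right mult_1)
qed simp

text \<open>Since \<open>h\<close> has sum 0 the magnetization drops out. Since \<open>h\<close> is
  Lipschitz, spins can be traded for blocks by averaging \<open>h\<close> instead, at a
  deterministic cost of order l / n.\<close>

lemma zf_bound:
 assumes s: "s \<in> Omega n"
 shows "(zf s)^2 \<le> 32 * C^2 / r^2 + 2 * C^2 / real n * (\<Sum>x\<in>torus n. (b s x)^2)"
proof -
 let ?B = "\<Sum>x\<in>torus n. \<bar>b s x\<bar>"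
 have l0: "l > 0" using l_ge by simp
 have e1: "(\<Sum>x\<in>torus n. h x * spin n s x) = (\<Sum>x\<in>torus n. h x * cspin n s x)"
  unfolding spin_eq distrib_left sum.distrib sum_distrib_right[symmetric] h0 by simp
 have e2: "(\<Sum>x\<in>torus n. h x * b s x) = (\<Sum>x\<in>torus n. (\<Sum>j=1..l. h (x - int j)) / real l * cspin n s x)"
 proof -
  have "(\<Sum>x\<in>torus n. h x * b s x) = (\<Sum>x\<in>torus n. \<Sum>j=1..l. h x * cspin n s (x + int j) / real l)"
   unfolding block_def sum_distrib_left by simp
  also have "... = (\<Sum>j=1..l. \<Sum>x\<in>torus n. h x * cspin n s (x + int j) / real l)" by (rule sum.swap)
  also have "... = (\<Sum>j=1..l. \<Sum>x\<in>torus n. h (x - int j) * cspin n s x / real l)"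
  proof (rule sum.cong[OF refl])
   fix j
   have "periodic_mod n (\<lambda>x. h (x - int j) * cspin n s x / real l)"
    by (intro periodic_mod_intros periodic_mod_shift_diff[OF hp] periodic_mod_cspin)
   from sum_torus_shift[OF this, of "int j"]
   show "(\<Sum>x\<in>torus n. h x * cspin n s (x + int j) / real l) = (\<Sum>x\<in>torus n. h (x - int j) * cspin n s x / real l)" by simp
  qed
  also have "... = (\<Sum>x\<in>torus n. (\<Sum>j=1..l. h (x - int j)) / real l * cspin n s x)"
   by (subst sum.swap) (simp add: sum_distrib_right sum_divide_distrib)
  finally show ?thesis .
 qed
 have d: "\<bar>h x - (\<Sum>j=1..l. h (x - int j)) / real l\<bar> \<le> real l * (C / real n)" for x
 proof -
  have "h x - (\<Sum>j=1..l. h (x - int j)) / real l = (\<Sum>j=1..l. h x - h (x - int j)) / real l"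
   using l0 by (simp add: sum_subtractf diff_divide_distrib)
  also have "\<bar>...\<bar> \<le> (\<Sum>j=1..l. real l * (C / real n)) / real l"
  proof -
   have "\<bar>h x - h (x - int j)\<bar> \<le> real l * (C / real n)" if "j \<in> {1..l}" for j
    by (rule order_trans[OF h_shift mult_right_mono]) (use that C1 in auto)
   then have "\<bar>\<Sum>j=1..l. h x - h (x - int j)\<bar> \<le> (\<Sum>j=1..l. real l * (C / real n))"
    by (intro order_trans[OF sum_abs] sum_mono)
   then show ?thesis unfolding abs_divide abs_of_nat by (rule divide_right_mono) simp
  qed
  finally show ?thesis using l0 by simp
 qed
 have "\<bar>(\<Sum>x\<in>torus n. h x * cspin n s x) - (\<Sum>x\<in>torus n. h x * b s x)\<bar> \<le> (\<Sum>x\<in>torus n. (real l * (C / real n)) * 2)"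
  unfolding e2 sum_subtractf[symmetric] left_diff_distrib[symmetric]
  by (rule order_trans[OF sum_abs], rule sum_mono)
    (unfold abs_mult, intro mult_mono d abs_cspin[OF s n_pos], use C1 in auto)
 also have "... = 2 * C * real l" using n_pos by simp
 finally have f1: "\<bar>(\<Sum>x\<in>torus n. h x * cspin n s x) - (\<Sum>x\<in>torus n. h x * b s x)\<bar> \<le> 2 * C * real l" .
 have f2: "\<bar>\<Sum>x\<in>torus n. h x * b s x\<bar> \<le> C * ?B"
  unfolding sum_distrib_left by (rule order_trans[OF sum_abs], rule sum_mono) (auto simp: abs_mult intro!: mult_right_mono hC)
 have "\<bar>real n * zf s\<bar> \<le> 2 * C * real l + C * ?B" unfolding zf_def using e1 f1 f2 n_pos by simp
 also have "... \<le> 4 * C * r ^ 3 + C * ?B" using l_le C1 mult_left_mono[of "real l" "2 * r ^ 3" "2 * C"] by simp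
 finally have "\<bar>real n * zf s\<bar> \<le> 4 * C * r ^ 3 + C * ?B" .
 then have "(real n * zf s)^2 \<le> (4 * C * r ^ 3 + C * ?B)^2" using power_mono[of "\<bar>real n * zf s\<bar>" _ 2] by simp
 also have "... \<le> 2 * (4 * C * r ^ 3)^2 + 2 * (C * ?B)^2"
  using sum_squares_bound[of "4 * C * r ^ 3" "C * ?B"] by (simp add: power2_sum)
 also have "(C * ?B)^2 \<le> C^2 * (real n * (\<Sum>x\<in>torus n. (b s x)^2))"
  using sum_squared_le_sum_of_squares[of "\<lambda>x. \<bar>b s x\<bar>" "torus n"] by (simp add: power_mult_distrib mult_left_mono mult.commute)
 also have "2 * (4 * C * r ^ 3)^2 = 32 * C^2 * r ^ 6" by (simp add: power_mult_distrib power_mult[symmetric])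
 finally have "(real n)^2 * (zf s)^2 \<le> 32 * C^2 * r ^ 6 + 2 * (C^2 * (real n * (\<Sum>x\<in>torus n. (b s x)^2)))"
  by (simp add: power_mult_distrib)
 then have "(zf s)^2 \<le> (32 * C^2 * r ^ 6 + 2 * (C^2 * (real n * (\<Sum>x\<in>torus n. (b s x)^2)))) / (real n)^2"
  using n_pos by (simp add: pos_le_divide_eq mult.commute)
 also have "... = 32 * C^2 / r^2 + 2 * C^2 / real n * (\<Sum>x\<in>torus n. (b s x)^2)"
 proof -
  have "32 * C^2 * r ^ 6 / (real n)^2 = 32 * C^2 / r^2" unfolding r_facts(2)[symmetric] using r_facts(4) by (simp add: field_simps eval_nat_numeral)
  then show ?thesis using n_pos by (simp add: add_divide_distrib power2_eq_square)
 qed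
 finally show ?thesis .
qed

lemma E_zf_sq: "E (\<lambda>s. (zf s)^2) \<le> 72 * C^2 / r^2"
proof -
 have "E (\<lambda>s. (zf s)^2) \<le> E (\<lambda>s. 32 * C^2 / r^2 + 2 * C^2 / real n * (\<Sum>x\<in>torus n. (b s x)^2))"
  by (rule E_mono[OF zf_bound])
 also have "... \<le> 32 * C^2 / r^2 + 2 * C^2 / real n * (20 * r)"
  unfolding E_add E_const E_cmult using E_block_sq by (intro add_left_mono mult_left_mono) auto
 also have "2 * C^2 / real n * (20 * r) \<le> 40 * C^2 / r^2"
 proof -
  have "2 * C^2 / real n * (20 * r) = 40 * C^2 / r ^ 3" unfolding r_facts(2)[symmetric] using r_facts(4) by (simp add: field_simps eval_nat_numeral)
  also have "... \<le> 40 * C^2 / r^2" using r_pow_mono[of 2 3] r_facts(1,4) by (intro divide_left_mono) auto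
  finally show ?thesis .
 qed
 finally show ?thesis by simp
qed

lemma E_abs_zf: "E (\<lambda>s. \<bar>zf s\<bar>) \<le> 37 * C^2 / r"
proof -
 have y: "\<bar>z\<bar> \<le> 1 / (2 * r) + r / 2 * z^2" for z
 proof -
  have "0 \<le> (r * \<bar>z\<bar> - 1)^2 / (2 * r)" using r_facts(1,4) by simp
  also have "... = 1 / (2 * r) + r / 2 * z^2 - \<bar>z\<bar>" using r_facts(1,4) by (simp add: power2_diff power_mult_distrib field_simps power2_eq_square)
  finally show ?thesis by simp
 qed
 have "E (\<lambda>s. \<bar>zf s\<bar>) \<le> E (\<lambda>s. 1 / (2 * r) + r / 2 * (zf s)^2)" by (intro E_mono y)
 also have "... \<le> 1 / (2 * r) + r / 2 * (72 * C^2 / r^2)"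
  unfolding E_add E_const E_cmult using E_zf_sq r_facts(1,4) by (intro add_left_mono mult_left_mono) auto
 also have "... \<le> 37 * C^2 / r"
  using r_facts(1,4) C_pow[of 0 2] by (simp add: field_simps power2_eq_square)
 finally show ?thesis .
qed

end

context test_function
begin

text \<open>n^(1/8). As weight in Young's inequality it balances n m^2 / \<rho> against \<rho> times
  the block energy: their means are of order r^2 / \<rho> and \<rho> r, which agree because \<rho>^2
  = r.\<close>

definition \<rho> :: real where "\<rho> = sqrt r"

lemma \<rho>_facts: "\<rho> \<ge> 1" "\<rho>^2 = r" "\<rho> > 0"
proof -
 show 1: "\<rho> \<ge> 1" using r_facts(1) by (simp add: \<rho>_def)
 show "\<rho>^2 = r" using r_facts(4) by (simp add: \<rho>_def)
 show "\<rho> > 0" using 1 by simp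
qed

lemma spin_exch_left:
 assumes "0 < k" "k + 2 \<le> int n" shows "spin n (exch n y s) (y - k) = spin n s (y - k)"
 using cspin_exch_left[OF assms] unfolding cspin_def mag_exch[OF n_ge] by simp

lemma spin_exch_right:
 assumes "2 \<le> k" "k + 1 \<le> int n" shows "spin n (exch n y s) (y + k) = spin n s (y + k)"
 using cspin_exch_right[OF assms] unfolding cspin_def mag_exch[OF n_ge] by simp

text \<open>In the product of the two factors magnetization plus block, the square of the
  magnetization multiplies the sum of \<open>h\<close> times the spins, which is n *
  \<open>zf\<close> and small because \<open>h\<close> has sum 0. The terms with a block are
  estimated in absolute value.\<close>

lemma cubic_remainder:
 assumes s: "s \<in> Omega n"
 shows "\<bar>\<Sum>x\<in>torus n. h x * spin n s x * (mag n s + b s (x - int l - 1)) * (mag n s + b s x)\<bar>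
  \<le> r^2 * (1 / (2 * r) * (real n * mag n s ^ 4) + r / 2 * (zf s)^2) + C / \<rho> * real n * (mag n s)^2
   + (C * \<rho> + C) * (\<Sum>x\<in>torus n. (b s x)^2)"
proof -
 let ?m = "mag n s" and ?a = "\<lambda>x. b s (x - int l - 1)" and ?B = "\<Sum>x\<in>torus n. (b s x)^2"
 have aB: "(\<Sum>x\<in>torus n. (?a x)^2) = ?B"
  using sum_torus_shift_diff[OF periodic_mod_comp[OF bp[of s], of "\<lambda>z. z^2"], where k = "int l + 1"] by (simp add: diff_diff_eq)
 have "(\<Sum>x\<in>torus n. h x * spin n s x * (?m + ?a x) * (?m + b s x))
   = ?m^2 * (\<Sum>x\<in>torus n. h x * spin n s x) + (\<Sum>x\<in>torus n. h x * spin n s x * (?m * ?a x + ?m * b s x + ?a x * b s x))"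
  unfolding sum_distrib_left sum.distrib[symmetric] by (intro sum.cong refl) (simp add: algebra_simps power2_eq_square)
 also have "?m^2 * (\<Sum>x\<in>torus n. h x * spin n s x) = ?m^2 * (real n * zf s)" using n_pos by (simp add: zf_def)
 finally have e: "(\<Sum>x\<in>torus n. h x * spin n s x * (?m + ?a x) * (?m + b s x))
   = ?m^2 * (real n * zf s) + (\<Sum>x\<in>torus n. h x * spin n s x * (?m * ?a x + ?m * b s x + ?a x * b s x))" .
 have 1: "\<bar>?m^2 * (real n * zf s)\<bar> \<le> r^2 * (1 / (2 * r) * (real n * ?m ^ 4) + r / 2 * (zf s)^2)"
 proof -
  let ?u = "r^2 * ?m^2"
  have "0 \<le> (?u - r * \<bar>zf s\<bar>)^2 / (2 * r)" using r_facts(4) by simp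
  also have "... = 1 / (2 * r) * ?u^2 + r / 2 * (zf s)^2 - ?u * \<bar>zf s\<bar>"
   using r_facts(4) by (simp add: power2_diff power_mult_distrib[of r "\<bar>zf s\<bar>"] field_simps power2_eq_square[of r])
  finally have "?u * \<bar>zf s\<bar> \<le> 1 / (2 * r) * ?u^2 + r / 2 * (zf s)^2" by simp
  moreover have "?u^2 = real n * ?m ^ 4" unfolding r_facts(2)[symmetric] by (simp add: power_mult_distrib power_mult[symmetric])
  ultimately have "r^2 * (?u * \<bar>zf s\<bar>) \<le> r^2 * (1 / (2 * r) * (real n * ?m ^ 4) + r / 2 * (zf s)^2)" by (intro mult_left_mono) auto
  moreover have "\<bar>?m^2 * (real n * zf s)\<bar> = r^2 * (?u * \<bar>zf s\<bar>)" unfolding r_facts(2)[symmetric] using r_facts(4) by (simp add: abs_mult eval_nat_numeral)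
  ultimately show ?thesis by simp
 qed
 have y: "\<bar>?m * z\<bar> \<le> ?m^2 / (2 * \<rho>) + \<rho> / 2 * z^2" for z
 proof -
  have "0 \<le> (\<bar>?m\<bar> - \<rho> * \<bar>z\<bar>)^2 / (2 * \<rho>)" using \<rho>_facts(3) by simp
  also have "... = ?m^2 / (2 * \<rho>) + \<rho> / 2 * z^2 - \<bar>?m\<bar> * \<bar>z\<bar>" using \<rho>_facts(3) by (simp add: power2_diff power_mult_distrib field_simps power2_eq_square[of \<rho>])
  finally show ?thesis by (simp add: abs_mult)
 qed
 have "\<bar>h x * spin n s x * (?m * ?a x + ?m * b s x + ?a x * b s x)\<bar> \<le> C * (?m^2 / \<rho> + (\<rho> + 1) / 2 * (?a x)^2 + (\<rho> + 1) / 2 * (b s x)^2)" for x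
 proof -
  have "\<bar>?a x * b s x\<bar> \<le> (?a x)^2 / 2 + (b s x)^2 / 2"
   using sum_squares_bound[of "\<bar>?a x\<bar>" "\<bar>b s x\<bar>"] by (simp add: abs_mult)
  then have "\<bar>?m * ?a x + ?m * b s x + ?a x * b s x\<bar> \<le> (?m^2 / (2 * \<rho>) + \<rho> / 2 * (?a x)^2) + (?m^2 / (2 * \<rho>) + \<rho> / 2 * (b s x)^2) + ((?a x)^2 / 2 + (b s x)^2 / 2)"
   using y[of "?a x"] y[of "b s x"] by linarith
  also have "... = ?m^2 / \<rho> + (\<rho> + 1) / 2 * (?a x)^2 + (\<rho> + 1) / 2 * (b s x)^2" by (simp add: field_simps)
  finally have "\<bar>h x\<bar> * \<bar>?m * ?a x + ?m * b s x + ?a x * b s x\<bar> \<le> C * (?m^2 / \<rho> + (\<rho> + 1) / 2 * (?a x)^2 + (\<rho> + 1) / 2 * (b s x)^2)"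
   using hC C1 by (intro mult_mono) auto
  then show ?thesis by (simp add: abs_mult abs_spin[OF s n_pos])
 qed
 then have "\<bar>\<Sum>x\<in>torus n. h x * spin n s x * (?m * ?a x + ?m * b s x + ?a x * b s x)\<bar>
   \<le> (\<Sum>x\<in>torus n. C * (?m^2 / \<rho> + (\<rho> + 1) / 2 * (?a x)^2 + (\<rho> + 1) / 2 * (b s x)^2))"
  by (intro order_trans[OF sum_abs] sum_mono)
 also have "... = C * (real n * (?m^2 / \<rho>) + (\<rho> + 1) / 2 * ?B + (\<rho> + 1) / 2 * ?B)"
  unfolding sum_distrib_left[symmetric] sum.distrib aB by simp
 also have "... = C / \<rho> * real n * ?m^2 + (C * \<rho> + C) * ?B" by (simp add: algebra_simps)
 finally have 2: "\<bar>\<Sum>x\<in>torus n. h x * spin n s x * (?m * ?a x + ?m * b s x + ?a x * b s x)\<bar> \<le> C / \<rho> * real n * ?m^2 + (C * \<rho> + C) * ?B" .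
 show ?thesis unfolding e using 1 2 by linarith
qed

text \<open>The cubic sum enters with 1 / sqrt n = r^(-2), which leaves 1 / \<rho> = n^(-1/8); this
  is the slowest error in \<open>gen_error\<close>. As in \<open>cubic_field_bound\<close>, the
  right neighbour is replaced before the left one.\<close>

lemma cubic_average:
 "cmod (E (\<lambda>s. (\<Sum>x\<in>torus n. h x * (spin n s (x - 1) * spin n s x * spin n s (x + 1))) *\<^sub>R \<Phi> s)) \<le> r * \<rho> * (C ^ 4 * (2 * K + 290))"
proof -
 let ?a = "\<lambda>s x. b s (x - int l - 1)"
 have sp: "periodic_mod n (spin n s)" for s by (rule periodic_mod_spin)
 have s1: "\<bar>spin n s x\<bar> = 1" if "s \<in> Omega n" for s x by (rule abs_spin[OF that n_pos])
 define S1 where "S1 s = (\<Sum>x\<in>torus n. (cspin n s (x + 1) - b s x) * (h x * spin n s (x - 1) * spin n s x))" for s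
 define S2 where "S2 s = (\<Sum>x\<in>torus n. (cspin n s (x - 1) - ?a s x) * (h x * spin n s x * (mag n s + b s x)))" for s
 define S3 where "S3 s = (\<Sum>x\<in>torus n. h x * spin n s x * (mag n s + ?a s x) * (mag n s + b s x))" for s
 have P1: "cmod (E (\<lambda>s. S1 s *\<^sub>R \<Phi> s)) \<le> r / 2 + 16 * C^2 * r^2 / r + 4 * C^2 * C^2 / r + 2 * C * C * r"
  unfolding S1_def
 proof (rule order_trans[OF replace_right[where w = "\<lambda>_. 1" and A = r and c = C and \<delta> = "C / r ^ 6"] replace_error])
  show "periodic_mod n (\<lambda>x. h x * spin n s (x - 1) * spin n s x)" for s
   by (intro periodic_mod_intros hp sp periodic_mod_shift_diff[OF sp])
  show "\<bar>h x * spin n s (x - 1) * spin n s x\<bar> \<le> C" if "s \<in> Omega n" for s x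
   using hC s1[OF that] by (simp add: abs_mult)
  show "h (y - int i) * spin n (exch n y s) (y - int i - 1) * spin n (exch n y s) (y - int i) = h (y - int i) * spin n s (y - int i - 1) * spin n s (y - int i)"
   if "i \<in> {1..l}" for s y i
   using spin_exch_left[of "int i + 1" y s] spin_exch_left[of "int i" y s] that l_n by (simp add: algebra_simps)
 qed (use l_ge norm_\<Phi> \<Phi>_increment C1 r_facts(1,4) in auto)
 have P2: "cmod (E (\<lambda>s. S2 s *\<^sub>R \<Phi> s)) \<le> r / 2 + 16 * (3 * C)^2 * r^2 / r + 4 * (3 * C)^2 * C^2 / r + 2 * (3 * C) * C * r"
  unfolding S2_def
 proof (rule order_trans[OF replace_left[where w = "\<lambda>_. 1" and A = r and c = "3 * C" and \<delta> = "C / r ^ 6"] replace_error])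
  show "periodic_mod n (\<lambda>x. h x * spin n s x * (mag n s + b s x))" for s
   by (intro periodic_mod_intros hp sp bp)
  show "\<bar>h x * spin n s x * (mag n s + b s x)\<bar> \<le> 3 * C" if e: "s \<in> Omega n" for s x
  proof -
   have "\<bar>mag n s + b s x\<bar> \<le> 3" using abs_mag[OF e n_pos] abs_avg_block[OF e n_pos, of l x] l_ge by linarith
   then have "\<bar>h x\<bar> * \<bar>mag n s + b s x\<bar> \<le> C * 3" using hC C1 by (intro mult_mono) auto
   then show ?thesis using s1[OF e] by (simp add: abs_mult)
  qed
  show "h (y + 1 + int i) * spin n (exch n y s) (y + 1 + int i) * (mag n (exch n y s) + b (exch n y s) (y + 1 + int i))
    = h (y + 1 + int i) * spin n s (y + 1 + int i) * (mag n s + b s (y + 1 + int i))" if i: "i \<in> {1..l}" for s y i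
  proof -
   have "cspin n (exch n y s) (y + 1 + int i + int j) = cspin n s (y + 1 + int i + int j)" if "j \<le> l" for j
    using cspin_exch_right[of "1 + int i + int j" y s] that i l_n by (simp add: algebra_simps)
   then have "b (exch n y s) (y + 1 + int i) = b s (y + 1 + int i)" unfolding block_def by simp
   moreover have "spin n (exch n y s) (y + 1 + int i) = spin n s (y + 1 + int i)"
    using spin_exch_right[of "1 + int i" y s] i l_n by (simp add: algebra_simps)
   ultimately show ?thesis by (simp add: mag_exch n_ge)
  qed
 qed (use l_ge norm_\<Phi> \<Phi>_increment C1 r_facts(1,4) in auto)
 have r\<rho>: "r \<le> r * \<rho>" "1 \<le> r * \<rho>" using r_facts(1) \<rho>_facts(1) mult_mono[of 1 r 1 \<rho>] by auto
 have P3: "cmod (E (\<lambda>s. S3 s *\<^sub>R \<Phi> s)) \<le> r * \<rho> * (K / 2 + 36 * C^2 + C * (K + 1) + 40 * C)"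
 proof -
  have "cmod (E (\<lambda>s. S3 s *\<^sub>R \<Phi> s)) \<le> E (\<lambda>s. r^2 * (1 / (2 * r) * (real n * mag n s ^ 4) + r / 2 * (zf s)^2) + C / \<rho> * real n * (mag n s)^2
   + (C * \<rho> + C) * (\<Sum>x\<in>torus n. (b s x)^2))"
   by (rule norm_E_le) (use cubic_remainder in \<open>simp add: norm_\<Phi> S3_def\<close>)
  also have "... = r^2 * (1 / (2 * r) * q4 + r / 2 * E (\<lambda>s. (zf s)^2)) + C / \<rho> * real n * E (\<lambda>s. (mag n s)^2)
   + (C * \<rho> + C) * E (\<lambda>s. \<Sum>x\<in>torus n. (b s x)^2)"
   by (simp only: E_add E_cmult)
  also have "... \<le> r^2 * (1 / (2 * r) * K + r / 2 * (72 * C^2 / r^2)) + r * \<rho> * (C * (K + 1)) + (C * \<rho> + C) * (20 * r)"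
  proof (intro add_mono mult_left_mono)
   have "C / \<rho> * real n * E (\<lambda>s. (mag n s)^2) = C / \<rho> * r^2 * (r^2 * E (\<lambda>s. (mag n s)^2))"
    unfolding r_facts(2)[symmetric] by (simp add: eval_nat_numeral)
   also have "... \<le> C / \<rho> * r^2 * (K + 1)" using E_mag2 C1 \<rho>_facts(3) by (intro mult_left_mono) auto
   also have "... = r * \<rho> * (C * (K + 1))" unfolding \<rho>_facts(2)[symmetric] using \<rho>_facts(3) by (simp add: field_simps eval_nat_numeral)
   finally show "C / \<rho> * real n * E (\<lambda>s. (mag n s)^2) \<le> r * \<rho> * (C * (K + 1))" .
  qed (use q4_le E_zf_sq E_block_sq r_facts(1,4) \<rho>_facts(3) C1 in auto)
  also have "r^2 * (1 / (2 * r) * K + r / 2 * (72 * C^2 / r^2)) = r * (K / 2 + 36 * C^2)"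
   using r_facts(4) by (simp add: field_simps power2_eq_square)
  also have "r * (K / 2 + 36 * C^2) \<le> r * \<rho> * (K / 2 + 36 * C^2)" using r\<rho> K_ge by (intro mult_right_mono) auto
  also have "(C * \<rho> + C) * (20 * r) \<le> r * \<rho> * (40 * C)"
  proof -
   have "C * r \<le> C * (r * \<rho>)" using r\<rho> C1 by (intro mult_left_mono) auto
   then show ?thesis by (simp add: algebra_simps)
  qed
  finally show ?thesis by (simp add: algebra_simps)
 qed
 have id: "(\<Sum>x\<in>torus n. h x * (spin n s (x - 1) * spin n s x * spin n s (x + 1))) = S1 s + S2 s + S3 s" for s
  unfolding S1_def S2_def S3_def sum.distrib[symmetric] cspin_def by (intro sum.cong refl) (simp add: algebra_simps)
 define X1 where "X1 = E (\<lambda>s. S1 s *\<^sub>R \<Phi> s)"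
 define X2 where "X2 = E (\<lambda>s. S2 s *\<^sub>R \<Phi> s)"
 define X3 where "X3 = E (\<lambda>s. S3 s *\<^sub>R \<Phi> s)"
 have X: "E (\<lambda>s. (\<Sum>x\<in>torus n. h x * (spin n s (x - 1) * spin n s x * spin n s (x + 1))) *\<^sub>R \<Phi> s) = X1 + X2 + X3"
  unfolding id scaleR_add_left E_add X1_def X2_def X3_def ..
 have "cmod (X1 + X2 + X3) \<le> cmod X1 + cmod X2 + cmod X3"
  using norm_triangle_ineq[of "X1 + X2" X3] norm_triangle_ineq[of X1 X2] by linarith
 also have "... \<le> r * \<rho> * (1 / 2 + 18 * C^2 + 4 * C ^ 4) + r * \<rho> * (1 / 2 + 150 * C^2 + 36 * C ^ 4) + r * \<rho> * (K / 2 + 36 * C^2 + C * (K + 1) + 40 * C)"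
 proof (intro add_mono P3[folded X3_def] order_trans[OF P1[folded X1_def]] order_trans[OF P2[folded X2_def]])
  have r1: "1 / r \<le> r" using r_facts(1) by (simp add: divide_le_eq) (metis mult_mono' mult_1 zero_le_one)
  have C4: "4 * C^2 * C^2 / r \<le> r * (4 * C ^ 4)" 
  proof -
   have "4 * C ^ 4 * (1 / r) \<le> 4 * C ^ 4 * r" using C1 by (intro mult_left_mono r1) simp
   moreover have "4 * C^2 * C^2 / r = 4 * C ^ 4 * (1 / r)" by (simp add: power_add[symmetric])
   ultimately show ?thesis by (simp add: mult_ac)
  qed
  have "r / 2 + 16 * C^2 * r^2 / r + 4 * C^2 * C^2 / r + 2 * C * C * r \<le> r * (1 / 2 + 18 * C^2 + 4 * C ^ 4)"
   using C4 r_facts(4) by (simp add: field_simps power2_eq_square)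
  also have "... \<le> r * \<rho> * (1 / 2 + 18 * C^2 + 4 * C ^ 4)" using r\<rho> by (intro mult_right_mono) auto
  finally show "r / 2 + 16 * C^2 * r^2 / r + 4 * C^2 * C^2 / r + 2 * C * C * r \<le> r * \<rho> * (1 / 2 + 18 * C^2 + 4 * C ^ 4)" .
  have "r / 2 + 16 * (3 * C)^2 * r^2 / r + 4 * (3 * C)^2 * C^2 / r + 2 * (3 * C) * C * r = r / 2 + 144 * C^2 * r + 9 * (4 * C^2 * C^2 / r) + 6 * C^2 * r"
   using r_facts(4) by (simp add: field_simps power2_eq_square)
  also have "... \<le> r * (1 / 2 + 150 * C^2 + 36 * C ^ 4)"
  proof -
   have "r / 2 + 144 * C^2 * r + 9 * Y + 6 * C^2 * r \<le> r * (1 / 2 + 150 * C^2 + 36 * C ^ 4)" if "Y \<le> r * (4 * C ^ 4)" for Y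
    using that by (simp add: algebra_simps)
   from this[OF C4] show ?thesis .
  qed
  also have "... \<le> r * \<rho> * (1 / 2 + 150 * C^2 + 36 * C ^ 4)" using r\<rho> by (intro mult_right_mono) auto
  finally show "r / 2 + 16 * (3 * C)^2 * r^2 / r + 4 * (3 * C)^2 * C^2 / r + 2 * (3 * C) * C * r \<le> r * \<rho> * (1 / 2 + 150 * C^2 + 36 * C ^ 4)" .
 qed
 also have "... = r * \<rho> * (1 + 204 * C^2 + 40 * C ^ 4 + K / 2 + C * (K + 1) + 40 * C)" by (simp add: algebra_simps)
 also have "... \<le> r * \<rho> * (C ^ 4 * (2 * K + 290))"
 proof (rule mult_left_mono)
  have c: "1 \<le> C ^ 4" "C \<le> C ^ 4" "C^2 \<le> C ^ 4" using C_pow[of 0 4] C_pow[of 1 4] C_pow[of 2 4] by auto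
  have "K / 2 \<le> C ^ 4 * (K / 2)" using c(1) K_ge by (simp add: mult_le_cancel_right1)
  moreover have "C * (K + 1) \<le> C ^ 4 * (K + 1)" using c(2) K_ge by (intro mult_right_mono) auto
  moreover have "0 \<le> C ^ 4 * K" using c K_ge by simp
  ultimately show "1 + 204 * C^2 + 40 * C ^ 4 + K / 2 + C * (K + 1) + 40 * C \<le> C ^ 4 * (2 * K + 290)"
   using c by (simp add: algebra_simps)
 qed (use r\<rho> in auto)
 finally show ?thesis unfolding X .
qed

section \<open>Expansion of the generator on a characteristic function\<close>

definition lap :: "int => real" where "lap x = (real n)^2 * (h (x + 1) + h (x - 1) - 2 * h x)"

text \<open>A Riemann sum of the squared derivative, n * (h (x + 1) - h x) being the difference
  quotient.\<close>

definition grad_energy :: real where "grad_energy = real n * (\<Sum>x\<in>torus n. (h (x + 1) - h x)^2)"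

definition mass :: real where "mass = (\<Sum>x\<in>torus n. (h x)^2) / real n"

text \<open>The stationarity hypothesis is about real functions, so it is applied to real and
  imaginary part.\<close>

lemma stationary_\<Phi>:
 "E (\<lambda>s. (real n)^2 *\<^sub>R (\<Sum>y\<in>torus n. \<Phi> (exch n y s) - \<Phi> s) + a *\<^sub>R (\<Sum>x\<in>torus n. flip_rate \<theta> n x s *\<^sub>R (\<Phi> (flip s x) - \<Phi> s))) = 0"
proof (rule complex_eqI)
 show "Re (E (\<lambda>s. (real n)^2 *\<^sub>R (\<Sum>y\<in>torus n. \<Phi> (exch n y s) - \<Phi> s) + a *\<^sub>R (\<Sum>x\<in>torus n. flip_rate \<theta> n x s *\<^sub>R (\<Phi> (flip s x) - \<Phi> s)))) = Re 0"
  using stationary[of "\<lambda>s. Re (\<Phi> s)"] by (simp add: gen_def [abs_def] L_ex_exch L_G_def expect_def)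
 show "Im (E (\<lambda>s. (real n)^2 *\<^sub>R (\<Sum>y\<in>torus n. \<Phi> (exch n y s) - \<Phi> s) + a *\<^sub>R (\<Sum>x\<in>torus n. flip_rate \<theta> n x s *\<^sub>R (\<Phi> (flip s x) - \<Phi> s)))) = Im 0"
  using stationary[of "\<lambda>s. Im (\<Phi> s)"] by (simp add: gen_def [abs_def] L_ex_exch L_G_def expect_def)
qed

text \<open>Taylor expansion of cis along each exchange. The linear terms add up to the Laplacian.
  In the quadratic ones, (\<sigma> - \<sigma>')^2 = 2 - 2 \<sigma> \<sigma>' for neighbouring spins
  separates the constant \<open>grad_energy\<close> / 4 from a sum for
  \<open>quadratic_average\<close>. The remainder is n^3 (C n^(-3/2))^3.\<close>

lemma exchange_part:
 assumes s: "s \<in> Omega n"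
 shows "cmod ((real n)^2 *\<^sub>R (\<Sum>y\<in>torus n. \<Phi> (exch n y s) - \<Phi> s)
   - (\<Phi> s * (\<i> * complex_of_real (lfield n lap s) - complex_of_real (grad_energy / 4))
    + (1 / (4 * real n)) *\<^sub>R ((\<Sum>x\<in>torus n. ((real n * (h (x + 1) - h x))^2 * spin n s x) * spin n s (x + 1)) *\<^sub>R \<Phi> s))) \<le> C ^ 3 / r ^ 6"
proof -
 let ?s = "spin n s"
 define v where "v y = lfield n h (exch n y s) - lfield n h s" for y
 have veq: "v y = (?s (y + 1) - ?s y) * (h y - h (y + 1)) / (2 * sqrt (real n))" if "y \<in> torus n" for y
  unfolding v_def by (rule lfield_exch[OF n_ge hp that])
 have v1: "(real n)^2 * (\<Sum>y\<in>torus n. v y) = lfield n lap s"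
 proof -
  have p1: "periodic_mod n (\<lambda>y. ?s y * (h (y - 1) - h y))"
   by (intro periodic_mod_intros periodic_mod_spin hp periodic_mod_shift_diff[OF hp])
  have "(\<Sum>y\<in>torus n. v y) = (\<Sum>y\<in>torus n. ?s (y + 1) * (h y - h (y + 1)) - ?s y * (h y - h (y + 1))) / (2 * sqrt (real n))"
   unfolding sum_divide_distrib by (intro sum.cong refl) (simp add: veq algebra_simps)
  also have "(\<Sum>y\<in>torus n. ?s (y + 1) * (h y - h (y + 1)) - ?s y * (h y - h (y + 1))) = (\<Sum>y\<in>torus n. ?s y * (h (y - 1) - h y)) - (\<Sum>y\<in>torus n. ?s y * (h y - h (y + 1)))"
   unfolding sum_subtractf using sum_torus_shift[OF p1, of 1] by simp
  also have "... = (\<Sum>y\<in>torus n. (h (y + 1) + h (y - 1) - 2 * h y) * ?s y)"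
   unfolding sum_subtractf[symmetric] by (intro sum.cong refl) (simp add: algebra_simps)
  finally have "(\<Sum>y\<in>torus n. v y) = (\<Sum>y\<in>torus n. (h (y + 1) + h (y - 1) - 2 * h y) * ?s y) / (2 * sqrt (real n))" .
  then show ?thesis unfolding lfield_def lap_def by (simp add: sum_distrib_left mult.assoc)
 qed
 have v2: "(real n)^2 * (\<Sum>y\<in>torus n. (v y)^2 / 2) = grad_energy / 4 - 1 / (4 * real n) * (\<Sum>x\<in>torus n. ((real n * (h (x + 1) - h x))^2 * ?s x) * ?s (x + 1))"
 proof -
  have "(v y)^2 / 2 = (h (y + 1) - h y)^2 / (4 * real n) - (h (y + 1) - h y)^2 * ?s y * ?s (y + 1) / (4 * real n)" if y: "y \<in> torus n" for y
  proof -
   have "(?s (y + 1) - ?s y)^2 = 2 - 2 * (?s y * ?s (y + 1))"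
    using spin_cases[OF s n_pos, of y] spin_cases[OF s n_pos, of "y + 1"] by (auto simp: power2_eq_square)
   moreover have "(v y)^2 = (?s (y + 1) - ?s y)^2 * (h (y + 1) - h y)^2 / (4 * real n)"
    unfolding veq[OF y] by (simp add: power_divide power_mult_distrib power2_commute[of "h y"])
   ultimately have e1: "(v y)^2 / 2 = (2 - 2 * (?s y * ?s (y + 1))) * (h (y + 1) - h y)^2 / (4 * real n) / 2" by simp
   have gen: "(2 - 2 * S) * H / N / 2 = H / N - H * S / N" for S H N :: real
   proof -
    have "(2 - 2 * S) * H / N / 2 = (2 - 2 * S) / 2 * H / N" by simp
    also have "(2 - 2 * S) / 2 = 1 - S" by (simp add: diff_divide_distrib)
    also have "(1 - S) * H / N = H / N - H * S / N" by (simp only: left_diff_distrib diff_divide_distrib mult_1 mult.commute[of S])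
    finally show ?thesis .
   qed
   show ?thesis unfolding e1 gen by (simp add: mult.assoc)
  qed
  then have e2: "(\<Sum>y\<in>torus n. (v y)^2 / 2) = (\<Sum>y\<in>torus n. (h (y + 1) - h y)^2) / (4 * real n) - (\<Sum>y\<in>torus n. (h (y + 1) - h y)^2 * ?s y * ?s (y + 1)) / (4 * real n)"
   unfolding sum_divide_distrib sum_subtractf[symmetric] by (intro sum.cong refl)
  have e3: "(\<Sum>x\<in>torus n. ((real n * (h (x + 1) - h x))^2 * ?s x) * ?s (x + 1)) = (real n)^2 * (\<Sum>y\<in>torus n. (h (y + 1) - h y)^2 * ?s y * ?s (y + 1))"
   by (simp add: sum_distrib_left power_mult_distrib mult_ac)
  have gen2: "N^2 * V = N * A / 4 - 1 / (4 * N) * W" if "V = A / (4 * N) - B / (4 * N)" "W = N^2 * B" "N > 0" for V A B W N :: real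
   unfolding that(1,2) using that(3) by (simp add: field_simps power2_eq_square)
  show ?thesis unfolding grad_energy_def by (rule gen2[OF e2 e3]) (simp add: n_pos)
 qed
 have split: "(real n)^2 *\<^sub>R (\<Sum>y\<in>torus n. \<Phi> (exch n y s) - \<Phi> s)
   - (\<Phi> s * (\<i> * complex_of_real (lfield n lap s) - complex_of_real (grad_energy / 4))
    + (1 / (4 * real n)) *\<^sub>R ((\<Sum>x\<in>torus n. ((real n * (h (x + 1) - h x))^2 * ?s x) * ?s (x + 1)) *\<^sub>R \<Phi> s))
   = (real n)^2 *\<^sub>R (\<Sum>y\<in>torus n. \<Phi> (exch n y s) - \<Phi> s - \<Phi> s * (\<i> * complex_of_real (v y) - complex_of_real ((v y)^2 / 2)))"
 proof -
  have "(real n)^2 *\<^sub>R (\<Sum>y\<in>torus n. \<Phi> s * (\<i> * complex_of_real (v y) - complex_of_real ((v y)^2 / 2)))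
    = \<Phi> s * (\<i> * complex_of_real ((real n)^2 * (\<Sum>y\<in>torus n. v y)) - complex_of_real ((real n)^2 * (\<Sum>y\<in>torus n. (v y)^2 / 2)))"
   by (simp add: sum_distrib_left sum_subtractf right_diff_distrib scaleR_conv_of_real mult_ac)
  also have "... = \<Phi> s * (\<i> * complex_of_real (lfield n lap s) - complex_of_real (grad_energy / 4))
    + (1 / (4 * real n)) *\<^sub>R ((\<Sum>x\<in>torus n. ((real n * (h (x + 1) - h x))^2 * ?s x) * ?s (x + 1)) *\<^sub>R \<Phi> s)"
   unfolding v1 v2 of_real_diff scaleR_conv_of_real of_real_mult[symmetric] by (simp add: algebra_simps)
  finally show ?thesis by (simp add: sum_subtractf scaleR_diff_right)
 qed
 have each: "cmod (\<Phi> (exch n y s) - \<Phi> s - \<Phi> s * (\<i> * complex_of_real (v y) - complex_of_real ((v y)^2 / 2))) \<le> (C / r ^ 6) ^ 3" for y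
 proof -
  have "\<bar>v y\<bar> ^ 3 \<le> (C / r ^ 6) ^ 3" using field_increment[OF s, of y] unfolding v_def by (intro power_mono) auto
  then show ?thesis using cis_taylor2[of "lfield n h s" "v y"] unfolding \<Phi>_def v_def by simp
 qed
 have "cmod ((real n)^2 *\<^sub>R (\<Sum>y\<in>torus n. \<Phi> (exch n y s) - \<Phi> s - \<Phi> s * (\<i> * complex_of_real (v y) - complex_of_real ((v y)^2 / 2))))
   \<le> (real n)^2 * (\<Sum>y\<in>torus n. (C / r ^ 6) ^ 3)"
  unfolding norm_scaleR by (intro mult_mono order_trans[OF norm_sum] sum_mono each) auto
 also have "... = C ^ 3 / r ^ 6" using r_facts(4) by (simp add: r_facts(2)[symmetric] power_divide power_mult[symmetric] field_simps power_add[symmetric])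
 finally show ?thesis unfolding split .
qed

lemma flip_rate_le: assumes "s \<in> Omega n" shows "0 \<le> flip_rate \<theta> n x s" "flip_rate \<theta> n x s \<le> 4"
proof -
 show "0 \<le> flip_rate \<theta> n x s" using rate_pos[OF assms, of x] by simp
 have "1 - g * spin n s x * spin n s z \<le> 2" for z
  using g_bounds spin_cases[OF assms n_pos, of x] spin_cases[OF assms n_pos, of z] by auto
 moreover have "0 \<le> 1 - g * spin n s x * spin n s z" for z
  using g_bounds spin_cases[OF assms n_pos, of x] spin_cases[OF assms n_pos, of z] by auto
 ultimately have "(1 - g * spin n s x * spin n s (x - 1)) * (1 - g * spin n s x * spin n s (x + 1)) \<le> 2 * 2"
  by (intro mult_mono) auto
 then show "flip_rate \<theta> n x s \<le> 4" unfolding flip_rate_factor[OF assms n_pos] by simp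
qed

text \<open>Taylor expansion along each flip. The linear terms combine to - \<theta> *
  \<open>zf\<close>, because 1 - 2 g is \<theta> / sqrt n, up to differences of \<open>h\<close> at
  neighbouring sites (\<open>R\<close>) and the cubic sum. In the quadratic terms the constant part
  of the rate gives \<open>mass\<close> / 2, and its spin products give sums for
  \<open>quadratic_average\<close>.\<close>

lemma flip_part:
 assumes s: "s \<in> Omega n"
 shows "cmod ((\<Sum>x\<in>torus n. flip_rate \<theta> n x s *\<^sub>R (\<Phi> (flip s x) - \<Phi> s))
   - (\<Phi> s * (- complex_of_real (mass / 2))
    - (\<i> * ((1 / sqrt (real n) * g^2) *\<^sub>R ((\<Sum>x\<in>torus n. h x * (spin n s (x - 1) * spin n s x * spin n s (x + 1))) *\<^sub>R \<Phi> s)))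
    + (g / (2 * real n)) *\<^sub>R ((\<Sum>x\<in>torus n. ((h (x + 1))^2 * spin n s x) * spin n s (x + 1)) *\<^sub>R \<Phi> s)
    + (g / (2 * real n)) *\<^sub>R ((\<Sum>x\<in>torus n. ((h x)^2 * spin n s x) * spin n s (x + 1)) *\<^sub>R \<Phi> s)
    - (g^2 / (2 * real n)) *\<^sub>R ((\<Sum>x\<in>torus n. ((h x)^2 * spin n s (x - 1)) * spin n s (x + 1)) *\<^sub>R \<Phi> s)))
  \<le> 4 * C ^ 3 / r^2 + 2 * C / r^2 + \<bar>\<theta>\<bar> * \<bar>zf s\<bar>"
proof -
 let ?s = "spin n s" and ?c = "\<lambda>x. flip_rate \<theta> n x s"
 define v where "v x = - (h x * ?s x / sqrt (real n))" for x
 define T where "T = (\<Sum>x\<in>torus n. h x * (?s (x - 1) * ?s x * ?s (x + 1)))"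
 define W1 where "W1 = (\<Sum>x\<in>torus n. ((h (x + 1))^2 * ?s x) * ?s (x + 1))"
 define W2 where "W2 = (\<Sum>x\<in>torus n. ((h x)^2 * ?s x) * ?s (x + 1))"
 define W3 where "W3 = (\<Sum>x\<in>torus n. ((h x)^2 * ?s (x - 1)) * ?s (x + 1))"
 define R where "R = (\<Sum>x\<in>torus n. ((h x - h (x + 1)) + (h x - h (x - 1))) * ?s x)"
 have rate: "?c x = 1 - g * (?s x * ?s (x - 1)) - g * (?s x * ?s (x + 1)) + g^2 * (?s (x - 1) * ?s (x + 1))" for x
  unfolding flip_rate_def by (simp add: algebra_simps)
 have w1: "(\<Sum>x\<in>torus n. (h x)^2 * (?s x * ?s (x - 1))) = W1"
 proof -
  have "periodic_mod n (\<lambda>x. (h x)^2 * (?s x * ?s (x - 1)))"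
   by (intro periodic_mod_intros periodic_mod_spin periodic_mod_shift_diff[OF periodic_mod_spin] periodic_mod_comp[OF hp])
  from sum_torus_shift[OF this, of 1] show ?thesis unfolding W1_def by (simp add: mult_ac)
 qed
 have sq: "(\<Sum>x\<in>torus n. ?c x * ((v x)^2 / 2)) = mass / 2 - g / (2 * real n) * W1 - g / (2 * real n) * W2 + g^2 / (2 * real n) * W3"
 proof -
  have "?c x * ((v x)^2 / 2) = ((h x)^2 - g * ((h x)^2 * (?s x * ?s (x - 1))) - g * (((h x)^2 * ?s x) * ?s (x + 1)) + g^2 * (((h x)^2 * ?s (x - 1)) * ?s (x + 1))) / (2 * real n)" for x
  proof -
   have "(v x)^2 = (h x)^2 / real n" unfolding v_def using spin_sq[OF s n_pos, of x]
    by (simp add: power_divide power_mult_distrib power2_eq_square[of "?s x"])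
   then have "?c x * ((v x)^2 / 2) = (?c x * (h x)^2) / (2 * real n)" by simp
   also have "?c x * (h x)^2 = (h x)^2 - g * ((h x)^2 * (?s x * ?s (x - 1))) - g * (((h x)^2 * ?s x) * ?s (x + 1)) + g^2 * (((h x)^2 * ?s (x - 1)) * ?s (x + 1))"
    unfolding rate by (simp add: algebra_simps)
   finally show ?thesis .
  qed
  then have "(\<Sum>x\<in>torus n. ?c x * ((v x)^2 / 2))
    = (\<Sum>x\<in>torus n. ((h x)^2 - g * ((h x)^2 * (?s x * ?s (x - 1))) - g * (((h x)^2 * ?s x) * ?s (x + 1)) + g^2 * (((h x)^2 * ?s (x - 1)) * ?s (x + 1))) / (2 * real n))"
   by (intro sum.cong refl)
  also have "... = ((\<Sum>x\<in>torus n. (h x)^2) - g * W1 - g * W2 + g^2 * W3) / (2 * real n)"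
   unfolding w1[symmetric] W2_def W3_def sum_divide_distrib[symmetric] sum_distrib_left sum_subtractf[symmetric] sum.distrib[symmetric] ..
  finally have "(\<Sum>x\<in>torus n. ?c x * ((v x)^2 / 2)) = ((\<Sum>x\<in>torus n. (h x)^2) - g * W1 - g * W2 + g^2 * W3) / (2 * real n)" .
  then show ?thesis unfolding mass_def by (simp add: add_divide_distrib diff_divide_distrib)
 qed
 have lin: "(\<Sum>x\<in>torus n. ?c x * v x) = - (\<theta> * zf s) - g / sqrt (real n) * R - 1 / sqrt (real n) * g^2 * T"
 proof -
  have sh1: "(\<Sum>x\<in>torus n. h x * ?s (x - 1)) = (\<Sum>x\<in>torus n. h (x + 1) * ?s x)"
  proof -
   have "periodic_mod n (\<lambda>x. h x * ?s (x - 1))" by (intro periodic_mod_intros hp periodic_mod_shift_diff[OF periodic_mod_spin])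
   from sum_torus_shift[OF this, of 1] show ?thesis by simp
  qed
  have sh2: "(\<Sum>x\<in>torus n. h x * ?s (x + 1)) = (\<Sum>x\<in>torus n. h (x - 1) * ?s x)"
  proof -
   have "periodic_mod n (\<lambda>x. h x * ?s (x + 1))" by (intro periodic_mod_intros hp periodic_mod_shift[OF periodic_mod_spin])
   from sum_torus_shift_diff[OF this, of 1] show ?thesis by simp
  qed
  have "?c x * v x = - (h x * ?s x - g * (h x * ?s (x - 1)) - g * (h x * ?s (x + 1)) + g^2 * (h x * (?s (x - 1) * ?s x * ?s (x + 1)))) / sqrt (real n)" for x
   unfolding v_def rate using spin_cases[OF s n_pos, of x] by (auto simp: algebra_simps add_divide_distrib diff_divide_distrib)
  then have "(\<Sum>x\<in>torus n. ?c x * v x)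
    = (\<Sum>x\<in>torus n. - (h x * ?s x - g * (h x * ?s (x - 1)) - g * (h x * ?s (x + 1)) + g^2 * (h x * (?s (x - 1) * ?s x * ?s (x + 1)))) / sqrt (real n))"
   by (intro sum.cong refl)
  also have "... = - ((\<Sum>x\<in>torus n. h x * ?s x) - g * (\<Sum>x\<in>torus n. h (x + 1) * ?s x) - g * (\<Sum>x\<in>torus n. h (x - 1) * ?s x) + g^2 * T) / sqrt (real n)"
   unfolding sh1[symmetric] sh2[symmetric] T_def sum_distrib_left sum_subtractf[symmetric] sum.distrib[symmetric] sum_negf[symmetric] sum_divide_distrib[symmetric] ..
  also have "(\<Sum>x\<in>torus n. h x * ?s x) - g * (\<Sum>x\<in>torus n. h (x + 1) * ?s x) - g * (\<Sum>x\<in>torus n. h (x - 1) * ?s x) + g^2 * T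
    = (1 - 2 * g) * (\<Sum>x\<in>torus n. h x * ?s x) + g * R + g^2 * T"
   unfolding R_def by (simp add: sum.distrib sum_subtractf sum_distrib_left algebra_simps)
  also have "- ((1 - 2 * g) * (\<Sum>x\<in>torus n. h x * ?s x) + g * R + g^2 * T) / sqrt (real n) = - (\<theta> * zf s) - g / sqrt (real n) * R - 1 / sqrt (real n) * g^2 * T"
   unfolding one_minus_g zf_def by (simp add: add_divide_distrib diff_divide_distrib divide_divide_eq_left)
  finally show ?thesis .
 qed
 have Rb: "\<bar>R\<bar> \<le> 2 * C"
 proof -
  have "\<bar>((h x - h (x + 1)) + (h x - h (x - 1))) * ?s x\<bar> \<le> 2 * (C / real n)" for x
  proof -
   have "\<bar>(h x - h (x + 1)) + (h x - h (x - 1))\<bar> \<le> 2 * (C / real n)" using hL[of x] hL[of "x - 1"] by (simp add: abs_le_iff)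
   then show ?thesis by (simp add: abs_mult abs_spin[OF s n_pos])
  qed
  then have "\<bar>R\<bar> \<le> (\<Sum>x\<in>torus n. 2 * (C / real n))" unfolding R_def by (intro order_trans[OF sum_abs] sum_mono)
  then show ?thesis using n_pos by simp
 qed
 define Z where "Z = (\<Sum>x\<in>torus n. ?c x *\<^sub>R (\<Phi> (flip s x) - \<Phi> s - \<Phi> s * (\<i> * complex_of_real (v x) - complex_of_real ((v x)^2 / 2))))"
 have Zb: "cmod Z \<le> 4 * C ^ 3 / r^2"
 proof -
  have "cmod (?c x *\<^sub>R (\<Phi> (flip s x) - \<Phi> s - \<Phi> s * (\<i> * complex_of_real (v x) - complex_of_real ((v x)^2 / 2)))) \<le> 4 * (C / r^2) ^ 3" if x: "x \<in> torus n" for x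
  proof -
   have vx: "lfield n h (flip s x) = lfield n h s + v x" using lfield_flip[OF s x, of h] by (simp add: v_def)
   have "\<bar>v x\<bar> \<le> C / r^2" unfolding v_def r_facts(3) using hC by (simp add: abs_mult abs_spin[OF s n_pos] divide_right_mono)
   then have "\<bar>v x\<bar> ^ 3 \<le> (C / r^2) ^ 3" by (intro power_mono) auto
   then have "cmod (\<Phi> (flip s x) - \<Phi> s - \<Phi> s * (\<i> * complex_of_real (v x) - complex_of_real ((v x)^2 / 2))) \<le> (C / r^2) ^ 3"
    using cis_taylor2[of "lfield n h s" "v x"] unfolding \<Phi>_def vx by simp
   then show ?thesis unfolding norm_scaleR using flip_rate_le[OF s, of x] by (intro mult_mono) auto
  qed
  then have "cmod Z \<le> (\<Sum>x\<in>torus n. 4 * (C / r^2) ^ 3)" unfolding Z_def by (intro order_trans[OF norm_sum] sum_mono)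
  also have "... = 4 * C ^ 3 / r^2" using r_facts(4) by (simp add: r_facts(2)[symmetric] power_divide power_mult[symmetric] field_simps power_add[symmetric])
  finally show ?thesis .
 qed
 have main: "(\<Sum>x\<in>torus n. ?c x *\<^sub>R (\<Phi> (flip s x) - \<Phi> s)) = Z + \<Phi> s * (\<i> * complex_of_real (\<Sum>x\<in>torus n. ?c x * v x) - complex_of_real (\<Sum>x\<in>torus n. ?c x * ((v x)^2 / 2)))"
  unfolding Z_def by (simp add: sum.distrib[symmetric] sum_distrib_left sum_subtractf[symmetric] scaleR_conv_of_real) (intro sum.cong refl, simp add: algebra_simps)
 have "(\<Sum>x\<in>torus n. ?c x *\<^sub>R (\<Phi> (flip s x) - \<Phi> s))
   - (\<Phi> s * (- complex_of_real (mass / 2)) - (\<i> * ((1 / sqrt (real n) * g^2) *\<^sub>R (T *\<^sub>R \<Phi> s)))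
    + (g / (2 * real n)) *\<^sub>R (W1 *\<^sub>R \<Phi> s) + (g / (2 * real n)) *\<^sub>R (W2 *\<^sub>R \<Phi> s) - (g^2 / (2 * real n)) *\<^sub>R (W3 *\<^sub>R \<Phi> s))
   = Z + \<Phi> s * (\<i> * complex_of_real (- (\<theta> * zf s) - g / sqrt (real n) * R))"
 proof -
  have gen: "z + p * (\<i> * complex_of_real (u - t * T') - complex_of_real (w - w1 * w1' - w2 * w2' + w3 * w3'))
    - (p * (- complex_of_real w) - \<i> * (t *\<^sub>R (T' *\<^sub>R p)) + w1 *\<^sub>R (w1' *\<^sub>R p) + w2 *\<^sub>R (w2' *\<^sub>R p) - w3 *\<^sub>R (w3' *\<^sub>R p))
    = z + p * (\<i> * complex_of_real u)" for z p :: complex and u t T' w w1 w2 w3 w1' w2' w3' :: real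
   unfolding scaleR_conv_of_real by (simp add: algebra_simps)
  show ?thesis unfolding main lin sq by (rule gen)
 qed
 also have "cmod ... \<le> cmod Z + \<bar>- (\<theta> * zf s) - g / sqrt (real n) * R\<bar>"
  by (rule order_trans[OF norm_triangle_ineq]) (simp add: norm_mult norm_\<Phi> del: of_real_diff of_real_minus of_real_mult)
 also have "... \<le> 4 * C ^ 3 / r^2 + (\<bar>\<theta>\<bar> * \<bar>zf s\<bar> + 2 * C / r^2)"
 proof (intro add_mono Zb)
  have "\<bar>g / sqrt (real n) * R\<bar> \<le> 1 / r^2 * (2 * C)"
   unfolding abs_mult r_facts(3) using Rb g_bounds by (intro mult_mono) (auto simp: divide_right_mono)
  moreover have "\<bar>- u - v\<bar> \<le> \<bar>u\<bar> + c" if "\<bar>v\<bar> \<le> c" for u v c :: real using that by linarith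
  ultimately show "\<bar>- (\<theta> * zf s) - g / sqrt (real n) * R\<bar> \<le> \<bar>\<theta>\<bar> * \<bar>zf s\<bar> + 2 * C / r^2"
   unfolding abs_mult[of \<theta> "zf s", symmetric] by simp
 qed
 finally show ?thesis unfolding T_def W1_def W2_def W3_def by simp
qed

end

context test_function
begin

lemma E_scaleR: "E (\<lambda>s. c *\<^sub>R F s) = c *\<^sub>R E F"
 by (simp add: expect_def scaleR_sum_right mult.commute)

definition gen_error :: real where
 "gen_error = C ^ 6 / \<rho> * ((1 + a) * (40 * \<bar>\<theta>\<bar> + 405 + 5 * K))"

text \<open>The approximate equation behind the Gaussian limit: when \<open>h\<close> moves by the
  heat equation, the derivative of E \<Phi> is (grad_energy / 4 + a * mass / 2) times E \<Phi>, up
  to \<open>gen_error\<close>.\<close>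

lemma generator_estimate:
 "cmod (E (\<lambda>s. \<Phi> s * (\<i> * complex_of_real (lfield n lap s) - complex_of_real (grad_energy / 4 + a * mass / 2)))) \<le> gen_error"
proof -
 let ?s = "\<lambda>s. spin n s"
 define F0 where "F0 s x = (real n * (h (x + 1) - h x))^2 * spin n s x" for s x
 define F1 where "F1 s x = (h (x + 1))^2 * spin n s x" for s x
 define F2 where "F2 s x = (h x)^2 * spin n s x" for s x
 define F3 where "F3 s x = (h x)^2 * spin n s (x - 1)" for s x
 define W where "W F = E (\<lambda>s. (\<Sum>x\<in>torus n. F s x * spin n s (x + 1)) *\<^sub>R \<Phi> s)" for F :: "(int => nat) => int => real"
 define T where "T = E (\<lambda>s. (\<Sum>x\<in>torus n. h x * (spin n s (x - 1) * spin n s x * spin n s (x + 1))) *\<^sub>R \<Phi> s)"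
 have C2: "C^2 \<ge> 1" using C_pow[of 0 2] by simp
 have h2: "(h x)^2 \<le> C^2" for x using hC[of x] C1 by (intro abs_le_square_iff[THEN iffD1]) auto
 have g2: "(real n * (h (x + 1) - h x))^2 \<le> C^2" for x
 proof (rule abs_le_square_iff[THEN iffD1])
  have "real n * \<bar>h (x + 1) - h x\<bar> \<le> real n * (C / real n)" using hL by (intro mult_left_mono) auto
  then show "\<bar>real n * (h (x + 1) - h x)\<bar> \<le> \<bar>C\<bar>" using n_pos C1 by (simp add: abs_mult)
 qed
 have s1: "\<bar>spin n s x\<bar> = 1" if "s \<in> Omega n" for s x by (rule abs_spin[OF that n_pos])
 define \<beta> where "\<beta> = r ^ 3 * (C ^ 6 * (K + 36))"
 have cc: "r ^ 3 * ((C^2)^2 * C^2 * (K + 36)) = \<beta>" unfolding \<beta>_def by (simp add: power_mult[symmetric] power_add[symmetric])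
 have W0: "cmod (W F0) \<le> \<beta>" unfolding W_def cc[symmetric]
 proof (rule quadratic_average[OF _ _ C2])
  show "periodic_mod n (F0 s)" for s unfolding F0_def [abs_def] power2_eq_square
   by (intro periodic_mod_intros hp periodic_mod_shift[OF hp] periodic_mod_spin)
  show "\<bar>F0 s x\<bar> \<le> C^2" if "s \<in> Omega n" for s x unfolding F0_def abs_mult s1[OF that] using g2[of x] by simp
  show "F0 (exch n y s) (y - int i) = F0 s (y - int i)" if "i \<in> {1..l}" for s y i
   unfolding F0_def using spin_exch_left[of "int i" y s] that l_n by simp
 qed
 have W1: "cmod (W F1) \<le> \<beta>" unfolding W_def cc[symmetric]
 proof (rule quadratic_average[OF _ _ C2])
  show "periodic_mod n (F1 s)" for s unfolding F1_def [abs_def] power2_eq_square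
   by (intro periodic_mod_intros hp periodic_mod_shift[OF hp] periodic_mod_spin)
  show "\<bar>F1 s x\<bar> \<le> C^2" if "s \<in> Omega n" for s x unfolding F1_def abs_mult s1[OF that] using h2[of "x + 1"] by simp
  show "F1 (exch n y s) (y - int i) = F1 s (y - int i)" if "i \<in> {1..l}" for s y i
   unfolding F1_def using spin_exch_left[of "int i" y s] that l_n by simp
 qed
 have W2: "cmod (W F2) \<le> \<beta>" unfolding W_def cc[symmetric]
 proof (rule quadratic_average[OF _ _ C2])
  show "periodic_mod n (F2 s)" for s unfolding F2_def [abs_def] power2_eq_square
   by (intro periodic_mod_intros hp periodic_mod_spin)
  show "\<bar>F2 s x\<bar> \<le> C^2" if "s \<in> Omega n" for s x unfolding F2_def abs_mult s1[OF that] using h2[of x] by simp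
  show "F2 (exch n y s) (y - int i) = F2 s (y - int i)" if "i \<in> {1..l}" for s y i
   unfolding F2_def using spin_exch_left[of "int i" y s] that l_n by simp
 qed
 have W3: "cmod (W F3) \<le> \<beta>" unfolding W_def cc[symmetric]
 proof (rule quadratic_average[OF _ _ C2])
  show "periodic_mod n (F3 s)" for s unfolding F3_def [abs_def] power2_eq_square
   by (intro periodic_mod_intros hp periodic_mod_shift_diff[OF periodic_mod_spin])
  show "\<bar>F3 s x\<bar> \<le> C^2" if "s \<in> Omega n" for s x unfolding F3_def abs_mult s1[OF that] using h2[of x] by simp
  show "F3 (exch n y s) (y - int i) = F3 s (y - int i)" if "i \<in> {1..l}" for s y i
   unfolding F3_def using spin_exch_left[of "int i + 1" y s] that l_n by (simp add: algebra_simps)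
 qed
 have T: "cmod T \<le> r * \<rho> * (C ^ 4 * (2 * K + 290))" unfolding T_def by (rule cubic_average)
 define Pex where "Pex s = \<Phi> s * (\<i> * complex_of_real (lfield n lap s) - complex_of_real (grad_energy / 4))
    + (1 / (4 * real n)) *\<^sub>R ((\<Sum>x\<in>torus n. F0 s x * spin n s (x + 1)) *\<^sub>R \<Phi> s)" for s
 define Pfl where "Pfl s = \<Phi> s * (- complex_of_real (mass / 2))
    - (\<i> * ((1 / sqrt (real n) * g^2) *\<^sub>R ((\<Sum>x\<in>torus n. h x * (spin n s (x - 1) * spin n s x * spin n s (x + 1))) *\<^sub>R \<Phi> s)))
    + (g / (2 * real n)) *\<^sub>R ((\<Sum>x\<in>torus n. F1 s x * spin n s (x + 1)) *\<^sub>R \<Phi> s)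
    + (g / (2 * real n)) *\<^sub>R ((\<Sum>x\<in>torus n. F2 s x * spin n s (x + 1)) *\<^sub>R \<Phi> s)
    - (g^2 / (2 * real n)) *\<^sub>R ((\<Sum>x\<in>torus n. F3 s x * spin n s (x + 1)) *\<^sub>R \<Phi> s)" for s
 define Gx where "Gx s = (real n)^2 *\<^sub>R (\<Sum>y\<in>torus n. \<Phi> (exch n y s) - \<Phi> s)" for s
 define Gf where "Gf s = (\<Sum>x\<in>torus n. flip_rate \<theta> n x s *\<^sub>R (\<Phi> (flip s x) - \<Phi> s))" for s
 define M where "M = E (\<lambda>s. \<Phi> s * (\<i> * complex_of_real (lfield n lap s) - complex_of_real (grad_energy / 4 + a * mass / 2)))"
 have EP: "E (\<lambda>s. Pex s + a *\<^sub>R Pfl s) = M + (1 / (4 * real n)) *\<^sub>R W F0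
   + a *\<^sub>R (- (\<i> * ((1 / sqrt (real n) * g^2) *\<^sub>R T)) + (g / (2 * real n)) *\<^sub>R W F1 + (g / (2 * real n)) *\<^sub>R W F2 - (g^2 / (2 * real n)) *\<^sub>R W F3)"
 proof -
  have "M = E (\<lambda>s. \<Phi> s * (\<i> * complex_of_real (lfield n lap s) - complex_of_real (grad_energy / 4))) + a *\<^sub>R E (\<lambda>s. \<Phi> s * (- complex_of_real (mass / 2)))"
   unfolding M_def E_scaleR[symmetric] E_add[symmetric] by (simp add: scaleR_conv_of_real algebra_simps)
  then show ?thesis unfolding Pex_def Pfl_def W_def T_def
   by (simp only: E_add E_diff E_scaleR E_cmult_complex scaleR_add_right scaleR_diff_right scaleR_minus_right) simp
 qed
 have z: "E (\<lambda>s. Gx s + a *\<^sub>R Gf s) = 0" unfolding Gx_def Gf_def by (rule stationary_\<Phi>)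
 have "cmod (E (\<lambda>s. Pex s + a *\<^sub>R Pfl s)) = cmod (E (\<lambda>s. (Gx s - Pex s) + a *\<^sub>R (Gf s - Pfl s)))"
 proof -
  have "E (\<lambda>s. (Gx s - Pex s) + a *\<^sub>R (Gf s - Pfl s)) = E (\<lambda>s. Gx s + a *\<^sub>R Gf s) - E (\<lambda>s. Pex s + a *\<^sub>R Pfl s)"
   unfolding E_diff[symmetric] by (simp add: scaleR_diff_right algebra_simps)
  then show ?thesis unfolding z by simp
 qed
 also have "... \<le> E (\<lambda>s. (C ^ 3 / r ^ 6 + a * (4 * C ^ 3 / r^2 + 2 * C / r^2)) + a * \<bar>\<theta>\<bar> * \<bar>zf s\<bar>)"
 proof (rule norm_E_le)
  fix s assume s: "s \<in> Omega n"
  have 1: "cmod (Gx s - Pex s) \<le> C ^ 3 / r ^ 6" unfolding Gx_def Pex_def F0_def by (rule exchange_part[OF s])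
  have 2: "cmod (Gf s - Pfl s) \<le> 4 * C ^ 3 / r^2 + 2 * C / r^2 + \<bar>\<theta>\<bar> * \<bar>zf s\<bar>" unfolding Gf_def Pfl_def F1_def F2_def F3_def by (rule flip_part[OF s])
  have "cmod ((Gx s - Pex s) + a *\<^sub>R (Gf s - Pfl s)) \<le> C ^ 3 / r ^ 6 + a * (4 * C ^ 3 / r^2 + 2 * C / r^2 + \<bar>\<theta>\<bar> * \<bar>zf s\<bar>)"
   by (rule norm_triangle_mono[OF 1]) (use 2 a_pos in \<open>simp add: mult_left_mono\<close>)
  then show "cmod ((Gx s - Pex s) + a *\<^sub>R (Gf s - Pfl s)) \<le> (C ^ 3 / r ^ 6 + a * (4 * C ^ 3 / r^2 + 2 * C / r^2)) + a * \<bar>\<theta>\<bar> * \<bar>zf s\<bar>"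
   by (simp add: algebra_simps)
 qed
 also have "... \<le> (C ^ 3 / r ^ 6 + a * (4 * C ^ 3 / r^2 + 2 * C / r^2)) + a * \<bar>\<theta>\<bar> * (37 * C^2 / r)"
  unfolding E_add E_const E_cmult using E_abs_zf a_pos by (intro add_left_mono mult_left_mono) auto
 finally have P: "cmod (E (\<lambda>s. Pex s + a *\<^sub>R Pfl s)) \<le> (C ^ 3 / r ^ 6 + a * (4 * C ^ 3 / r^2 + 2 * C / r^2)) + a * \<bar>\<theta>\<bar> * (37 * C^2 / r)" .
 have g01: "0 \<le> g" "g \<le> 1" "0 \<le> g^2" "g^2 \<le> 1" using g_bounds by (auto simp: power_le_one)
 define Q where "Q = - (\<i> * ((1 / sqrt (real n) * g^2) *\<^sub>R T)) + (g / (2 * real n)) *\<^sub>R W F1 + (g / (2 * real n)) *\<^sub>R W F2 - (g^2 / (2 * real n)) *\<^sub>R W F3"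
 have Qb: "cmod Q \<le> 1 / r^2 * (r * \<rho> * (C ^ 4 * (2 * K + 290))) + 1 / (2 * real n) * \<beta> + 1 / (2 * real n) * \<beta> + 1 / (2 * real n) * \<beta>"
  unfolding Q_def
 proof (intro norm_triangle_mono order_trans[OF norm_triangle_ineq4] add_mono)
  have gg: "1 / sqrt (real n) * g^2 \<le> 1 / r^2" unfolding r_facts(3) using g01 by (simp add: divide_right_mono)
  show "cmod (- (\<i> * (1 / sqrt (real n) * g^2) *\<^sub>R T)) \<le> 1 / r^2 * (r * \<rho> * (C ^ 4 * (2 * K + 290)))"
   using mult_mono[OF gg T] g01 by (simp add: norm_mult)
  have u: "g / (2 * real n) \<le> 1 / (2 * real n)" "g^2 / (2 * real n) \<le> 1 / (2 * real n)" using g01 by (auto intro: divide_right_mono)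
  show "cmod ((g / (2 * real n)) *\<^sub>R W F1) \<le> 1 / (2 * real n) * \<beta>" using mult_mono[OF u(1) W1] g01 by simp
  show "cmod ((g / (2 * real n)) *\<^sub>R W F2) \<le> 1 / (2 * real n) * \<beta>" using mult_mono[OF u(1) W2] g01 by simp
  show "cmod ((g^2 / (2 * real n)) *\<^sub>R W F3) \<le> 1 / (2 * real n) * \<beta>" using mult_mono[OF u(2) W3] g01 by simp
 qed
 have "M = E (\<lambda>s. Pex s + a *\<^sub>R Pfl s) - (1 / (4 * real n)) *\<^sub>R W F0 - a *\<^sub>R Q" using EP unfolding Q_def by simp
 also have "cmod ... \<le> ((C ^ 3 / r ^ 6 + a * (4 * C ^ 3 / r^2 + 2 * C / r^2)) + a * \<bar>\<theta>\<bar> * (37 * C^2 / r)) + 1 / (4 * real n) * \<beta>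
   + a * (1 / r^2 * (r * \<rho> * (C ^ 4 * (2 * K + 290))) + 1 / (2 * real n) * \<beta> + 1 / (2 * real n) * \<beta> + 1 / (2 * real n) * \<beta>)"
 proof (intro order_trans[OF norm_triangle_ineq4] add_mono P)
  show "cmod ((1 / (4 * real n)) *\<^sub>R W F0) \<le> 1 / (4 * real n) * \<beta>" using W0 by (simp add: divide_right_mono)
  show "cmod (a *\<^sub>R Q) \<le> a * (1 / r^2 * (r * \<rho> * (C ^ 4 * (2 * K + 290))) + 1 / (2 * real n) * \<beta> + 1 / (2 * real n) * \<beta> + 1 / (2 * real n) * \<beta>)"
   unfolding norm_scaleR using Qb a_pos by (intro mult_mono) auto
 qed
 also have "... \<le> gen_error"
 proof -
  define \<kappa> where "\<kappa> = C ^ 6 / \<rho>"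
  have Cp: "0 \<le> C ^ 6" "1 \<le> C ^ 6" "C \<le> C ^ 6" "C^2 \<le> C ^ 6" "C ^ 3 \<le> C ^ 6" "C ^ 4 \<le> C ^ 6"
   using C_pow[of 0 6] C_pow[of 1 6] C_pow[of 2 6] C_pow[of 3 6] C_pow[of 4 6] C1 by auto
  have \<rho>1: "\<rho> > 0" "1 \<le> \<rho>" by (fact \<rho>_facts(3) \<rho>_facts(1))+
  have rp: "\<rho> \<le> r" "\<rho> \<le> r^2" "\<rho> \<le> r ^ 6"
  proof -
   have "\<rho> ^ 1 \<le> \<rho> ^ k" if "1 \<le> k" for k using that \<rho>1 by (intro power_increasing) auto
   from this[of 2] this[of 4] this[of 12] show "\<rho> \<le> r" "\<rho> \<le> r^2" "\<rho> \<le> r ^ 6"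
    unfolding \<rho>_facts(2)[symmetric] by (simp_all add: power_mult[symmetric])
  qed
  have q: "u / v \<le> \<kappa>" if "u \<le> C ^ 6" "\<rho> \<le> v" for u v
   unfolding \<kappa>_def using that Cp(1) \<rho>1 by (intro frac_le) auto
  have \<kappa>0: "0 \<le> \<kappa>" unfolding \<kappa>_def using Cp \<rho>1 by simp
  have e\<beta>: "\<beta> / real n = C ^ 6 * (K + 36) / r" unfolding \<beta>_def r_facts(2)[symmetric] using r_facts(4) by (simp add: field_simps eval_nat_numeral)
  also have "... = C ^ 6 / r * (K + 36)" by simp
  also have "... \<le> \<kappa> * (K + 36)" using q[OF order_refl rp(1)] K_ge by (intro mult_right_mono) auto
  finally have \<beta>n: "\<beta> / real n \<le> \<kappa> * (K + 36)" .
  have t: "1 / r^2 * (r * \<rho> * (C ^ 4 * (2 * K + 290))) \<le> \<kappa> * (2 * K + 290)"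
  proof -
   have "1 / r^2 * (r * \<rho> * (C ^ 4 * (2 * K + 290))) = C ^ 4 / \<rho> * (2 * K + 290)"
    unfolding \<rho>_facts(2)[symmetric] using \<rho>1 by (simp add: field_simps eval_nat_numeral)
   also have "... \<le> \<kappa> * (2 * K + 290)" using q[OF Cp(6) order_refl] K_ge by (intro mult_right_mono) auto
   finally show ?thesis .
  qed
  have a0: "0 \<le> a" using a_pos by simp
  have "((C ^ 3 / r ^ 6 + a * (4 * C ^ 3 / r^2 + 2 * C / r^2)) + a * \<bar>\<theta>\<bar> * (37 * C^2 / r)) + 1 / (4 * real n) * \<beta>
   + a * (1 / r^2 * (r * \<rho> * (C ^ 4 * (2 * K + 290))) + 1 / (2 * real n) * \<beta> + 1 / (2 * real n) * \<beta> + 1 / (2 * real n) * \<beta>)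
   \<le> ((\<kappa> + a * (4 * \<kappa> + 2 * \<kappa>)) + a * \<bar>\<theta>\<bar> * (37 * \<kappa>)) + \<kappa> * (K + 36) + a * (\<kappa> * (2 * K + 290) + \<kappa> * (K + 36) + \<kappa> * (K + 36) + \<kappa> * (K + 36))"
  proof (intro add_mono mult_left_mono t a0)
   show "C ^ 3 / r ^ 6 \<le> \<kappa>" by (rule q[OF Cp(5) rp(3)])
   show "4 * C ^ 3 / r^2 \<le> 4 * \<kappa>" using q[OF Cp(5) rp(2)] by simp
   show "2 * C / r^2 \<le> 2 * \<kappa>" using q[OF Cp(3) rp(2)] by simp
   show "37 * C^2 / r \<le> 37 * \<kappa>" using q[OF Cp(4) rp(1)] by simp
   have \<beta>0: "0 \<le> \<beta> / real n" unfolding e\<beta> using Cp K_ge r_facts(4) by simp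
   show "1 / (4 * real n) * \<beta> \<le> \<kappa> * (K + 36)" using \<beta>n \<beta>0 by (simp add: field_simps)
   have "1 / (2 * real n) * \<beta> \<le> \<kappa> * (K + 36)" using \<beta>n \<beta>0 by (simp add: field_simps)
   then show "1 / (2 * real n) * \<beta> \<le> \<kappa> * (K + 36)" "1 / (2 * real n) * \<beta> \<le> \<kappa> * (K + 36)" "1 / (2 * real n) * \<beta> \<le> \<kappa> * (K + 36)" by blast+
  qed (use a0 in auto)
  also have "... = \<kappa> * (1 + (K + 36) + a * (6 + 37 * \<bar>\<theta>\<bar> + (2 * K + 290) + 3 * (K + 36)))" by (simp add: algebra_simps)
  also have "... \<le> \<kappa> * ((1 + a) * (40 * \<bar>\<theta>\<bar> + 405 + 5 * K))"
  proof (rule mult_left_mono[OF _ \<kappa>0])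
   have "a * (6 + 37 * \<bar>\<theta>\<bar> + (2 * K + 290) + 3 * (K + 36)) \<le> a * (40 * \<bar>\<theta>\<bar> + 405 + 5 * K)" using a0 by (intro mult_left_mono) auto
   moreover have "1 + (K + 36) \<le> 40 * \<bar>\<theta>\<bar> + 405 + 5 * K" using K_ge by simp
   ultimately show "1 + (K + 36) + a * (6 + 37 * \<bar>\<theta>\<bar> + (2 * K + 290) + 3 * (K + 36)) \<le> (1 + a) * (40 * \<bar>\<theta>\<bar> + 405 + 5 * K)"
    by (simp add: distrib_right)
  qed
  finally show ?thesis unfolding gen_error_def \<kappa>_def by (simp add: mult_ac)
 qed
 finally show ?thesis unfolding M_def .
qed

text \<open>Linear in the sup norm of the potential \<open>p\<close>, so the field becomes
  negligible once the heat flow has flattened \<open>p\<close>. As \<open>h\<close> is a difference,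
  one factor of the squared field is a sum of spin differences; the other factor joins
  \<open>G\<close>, and \<open>ibp_bound\<close> returns half of the second moment.\<close>

lemma field_second_moment:
 assumes p: "periodic_mod n p" and hpp: "\<And>x. h x = real n * (p (x + 1) - p x)" and pe: "\<And>x. \<bar>p x\<bar> \<le> e" and e: "0 < e" "e \<le> 1"
 shows "E (\<lambda>s. (lfield n h s)^2) \<le> 20 * C * e"
proof -
 define G where "G y s = (sqrt (real n) / 2 * (p (y + 1)) * lfield n h s)" for y s
 have lf: "lfield n h s = (\<Sum>y\<in>torus n. (spin n s y - spin n s (y + 1)) * (sqrt (real n) / 2 * p (y + 1)))" for s
 proof -
  have "periodic_mod n (\<lambda>x. p x * spin n s x)" by (intro periodic_mod_intros p periodic_mod_spin)
  from sum_torus_shift[OF this, of 1]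
  have "(\<Sum>x\<in>torus n. (p (x + 1) - p x) * spin n s x) = (\<Sum>y\<in>torus n. (spin n s y - spin n s (y + 1)) * p (y + 1))"
   by (simp add: sum_subtractf algebra_simps)
  then have "(\<Sum>x\<in>torus n. h x * spin n s x) = real n * (\<Sum>y\<in>torus n. (spin n s y - spin n s (y + 1)) * p (y + 1))"
   unfolding hpp mult.assoc sum_distrib_left[symmetric] by simp
  then have "lfield n h s = (real n / sqrt (real n)) / 2 * (\<Sum>y\<in>torus n. (spin n s y - spin n s (y + 1)) * p (y + 1))"
   unfolding lfield_def by simp
  also have "real n / sqrt (real n) = sqrt (real n)" by (simp add: real_div_sqrt)
  finally show ?thesis by (simp add: sum_distrib_left mult_ac)
 qed
 have id: "(lfield n h s)^2 = (\<Sum>y\<in>torus n. (spin n s y - spin n s (y + 1)) *\<^sub>R G y s)" for s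
 proof -
  have "(lfield n h s)^2 = (\<Sum>y\<in>torus n. (spin n s y - spin n s (y + 1)) * (sqrt (real n) / 2 * p (y + 1))) * lfield n h s"
   using lf[of s] by (simp add: power2_eq_square)
  then show ?thesis unfolding G_def sum_distrib_right by (simp add: mult_ac)
 qed
 \<comment> \<open>Makes e^2 / A, the coefficient with which the second moment comes back, equal to
   1 / 2.\<close>
 let ?A = "2 * e^2"
 let ?V = "E (\<lambda>s. (lfield n h s)^2)"
 have A: "?A > 0" using e by simp
 have "norm (E (\<lambda>s. \<Sum>y\<in>torus n. (spin n s y - spin n s (y + 1)) *\<^sub>R G y s)) \<le> ?A * D / 2 + 1 / (?A * (real n)^2) * (4 * E (\<lambda>s. (real n)^2 * e^2 / 4 * (lfield n h s)^2) + real n * E (\<lambda>s. (C * e / real n)^2))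
    + real n * E (\<lambda>s. C * e / real n)"
 proof (rule ibp_bound[OF A, where G = G])
  fix s
  have "(norm (G y s))^2 \<le> real n * e^2 / 4 * (lfield n h s)^2" for y
  proof -
   have "(p (y + 1))^2 \<le> e^2" using pe[of "y + 1"] e by (intro abs_le_square_iff[THEN iffD1]) auto
   then have "real n / 4 * (lfield n h s)^2 * (p (y + 1))^2 \<le> real n / 4 * (lfield n h s)^2 * e^2" by (intro mult_left_mono) auto
   then show ?thesis unfolding G_def by (simp add: power_mult_distrib power_divide mult_ac)
  qed
  then have "(\<Sum>y\<in>torus n. (norm (G y s))^2) \<le> (\<Sum>y\<in>torus n. real n * e^2 / 4 * (lfield n h s)^2)" by (intro sum_mono)
  then show "(\<Sum>y\<in>torus n. (norm (G y s))^2) \<le> (real n)^2 * e^2 / 4 * (lfield n h s)^2" by (simp add: power2_eq_square mult_ac)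
 next
  fix s y assume s: "s \<in> Omega n"
  have "norm (G y (exch n y s) - G y s) = sqrt (real n) / 2 * \<bar>p (y + 1)\<bar> * \<bar>lfield n h (exch n y s) - lfield n h s\<bar>"
   unfolding G_def right_diff_distrib[symmetric] by (simp add: abs_mult)
  also have "... \<le> sqrt (real n) / 2 * e * (C / r ^ 6)"
   using pe[of "y + 1"] field_increment[OF s, of y] e by (intro mult_mono) auto
  also have "... = C * e / (2 * real n)" unfolding r_facts(3)[symmetric] unfolding r_facts(2)[symmetric] using r_facts(4) by (simp add: field_simps eval_nat_numeral)
  also have "... \<le> C * e / real n" using C1 e n_pos by (simp add: field_simps)
  finally show "norm (G y (exch n y s) - G y s) \<le> C * e / real n" .
 qed
 also have "... = ?A * D / 2 + 1 / 2 * ?V + C^2 / (2 * (real n) ^ 3) + C * e"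
  unfolding E_cmult E_const using e n_pos by (simp add: field_simps power2_eq_square eval_nat_numeral)
 finally have "?V \<le> ?A * D / 2 + 1 / 2 * ?V + C^2 / (2 * (real n) ^ 3) + C * e" unfolding id[symmetric] by simp
 moreover have "?A * D / 2 \<le> C * e"
 proof -
  have "e * e * D \<le> 1 * e * 1" using D_le e dirichlet_nonneg[of n \<mu>] by (intro mult_mono) auto
  also have "... \<le> C * e" using C1 e by simp
  finally show ?thesis by (simp add: power2_eq_square)
 qed
 ultimately have V: "?V \<le> 4 * C * e + C^2 / (real n) ^ 3" by (simp add: field_simps) 
 show ?thesis
 \<comment> \<open>The leftover C^2 / n^3 is free of \<open>e\<close>. If it exceeds 16 C e, then
   \<open>e\<close> is below C / n^3, and the deterministic bound n^3 e^2 on the squared field is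
   enough.\<close>
 proof (cases "C^2 / (real n) ^ 3 \<le> 16 * C * e")
  case True then show ?thesis using V by linarith
 next
  case False
  have "(lfield n h s)^2 \<le> real n ^ 3 * e^2" if s: "s \<in> Omega n" for s
  proof -
   have "\<bar>lfield n h s\<bar> \<le> (\<Sum>y\<in>torus n. 2 * (sqrt (real n) / 2 * e))"
    unfolding lf
   proof (rule order_trans[OF sum_abs sum_mono])
    fix y
    have "\<bar>spin n s y - spin n s (y + 1)\<bar> \<le> 2" using abs_spin[OF s n_pos, of y] abs_spin[OF s n_pos, of "y+1"] by linarith
    moreover have "\<bar>sqrt (real n) / 2 * p (y + 1)\<bar> \<le> sqrt (real n) / 2 * e" unfolding abs_mult using pe[of "y+1"] by (intro mult_mono) auto
    ultimately show "\<bar>(spin n s y - spin n s (y + 1)) * (sqrt (real n) / 2 * p (y + 1))\<bar> \<le> 2 * (sqrt (real n) / 2 * e)"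
     unfolding abs_mult[of "spin n s y - spin n s (y + 1)"] by (intro mult_mono) auto
   qed
   also have "... = real n * sqrt (real n) * e" by simp
   finally have "(lfield n h s)^2 \<le> (real n * sqrt (real n) * e)^2" using e by (intro abs_le_square_iff[THEN iffD1]) auto
   also have "(real n * sqrt (real n) * e)^2 = (real n)^2 * real n * e^2" by (simp add: power_mult_distrib)
   also have "... = real n ^ 3 * e^2" by (simp add: eval_nat_numeral)
   finally show ?thesis .
  qed
  then have "?V \<le> real n ^ 3 * e^2" by (rule E_le_const)
  also have "... = (real n ^ 3 * e) * e" by (simp add: power2_eq_square)
  also have "... \<le> C * e"
  proof (rule mult_right_mono)
   have n3: "0 < real n ^ 3" using n_pos by simp
   have "16 * C * e < C^2 / (real n) ^ 3" using False by simp
   then have "16 * C * e * real n ^ 3 < C * C" using n3 by (simp add: pos_less_divide_eq power2_eq_square)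
   then have "C * (16 * e * real n ^ 3) < C * C" by (simp add: mult_ac)
   then have "16 * e * real n ^ 3 < C" using C1 by simp
   moreover have "0 \<le> e * real n ^ 3" using e by simp
   ultimately have "e * real n ^ 3 \<le> C" by linarith
   then show "real n ^ 3 * e \<le> C" by (simp add: mult.commute)
  qed (use e in auto)
  also have "... \<le> 20 * C * e" using C1 e by simp
  finally show ?thesis .
 qed
qed

end

section \<open>Interpolation along the discrete heat flow\<close>

definition fdiff :: "nat => (int => real) => int => real" where
 "fdiff n p x = real n * (p (x + 1) - p x)"

text \<open>An Euler step of length 1 / (4 n^2) for the heat equation. The weights 1/4, 1/2, 1/4
  make it an average over sites, so it preserves sup bounds, and it commutes with
  \<open>fdiff\<close>.\<close>

definition heat_step :: "(int => real) => int => real" where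
 "heat_step p x = (p (x + 1) + 2 * p x + p (x - 1)) / 4"

lemma periodic_fdiff: "periodic_mod n p ==> periodic_mod n (fdiff n p)"
 unfolding fdiff_def [abs_def] by (intro periodic_mod_intros periodic_mod_shift)

lemma periodic_heat_step: "periodic_mod n p ==> periodic_mod n (heat_step p)"
 unfolding heat_step_def [abs_def] by (intro periodic_mod_intros periodic_mod_shift periodic_mod_shift_diff)

lemma fdiff_heat_step: "fdiff n (heat_step p) = heat_step (fdiff n p)"
 by (rule ext) (simp add: fdiff_def heat_step_def field_simps)

lemma heat_step_bound: assumes "\<And>x. \<bar>p x\<bar> \<le> c" shows "\<bar>heat_step p x\<bar> \<le> c"
proof -
 have "\<bar>p (x + 1) + 2 * p x + p (x - 1)\<bar> \<le> 4 * c" using assms[of "x + 1"] assms[of x] assms[of "x - 1"] by linarith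
 then show ?thesis unfolding heat_step_def by simp
qed

lemma sum_fdiff: "periodic_mod n p ==> (\<Sum>x\<in>torus n. fdiff n p x) = 0"
 unfolding fdiff_def sum_distrib_left[symmetric] sum_subtractf by (simp add: sum_torus_shift)

lemma sum_heat_step: "periodic_mod n p ==> (\<Sum>x\<in>torus n. heat_step p x) = (\<Sum>x\<in>torus n. p x)"
 unfolding heat_step_def sum_divide_distrib[symmetric] sum.distrib sum_distrib_left[symmetric]
 by (simp add: sum_torus_shift sum_torus_shift_diff)

text \<open>An identity, because the gradient term has to cancel against the generator; for smooth
  \<open>p\<close> the last term is of order n^(-4) per site.\<close>

lemma sum_heat_step_sq:
 assumes p: "periodic_mod n p"
 shows "(\<Sum>x\<in>torus n. (heat_step p x)^2) = (\<Sum>x\<in>torus n. (p x)^2) - 1/2 * (\<Sum>x\<in>torus n. (p (x + 1) - p x)^2)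
   + 1/16 * (\<Sum>x\<in>torus n. (p (x + 1) + p (x - 1) - 2 * p x)^2)"
proof -
 have q1: "periodic_mod n (\<lambda>x. p x * p (x - 1))" by (intro periodic_mod_intros p periodic_mod_shift_diff[OF p])
 have s1: "(\<Sum>x\<in>torus n. p x * p (x - 1)) = (\<Sum>x\<in>torus n. p (x + 1) * p x)" using sum_torus_shift[OF q1, of 1] by simp
 have s2: "(\<Sum>x\<in>torus n. (p (x + 1))^2) = (\<Sum>x\<in>torus n. (p x)^2)" by (rule sum_torus_shift) (rule periodic_mod_comp[OF p])
 have "(\<Sum>x\<in>torus n. (heat_step p x)^2) = (\<Sum>x\<in>torus n. (p x)^2 + 1/2 * (p (x + 1) * p x + p x * p (x - 1) - 2 * (p x)^2) + 1/16 * (p (x + 1) + p (x - 1) - 2 * p x)^2)"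
  unfolding heat_step_def by (intro sum.cong refl) (simp add: power2_eq_square field_simps)
 also have "... = (\<Sum>x\<in>torus n. (p x)^2) + 1/2 * (2 * (\<Sum>x\<in>torus n. p (x + 1) * p x) - 2 * (\<Sum>x\<in>torus n. (p x)^2)) + 1/16 * (\<Sum>x\<in>torus n. (p (x + 1) + p (x - 1) - 2 * p x)^2)"
  unfolding sum.distrib sum_distrib_left[symmetric] sum_subtractf s1 by simp
 also have "2 * (\<Sum>x\<in>torus n. p (x + 1) * p x) - 2 * (\<Sum>x\<in>torus n. (p x)^2) = - (\<Sum>x\<in>torus n. (p (x + 1) - p x)^2)"
 proof -
  have "(\<Sum>x\<in>torus n. (p (x + 1) - p x)^2) = (\<Sum>x\<in>torus n. (p (x + 1))^2 - 2 * (p (x + 1) * p x) + (p x)^2)"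
   by (intro sum.cong refl) (simp add: power2_eq_square algebra_simps)
  then show ?thesis unfolding sum.distrib sum_subtractf sum_distrib_left[symmetric] s2 by simp
 qed
 finally show ?thesis by simp
qed

text \<open>Since the values sum to 0, p y is the mean of its differences to all values, and each of
  these is at most the total variation.\<close>

lemma torus_oscillation:
 assumes p: "periodic_mod n p" and n: "n > 0" and p0: "(\<Sum>x\<in>torus n. p x) = (0::real)"
 shows "\<bar>p y\<bar> \<le> (\<Sum>x\<in>torus n. \<bar>p (x + 1) - p x\<bar>)"
proof -
 let ?S = "\<Sum>x\<in>torus n. \<bar>p (x + 1) - p x\<bar>"
 have step: "\<bar>p (y + int j) - p y\<bar> \<le> (\<Sum>i<j. \<bar>p (y + int i + 1) - p (y + int i)\<bar>)" for j
 proof (induction j)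
  case (Suc j)
  have "\<bar>p (y + int (Suc j)) - p y\<bar> \<le> \<bar>p (y + int j + 1) - p (y + int j)\<bar> + \<bar>p (y + int j) - p y\<bar>" by (simp add: algebra_simps)
  then show ?case using Suc by simp
 qed simp
 have d: "\<bar>p (y + int j) - p y\<bar> \<le> ?S" if "j < n" for j
 proof -
  have "(\<Sum>i<j. \<bar>p (y + int i + 1) - p (y + int i)\<bar>) \<le> (\<Sum>i<n. \<bar>p (y + int i + 1) - p (y + int i)\<bar>)"
   using that by (intro sum_mono2) auto
  also have "... = (\<Sum>j=1..n. (\<lambda>x. \<bar>p (x + 1) - p x\<bar>) ((y - 1) + int j))"
   by (rule sum.reindex_bij_witness[where i = "\<lambda>j. j - 1" and j = Suc]) (auto simp: algebra_simps)
  also have "... = ?S"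
   by (rule sum_torus_window) (intro periodic_mod_comp2[OF periodic_mod_shift[OF p] p])
  finally show ?thesis using step[of j] by simp
 qed
 have "(\<Sum>j=1..n. p ((y - 1) + int j)) = 0" using sum_torus_window[OF p] p0 by simp
 then have z: "(\<Sum>j<n. p (y + int j)) = 0"
  by (subst sum.reindex_bij_witness[where i = "\<lambda>j. j - 1" and j = Suc and T = "{1..n}" and h = "\<lambda>j. p ((y - 1) + int j)"]) (auto simp: algebra_simps)
 have "real n * p y = (\<Sum>j<n. p y - p (y + int j))" using z by (simp add: sum_subtractf)
 also have "\<bar>...\<bar> \<le> (\<Sum>j<n. ?S)"
  by (rule order_trans[OF sum_abs], rule sum_mono) (use d in \<open>auto simp: abs_minus_commute\<close>)
 finally have "real n * \<bar>p y\<bar> \<le> real n * ?S" by (simp add: abs_mult)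
 then show ?thesis using n by simp
qed

lemma sum_fdiff_sq: "(\<Sum>x\<in>torus n. (fdiff n p x)^2) = (real n)^2 * (\<Sum>x\<in>torus n. (p (x + 1) - p x)^2)"
 by (simp add: fdiff_def power_mult_distrib sum_distrib_left)

lemma torus_sup_le_energy:
 assumes p: "periodic_mod n p" and n: "n > 0" and p0: "(\<Sum>x\<in>torus n. p x) = 0"
 shows "(p y)^2 \<le> (\<Sum>x\<in>torus n. (fdiff n p x)^2) / real n"
proof -
 have "(p y)^2 \<le> (\<Sum>x\<in>torus n. \<bar>p (x + 1) - p x\<bar>)^2"
  using power_mono[OF torus_oscillation[OF assms, of y], of 2] by simp
 also have "... \<le> (\<Sum>x\<in>torus n. \<bar>p (x + 1) - p x\<bar>^2) * real (card (torus n))" by (rule sum_squared_le_sum_of_squares)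
 also have "... = (\<Sum>x\<in>torus n. (fdiff n p x)^2) / real n"
  unfolding sum_fdiff_sq using n by (simp add: power2_eq_square)
 finally show ?thesis .
qed

text \<open>\<open>torus_sup_le_energy\<close>, summed over the sites, is a Poincare inequality. In
  \<open>sum_heat_step_sq\<close> the last term takes away at most half of the gradient
  term.\<close>

lemma heat_step_decay:
 assumes p: "periodic_mod n p" and n: "n > 0" and p0: "(\<Sum>x\<in>torus n. p x) = 0"
 shows "(\<Sum>x\<in>torus n. (heat_step p x)^2) \<le> exp (- 1 / (4 * (real n)^2)) * (\<Sum>x\<in>torus n. (p x)^2)"
proof -
 let ?G = "\<Sum>x\<in>torus n. (p (x + 1) - p x)^2" and ?P = "\<Sum>x\<in>torus n. (p x)^2"
 have s: "(\<Sum>x\<in>torus n. (p x - p (x - 1))^2) = ?G"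
 proof -
  have "periodic_mod n (\<lambda>x. (p x - p (x - 1))^2)" by (rule periodic_mod_comp) (intro periodic_mod_intros p periodic_mod_shift_diff[OF p])
  from sum_torus_shift[OF this, of 1] show ?thesis by simp
 qed
 have "(\<Sum>x\<in>torus n. (p (x + 1) + p (x - 1) - 2 * p x)^2) \<le> (\<Sum>x\<in>torus n. 2 * (p (x + 1) - p x)^2 + 2 * (p x - p (x - 1))^2)"
 proof (rule sum_mono)
  fix x
  have "(u - v)^2 \<le> 2 * u^2 + 2 * v^2" for u v :: real
  proof -
   have "0 \<le> (u + v)^2" by simp
   then show ?thesis by (simp add: power2_eq_square algebra_simps)
  qed
  from this[of "p (x + 1) - p x" "p x - p (x - 1)"]
  show "(p (x + 1) + p (x - 1) - 2 * p x)^2 \<le> 2 * (p (x + 1) - p x)^2 + 2 * (p x - p (x - 1))^2" by (simp add: algebra_simps)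
 qed
 also have "... = 4 * ?G" unfolding sum.distrib sum_distrib_left[symmetric] s by simp
 finally have L: "(\<Sum>x\<in>torus n. (heat_step p x)^2) \<le> ?P - 1/4 * ?G" unfolding sum_heat_step_sq[OF p] by simp
 have fd: "(\<Sum>x\<in>torus n. (fdiff n p x)^2) = (real n)^2 * ?G" by (rule sum_fdiff_sq)
 have "?P \<le> (\<Sum>y\<in>torus n. (\<Sum>x\<in>torus n. (fdiff n p x)^2) / real n)" by (intro sum_mono torus_sup_le_energy assms)
 then have "?P \<le> (real n)^2 * ?G" using n unfolding fd by simp
 then have "1 / (4 * (real n)^2) * ?P \<le> 1/4 * ?G" using n by (simp add: field_simps)
 moreover have "(1 + - 1 / (4 * (real n)^2)) * ?P = ?P - 1 / (4 * (real n)^2) * ?P" by (simp only: distrib_right)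
 ultimately have "(\<Sum>x\<in>torus n. (heat_step p x)^2) \<le> (1 + - 1 / (4 * (real n)^2)) * ?P" using L by linarith
 also have "... \<le> exp (- 1 / (4 * (real n)^2)) * ?P" by (intro mult_right_mono exp_ge_add_one_self sum_nonneg) auto
 finally show ?thesis .
qed

text \<open>Three difference quotients: the field is tested with \<open>fdiff n p\<close>, whose
  Laplacian drives the flow.\<close>

definition tame :: "nat => real => (int => real) => bool" where
 "tame n C p \<longleftrightarrow> periodic_mod n p \<and> (\<Sum>x\<in>torus n. p x) = 0 \<and>
   (\<forall>x. \<bar>p x\<bar> \<le> C \<and> \<bar>fdiff n p x\<bar> \<le> C \<and> \<bar>fdiff n (fdiff n p) x\<bar> \<le> C \<and> \<bar>fdiff n (fdiff n (fdiff n p)) x\<bar> \<le> C)"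

lemma tame_heat_step: "tame n C p ==> tame n C (heat_step p)"
 unfolding tame_def fdiff_heat_step by (auto simp: periodic_heat_step sum_heat_step intro: heat_step_bound)

text \<open>The limiting variance for the test function p' on the grid, with <p', (-Laplacian)^(-1)
  p'> written as <p, p>.\<close>

definition cov_form :: "real => nat => (int => real) => real" where
 "cov_form a n p = 1/4 * ((\<Sum>x\<in>torus n. (fdiff n p x)^2) / real n) + a / 2 * ((\<Sum>x\<in>torus n. (p x)^2) / real n)"

lemma lfield_add: "lfield n (\<lambda>x. f x + c * k x) s = lfield n f s + c * lfield n k s"
 by (simp add: lfield_def distrib_right sum.distrib sum_distrib_left add_divide_distrib mult.assoc)

lemma abs_lfield_le:
 assumes s: "s \<in> Omega n" and n: "n > 0" and f: "\<And>x. \<bar>f x\<bar> \<le> c"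
 shows "\<bar>lfield n f s\<bar> \<le> c * sqrt (real n) / 2"
proof -
 have "\<bar>\<Sum>x\<in>torus n. f x * spin n s x\<bar> \<le> (\<Sum>x\<in>torus n. c)"
  by (rule order_trans[OF sum_abs], rule sum_mono) (use f in \<open>simp add: abs_mult abs_spin[OF s n]\<close>)
 then have "\<bar>lfield n f s\<bar> \<le> real n * c / (2 * sqrt (real n))" unfolding lfield_def by (simp add: divide_right_mono)
 also have "... = (real n / sqrt (real n)) * c / 2" by simp
 also have "real n / sqrt (real n) = sqrt (real n)" by (simp add: real_div_sqrt)
 finally show ?thesis by (simp add: mult.commute)
qed

text \<open>In one step the characteristic function gains a factor near 1 + x and the exponential of
  half the variance gains exp (e - x); the product is 1 up to \<open>e\<close> and second
  order.\<close>

lemma exp_step_error: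
 fixes x e :: real
 assumes x: "0 \<le> x" "x \<le> m" and e: "0 \<le> e" "e \<le> m" and m: "m \<le> 1/2"
 shows "\<bar>(1 + x) * exp (e - x) - 1\<bar> \<le> e + 10 * m^2" "exp (e - x) \<le> 2"
proof -
 let ?u = "e - x"
 have u: "\<bar>?u\<bar> \<le> m" using x e by linarith
 have "\<bar>exp ?u - 1 - ?u\<bar> \<le> \<bar>?u\<bar>^2"
 proof -
  have "\<bar>exp ?u - (1 + ?u)\<bar> \<le> exp \<bar>?u\<bar> * \<bar>?u\<bar>^2"
   using Taylor_exp_field[of ?u 1] by (simp add: eval_nat_numeral)
  have "exp ?u - 1 - ?u \<ge> 0" using exp_ge_add_one_self[of ?u] by linarith
  moreover have "exp ?u \<le> 1 + ?u + ?u^2"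
  proof (cases "?u \<ge> 0")
   case True then show ?thesis using exp_bound[of ?u] u m by simp
  next
   case False
   have "1 - ?u \<le> exp (- ?u)" using exp_ge_add_one_self[of "- ?u"] by linarith
   then have "(1 - ?u) * exp ?u \<le> exp (- ?u) * exp ?u" by (rule mult_right_mono) simp
   then have "(1 - ?u) * exp ?u \<le> 1" unfolding exp_add[symmetric] by simp
   then have "exp ?u \<le> 1 / (1 - ?u)" using False by (simp add: pos_le_divide_eq mult.commute)
   also have "... \<le> 1 + ?u + ?u^2"
   proof -
    have "1 \<le> (1 + ?u + ?u^2) * (1 - ?u)"
    proof -
     have "(1 + ?u + ?u^2) * (1 - ?u) = 1 - ?u ^ 3" by (simp add: power2_eq_square power3_eq_cube algebra_simps)
     moreover have "?u ^ 3 \<le> 0" using False by (simp add: power_le_zero_eq)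
     ultimately show ?thesis by linarith
    qed
    then show ?thesis using False by (simp add: pos_divide_le_eq)
   qed
   finally show ?thesis .
  qed
  ultimately show ?thesis by simp
 qed
 then obtain q where q: "exp ?u = 1 + ?u + q" "\<bar>q\<bar> \<le> m^2"
  using power_mono[OF u, of 2] by (intro that[of "exp ?u - 1 - ?u"]) auto
 have m0: "0 \<le> m" using x by linarith
 have "(1 + x) * exp ?u - 1 = e + x * ?u + (1 + x) * q" unfolding q(1) by (simp add: algebra_simps)
 moreover have "\<bar>x * ?u\<bar> \<le> m * m" unfolding abs_mult using x u by (intro mult_mono) auto
 moreover have "\<bar>(1 + x) * q\<bar> \<le> 2 * m^2" unfolding abs_mult using x q m by (intro mult_mono) auto
 ultimately have "\<bar>(1 + x) * exp ?u - 1\<bar> \<le> e + (m * m + 2 * m^2)" using e by linarith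
 also have "... \<le> e + 10 * m^2" by (simp add: power2_eq_square)
 finally show "\<bar>(1 + x) * exp (e - x) - 1\<bar> \<le> e + 10 * m^2" .
 have "m^2 \<le> 1 / 2 * (1 / 2)" unfolding power2_eq_square using m m0 by (intro mult_mono) auto
 then show "exp (e - x) \<le> 2" unfolding q(1) using q(2) u m by linarith
qed

context controlled_weight
begin

text \<open>\<open>gen_error\<close>, stated outside the locale of a test function, on which it
  depends through \<open>C\<close> only.\<close>

definition err :: "real => real" where
 "err C = C ^ 6 / sqrt r * ((1 + a) * (40 * \<bar>\<theta>\<bar> + 405 + 5 * K))"

lemma tame_test_function:
 assumes t: "tame n C p" and C: "C \<ge> 1"
 shows "test_function n \<mu> \<theta> a K l (fdiff n p) C"
proof (unfold_locales)
 show "periodic_mod n (fdiff n p)" using t by (auto simp: tame_def intro: periodic_fdiff)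
 show "(\<Sum>x\<in>torus n. fdiff n p x) = 0" using t by (auto simp: tame_def intro: sum_fdiff)
 show "\<bar>fdiff n p x\<bar> \<le> C" for x using t by (auto simp: tame_def)
 show "\<bar>fdiff n p (x + 1) - fdiff n p x\<bar> \<le> C / real n" for x
 proof -
  have "\<bar>fdiff n (fdiff n p) x\<bar> \<le> C" using t by (auto simp: tame_def)
  then have "real n * \<bar>fdiff n p (x + 1) - fdiff n p x\<bar> \<le> C" by (subst (asm) fdiff_def) (simp add: abs_mult)
  then show ?thesis using n_pos by (simp add: field_simps)
 qed
 show "1 \<le> C" by (rule C)
qed

text \<open>For a Gaussian field with variance \<open>cov_form\<close> this would be 1.\<close>

definition Fint :: "(int => real) => complex" where
 "Fint p = E (\<lambda>s. cis (lfield n (fdiff n p) s)) * complex_of_real (exp (cov_form a n p / 2))"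

lemma cov_form_bounds:
 assumes t: "tame n C p" shows "0 \<le> cov_form a n p" "cov_form a n p \<le> 2 * ((1 + a) * C^2)"
proof -
 have b: "\<bar>p x\<bar> \<le> C" "\<bar>fdiff n p x\<bar> \<le> C" for x using t by (auto simp: tame_def)
 then have b2: "(p x)^2 \<le> C^2" "(fdiff n p x)^2 \<le> C^2" for x
  by (metis abs_ge_zero power2_abs power_mono)+
 have "(\<Sum>x\<in>torus n. (p x)^2) \<le> (\<Sum>x\<in>torus n. C^2)" "(\<Sum>x\<in>torus n. (fdiff n p x)^2) \<le> (\<Sum>x\<in>torus n. C^2)"
  by (intro sum_mono b2)+
 then have s: "(\<Sum>x\<in>torus n. (p x)^2) / real n \<le> C^2" "(\<Sum>x\<in>torus n. (fdiff n p x)^2) / real n \<le> C^2"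
  using n_pos by (simp_all add: divide_le_eq mult.commute)
 have s0: "0 \<le> (\<Sum>x\<in>torus n. (p x)^2) / real n" "0 \<le> (\<Sum>x\<in>torus n. (fdiff n p x)^2) / real n" by (auto intro!: divide_nonneg_nonneg sum_nonneg)
 show "0 \<le> cov_form a n p" unfolding cov_form_def using s0 a_pos by (intro add_nonneg_nonneg mult_nonneg_nonneg) auto
 have "cov_form a n p \<le> 1/4 * C^2 + a / 2 * C^2" unfolding cov_form_def using s a_pos by (intro add_mono mult_left_mono) auto
 also have "... \<le> 2 * ((1 + a) * C^2)"
 proof -
  have "0 \<le> a * C^2" using a_pos by simp
  moreover have "1/4 * z + a / 2 * z \<le> 2 * ((1 + a) * z)" if "0 \<le> z" "0 \<le> a * z" for z :: real
   using that by (simp add: field_simps)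
  ultimately show ?thesis by simp
 qed
 finally show "cov_form a n p \<le> 2 * ((1 + a) * C^2)" .
qed

text \<open>The flow takes of order n^2 steps, so the bracket, which must still tend to 0, comes
  with the factor 1 / n^2.\<close>

lemma interpolation_step:
 assumes t: "tame n C p" and C: "C \<ge> 1" and nC: "real n \<ge> 2 * ((1 + a) * C^2)"
 shows "cmod (Fint (heat_step p) - Fint p) \<le> exp ((1 + a) * C^2) * (err C + 13 * ((1 + a) * C^2)^2 / real n) / (real n)^2"
proof -
 interpret T: test_function n \<mu> \<theta> a K l "fdiff n p" C by (rule tame_test_function[OF t C])
 let ?h = "fdiff n p"
 define c where "c = (1 + a) * C^2"
 have C2: "1 \<le> C^2" using T.C_pow[of 0 2] by simp
 have c1: "1 \<le> c" unfolding c_def using mult_mono[of 1 "1 + a" 1 "C^2"] a_pos C2 by simp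
 have Cc: "C^2 \<le> c" unfolding c_def using mult_right_mono[of 1 "1 + a" "C^2"] a_pos by simp
 have n1: "real n \<ge> 1" using n_pos by simp
 define \<delta> where "\<delta> = 1 / (4 * (real n)^2)"
 define w where "w = T.grad_energy / 4 + a * T.mass / 2"
 define \<phi> where "\<phi> = E (\<lambda>s. cis (lfield n ?h s))"
 define \<phi>' where "\<phi>' = E (\<lambda>s. cis (lfield n (fdiff n (heat_step p)) s))"
 have b: "\<bar>p x\<bar> \<le> C" "\<bar>?h x\<bar> \<le> C" "\<bar>fdiff n ?h x\<bar> \<le> C" "\<bar>fdiff n (fdiff n ?h) x\<bar> \<le> C" for x using t by (auto simp: tame_def)
 have pp: "periodic_mod n p" and hp: "periodic_mod n ?h" using t by (auto simp: tame_def intro: periodic_fdiff)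
 have sqle: "z^2 \<le> C^2" if "\<bar>z\<bar> \<le> C" for z using power_mono[OF that, of 2] by simp
 have lap: "T.lap x = fdiff n (fdiff n ?h) (x - 1)" for x
  unfolding T.lap_def by (simp add: fdiff_def[of n "fdiff n (fdiff n p)"] fdiff_def[of n "?h"] power2_eq_square algebra_simps)
 have lapC: "\<bar>T.lap x\<bar> \<le> C" for x unfolding lap by (rule b)
 have hs: "fdiff n (heat_step p) = (\<lambda>x. ?h x + \<delta> * T.lap x)"
  unfolding fdiff_heat_step using n_pos by (intro ext) (simp add: heat_step_def T.lap_def \<delta>_def field_simps)
 have avg: "(\<Sum>x\<in>torus n. f x) / real n \<le> M" if "\<And>x. f x \<le> M" for f :: "int => real" and M
  using sum_mono[of "torus n" f "\<lambda>_. M"] that n_pos by (simp add: divide_le_eq mult.commute)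
 have w0: "0 \<le> w" unfolding w_def T.grad_energy_def T.mass_def using a_pos
  by (intro add_nonneg_nonneg divide_nonneg_nonneg mult_nonneg_nonneg sum_nonneg) auto
 have ge: "T.grad_energy = (\<Sum>x\<in>torus n. (fdiff n ?h x)^2) / real n"
  unfolding T.grad_energy_def sum_fdiff_sq using n_pos by (simp add: power2_eq_square)
 have wc: "w \<le> c"
 proof -
  have "T.grad_energy \<le> C^2" unfolding ge by (rule avg) (rule sqle[OF b(3)])
  moreover have "T.mass \<le> C^2" unfolding T.mass_def by (rule avg) (rule sqle[OF b(2)])
  then have "a * T.mass \<le> a * C^2" using a_pos by (intro mult_left_mono) auto
  moreover have "0 \<le> a * C^2" using a_pos by simp
  ultimately show ?thesis unfolding w_def c_def using C2 by (simp add: distrib_right)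
 qed
 \<comment> \<open>The last terms of \<open>sum_heat_step_sq\<close> for p' and for p: what the
   decrease of the variance misses of \<delta> * w. Tameness makes them O(n^(-4)).\<close>
 define \<epsilon> where "\<epsilon> = 1/8 * (1/16 * ((\<Sum>x\<in>torus n. (?h (x + 1) + ?h (x - 1) - 2 * ?h x)^2) / real n)) + a/4 * (1/16 * ((\<Sum>x\<in>torus n. (p (x + 1) + p (x - 1) - 2 * p x)^2) / real n))"
 have cov: "cov_form a n (heat_step p) / 2 = cov_form a n p / 2 - \<delta> * w + \<epsilon>"
 proof -
  define G1 where "G1 = (\<Sum>x\<in>torus n. (?h (x + 1) - ?h x)^2)"
  define G0 where "G0 = (\<Sum>x\<in>torus n. (p (x + 1) - p x)^2)"
  have "T.grad_energy = real n * G1" unfolding T.grad_energy_def G1_def ..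
  moreover have "T.mass = real n * G0" unfolding T.mass_def G0_def sum_fdiff_sq using n_pos
   by (simp add: power2_eq_square)
  ultimately have dw: "\<delta> * w = G1 / (16 * real n) + a * G0 / (8 * real n)"
   unfolding \<delta>_def w_def using n_pos by (simp add: field_simps power2_eq_square)
  show ?thesis unfolding cov_form_def fdiff_heat_step sum_heat_step_sq[OF pp] sum_heat_step_sq[OF hp] dw \<epsilon>_def
   unfolding G1_def[symmetric] G0_def[symmetric] using n_pos by (simp add: field_simps)
 qed
 have \<epsilon>0: "0 \<le> \<epsilon>" unfolding \<epsilon>_def using a_pos by (intro add_nonneg_nonneg mult_nonneg_nonneg divide_nonneg_nonneg sum_nonneg) auto
 have \<epsilon>c: "\<epsilon> \<le> c / (real n) ^ 4"
 proof -
  have d1: "(?h (x + 1) + ?h (x - 1) - 2 * ?h x)^2 \<le> C^2 / (real n) ^ 4" for x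
  proof -
   have "(real n)^2 * (?h (x + 1) + ?h (x - 1) - 2 * ?h x) = T.lap x" by (simp add: T.lap_def)
   then have "((real n)^2 * (?h (x + 1) + ?h (x - 1) - 2 * ?h x))^2 \<le> C^2" using sqle[OF lapC] by simp
   then have "(real n) ^ 4 * (?h (x + 1) + ?h (x - 1) - 2 * ?h x)^2 \<le> C^2" by (simp add: power_mult_distrib power_mult[symmetric])
   then show ?thesis using n_pos by (simp add: field_simps)
  qed
  have d0: "(p (x + 1) + p (x - 1) - 2 * p x)^2 \<le> C^2 / (real n) ^ 4" for x
  proof -
   have "(real n)^2 * (p (x + 1) + p (x - 1) - 2 * p x) = fdiff n ?h (x - 1)" by (simp add: fdiff_def power2_eq_square algebra_simps)
   then have "((real n)^2 * (p (x + 1) + p (x - 1) - 2 * p x))^2 \<le> C^2" using sqle[OF b(3)] by simp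
   then have "(real n) ^ 4 * (p (x + 1) + p (x - 1) - 2 * p x)^2 \<le> C^2" by (simp add: power_mult_distrib power_mult[symmetric])
   then show ?thesis using n_pos by (simp add: field_simps)
  qed
  have "\<epsilon> \<le> 1/8 * (1/16 * (C^2 / (real n) ^ 4)) + a/4 * (1/16 * (C^2 / (real n) ^ 4))"
   unfolding \<epsilon>_def using a_pos by (intro add_mono mult_left_mono avg d1 d0) auto
  also have "... \<le> (1 + a) * (C^2 / (real n) ^ 4)"
  proof -
   have "0 \<le> C^2 / (real n) ^ 4" "0 \<le> a * (C^2 / (real n) ^ 4)" using a_pos by auto
   then show ?thesis by (simp only: distrib_right mult_1)
  qed
  finally show ?thesis by (simp add: c_def)
 qed
 have n2: "1 \<le> (real n)^2" using n1 by simp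
 define m where "m = c / (real n)^2"
 have m: "m \<le> 1/2"
 proof -
  have "2 * c \<le> real n" using nC by (simp add: c_def)
  also have "... \<le> (real n)^2" using n1 by (simp add: power2_eq_square)
  finally show ?thesis unfolding m_def using n_pos by (simp add: divide_le_eq)
 qed
 have x: "0 \<le> \<delta> * w" "\<delta> * w \<le> m"
 proof -
  show "0 \<le> \<delta> * w" using w0 by (simp add: \<delta>_def)
  have "\<delta> * w \<le> 1 / (real n)^2 * c" unfolding \<delta>_def using wc w0 n_pos by (intro mult_mono) (auto simp: field_simps)
  then show "\<delta> * w \<le> m" by (simp add: m_def)
 qed
 have \<epsilon>m: "\<epsilon> \<le> m"
 proof -
  have "c / (real n) ^ 4 \<le> c / (real n)^2" using c1 n1 by (intro divide_left_mono power_increasing) auto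
  then show ?thesis using \<epsilon>c by (simp add: m_def)
 qed
 note es = exp_step_error[OF x \<epsilon>0 \<epsilon>m m]
 have \<phi>1: "cmod \<phi> \<le> 1" unfolding \<phi>_def using norm_E[of "\<lambda>s. cis (lfield n ?h s)"] by (simp add: E_const)
 have step: "cmod (\<phi>' - \<phi> * complex_of_real (1 + \<delta> * w)) \<le> \<delta> * err C + C^2 / (real n) ^ 3"
 proof -
  have tay: "cmod (cis (u + v) - cis u - cis u * (\<i> * complex_of_real v)) \<le> v^2 / 2" for u v
  proof -
   have e: "cis (u + v) = cis u * iexp v" by (simp add: cis_conv_exp exp_add[symmetric] algebra_simps)
   have "cis (u + v) - cis u - cis u * (\<i> * complex_of_real v) = cis u * (iexp v - (\<Sum>k\<le>1. (\<i> * complex_of_real v) ^ k / fact k))"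
    unfolding e by (simp add: algebra_simps)
   moreover have "cmod (iexp v - (\<Sum>k\<le>1. (\<i> * complex_of_real v) ^ k / fact k)) \<le> v^2 / 2"
    using iexp_approx1[of v 1] by (simp add: eval_nat_numeral)
   ultimately show ?thesis by (simp add: norm_mult)
  qed
  define R where "R = E (\<lambda>s. cis (lfield n (fdiff n (heat_step p)) s) - cis (lfield n ?h s) - cis (lfield n ?h s) * (\<i> * complex_of_real (\<delta> * lfield n T.lap s)))"
  have R: "cmod R \<le> C^2 / (real n) ^ 3"
  proof -
   have "cmod R \<le> E (\<lambda>_. C^2 / (real n) ^ 3)" unfolding R_def
   proof (rule norm_E_le)
    fix s assume s: "s \<in> Omega n"
    have "(\<delta> * lfield n T.lap s)^2 \<le> (\<delta> * (C * sqrt (real n) / 2))^2"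
    proof (rule abs_le_square_iff[THEN iffD1])
     have "\<delta> * \<bar>lfield n T.lap s\<bar> \<le> \<delta> * (C * sqrt (real n) / 2)" using abs_lfield_le[OF s n_pos lapC] by (intro mult_left_mono) (auto simp: \<delta>_def)
     then show "\<bar>\<delta> * lfield n T.lap s\<bar> \<le> \<bar>\<delta> * (C * sqrt (real n) / 2)\<bar>" using C by (simp add: abs_mult \<delta>_def)
    qed
    also have "... = C^2 / (64 * (real n) ^ 3)"
    proof -
     have "(\<delta> * (C * sqrt (real n) / 2))^2 = \<delta>^2 * (C^2 * real n / 4)" by (simp add: power_mult_distrib power_divide)
     then show ?thesis unfolding \<delta>_def using n_pos by (simp add: field_simps eval_nat_numeral)
    qed
    also have "... \<le> C^2 / (real n) ^ 3" using n_pos by (intro divide_left_mono) auto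
    finally have v2: "(\<delta> * lfield n T.lap s)^2 \<le> C^2 / (real n) ^ 3" .
    have "cmod (cis (lfield n (fdiff n (heat_step p)) s) - cis (lfield n ?h s) - cis (lfield n ?h s) * (\<i> * complex_of_real (\<delta> * lfield n T.lap s))) \<le> (\<delta> * lfield n T.lap s)^2 / 2"
     unfolding hs lfield_add by (rule tay)
    also have "... \<le> (\<delta> * lfield n T.lap s)^2" by simp
    finally show "cmod (cis (lfield n (fdiff n (heat_step p)) s) - cis (lfield n ?h s) - cis (lfield n ?h s) * (\<i> * complex_of_real (\<delta> * lfield n T.lap s))) \<le> C^2 / (real n) ^ 3"
     using v2 by (rule order_trans)
   qed
   then show ?thesis by (simp add: E_const)
  qed
  define Z where "Z = E (\<lambda>s. cis (lfield n ?h s) * (\<i> * complex_of_real (lfield n T.lap s) - complex_of_real w))"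
  have Z: "cmod Z \<le> err C"
   using T.generator_estimate unfolding Z_def w_def T.\<Phi>_def T.gen_error_def T.\<rho>_def err_def .
  have "\<phi>' - \<phi> * complex_of_real (1 + \<delta> * w) = R + complex_of_real \<delta> * Z"
  proof -
   have "R + complex_of_real \<delta> * Z = E (\<lambda>s. cis (lfield n (fdiff n (heat_step p)) s) - complex_of_real (1 + \<delta> * w) * cis (lfield n ?h s))"
    unfolding R_def Z_def E_cmult_complex[symmetric] E_add[symmetric] by (intro E_cong) (simp add: algebra_simps)
   then show ?thesis unfolding E_diff E_cmult_complex \<phi>_def \<phi>'_def by (simp add: mult.commute)
  qed
  also have "cmod ... \<le> C^2 / (real n) ^ 3 + \<delta> * err C"
  proof (rule norm_triangle_mono[OF R])
   have "0 \<le> \<delta>" by (simp add: \<delta>_def)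
   then show "cmod (complex_of_real \<delta> * Z) \<le> \<delta> * err C" using Z by (simp add: norm_mult mult_left_mono)
  qed
  finally show ?thesis by simp
 qed
 let ?G = "exp (cov_form a n p / 2)"
 have GE: "?G \<le> exp c" using cov_form_bounds(2)[OF t] unfolding c_def by simp
 have "Fint (heat_step p) - Fint p = complex_of_real ?G * ((\<phi>' - \<phi> * complex_of_real (1 + \<delta> * w)) * complex_of_real (exp (\<epsilon> - \<delta> * w))
   + \<phi> * complex_of_real ((1 + \<delta> * w) * exp (\<epsilon> - \<delta> * w) - 1))"
 proof -
  have "exp (cov_form a n (heat_step p) / 2) = ?G * exp (\<epsilon> - \<delta> * w)" unfolding cov exp_add[symmetric] by (simp add: algebra_simps)
  then show ?thesis unfolding Fint_def \<phi>_def[symmetric] \<phi>'_def[symmetric] by (simp add: algebra_simps)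
 qed
 also have "cmod ... \<le> exp c * ((\<delta> * err C + C^2 / (real n) ^ 3) * 2 + 1 * (\<epsilon> + 10 * m^2))"
  unfolding norm_mult[of "complex_of_real ?G"]
 proof (intro mult_mono)
  show "cmod ((\<phi>' - \<phi> * complex_of_real (1 + \<delta> * w)) * complex_of_real (exp (\<epsilon> - \<delta> * w)) + \<phi> * complex_of_real ((1 + \<delta> * w) * exp (\<epsilon> - \<delta> * w) - 1))
    \<le> (\<delta> * err C + C^2 / (real n) ^ 3) * 2 + 1 * (\<epsilon> + 10 * m^2)"
  proof (rule norm_triangle_mono)
   show "cmod ((\<phi>' - \<phi> * complex_of_real (1 + \<delta> * w)) * complex_of_real (exp (\<epsilon> - \<delta> * w))) \<le> (\<delta> * err C + C^2 / (real n) ^ 3) * 2"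
    unfolding norm_mult using step es(2) order_trans[OF norm_ge_zero step] by (intro mult_mono) auto
   show "cmod (\<phi> * complex_of_real ((1 + \<delta> * w) * exp (\<epsilon> - \<delta> * w) - 1)) \<le> 1 * (\<epsilon> + 10 * m^2)"
    unfolding norm_mult norm_of_real using \<phi>1 es(1) by (intro mult_mono) auto
  qed
 qed (use GE in auto)
 also have "... \<le> exp c * (err C + 13 * c^2 / real n) / (real n)^2"
 proof -
  have e0: "0 \<le> err C" unfolding err_def using C a_pos K_ge r_facts(1) by (intro mult_nonneg_nonneg divide_nonneg_nonneg) auto
  have cc: "c \<le> c^2" using c1 by (simp add: power2_eq_square)
  have n34: "c^2 / (real n) ^ 4 \<le> c^2 / (real n) ^ 3" using n1 by (intro divide_left_mono power_increasing) auto
  have "\<delta> * err C * 2 \<le> err C / (real n)^2" unfolding \<delta>_def using e0 n_pos by (simp add: field_simps)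
  moreover have "C^2 / (real n) ^ 3 \<le> c^2 / (real n) ^ 3" using Cc cc by (intro divide_right_mono) auto
  moreover have "\<epsilon> \<le> c^2 / (real n) ^ 3"
  proof -
   have "c / (real n) ^ 4 \<le> c^2 / (real n) ^ 4" using cc by (intro divide_right_mono) auto
   then show ?thesis using \<epsilon>c n34 by linarith
  qed
  moreover have "m^2 \<le> c^2 / (real n) ^ 3" using n34 unfolding m_def by (simp add: power_divide power_mult[symmetric])
  ultimately have "(\<delta> * err C + C^2 / (real n) ^ 3) * 2 + 1 * (\<epsilon> + 10 * m^2) \<le> err C / (real n)^2 + 13 * (c^2 / (real n) ^ 3)"
   by (simp add: algebra_simps)
  also have "... = (err C + 13 * c^2 / real n) / (real n)^2" using n_pos by (simp add: field_simps eval_nat_numeral)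
  finally show ?thesis by (simp add: mult_left_mono flip: times_divide_eq_right)
 qed
 finally show ?thesis unfolding c_def .
qed

definition flow :: "(int => real) => nat => int => real" where "flow p k = (heat_step ^^ k) p"

lemma flow_Suc: "flow p (Suc k) = heat_step (flow p k)" by (simp add: flow_def)

lemma tame_flow: "tame n C p ==> tame n C (flow p k)"
 by (induction k) (auto simp: flow_def tame_heat_step)

lemma flow_decay:
 assumes t: "tame n C p"
 shows "(\<Sum>x\<in>torus n. (fdiff n (flow p k) x)^2) / real n \<le> C^2 * exp (- real k / (4 * (real n)^2))"
proof (induction k)
 case 0
 have "(fdiff n p x)^2 \<le> C^2" for x
 proof -
  have "\<bar>fdiff n p x\<bar> \<le> C" using t by (auto simp: tame_def)
  from power_mono[OF this, of 2] show ?thesis by simp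
 qed
 then have "(\<Sum>x\<in>torus n. (fdiff n p x)^2) \<le> (\<Sum>x\<in>torus n. C^2)" by (intro sum_mono)
 then show ?case using n_pos by (simp add: flow_def divide_le_eq mult.commute)
next
 case (Suc k)
 have p: "periodic_mod n (flow p k)" using tame_flow[OF t, of k] by (auto simp: tame_def)
 have "(\<Sum>x\<in>torus n. (fdiff n (flow p (Suc k)) x)^2) \<le> exp (- 1 / (4 * (real n)^2)) * (\<Sum>x\<in>torus n. (fdiff n (flow p k) x)^2)"
  unfolding flow_Suc fdiff_heat_step by (intro heat_step_decay periodic_fdiff p sum_fdiff n_pos)
 then have "(\<Sum>x\<in>torus n. (fdiff n (flow p (Suc k)) x)^2) / real n \<le> exp (- 1 / (4 * (real n)^2)) * ((\<Sum>x\<in>torus n. (fdiff n (flow p k) x)^2) / real n)"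
  by (simp add: divide_right_mono)
 also have "... \<le> exp (- 1 / (4 * (real n)^2)) * (C^2 * exp (- real k / (4 * (real n)^2)))" by (intro mult_left_mono Suc) auto
 also have "... = C^2 * exp (- real (Suc k) / (4 * (real n)^2))"
  by (simp add: exp_add[symmetric] mult.left_commute add_divide_distrib[symmetric] algebra_simps)
 finally show ?case .
qed

lemma interpolation:
 assumes t: "tame n C p" and C: "C \<ge> 1" and nC: "real n \<ge> 2 * ((1 + a) * C^2)"
 shows "cmod (Fint (flow p k) - Fint p) \<le> real k / (real n)^2 * (exp ((1 + a) * C^2) * (err C + 13 * ((1 + a) * C^2)^2 / real n))"
proof (induction k)
 case (Suc k)
 define s where "s = exp ((1 + a) * C^2) * (err C + 13 * ((1 + a) * C^2)^2 / real n)"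
 have "cmod (Fint (flow p (Suc k)) - Fint (flow p k)) \<le> s / (real n)^2"
  unfolding flow_Suc s_def by (rule interpolation_step[OF tame_flow[OF t] C nC])
 then have "cmod ((Fint (flow p (Suc k)) - Fint (flow p k)) + (Fint (flow p k) - Fint p)) \<le> s / (real n)^2 + real k / (real n)^2 * s"
  using Suc[folded s_def] by (rule norm_triangle_mono)
 moreover have "s / (real n)^2 + real k / (real n)^2 * s = real (Suc k) / (real n)^2 * s"
  by (simp add: add_divide_distrib distrib_right)
 ultimately show ?case unfolding s_def[symmetric] by simp
qed (simp add: flow_def)

text \<open>With Y the field, E |cis Y - 1| <= E |Y| <= sqrt (E Y^2), and both this second moment
  and the variance are small once the flow is below \<open>e\<close>.\<close>

lemma Fint_flow_near_1:
 assumes t: "tame n C p" and C: "C \<ge> 1" and e: "C * exp (- real k / (8 * (real n)^2)) \<le> e" "0 < e" "e \<le> 1"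
 shows "cmod (Fint (flow p k) - 1) \<le> exp ((1 + a) * C^2) * sqrt (20 * C * e) + (exp ((1 + a) * e^2) - 1)"
proof -
 let ?q = "flow p k"
 have tq: "tame n C ?q" by (rule tame_flow[OF t])
 have qp: "periodic_mod n ?q" "(\<Sum>x\<in>torus n. ?q x) = 0" using tq by (auto simp: tame_def)
 interpret T: test_function n \<mu> \<theta> a K l "fdiff n ?q" C by (rule tame_test_function[OF tq C])
 have S: "(\<Sum>x\<in>torus n. (fdiff n ?q x)^2) / real n \<le> e^2"
 proof -
  have "C^2 * exp (- real k / (4 * (real n)^2)) = (C * exp (- real k / (8 * (real n)^2)))^2"
   by (simp add: power_mult_distrib exp_double[symmetric])
  also have "... \<le> e^2" using e(1) C by (intro power_mono) auto
  finally show ?thesis using flow_decay[OF t, of k] by linarith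
 qed
 have q2: "(?q x)^2 \<le> e^2" for x using torus_sup_le_energy[OF qp(1) n_pos qp(2), of x] S by linarith
 have qe: "\<bar>?q x\<bar> \<le> e" for x using q2[of x] e(2) abs_le_square_iff[of "?q x" e] by simp
 have V: "E (\<lambda>s. (lfield n (fdiff n ?q) s)^2) \<le> 20 * C * e"
  by (rule T.field_second_moment[OF qp(1) _ qe e(2,3)]) (simp add: fdiff_def)
 have cv: "cov_form a n ?q / 2 \<le> (1 + a) * e^2"
 proof -
  have "(\<Sum>x\<in>torus n. (?q x)^2) \<le> (\<Sum>x\<in>torus n. e^2)" by (intro sum_mono q2)
  then have "(\<Sum>x\<in>torus n. (?q x)^2) / real n \<le> e^2" using n_pos by (simp add: divide_le_eq mult.commute)
  then have "cov_form a n ?q \<le> 1/4 * e^2 + a/2 * e^2" unfolding cov_form_def using S a_pos by (intro add_mono mult_left_mono) auto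
  moreover have "0 \<le> a * e^2" "0 \<le> e^2" using a_pos by auto
  ultimately show ?thesis by (simp only: distrib_right mult_1)
 qed
 define \<phi> where "\<phi> = E (\<lambda>s. cis (lfield n (fdiff n ?q) s))"
 have "cmod (\<phi> - 1) = cmod (E (\<lambda>s. cis (lfield n (fdiff n ?q) s) - cis 0))" by (simp add: \<phi>_def E_diff E_const)
 also have "... \<le> E (\<lambda>s. \<bar>lfield n (fdiff n ?q) s\<bar> * 1)" by (rule norm_E_le) (use cis_diff_le[of _ 0] in simp)
 also have "... \<le> sqrt (E (\<lambda>s. \<bar>lfield n (fdiff n ?q) s\<bar>^2)) * sqrt (E (\<lambda>_. 1^2))" by (rule E_cauchy_schwarz)
 also have "... \<le> sqrt (20 * C * e)" using V by (simp add: E_const)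
 finally have \<phi>: "cmod (\<phi> - 1) \<le> sqrt (20 * C * e)" .
 let ?G = "exp (cov_form a n ?q / 2)"
 have G1: "?G \<le> exp ((1 + a) * C^2)" using cov_form_bounds(2)[OF tq] by simp
 have "Fint ?q - 1 = complex_of_real ?G * (\<phi> - 1) + complex_of_real (?G - 1)" unfolding Fint_def \<phi>_def[symmetric] by (simp add: algebra_simps)
 also have "cmod ... \<le> exp ((1 + a) * C^2) * sqrt (20 * C * e) + (exp ((1 + a) * e^2) - 1)"
 proof (rule norm_triangle_mono)
  show "cmod (complex_of_real ?G * (\<phi> - 1)) \<le> exp ((1 + a) * C^2) * sqrt (20 * C * e)" unfolding norm_mult using G1 \<phi> by (intro mult_mono) auto
  have "1 \<le> ?G" using cov_form_bounds(1)[OF tq] by simp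
  then show "cmod (complex_of_real (?G - 1)) \<le> exp ((1 + a) * e^2) - 1" unfolding norm_of_real using cv by simp
 qed
 finally show ?thesis .
qed

text \<open>\<open>field_second_moment\<close> asks for a potential bounded by 1; dividing by
  \<open>C\<close> and scaling back gives the square of \<open>C\<close>.\<close>

lemma variance_bound:
 assumes t: "tame n C p" and C: "C \<ge> 1"
 shows "E (\<lambda>s. (lfield n (fdiff n p) s)^2) \<le> 20 * C^2"
proof -
 let ?p = "\<lambda>x. p x / C"
 have f: "fdiff n ?p x = fdiff n p x / C" for x by (simp add: fdiff_def diff_divide_distrib right_diff_distrib)
 have f2: "fdiff n ?p = (\<lambda>x. fdiff n p x / C)" by (rule ext) (rule f)
 have b: "\<bar>p x\<bar> \<le> C" "\<bar>fdiff n p x\<bar> \<le> C" "\<bar>fdiff n (fdiff n p) x\<bar> \<le> C" "\<bar>fdiff n (fdiff n (fdiff n p)) x\<bar> \<le> C" for x using t by (auto simp: tame_def)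
 have g: "fdiff n (\<lambda>x. u x / C) = (\<lambda>x. fdiff n u x / C)" for u by (rule ext) (simp add: fdiff_def diff_divide_distrib right_diff_distrib)
 have pp: "periodic_mod n ?p" using t by (auto simp: tame_def intro: periodic_mod_comp)
 have t1: "tame n 1 ?p"
  unfolding tame_def g using t pp b C by (auto simp: tame_def sum_divide_distrib[symmetric] divide_le_eq)
 interpret T: test_function n \<mu> \<theta> a K l "fdiff n ?p" 1 by (rule tame_test_function[OF t1]) simp
 have "E (\<lambda>s. (lfield n (fdiff n ?p) s)^2) \<le> 20 * 1 * 1"
  by (rule T.field_second_moment[OF pp]) (use b(1) C in \<open>auto simp: fdiff_def divide_le_eq\<close>)
 moreover have "lfield n (fdiff n ?p) s = lfield n (fdiff n p) s / C" for s
  unfolding f2 lfield_def by (simp add: sum_divide_distrib mult_ac)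
 ultimately have "E (\<lambda>s. 1 / C^2 * (lfield n (fdiff n p) s)^2) \<le> 20" by (simp add: power_divide)
 then show ?thesis unfolding E_cmult using C by (simp add: field_simps)
qed

end

section \<open>Convergence in distribution from characteristic functions\<close>

definition zero_outside :: "'i set => ('i => real) => 'i => real" where
 "zero_outside J v = (\<lambda>i. if i \<in> J then v i else 0)"

lemma measurable_zero_outside:
 "(\<And>i. i \<in> J ==> (\<lambda>\<omega>. X \<omega> i) \<in> borel_measurable M) ==> (\<lambda>\<omega>. zero_outside J (X \<omega>) i) \<in> borel_measurable M"
 by (cases "i \<in> J") (simp_all add: zero_outside_def)

text \<open>Thanks to the phase \<open>b\<close>, sines and constants are covered by cosines, and a
  single product formula closes the class under multiplication.\<close>

inductive_set trig_poly :: "'i set => (('i => real) => real) set" for J :: "'i set" where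
 trig_cos: "(\<lambda>x. c * cos ((\<Sum>i\<in>J. t i * x i) + b)) \<in> trig_poly J"
| trig_add: "f \<in> trig_poly J ==> g \<in> trig_poly J ==> (\<lambda>x. f x + g x) \<in> trig_poly J"

lemma trig_poly_mult_cos:
 "g \<in> trig_poly J ==> (\<lambda>x. (c * cos ((\<Sum>i\<in>J. t i * x i) + b)) * g x) \<in> trig_poly J"
proof (induction rule: trig_poly.induct)
 case (trig_cos c' t' b')
 have "(\<lambda>x. (c * cos ((\<Sum>i\<in>J. t i * x i) + b)) * (c' * cos ((\<Sum>i\<in>J. t' i * x i) + b'))) =
   (\<lambda>x. c * c' / 2 * cos ((\<Sum>i\<in>J. (t i - t' i) * x i) + (b - b')) + c * c' / 2 * cos ((\<Sum>i\<in>J. (t i + t' i) * x i) + (b + b')))"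
 proof
  fix x
  have "c * cos u * (c' * cos v) = c * c' / 2 * cos (u - v) + c * c' / 2 * cos (u + v)" for u v
   by (simp add: cos_diff cos_add field_simps)
  then show "(c * cos ((\<Sum>i\<in>J. t i * x i) + b)) * (c' * cos ((\<Sum>i\<in>J. t' i * x i) + b')) =
   c * c' / 2 * cos ((\<Sum>i\<in>J. (t i - t' i) * x i) + (b - b')) + c * c' / 2 * cos ((\<Sum>i\<in>J. (t i + t' i) * x i) + (b + b'))"
   by (simp add: left_diff_distrib distrib_right sum_subtractf sum.distrib algebra_simps)
 qed
 then show ?case by (simp only: trig_poly.intros)
next
 case (trig_add f g)
 then show ?case by (simp add: distrib_left trig_poly.intros)
qed

lemma trig_poly_mult:
 "f \<in> trig_poly J ==> g \<in> trig_poly J ==> (\<lambda>x. f x * g x) \<in> trig_poly J"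
proof (induction rule: trig_poly.induct)
 case (trig_cos c t b) then show ?case by (rule trig_poly_mult_cos)
next
 case (trig_add f g) then show ?case by (simp add: distrib_right trig_poly.intros)
qed

lemma trig_poly_zero_outside: "g \<in> trig_poly J ==> g (zero_outside J x) = g x"
 by (induction rule: trig_poly.induct) (auto simp: zero_outside_def intro!: arg_cong[where f=cos] sum.cong)

lemma compact_cube: "compact {s :: 'i => real. \<forall>i. \<bar>s i\<bar> \<le> 1 \<and> (i \<notin> J \<longrightarrow> s i = 0)}"
proof -
 have "compactin (product_topology (\<lambda>i. euclidean) UNIV) (PiE UNIV (\<lambda>i. if i \<in> J then {-1..1::real} else {0}))"
  by (subst compactin_PiE) auto
 moreover have "PiE UNIV (\<lambda>i. if i \<in> J then {-1..1::real} else {0}) = {s. \<forall>i. \<bar>s i\<bar> \<le> 1 \<and> (i \<notin> J \<longrightarrow> s i = 0)}"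
  unfolding PiE_UNIV_domain Pi_def by (intro Collect_cong all_cong1) (auto simp: abs_le_iff)
 ultimately show ?thesis by (simp add: euclidean_product_topology)
qed

text \<open>The map \<open>x \<mapsto> (2 L / pi) * arcsin (sin (pi * x / (2 L)))\<close> is the identity on \<open>[-L, L]\<close> and
 turns a continuous function into one that Stone-Weierstrass approximates by trigonometric
 polynomials on the whole space.\<close>

lemma trig_poly_approx:
 fixes \<phi> :: "('i::countable => real) => real" and e V B :: real
 assumes J: "finite J" and cont: "continuous_on {x. \<forall>i. i \<notin> J \<longrightarrow> x i = 0} \<phi>"
  and bd: "\<And>x. (\<forall>i. i \<notin> J \<longrightarrow> x i = 0) ==> \<bar>\<phi> x\<bar> \<le> B" and e: "e > 0"
 shows "\<exists>g\<in>trig_poly J. \<forall>x. \<bar>\<phi> (zero_outside J x) - g x\<bar> \<le> e * (1 + (\<Sum>i\<in>J. (x i)^2))"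
proof -
 have B: "0 \<le> B" using bd[of "\<lambda>_. 0"] by auto
 \<comment> \<open>Gives 2 B <= e L^2. Outside the cube [-L, L] the folded point may differ from the
   given one, and the error 2 B is then covered by e times the sum of squares.\<close>
 define L where "L = sqrt (2 * B / e) + 1"
 have L: "L > 0" using B e by (auto simp: L_def intro: add_nonneg_pos)
 have L2: "2 * B \<le> e * L^2"
 proof -
  have "2 * B / e = (sqrt (2 * B / e))^2" using B e by simp
  also have "... \<le> L^2" unfolding L_def using B e by (intro power_mono) auto
  finally show ?thesis using e by (simp add: field_simps)
 qed
 define c where "c = pi / (2 * L)"
 have c: "c > 0" using L by (simp add: c_def)
 define S where "S = {s :: 'i => real. \<forall>i. \<bar>s i\<bar> \<le> 1 \<and> (i \<notin> J \<longrightarrow> s i = 0)}"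
 define R where "R = {f. continuous_on S f \<and> (\<lambda>x. f (\<lambda>i. sin (c * x i))) \<in> trig_poly J}"
 interpret function_ring_on R S
 proof
  show "compact S" unfolding S_def by (rule compact_cube)
  show "continuous_on S f" if "f \<in> R" for f using that by (simp add: R_def)
  show "(\<lambda>x. f x + g x) \<in> R" if "f \<in> R" "g \<in> R" for f g
   using that by (auto simp: R_def intro: continuous_on_add trig_add)
  show "(\<lambda>x. f x * g x) \<in> R" if "f \<in> R" "g \<in> R" for f g
   using that by (auto simp: R_def intro: continuous_on_mult trig_poly_mult)
  show "(\<lambda>_. k) \<in> R" for k using trig_cos[of k "\<lambda>_. 0" J 0] by (auto simp: R_def)
  show "\<exists>f\<in>R. f x \<noteq> f y" if xy: "x \<in> S" "y \<in> S" "x \<noteq> y" for x y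
  proof -
   obtain i where i: "x i \<noteq> y i" using xy(3) by blast
   then have iJ: "i \<in> J" using xy by (auto simp: S_def)
   \<comment> \<open>A sine is a cosine with phase - pi / 2; the coordinates themselves separate the
     points of \<open>S\<close>.\<close>
   have "(\<lambda>x. 1 * cos ((\<Sum>j\<in>J. (if j = i then c else 0) * x j) + (- (pi/2)))) \<in> trig_poly J" by (rule trig_cos)
   also have "(\<lambda>x. 1 * cos ((\<Sum>j\<in>J. (if j = i then c else 0) * x j) + (- (pi/2)))) = (\<lambda>x. sin (c * x i))"
    using J iJ by (simp add: if_distrib[of "\<lambda>z. z * _"] cos_diff cong: if_cong)
   finally have tp: "(\<lambda>x. sin (c * x i)) \<in> trig_poly J" .
   have "continuous_on S (\<lambda>s :: 'i => real. s i)"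
    by (rule continuous_on_subset[OF continuous_on_product_coordinates]) simp
   then have "(\<lambda>s. s i) \<in> R" using tp by (simp add: R_def)
   then show ?thesis using i by (intro bexI[of _ "\<lambda>s. s i"])
  qed
 qed
 have arcsin_dom: "(\<lambda>i. arcsin (s i) / c) \<in> {x. \<forall>i. i \<notin> J \<longrightarrow> x i = 0}" if "s \<in> S" for s
  using that by (auto simp: S_def)
 have "continuous_on S (\<lambda>s i. arcsin (s i) / c)"
 proof (rule continuous_on_coordinatewise_then_product)
  fix i
  have "continuous_on S (\<lambda>s :: 'i => real. s i)"
   by (rule continuous_on_subset[OF continuous_on_product_coordinates]) simp
  moreover have "\<forall>s\<in>S. - 1 \<le> s i \<and> s i \<le> 1" by (simp add: S_def abs_le_iff minus_le_iff)
  ultimately have "continuous_on S (\<lambda>s. arcsin (s i))" by (rule continuous_on_arcsin)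
  then show "continuous_on S (\<lambda>s. arcsin (s i) / c)" by (rule continuous_on_divide[OF _ continuous_on_const]) (use c in auto)
 qed
 then have "continuous_on S (\<lambda>s. \<phi> (\<lambda>i. arcsin (s i) / c))"
  using arcsin_dom by (intro continuous_on_compose2[OF cont]) auto
 then obtain f where f: "f \<in> R" and fe: "\<And>s. s \<in> S ==> \<bar>\<phi> (\<lambda>i. arcsin (s i) / c) - f s\<bar> < e"
  using Stone_Weierstrass_basic[OF _ e] by blast
 define g where "g x = f (\<lambda>i. sin (c * x i))" for x
 have g: "g \<in> trig_poly J" using f unfolding R_def g_def by simp
 have "\<bar>\<phi> (zero_outside J x) - g x\<bar> \<le> e * (1 + (\<Sum>i\<in>J. (x i)^2))" for x
 proof -
  define z where "z = zero_outside J x"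
  have z0: "\<And>i. i \<notin> J ==> z i = 0" by (simp add: z_def zero_outside_def)
  define w where "w i = arcsin (sin (c * z i)) / c" for i
  have w0: "\<And>i. i \<notin> J ==> w i = 0" by (simp add: w_def z0)
  have "(\<lambda>i. sin (c * z i)) \<in> S" by (simp add: S_def z0)
  from fe[OF this] have 1: "\<bar>\<phi> w - g z\<bar> < e" by (simp add: g_def w_def[abs_def])
  have gz: "g z = g x" unfolding z_def by (rule trig_poly_zero_outside[OF g])
  have sn: "0 \<le> (\<Sum>i\<in>J. (x i)^2)" by (simp add: sum_nonneg)
  show ?thesis
  proof (cases "\<forall>i\<in>J. \<bar>x i\<bar> \<le> L")
   case True
   have "w i = z i" for i
   proof (cases "i \<in> J")
    case True
    have "\<bar>c * z i\<bar> \<le> c * L" using \<open>\<forall>i\<in>J. \<bar>x i\<bar> \<le> L\<close> True c by (simp add: z_def zero_outside_def abs_mult)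
    also have "c * L = pi / 2" using L by (simp add: c_def)
    finally have "arcsin (sin (c * z i)) = c * z i" by (intro arcsin_sin) auto
    then show ?thesis using c by (simp add: w_def)
   qed (simp add: w0 z0)
   then have "w = z" by blast
   then have "\<bar>\<phi> z - g x\<bar> \<le> e" using 1 gz by simp
   also have "e \<le> e * (1 + (\<Sum>i\<in>J. (x i)^2))" using e sn by simp
   finally show ?thesis by (simp add: z_def)
  next
   case False
   then obtain i where i: "i \<in> J" "L < \<bar>x i\<bar>" by force
   have "L^2 \<le> (x i)^2" using i L by (metis abs_of_pos less_imp_le power2_le_iff_abs_le abs_le_square_iff)
   also have "... \<le> (\<Sum>i\<in>J. (x i)^2)" using J i by (intro member_le_sum) auto
   finally have "2 * B \<le> e * (\<Sum>i\<in>J. (x i)^2)" using L2 e by (meson less_imp_le mult_left_mono order_trans)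
   moreover have "\<bar>\<phi> z\<bar> \<le> B" "\<bar>\<phi> w\<bar> \<le> B" using bd z0 w0 by auto
   ultimately show ?thesis using 1 unfolding gz z_def[symmetric] distrib_left by argo
  qed
 qed
 then show ?thesis using g by blast
qed

lemma trig_poly_measurable:
 "g \<in> trig_poly J ==> (\<And>i. i \<in> J ==> (\<lambda>\<omega>. X \<omega> i) \<in> borel_measurable M) ==> (\<lambda>\<omega>. g (X \<omega>)) \<in> borel_measurable M"
 by (induction rule: trig_poly.induct) auto

lemma trig_poly_bounded: "g \<in> trig_poly J ==> \<exists>B. \<forall>x. \<bar>g x\<bar> \<le> B"
proof (induction rule: trig_poly.induct)
 case (trig_cos c t b)
 have "\<bar>c * cos ((\<Sum>i\<in>J. t i * x i) + b)\<bar> \<le> \<bar>c\<bar>" for x by (simp add: abs_mult mult_left_le)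
 then show ?case by blast
next
 case (trig_add f g)
 then obtain B C where "\<And>x. \<bar>f x\<bar> \<le> B" "\<And>x. \<bar>g x\<bar> \<le> C" by blast
 then have "\<bar>f x + g x\<bar> \<le> B + C" for x by (meson abs_triangle_ineq add_mono order_trans)
 then show ?case by blast
qed

text \<open>\<phi> is continuous only on the subspace of points that vanish off \<open>J\<close>, so
  measurability is obtained from a pointwise limit of trigonometric polynomials.\<close>

lemma continuous_measurable_components:
 fixes \<phi> :: "('i::countable => real) => real" and e V B :: real
 assumes J: "finite J" and cont: "continuous_on {x. \<forall>i. i \<notin> J \<longrightarrow> x i = 0} \<phi>"
  and bd: "\<And>x. (\<forall>i. i \<notin> J \<longrightarrow> x i = 0) ==> \<bar>\<phi> x\<bar> \<le> B"
  and X: "\<And>i. i \<in> J ==> (\<lambda>\<omega>. X \<omega> i) \<in> borel_measurable M"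
 shows "(\<lambda>\<omega>. \<phi> (zero_outside J (X \<omega>))) \<in> borel_measurable M"
proof -
 have "\<forall>m. \<exists>g\<in>trig_poly J. \<forall>x. \<bar>\<phi> (zero_outside J x) - g x\<bar> \<le> inverse (real (Suc m)) * (1 + (\<Sum>i\<in>J. (x i)^2))"
  using trig_poly_approx[OF J cont bd] by simp
 then obtain g where g: "\<And>m. g m \<in> trig_poly J"
  and ap: "\<And>m x. \<bar>\<phi> (zero_outside J x) - g m x\<bar> \<le> inverse (real (Suc m)) * (1 + (\<Sum>i\<in>J. (x i)^2))" by metis
 show ?thesis
 proof (rule borel_measurable_LIMSEQ_real)
  show "(\<lambda>\<omega>. g m (X \<omega>)) \<in> borel_measurable M" for m by (rule trig_poly_measurable[OF g X])
  fix \<omega>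
  have "(\<lambda>m. inverse (real (Suc m)) * (1 + (\<Sum>i\<in>J. (X \<omega> i)^2))) \<longlonglongrightarrow> 0 * (1 + (\<Sum>i\<in>J. (X \<omega> i)^2))"
   by (intro tendsto_mult LIMSEQ_inverse_real_of_nat tendsto_const)
  then have lim: "(\<lambda>m. inverse (real (Suc m)) * (1 + (\<Sum>i\<in>J. (X \<omega> i)^2))) \<longlonglongrightarrow> 0" by simp
  have "norm (g m (X \<omega>) - \<phi> (zero_outside J (X \<omega>))) \<le> inverse (real (Suc m)) * (1 + (\<Sum>i\<in>J. (X \<omega> i)^2))" for m
   unfolding real_norm_def using ap[of "X \<omega>" m] by (simp only: abs_minus_commute)
  then have "(\<lambda>m. g m (X \<omega>) - \<phi> (zero_outside J (X \<omega>))) \<longlonglongrightarrow> 0"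
   by (intro Lim_null_comparison[OF always_eventually lim] allI)
  then show "(\<lambda>m. g m (X \<omega>)) \<longlonglongrightarrow> \<phi> (zero_outside J (X \<omega>))" by (simp add: LIM_zero_iff)
 qed
qed

lemma expectation_trig_poly_approx:
 fixes \<phi> :: "('i::countable => real) => real" and e V B :: real
 assumes M: "prob_space M" and J: "finite J" and cont: "continuous_on {x. \<forall>i. i \<notin> J \<longrightarrow> x i = 0} \<phi>"
  and bd: "\<And>x. (\<forall>i. i \<notin> J \<longrightarrow> x i = 0) ==> \<bar>\<phi> x\<bar> \<le> B"
  and X: "\<And>i. i \<in> J ==> (\<lambda>\<omega>. X \<omega> i) \<in> borel_measurable M"
  and X2: "\<And>i. i \<in> J ==> integrable M (\<lambda>\<omega>. (X \<omega> i)^2)" "\<And>i. i \<in> J ==> (\<integral>\<omega>. (X \<omega> i)^2 \<partial>M) \<le> V"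
  and g: "g \<in> trig_poly J" and e: "e \<ge> 0" "\<And>x. \<bar>\<phi> (zero_outside J x) - g x\<bar> \<le> e * (1 + (\<Sum>i\<in>J. (x i)^2))"
 shows "\<bar>(\<integral>\<omega>. \<phi> (zero_outside J (X \<omega>)) \<partial>M) - (\<integral>\<omega>. g (X \<omega>) \<partial>M)\<bar> \<le> e * (1 + card J * V)"
proof -
 interpret prob_space M by (rule M)
 have i1: "integrable M (\<lambda>\<omega>. \<phi> (zero_outside J (X \<omega>)))"
 proof (rule integrable_const_bound[where B=B])
  show "AE \<omega> in M. norm (\<phi> (zero_outside J (X \<omega>))) \<le> B" by (auto intro!: bd simp: zero_outside_def)
 qed (rule continuous_measurable_components[OF J cont bd X])
 obtain C where "\<And>x. \<bar>g x\<bar> \<le> C" using trig_poly_bounded[OF g] by blast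
 then have i2: "integrable M (\<lambda>\<omega>. g (X \<omega>))"
  by (intro integrable_const_bound[where B=C]) (auto intro!: trig_poly_measurable[OF g X])
 have i3: "integrable M (\<lambda>\<omega>. e * (1 + (\<Sum>i\<in>J. (X \<omega> i)^2)))"
  using X2(1) by (intro integrable_mult_right integrable_add integrable_sum) auto
 have "\<bar>(\<integral>\<omega>. \<phi> (zero_outside J (X \<omega>)) \<partial>M) - (\<integral>\<omega>. g (X \<omega>) \<partial>M)\<bar> = \<bar>\<integral>\<omega>. \<phi> (zero_outside J (X \<omega>)) - g (X \<omega>) \<partial>M\<bar>"
  using i1 i2 by simp
 also have "... \<le> (\<integral>\<omega>. \<bar>\<phi> (zero_outside J (X \<omega>)) - g (X \<omega>)\<bar> \<partial>M)"
  by (rule integral_abs_bound)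
 also have "... \<le> (\<integral>\<omega>. e * (1 + (\<Sum>i\<in>J. (X \<omega> i)^2)) \<partial>M)"
  using i1 i2 i3 by (intro integral_mono e(2)) auto
 also have "... = e * (1 + (\<Sum>i\<in>J. \<integral>\<omega>. (X \<omega> i)^2 \<partial>M))"
  using X2(1) by (simp add: prob_space)
 also have "... \<le> e * (1 + card J * V)"
  using X2(2) e(1) by (intro mult_left_mono add_left_mono sum_bounded_above) auto
 finally show ?thesis .
qed

lemma trig_poly_expectation_tendsto:
 fixes J :: "'j set"
 assumes M: "\<And>n. prob_space (M n)" and N: "prob_space N"
  and X: "\<And>n i. i \<in> J ==> (\<lambda>\<omega>. X n \<omega> i) \<in> borel_measurable (M n)"
  and Y: "\<And>i. i \<in> J ==> (\<lambda>\<omega>. Y \<omega> i) \<in> borel_measurable N"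
  and cf: "\<And>t. (\<lambda>n. \<integral>\<omega>. cis (\<Sum>i\<in>J. t i * X n \<omega> i) \<partial>M n) \<longlonglongrightarrow> (\<integral>\<omega>. cis (\<Sum>i\<in>J. t i * Y \<omega> i) \<partial>N)"
  and g: "g \<in> trig_poly J"
 shows "(\<lambda>n. \<integral>\<omega>. g (X n \<omega>) \<partial>M n) \<longlonglongrightarrow> (\<integral>\<omega>. g (Y \<omega>) \<partial>N)"
 using g
proof (induction rule: trig_poly.induct)
 case (trig_cos c t b)
 have eq: "(\<integral>\<omega>. c * cos ((\<Sum>i\<in>J. t i * Z \<omega> i) + b) \<partial>Q) = Re (c * cis b * (\<integral>\<omega>. cis (\<Sum>i\<in>J. t i * Z \<omega> i) \<partial>Q))"
  if Q: "prob_space Q" and Z: "\<And>i. i \<in> J ==> (\<lambda>\<omega>. Z \<omega> i) \<in> borel_measurable Q" for Q and Z :: "'x => 'j => real"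
 proof -
  interpret prob_space Q by (rule Q)
  have m: "(\<lambda>\<omega>. cis (\<Sum>i\<in>J. t i * Z \<omega> i)) \<in> borel_measurable Q"
   unfolding cis_conv_exp using Z by measurable
  then have i: "integrable Q (\<lambda>\<omega>. cis (\<Sum>i\<in>J. t i * Z \<omega> i))" by (intro integrable_const_bound[where B=1]) auto
  have "Re (c * cis b * (\<integral>\<omega>. cis (\<Sum>i\<in>J. t i * Z \<omega> i) \<partial>Q)) = Re (\<integral>\<omega>. c * cis b * cis (\<Sum>i\<in>J. t i * Z \<omega> i) \<partial>Q)"
   using i by simp
  also have "... = (\<integral>\<omega>. Re (c * cis b * cis (\<Sum>i\<in>J. t i * Z \<omega> i)) \<partial>Q)"
   using i by (intro integral_Re[symmetric] integrable_mult_right) auto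
  also have "... = (\<integral>\<omega>. c * cos ((\<Sum>i\<in>J. t i * Z \<omega> i) + b) \<partial>Q)"
   by (intro Bochner_Integration.integral_cong refl) (simp add: cos_add algebra_simps)
  finally show ?thesis by simp
 qed
 have 1: "(\<integral>\<omega>. c * cos ((\<Sum>i\<in>J. t i * X n \<omega> i) + b) \<partial>M n) = Re (c * cis b * (\<integral>\<omega>. cis (\<Sum>i\<in>J. t i * X n \<omega> i) \<partial>M n))" for n
  by (rule eq[OF M X])
 have 2: "(\<integral>\<omega>. c * cos ((\<Sum>i\<in>J. t i * Y \<omega> i) + b) \<partial>N) = Re (c * cis b * (\<integral>\<omega>. cis (\<Sum>i\<in>J. t i * Y \<omega> i) \<partial>N))"
  by (rule eq[OF N Y])
 show ?case unfolding 1 2 by (intro tendsto_intros cf)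
next
 case (trig_add f g)
 have i: "integrable Q (\<lambda>\<omega>. h (Z \<omega>))"
  if Q: "prob_space Q" and Z: "\<And>i. i \<in> J ==> (\<lambda>\<omega>. Z \<omega> i) \<in> borel_measurable Q" and h: "h \<in> trig_poly J" for Q and Z :: "'x => 'j => real" and h
 proof -
  interpret prob_space Q by (rule Q)
  obtain C where "\<And>x. \<bar>h x\<bar> \<le> C" using trig_poly_bounded[OF h] by blast
  then show ?thesis by (intro integrable_const_bound[where B=C]) (auto intro!: trig_poly_measurable[OF h Z])
 qed
 show ?case using trig_add.IH i[OF M X trig_add.hyps(1)] i[OF M X trig_add.hyps(2)] i[OF N Y trig_add.hyps(1)] i[OF N Y trig_add.hyps(2)]
  by (simp add: tendsto_add)
qed

text \<open>Uniform second moments replace tightness: the error in \<open>trig_poly_approx\<close>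
  grows quadratically, so it is small in mean uniformly in n, and for trigonometric polynomials
  convergence is the hypothesis \<open>cf\<close>.\<close>

theorem cf_convergence:
 fixes \<phi> :: "('i::countable => real) => real" and e V B :: real
 assumes M: "\<And>n. prob_space (M n)" and N: "prob_space N"
  and X: "\<And>n i. i \<in> J ==> (\<lambda>\<omega>. X n \<omega> i) \<in> borel_measurable (M n)"
  and X2: "\<And>n i. i \<in> J ==> integrable (M n) (\<lambda>\<omega>. (X n \<omega> i)^2)" "\<And>n i. i \<in> J ==> (\<integral>\<omega>. (X n \<omega> i)^2 \<partial>M n) \<le> V"
  and Y: "\<And>i. i \<in> J ==> (\<lambda>\<omega>. Y \<omega> i) \<in> borel_measurable N"
  and Y2: "\<And>i. i \<in> J ==> integrable N (\<lambda>\<omega>. (Y \<omega> i)^2)" "\<And>i. i \<in> J ==> (\<integral>\<omega>. (Y \<omega> i)^2 \<partial>N) \<le> V"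
  and cf: "\<And>t. (\<lambda>n. \<integral>\<omega>. cis (\<Sum>i\<in>J. t i * X n \<omega> i) \<partial>M n) \<longlonglongrightarrow> (\<integral>\<omega>. cis (\<Sum>i\<in>J. t i * Y \<omega> i) \<partial>N)"
  and J: "finite J" and cont: "continuous_on {x. \<forall>i. i \<notin> J \<longrightarrow> x i = 0} \<phi>"
  and bd: "\<And>x. (\<forall>i. i \<notin> J \<longrightarrow> x i = 0) ==> \<bar>\<phi> x\<bar> \<le> B"
 shows "(\<lambda>n. \<integral>\<omega>. \<phi> (zero_outside J (X n \<omega>)) \<partial>M n) \<longlonglongrightarrow> (\<integral>\<omega>. \<phi> (zero_outside J (Y \<omega>)) \<partial>N)"
proof (rule LIMSEQ_I)
 fix r :: real assume r: "0 < r"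
 define W where "W = 1 + card J * max V 0"
 have W: "W > 0" by (simp add: W_def add_pos_nonneg)
 define e where "e = r / (4 * W)"
 have e: "e > 0" "e * W = r / 4" using r W by (auto simp: e_def)
 obtain g where g: "g \<in> trig_poly J" and ge: "\<And>x. \<bar>\<phi> (zero_outside J x) - g x\<bar> \<le> e * (1 + (\<Sum>i\<in>J. (x i)^2))"
  using trig_poly_approx[OF J cont bd e(1)] by blast
 have 1: "\<bar>(\<integral>\<omega>. \<phi> (zero_outside J (X n \<omega>)) \<partial>M n) - (\<integral>\<omega>. g (X n \<omega>) \<partial>M n)\<bar> \<le> r / 4" for n
  unfolding e(2)[symmetric] W_def
  by (rule expectation_trig_poly_approx[OF M J cont bd X X2(1) _ g]) (use X2(2) e ge in \<open>auto simp: le_max_iff_disj\<close>)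
 have 2: "\<bar>(\<integral>\<omega>. \<phi> (zero_outside J (Y \<omega>)) \<partial>N) - (\<integral>\<omega>. g (Y \<omega>) \<partial>N)\<bar> \<le> r / 4"
  unfolding e(2)[symmetric] W_def
  by (rule expectation_trig_poly_approx[OF N J cont bd Y Y2(1) _ g]) (use Y2(2) e ge in \<open>auto simp: le_max_iff_disj\<close>)
 obtain n0 where n0: "\<And>n. n \<ge> n0 ==> \<bar>(\<integral>\<omega>. g (X n \<omega>) \<partial>M n) - (\<integral>\<omega>. g (Y \<omega>) \<partial>N)\<bar> < r / 4"
  using LIMSEQ_D[OF trig_poly_expectation_tendsto[OF M N X Y cf g], of "r / 4"] r by auto
 show "\<exists>no. \<forall>n\<ge>no. norm ((\<integral>\<omega>. \<phi> (zero_outside J (X n \<omega>)) \<partial>M n) - (\<integral>\<omega>. \<phi> (zero_outside J (Y \<omega>)) \<partial>N)) < r"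
 proof (intro exI allI impI)
  fix n assume "n \<ge> n0"
  from n0[OF this] 1[of n] 2 r show "norm ((\<integral>\<omega>. \<phi> (zero_outside J (X n \<omega>)) \<partial>M n) - (\<integral>\<omega>. \<phi> (zero_outside J (Y \<omega>)) \<partial>N)) < r"
   unfolding real_norm_def by argo
 qed
qed

section \<open>Laws determined by their characteristic functions\<close>

lemma closed_indicator_limit:
 fixes A :: "'a::metric_space set"
 assumes "closed A" "A \<noteq> {}"
 shows "(\<lambda>m. max 0 (1 - real m * infdist x A)) \<longlonglongrightarrow> indicator A x"
proof (cases "x \<in> A")
 case True then show ?thesis by simp
next
 case False
 then have d: "infdist x A > 0" using assms in_closed_iff_infdist_zero infdist_nonneg by (metis less_le)
 obtain m0 :: nat where "1 / infdist x A < real m0" using reals_Archimedean2 by blast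
 then have "1 \<le> real m * infdist x A" if "m \<ge> m0" for m
 proof -
  have "1 / infdist x A \<le> real m" using \<open>1 / infdist x A < real m0\<close> that by linarith
  then show ?thesis using d by (simp add: pos_divide_le_eq)
 qed
 then have "eventually (\<lambda>m. max 0 (1 - real m * infdist x A) = indicator A x) sequentially"
  using False by (intro eventually_sequentiallyI[of m0]) auto
 then show ?thesis by (rule tendsto_eventually)
qed

lemma measure_eqI_closed:
 fixes M N :: "'a::metric_space measure"
 assumes M: "prob_space M" "sets M = sets borel" and N: "prob_space N" "sets N = sets borel"
  and eq: "\<And>f :: 'a => real. continuous_on UNIV f ==> (\<And>x. \<bar>f x\<bar> \<le> 1) ==> (\<integral>x. f x \<partial>M) = (\<integral>x. f x \<partial>N)"
 shows "M = N"
proof -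
 interpret M: prob_space M by (rule M)
 interpret N: prob_space N by (rule N)
 have cl: "emeasure M A = emeasure N A" if A: "closed A" for A
 proof (cases "A = {}")
  case False
  define f where "f m x = max 0 (1 - real m * infdist x A)" for m x
  have c: "continuous_on UNIV (f m)" for m unfolding f_def by (intro continuous_intros)
  have b: "\<bar>f m x\<bar> \<le> 1" for m x unfolding f_def using infdist_nonneg[of x A] by auto
  have fm: "f m \<in> borel_measurable borel" for m using c by (rule borel_measurable_continuous_onI)
  have lim: "(\<lambda>m. \<integral>x. f m x \<partial>Q) \<longlonglongrightarrow> measure Q A" if Q: "prob_space Q" "sets Q = sets borel" for Q
  proof -
   interpret Q: prob_space Q by (rule Q)
   have mc: "borel_measurable Q = (borel_measurable borel :: ('a => real) set)" by (rule measurable_cong_sets) (simp_all add: Q)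
   have "(\<lambda>m. \<integral>x. f m x \<partial>Q) \<longlonglongrightarrow> (\<integral>x. indicator A x \<partial>Q)"
   proof (rule integral_dominated_convergence[where w="\<lambda>_. 1"])
    show "AE x in Q. (\<lambda>m. f m x) \<longlonglongrightarrow> indicator A x" unfolding f_def by (intro AE_I2 closed_indicator_limit A False)
    show "\<And>m. AE x in Q. norm (f m x) \<le> 1" using b by simp
   qed (use A fm in \<open>simp_all add: mc\<close>)
   then show ?thesis using A by (simp add: Q sets_eq_imp_space_eq[OF Q(2)])
  qed
  have "measure M A = measure N A"
   using lim[OF M] lim[OF N] unfolding eq[OF c b] by (rule LIMSEQ_unique)
  then show ?thesis by (simp add: M.emeasure_eq_measure N.emeasure_eq_measure)
 qed simp
 show ?thesis
 proof (rule measure_eqI_generator_eq[where E="Collect closed" and \<Omega>=UNIV and A="\<lambda>_. UNIV"])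
  show "Int_stable (Collect closed :: 'a set set)" by (auto simp: Int_stable_def)
  show "sets M = sigma_sets UNIV (Collect closed)" "sets N = sigma_sets UNIV (Collect closed)"
   by (simp_all add: M N borel_eq_closed)
  show "emeasure M UNIV \<noteq> \<infinity>" by simp
 qed (use cl in auto)
qed

text \<open>Uniqueness is \<open>cf_convergence\<close> for constant sequences: both laws give the
  same integral to bounded continuous functions.\<close>

lemma law_eq_of_cf_nat:
 fixes J :: "nat set" and X :: "'w => nat => real" and Y :: "'v => nat => real"
 assumes M: "prob_space M" and N: "prob_space N" and J: "finite J"
  and X: "\<And>i. i \<in> J ==> (\<lambda>\<omega>. X \<omega> i) \<in> borel_measurable M"
  and X2: "\<And>i. i \<in> J ==> integrable M (\<lambda>\<omega>. (X \<omega> i)^2)"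
  and Y: "\<And>i. i \<in> J ==> (\<lambda>\<omega>. Y \<omega> i) \<in> borel_measurable N"
  and Y2: "\<And>i. i \<in> J ==> integrable N (\<lambda>\<omega>. (Y \<omega> i)^2)"
  and cf: "\<And>t. (\<integral>\<omega>. cis (\<Sum>i\<in>J. t i * X \<omega> i) \<partial>M) = (\<integral>\<omega>. cis (\<Sum>i\<in>J. t i * Y \<omega> i) \<partial>N)"
 shows "distr M borel (\<lambda>\<omega>. zero_outside J (X \<omega>)) = distr N borel (\<lambda>\<omega>. zero_outside J (Y \<omega>))"
proof -
 interpret M: prob_space M by (rule M)
 interpret N: prob_space N by (rule N)
 have mX: "(\<lambda>\<omega>. zero_outside J (X \<omega>)) \<in> measurable M borel"
  using X by (intro measurable_coordinatewise_then_product measurable_zero_outside)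
 have mY: "(\<lambda>\<omega>. zero_outside J (Y \<omega>)) \<in> measurable N borel"
  using Y by (intro measurable_coordinatewise_then_product measurable_zero_outside)
 show ?thesis
 proof (rule measure_eqI_closed)
  fix f :: "(nat => real) => real" assume f: "continuous_on UNIV f" "\<And>x. \<bar>f x\<bar> \<le> 1"
  define V where "V = (\<Sum>i\<in>J. (\<integral>\<omega>. (X \<omega> i)^2 \<partial>M)) + (\<Sum>i\<in>J. (\<integral>\<omega>. (Y \<omega> i)^2 \<partial>N))"
  have VX: "(\<integral>\<omega>. (X \<omega> i)^2 \<partial>M) \<le> V" if "i \<in> J" for i
   unfolding V_def using J that by (intro add_increasing2 member_le_sum sum_nonneg) auto
  have VY: "(\<integral>\<omega>. (Y \<omega> i)^2 \<partial>N) \<le> V" if "i \<in> J" for i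
   unfolding V_def using J that by (intro add_increasing member_le_sum sum_nonneg) auto
  have "(\<lambda>n::nat. \<integral>\<omega>. f (zero_outside J (X \<omega>)) \<partial>M) \<longlonglongrightarrow> (\<integral>\<omega>. f (zero_outside J (Y \<omega>)) \<partial>N)"
   by (rule cf_convergence[OF M N X X2 VX Y Y2 VY _ J continuous_on_subset[OF f(1)] f(2)])
     (simp_all add: cf)
  then have "(\<integral>\<omega>. f (zero_outside J (X \<omega>)) \<partial>M) = (\<integral>\<omega>. f (zero_outside J (Y \<omega>)) \<partial>N)"
   by (simp add: LIMSEQ_const_iff)
  then show "(\<integral>x. f x \<partial>distr M borel (\<lambda>\<omega>. zero_outside J (X \<omega>))) = (\<integral>x. f x \<partial>distr N borel (\<lambda>\<omega>. zero_outside J (Y \<omega>)))"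
   using mX mY f(1) by (simp add: integral_distr borel_measurable_continuous_onI)
 qed (use mX mY in \<open>simp_all add: M.prob_space_distr N.prob_space_distr\<close>)
qed

text \<open>The Gaussian field is indexed by functions, an uncountable type, whereas the previous
  lemma works with Borel sets of sequences. A bijection of \<open>J\<close> with an initial segment
  carries it over.\<close>

lemma law_eq_of_cf:
 fixes J :: "'i set" and X :: "'w => 'i => real" and Y :: "'v => 'i => real"
 assumes M: "prob_space M" and N: "prob_space N" and J: "finite J"
  and X: "\<And>i. i \<in> J ==> (\<lambda>\<omega>. X \<omega> i) \<in> borel_measurable M"
  and X2: "\<And>i. i \<in> J ==> integrable M (\<lambda>\<omega>. (X \<omega> i)^2)"
  and Y: "\<And>i. i \<in> J ==> (\<lambda>\<omega>. Y \<omega> i) \<in> borel_measurable N"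
  and Y2: "\<And>i. i \<in> J ==> integrable N (\<lambda>\<omega>. (Y \<omega> i)^2)"
  and cf: "\<And>t. (\<integral>\<omega>. cis (\<Sum>i\<in>J. t i * X \<omega> i) \<partial>M) = (\<integral>\<omega>. cis (\<Sum>i\<in>J. t i * Y \<omega> i) \<partial>N)"
 shows "distr M (PiM J (\<lambda>_. borel)) (\<lambda>\<omega>. restrict (X \<omega>) J) = distr N (PiM J (\<lambda>_. borel)) (\<lambda>\<omega>. restrict (Y \<omega>) J)"
proof -
 obtain h where h: "bij_betw h J {0..<card J}" using J ex_bij_betw_finite_nat by blast
 let ?K = "{0..<card J}"
 define g where "g = inv_into J h"
 have g: "bij_betw g ?K J" unfolding g_def by (rule bij_betw_inv_into[OF h])
 have gh: "g (h i) = i" if "i \<in> J" for i unfolding g_def using h that by (simp add: bij_betw_inv_into_left)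
 have hK: "h i \<in> ?K" if "i \<in> J" for i using h that by (rule bij_betwE[rule_format])
 have gJ: "g k \<in> J" if "k \<in> ?K" for k using g that by (rule bij_betwE[rule_format])
 define R where "R s = (\<lambda>i\<in>J. s (h i))" for s :: "nat => real"
 have R: "R \<in> measurable borel (PiM J (\<lambda>_. borel))"
  unfolding R_def by (intro measurable_restrict) (auto intro: borel_measurable_continuous_onI continuous_on_product_coordinates)
 have mX: "(\<lambda>\<omega>. zero_outside ?K (\<lambda>k. X \<omega> (g k))) \<in> measurable M borel"
  using X[OF gJ] by (intro measurable_coordinatewise_then_product measurable_zero_outside)
 have mY: "(\<lambda>\<omega>. zero_outside ?K (\<lambda>k. Y \<omega> (g k))) \<in> measurable N borel"
  using Y[OF gJ] by (intro measurable_coordinatewise_then_product measurable_zero_outside)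
 have RX: "R (zero_outside ?K (\<lambda>k. Z (g k))) = restrict Z J" for Z
  using hK gh by (auto simp: R_def zero_outside_def restrict_def)
 have reindex: "(\<Sum>k\<in>?K. t k * Z (g k)) = (\<Sum>i\<in>J. t (h i) * Z i)" for t and Z :: "'i => real"
  using gh by (intro sum.reindex_bij_betw[OF h, of "\<lambda>k. t k * Z (g k)", symmetric, THEN trans] sum.cong) auto
 have "distr M borel (\<lambda>\<omega>. zero_outside ?K (\<lambda>k. X \<omega> (g k))) = distr N borel (\<lambda>\<omega>. zero_outside ?K (\<lambda>k. Y \<omega> (g k)))"
  by (rule law_eq_of_cf_nat[OF M N]) (use X X2 Y Y2 gJ in \<open>auto simp: reindex cf\<close>)
 then have "distr (distr M borel (\<lambda>\<omega>. zero_outside ?K (\<lambda>k. X \<omega> (g k)))) (PiM J (\<lambda>_. borel)) R =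
   distr (distr N borel (\<lambda>\<omega>. zero_outside ?K (\<lambda>k. Y \<omega> (g k)))) (PiM J (\<lambda>_. borel)) R" by simp
 then show ?thesis by (simp add: distr_distr[OF R mX] distr_distr[OF R mY] o_def RX)
qed

section \<open>Gaussian fields\<close>

definition pos_semidef :: "'v set => ('v => 'v => real) => bool" where
 "pos_semidef V C \<longleftrightarrow> (\<forall>i\<in>V. \<forall>j\<in>V. C i j = C j i) \<and>
   (\<forall>F c. finite F \<longrightarrow> F \<subseteq> V \<longrightarrow> 0 \<le> (\<Sum>i\<in>F. \<Sum>j\<in>F. c i * c j * C i j))"

lemma pos_semidef_subset: "pos_semidef V C ==> W \<subseteq> V ==> pos_semidef W C"
 unfolding pos_semidef_def by (meson subset_iff subset_trans)

lemma pos_semidefD: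
 "pos_semidef V C ==> finite F ==> F \<subseteq> V ==> 0 \<le> (\<Sum>i\<in>F. \<Sum>j\<in>F. c i * c j * C i j)"
 unfolding pos_semidef_def by blast

lemma quadratic_form_insert:
 fixes C :: "'v => 'v => real"
 assumes "finite F" "p \<notin> F" "\<And>i. i \<in> F ==> C i p = C p i"
 shows "(\<Sum>i\<in>insert p F. \<Sum>j\<in>insert p F. c i * c j * C i j) =
  c p ^ 2 * C p p + 2 * c p * (\<Sum>j\<in>F. c j * C p j) + (\<Sum>i\<in>F. \<Sum>j\<in>F. c i * c j * C i j)"
proof -
 have "(\<Sum>i\<in>F. \<Sum>j\<in>insert p F. c i * c j * C i j) = c p * (\<Sum>j\<in>F. c j * C p j) + (\<Sum>i\<in>F. \<Sum>j\<in>F. c i * c j * C i j)"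
  using assms by (simp add: sum.distrib sum_distrib_left mult_ac)
 moreover have "(\<Sum>j\<in>F. c p * c j * C p j) = c p * (\<Sum>j\<in>F. c j * C p j)"
  by (simp add: sum_distrib_left mult.assoc)
 ultimately show ?thesis using assms(1,2) by (simp add: power2_eq_square)
qed

text \<open>Cholesky factorization by induction on the index set: one pivot is split off, and the
  Schur complement is again positive semidefinite. A zero pivot forces its row to vanish.\<close>

lemma gram_factorization:
 assumes "finite F" "pos_semidef F C"
 shows "\<exists>m A. \<forall>i\<in>F. \<forall>j\<in>F. C i j = (\<Sum>k<(m::nat). A i k * (A j k :: real))"
 using assms
proof (induction F arbitrary: C)
 case (insert p F)
 have sym: "C i j = C j i" if "i \<in> insert p F" "j \<in> insert p F" for i j
  using insert.prems that unfolding pos_semidef_def by blast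
 have "0 \<le> (\<Sum>i\<in>{p}. \<Sum>j\<in>{p}. 1 * 1 * C i j)"
  by (intro pos_semidefD[OF insert.prems]) auto
 then have "0 \<le> C p p" by simp
 show ?case
 proof (cases "C p p = 0")
  case True
  have z: "C p q = 0" if q: "q \<in> F" for q
  proof (rule ccontr)
   assume nz: "C p q \<noteq> 0"
   \<comment> \<open>With C p p = 0 the form takes the value 2 * c p * C p q + C q q = -1 at this
     vector.\<close>
   define c where "c i = (if i = p then - (C q q + 1) / (2 * C p q) else (1::real))" for i
   have pq: "p \<notin> {q}" using q insert.hyps by auto
   have "0 \<le> (\<Sum>i\<in>insert p {q}. \<Sum>j\<in>insert p {q}. c i * c j * C i j)"
    using q by (intro pos_semidefD[OF insert.prems]) auto
   also have "... = c p ^ 2 * C p p + 2 * c p * (\<Sum>j\<in>{q}. c j * C p j) + (\<Sum>i\<in>{q}. \<Sum>j\<in>{q}. c i * c j * C i j)"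
    using pq q sym by (intro quadratic_form_insert) auto
   also have "... = -1" using pq nz True by (auto simp: c_def field_simps)
   finally show False by simp
  qed
  obtain m A where A: "\<forall>i\<in>F. \<forall>j\<in>F. C i j = (\<Sum>k<(m::nat). A i k * (A j k :: real))"
   using insert.IH[of C] insert.prems pos_semidef_subset by (metis subset_insertI)
  have "\<forall>i\<in>insert p F. \<forall>j\<in>insert p F. C i j = (\<Sum>k<m. (if i = p then 0 else A i k) * (if j = p then 0 else A j k))"
   using A z True sym insert.hyps by (auto intro!: sum.cong[OF refl])
  then show ?thesis by (intro exI[of _ m] exI[of _ "\<lambda>i k. if i = p then 0 else A i k"])
 next
  case False
  then have pp: "C p p > 0" using \<open>0 \<le> C p p\<close> by simp
  define C' where "C' i j = C i j - C p i * C p j / C p p" for i j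
  have "pos_semidef F C'"
   unfolding pos_semidef_def
  proof (intro conjI allI impI ballI)
   show "C' i j = C' j i" if "i \<in> F" "j \<in> F" for i j using sym that by (simp add: C'_def)
   fix G and c :: "'a => real" assume G: "finite G" "G \<subseteq> F"
   define s where "s = (\<Sum>j\<in>G. c j * C p j)"
   \<comment> \<open>The coefficient of \<open>p\<close> that minimizes the form for given
     coefficients on \<open>G\<close>; the minimum is the form of \<open>C'\<close>.\<close>
   define c' where "c' i = (if i = p then - s / C p p else c i)" for i
   have pG: "p \<notin> G" using G insert.hyps by auto
   have "0 \<le> (\<Sum>i\<in>insert p G. \<Sum>j\<in>insert p G. c' i * c' j * C i j)"
    using G by (intro pos_semidefD[OF insert.prems]) auto
   also have "... = c' p ^ 2 * C p p + 2 * c' p * (\<Sum>j\<in>G. c' j * C p j) + (\<Sum>i\<in>G. \<Sum>j\<in>G. c' i * c' j * C i j)"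
    using G pG sym by (intro quadratic_form_insert) auto
   also have "(\<Sum>j\<in>G. c' j * C p j) = s" unfolding s_def using pG by (intro sum.cong) (auto simp: c'_def)
   also have "(\<Sum>i\<in>G. \<Sum>j\<in>G. c' i * c' j * C i j) = (\<Sum>i\<in>G. \<Sum>j\<in>G. c i * c j * C i j)"
    using pG by (intro sum.cong[OF refl]) (auto simp: c'_def)
   also have "c' p ^ 2 * C p p + 2 * c' p * s + (\<Sum>i\<in>G. \<Sum>j\<in>G. c i * c j * C i j) = (\<Sum>i\<in>G. \<Sum>j\<in>G. c i * c j * C i j) - s * s / C p p"
    using pp by (simp add: c'_def power2_eq_square field_simps)
   also have "s * s / C p p = (\<Sum>i\<in>G. \<Sum>j\<in>G. c i * c j * (C p i * C p j / C p p))"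
    unfolding s_def sum_product sum_divide_distrib by (intro sum.cong[OF refl]) (simp add: mult_ac)
   also have "(\<Sum>i\<in>G. \<Sum>j\<in>G. c i * c j * C i j) - ... = (\<Sum>i\<in>G. \<Sum>j\<in>G. c i * c j * C' i j)"
    by (simp add: C'_def right_diff_distrib sum_subtractf)
   finally show "0 \<le> (\<Sum>i\<in>G. \<Sum>j\<in>G. c i * c j * C' i j)" .
  qed
  then obtain m A where A: "\<forall>i\<in>F. \<forall>j\<in>F. C' i j = (\<Sum>k<(m::nat). A i k * (A j k :: real))"
   using insert.IH[of C'] by blast
  define B where "B i k = (if k = m then C p i / sqrt (C p p) else if i = p then 0 else A i k)" for i k
  have "C i j = (\<Sum>k<Suc m. B i k * B j k)" if ij: "i \<in> insert p F" "j \<in> insert p F" for i j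
  proof -
   have "(\<Sum>k<Suc m. B i k * B j k) = (\<Sum>k<m. (if i = p then 0 else A i k) * (if j = p then 0 else A j k)) + C p i * C p j / C p p"
    using pp by (simp add: B_def)
   also have "(\<Sum>k<m. (if i = p then 0 else A i k) * (if j = p then 0 else A j k)) = C' i j"
    using A ij insert.hyps sym pp by (auto simp: C'_def intro!: sum.cong[OF refl])
   finally show ?thesis by (simp add: C'_def)
  qed
  then show ?thesis by blast
 qed
qed simp

lemma prob_std_normal: "prob_space std_normal_distribution"
 using real_dist_normal_dist by (simp add: real_distribution_def)

lemma cis_std_normal: "(\<integral>z. cis (t * z) \<partial>std_normal_distribution) = complex_of_real (exp (- t\<^sup>2 / 2))"
 using char_std_normal_distribution unfolding char_def cis_conv_exp[symmetric] by meson

lemma centered_gaussian_moments: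
 assumes X: "X \<in> borel_measurable M" and d: "distr M borel X = distr std_normal_distribution borel (\<lambda>z. s * z)"
 shows "integrable M X" "integrable M (\<lambda>\<omega>. (X \<omega>)^2)" "(\<integral>\<omega>. X \<omega> \<partial>M) = 0" "(\<integral>\<omega>. (X \<omega>)^2 \<partial>M) = s^2"
proof -
 have m: "(\<lambda>z. s * z) \<in> measurable std_normal_distribution borel" by simp
 have 1: "integrable std_normal_distribution (\<lambda>z. z)" using integrable_std_normal_distribution_moment[of 1] by simp
 have 2: "integrable std_normal_distribution (\<lambda>z. z^2)" by (rule integrable_std_normal_distribution_moment)
 have e1: "(\<integral>z. z \<partial>std_normal_distribution) = 0" using integral_std_normal_distribution_moment_odd[of 1] by simp
 have e2: "(\<integral>z. z^2 \<partial>std_normal_distribution) = 1" using std_normal_distribution_even_moments(1)[of 1] by (simp add: fact_2)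
 have t: "integrable M (\<lambda>\<omega>. f (X \<omega>)) \<longleftrightarrow> integrable std_normal_distribution (\<lambda>z. f (s * z))"
  if "f \<in> borel_measurable borel" for f :: "real => real"
  using integrable_distr_eq[OF X that] integrable_distr_eq[OF m that] unfolding d by simp
 have u: "(\<integral>\<omega>. f (X \<omega>) \<partial>M) = (\<integral>z. f (s * z) \<partial>std_normal_distribution)"
  if "f \<in> borel_measurable borel" for f :: "real => real"
  using integral_distr[OF X that] integral_distr[OF m that] unfolding d by simp
 have b1: "(\<lambda>z. z) \<in> borel_measurable (borel :: real measure)" and b2: "(\<lambda>z. z^2) \<in> borel_measurable (borel :: real measure)"
  by simp_all
 have "integrable std_normal_distribution (\<lambda>z. s * z)" by (rule integrable_mult_right[OF 1])
 then show "integrable M X" by (rule t[OF b1, THEN iffD2])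
 have "integrable std_normal_distribution (\<lambda>z. (s * z)^2)" unfolding power_mult_distrib by (rule integrable_mult_right[OF 2])
 then show "integrable M (\<lambda>\<omega>. (X \<omega>)^2)" by (rule t[OF b2, THEN iffD2])
 show "(\<integral>\<omega>. X \<omega> \<partial>M) = 0" unfolding u[OF b1] integral_mult_right_zero e1 by simp
 show "(\<integral>\<omega>. (X \<omega>)^2 \<partial>M) = s^2" unfolding u[OF b2] power_mult_distrib integral_mult_right_zero e2 by simp
qed

lemma gaussian_of_cf:
 assumes M: "prob_space M" and X: "X \<in> borel_measurable M" and v: "0 \<le> v"
  and cf: "\<And>u. (\<integral>\<omega>. cis (u * X \<omega>) \<partial>M) = complex_of_real (exp (- (u^2 * v) / 2))"
 shows "distr M borel X = distr std_normal_distribution borel (\<lambda>z. sqrt v * z)"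
proof (rule Levy_uniqueness)
 interpret prob_space M by (rule M)
 show "real_distribution (distr M borel X)" using X by (rule real_distribution_distr)
 show "real_distribution (distr std_normal_distribution borel (\<lambda>z. sqrt v * z))"
  using prob_space.real_distribution_distr[OF prob_std_normal] by simp
 show "char (distr M borel X) = char (distr std_normal_distribution borel (\<lambda>z. sqrt v * z))"
 proof
  fix u
  have m: "(\<lambda>x. iexp (u * x)) \<in> borel_measurable borel"
   by (intro borel_measurable_continuous_onI continuous_intros)
  have "char (distr M borel X) u = (\<integral>\<omega>. cis (u * X \<omega>) \<partial>M)"
   unfolding char_def cis_conv_exp by (rule integral_distr[OF X m])
  also have "... = (\<integral>z. cis ((u * sqrt v) * z) \<partial>std_normal_distribution)"
   unfolding cf cis_std_normal using v by (simp add: power_mult_distrib)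
  also have "... = char (distr std_normal_distribution borel (\<lambda>z. sqrt v * z)) u"
   unfolding char_def cis_conv_exp mult.assoc by (rule integral_distr[OF _ m, symmetric]) simp
  finally show "char (distr M borel X) u = char (distr std_normal_distribution borel (\<lambda>z. sqrt v * z)) u" .
 qed
qed

text \<open>The image of independent standard normals under the factor \<open>A\<close>; degenerate
  covariances are included.\<close>

lemma gaussian_vector_exists:
 assumes J: "finite J" and C: "pos_semidef J C"
 shows "\<exists>Q :: ('v => real) measure. prob_space Q \<and> sets Q = sets (PiM J (\<lambda>_. borel)) \<and>
  (\<forall>t. (\<integral>\<omega>. cis (\<Sum>i\<in>J. t i * \<omega> i) \<partial>Q) = complex_of_real (exp (- (\<Sum>i\<in>J. \<Sum>j\<in>J. t i * t j * C i j) / 2)))"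
proof -
 obtain m A where A: "\<forall>i\<in>J. \<forall>j\<in>J. C i j = (\<Sum>k<(m::nat). A i k * (A j k :: real))"
  using gram_factorization[OF J C] by blast
 define G where "G = PiM {..<m} (\<lambda>_. std_normal_distribution)"
 interpret product_prob_space "\<lambda>_::nat. std_normal_distribution" "{..<m}"
  by (intro product_prob_spaceI prob_std_normal)
 interpret G: prob_space G unfolding G_def by (rule prob_space_axioms)
 define X where "X \<xi> = (\<lambda>i\<in>J. \<Sum>k<m. A i k * \<xi> k)" for \<xi>
 have comp: "(\<lambda>\<xi>. \<xi> k) \<in> borel_measurable G" if "k < m" for k
  unfolding G_def using measurable_component_singleton[of k "{..<m}" "\<lambda>_. std_normal_distribution"] that by simp
 have X: "X \<in> measurable G (PiM J (\<lambda>_. borel))"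
  unfolding X_def using comp by (intro measurable_restrict borel_measurable_sum) auto
 define Q where "Q = distr G (PiM J (\<lambda>_. borel)) X"
 have "(\<integral>\<omega>. cis (\<Sum>i\<in>J. t i * \<omega> i) \<partial>Q) = complex_of_real (exp (- (\<Sum>i\<in>J. \<Sum>j\<in>J. t i * t j * C i j) / 2))" for t
 proof -
  define b where "b k = (\<Sum>i\<in>J. t i * A i k)" for k
  have mc: "(\<lambda>\<omega>. cis (\<Sum>i\<in>J. t i * \<omega> i)) \<in> borel_measurable (PiM J (\<lambda>_. borel))"
   unfolding cis_conv_exp by measurable
  have sumX: "(\<Sum>i\<in>J. t i * X \<xi> i) = (\<Sum>k<m. b k * \<xi> k)" for \<xi>
  proof -
   have "(\<Sum>i\<in>J. t i * X \<xi> i) = (\<Sum>i\<in>J. \<Sum>k<m. t i * A i k * \<xi> k)"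
    by (intro sum.cong refl) (simp add: X_def sum_distrib_left mult.assoc)
   also have "... = (\<Sum>k<m. b k * \<xi> k)" unfolding b_def sum_distrib_right by (rule sum.swap)
   finally show ?thesis .
  qed
  have sq: "(\<Sum>i\<in>J. \<Sum>j\<in>J. t i * t j * C i j) = (\<Sum>k<m. (b k)^2)"
  proof -
   have "(\<Sum>i\<in>J. \<Sum>j\<in>J. t i * t j * C i j) = (\<Sum>i\<in>J. \<Sum>j\<in>J. \<Sum>k<m. (t i * A i k) * (t j * A j k))"
    using A by (intro sum.cong[OF refl]) (simp add: sum_distrib_left mult_ac)
   also have "... = (\<Sum>i\<in>J. \<Sum>k<m. \<Sum>j\<in>J. (t i * A i k) * (t j * A j k))"
    by (intro sum.cong[OF refl] sum.swap)
   also have "... = (\<Sum>k<m. \<Sum>i\<in>J. \<Sum>j\<in>J. (t i * A i k) * (t j * A j k))" by (rule sum.swap)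
   also have "... = (\<Sum>k<m. (b k)^2)" unfolding b_def power2_eq_square sum_product ..
   finally show ?thesis .
  qed
  have "(\<integral>\<omega>. cis (\<Sum>i\<in>J. t i * \<omega> i) \<partial>Q) = (\<integral>\<xi>. cis (\<Sum>k<m. b k * \<xi> k) \<partial>G)"
   unfolding Q_def integral_distr[OF X mc] sumX ..
  also have "... = (\<integral>\<xi>. (\<Prod>k<m. cis (b k * \<xi> k)) \<partial>G)"
   by (simp add: cis_conv_exp sum_distrib_left exp_sum)
  also have "... = (\<Prod>k<m. \<integral>z. cis (b k * z) \<partial>std_normal_distribution)"
   unfolding G_def
  proof (rule product_integral_prod)
   show "integrable std_normal_distribution (\<lambda>z. cis (b k * z))" for k
    by (intro finite_measure.integrable_const_bound[where B=1] prob_space.finite_measure prob_std_normal)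
      (auto simp: cis_conv_exp)
  qed simp
  also have "... = complex_of_real (exp (- (\<Sum>k<m. (b k)^2) / 2))"
   unfolding cis_std_normal of_real_prod[symmetric] by (simp add: exp_sum[symmetric] sum_negf sum_divide_distrib)
  finally show ?thesis unfolding sq .
 qed
 moreover have "prob_space Q" unfolding Q_def using X by (rule G.prob_space_distr)
 moreover have "sets Q = sets (PiM J (\<lambda>_. borel))" by (simp add: Q_def)
 ultimately show ?thesis by blast
qed

lemma gaussian_linear_combination:
 assumes M: "prob_space M" and X: "\<And>i. i \<in> J ==> (\<lambda>\<omega>. X \<omega> i) \<in> borel_measurable M"
  and J: "finite J" and C: "pos_semidef J C"
  and cf: "\<And>t. (\<integral>\<omega>. cis (\<Sum>i\<in>J. t i * X \<omega> i) \<partial>M) = complex_of_real (exp (- (\<Sum>i\<in>J. \<Sum>j\<in>J. t i * t j * C i j) / 2))"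
 shows "distr M borel (\<lambda>\<omega>. \<Sum>i\<in>J. c i * X \<omega> i) =
  distr std_normal_distribution borel (\<lambda>z. sqrt (\<Sum>i\<in>J. \<Sum>j\<in>J. c i * c j * C i j) * z)"
proof (rule gaussian_of_cf[OF M])
 show "(\<lambda>\<omega>. \<Sum>i\<in>J. c i * X \<omega> i) \<in> borel_measurable M" using X by simp
 show "0 \<le> (\<Sum>i\<in>J. \<Sum>j\<in>J. c i * c j * C i j)" by (rule pos_semidefD[OF C J]) simp
 fix u
 have "(\<integral>\<omega>. cis (u * (\<Sum>i\<in>J. c i * X \<omega> i)) \<partial>M) = (\<integral>\<omega>. cis (\<Sum>i\<in>J. (u * c i) * X \<omega> i) \<partial>M)"
  by (simp add: sum_distrib_left mult.assoc)
 moreover have "(\<Sum>i\<in>J. \<Sum>j\<in>J. (u * c i) * (u * c j) * C i j) = u^2 * (\<Sum>i\<in>J. \<Sum>j\<in>J. c i * c j * C i j)"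
  by (simp add: sum_distrib_left power2_eq_square mult_ac)
 ultimately show "(\<integral>\<omega>. cis (u * (\<Sum>i\<in>J. c i * X \<omega> i)) \<partial>M) = complex_of_real (exp (- (u^2 * (\<Sum>i\<in>J. \<Sum>j\<in>J. c i * c j * C i j)) / 2))"
  using cf[of "\<lambda>i. u * c i"] by (simp only:)
qed

lemma gaussian_coordinates_square_integrable:
 assumes M: "prob_space M" and X: "\<And>i. i \<in> J ==> (\<lambda>\<omega>. X \<omega> i) \<in> borel_measurable M"
  and J: "finite J" and C: "pos_semidef J C"
  and cf: "\<And>t. (\<integral>\<omega>. cis (\<Sum>i\<in>J. t i * X \<omega> i) \<partial>M) = complex_of_real (exp (- (\<Sum>i\<in>J. \<Sum>j\<in>J. t i * t j * C i j) / 2))"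
  and i: "i \<in> J"
 shows "integrable M (\<lambda>\<omega>. (X \<omega> i)^2)"
proof -
 have "(\<Sum>j\<in>J. (if j = i then 1 else 0) * X \<omega> j) = X \<omega> i" for \<omega>
  using J i by (simp add: if_distrib[of "\<lambda>z. z * _"] cong: if_cong)
 then show ?thesis
  using centered_gaussian_moments(2)[OF _ gaussian_linear_combination[OF M X J C cf, of "\<lambda>j. if j = i then 1 else 0"]] X[OF i]
  by simp
qed

text \<open>Kolmogorov extension, with the coordinates as field. The finite-dimensional laws are
  mere choices of \<open>SOME\<close>, so their consistency is derived from their characteristic
  functions by \<open>law_eq_of_cf\<close>.\<close>

theorem gaussian_field_exists:
 fixes C :: "'v => 'v => real"
 assumes C: "pos_semidef V C"
 shows "\<exists>P :: ('v => real) measure. centered_gaussian_field P V (\<lambda>H \<omega>. \<omega> H) C \<and>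
  (\<forall>J t. finite J \<longrightarrow> J \<subseteq> V \<longrightarrow> (\<integral>\<omega>. cis (\<Sum>i\<in>J. t i * \<omega> i) \<partial>P) = complex_of_real (exp (- (\<Sum>i\<in>J. \<Sum>j\<in>J. t i * t j * C i j) / 2)))"
proof -
 have CJ: "pos_semidef J C" if "J \<subseteq> V" for J using pos_semidef_subset[OF C that] .
 define good where "good J Q \<longleftrightarrow> prob_space Q \<and> sets Q = sets (PiM J (\<lambda>_. borel :: real measure)) \<and>
  (\<forall>t. (\<integral>\<omega>. cis (\<Sum>i\<in>J. t i * \<omega> i) \<partial>Q) = complex_of_real (exp (- (\<Sum>i\<in>J. \<Sum>j\<in>J. t i * t j * C i j) / 2)))" for J Q
 define P where "P J = (SOME Q. good J Q)" for J
 have goodP: "good J (P J)" if "finite J" "J \<subseteq> V" for J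
  unfolding P_def by (rule someI_ex) (use gaussian_vector_exists[OF that(1) CJ[OF that(2)]] in \<open>simp add: good_def\<close>)
 have comp: "(\<lambda>\<omega>. \<omega> i) \<in> borel_measurable (P J)" if "finite J" "J \<subseteq> V" "i \<in> J" for i J
 proof -
  have "sets (P J) = sets (PiM J (\<lambda>_. borel))" using goodP[OF that(1,2)] by (simp add: good_def)
  then show ?thesis using measurable_component_singleton[OF that(3), of "\<lambda>_. borel"] measurable_cong_sets by blast
 qed
 have sub: "(\<integral>\<omega>. cis (\<Sum>i\<in>J. t i * \<omega> i) \<partial>P H) = complex_of_real (exp (- (\<Sum>i\<in>J. \<Sum>j\<in>J. t i * t j * C i j) / 2))"
  if "J \<subseteq> H" "finite H" "H \<subseteq> V" for J H t
 proof -
  \<comment> \<open>Passing to the marginal on \<open>J\<close> means setting the coefficients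
    outside \<open>J\<close> to 0.\<close>
  define t' where "t' i = (if i \<in> J then t i else 0)" for i
  have J: "finite J" using that finite_subset by blast
  have s: "(\<Sum>i\<in>H. t' i * f i) = (\<Sum>i\<in>J. t i * f i)" for f
   unfolding t'_def using that by (intro sum.mono_neutral_cong_right) auto
  have q: "(\<Sum>i\<in>H. \<Sum>j\<in>H. t' i * t' j * C i j) = (\<Sum>i\<in>J. \<Sum>j\<in>J. t i * t j * C i j)"
   unfolding mult.assoc sum_distrib_left[symmetric] s ..
  have "\<forall>t. (\<integral>\<omega>. cis (\<Sum>i\<in>H. t i * \<omega> i) \<partial>P H) = complex_of_real (exp (- (\<Sum>i\<in>H. \<Sum>j\<in>H. t i * t j * C i j) / 2))"
   using goodP[OF that(2,3)] unfolding good_def by blast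
  from this[rule_format, of t'] show ?thesis unfolding q s .
 qed
 interpret polish_projective V P
 proof (intro polish_projective.intro projective_family.intro)
  fix J H assume JH: "J \<subseteq> H" "finite H" "H \<subseteq> V"
  then have J: "finite J" "J \<subseteq> V" using finite_subset by auto
  have pr: "prob_space (P J)" "prob_space (P H)" using goodP J JH by (auto simp: good_def)
  have cf: "(\<integral>\<omega>. cis (\<Sum>i\<in>J. t i * \<omega> i) \<partial>P J) = (\<integral>\<omega>. cis (\<Sum>i\<in>J. t i * \<omega> i) \<partial>P H)" for t
   using sub[OF JH] sub[OF order_refl J] by simp
  have "distr (P J) (PiM J (\<lambda>_. borel)) (\<lambda>\<omega>. restrict \<omega> J) = distr (P H) (PiM J (\<lambda>_. borel)) (\<lambda>\<omega>. restrict \<omega> J)"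
  proof (rule law_eq_of_cf[OF pr J(1) _ _ _ _ cf])
   show "(\<lambda>\<omega>. \<omega> i) \<in> borel_measurable (P J)" "(\<lambda>\<omega>. \<omega> i) \<in> borel_measurable (P H)" if "i \<in> J" for i
    using comp J JH that by auto
   show "integrable (P J) (\<lambda>\<omega>. (\<omega> i)^2)" if "i \<in> J" for i
    by (rule gaussian_coordinates_square_integrable[OF pr(1) comp[OF J] J(1) CJ[OF J(2)] sub[OF order_refl J] that])
   show "integrable (P H) (\<lambda>\<omega>. (\<omega> i)^2)" if "i \<in> J" for i
    by (rule gaussian_coordinates_square_integrable[OF pr(2) comp[OF JH(2,3)] JH(2) CJ[OF JH(3)] sub[OF order_refl JH(2,3)]])
      (use that JH in auto)
  qed
  moreover have "distr (P J) (PiM J (\<lambda>_. borel)) (\<lambda>\<omega>. restrict \<omega> J) = P J"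
  proof -
   have "distr (P J) (PiM J (\<lambda>_. borel)) (\<lambda>\<omega>. restrict \<omega> J) = distr (P J) (P J) (\<lambda>\<omega>. \<omega>)"
   proof (rule distr_cong)
    show "sets (PiM J (\<lambda>_. borel)) = sets (P J)" using goodP[OF J] by (simp add: good_def)
    fix \<omega> assume "\<omega> \<in> space (P J)"
    then have "\<omega> \<in> space (PiM J (\<lambda>_. borel))" using goodP[OF J] sets_eq_imp_space_eq unfolding good_def by blast
    then show "restrict \<omega> J = \<omega>" by (auto simp: space_PiM PiE_def extensional_restrict)
   qed simp
   then show ?thesis by (simp add: distr_id)
  qed
  ultimately show "P J = distr (P H) (PiM J (\<lambda>_. borel)) (\<lambda>f. restrict f J)" by simp
 next
  show "prob_space (P J)" if "finite J" "J \<subseteq> V" for J using goodP[OF that] by (simp add: good_def)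
 qed
 have lim_eq: "distr lim (PiM J (\<lambda>_. borel)) (\<lambda>\<omega>. restrict \<omega> J) = P J" if J: "finite J" "J \<subseteq> V" for J
 proof (rule measure_eqI)
  show "sets (distr lim (PiM J (\<lambda>_. borel)) (\<lambda>\<omega>. restrict \<omega> J)) = sets (P J)" using goodP[OF J] by (simp add: good_def)
  fix A assume "A \<in> sets (distr lim (PiM J (\<lambda>_. borel)) (\<lambda>\<omega>. restrict \<omega> J))"
  then have A: "A \<in> sets (PiM J (\<lambda>_. borel))" by simp
  have m: "(\<lambda>\<omega>. restrict \<omega> J) \<in> measurable lim (PiM J (\<lambda>_. borel))"
   using measurable_restrict_subset[OF J(2), of "\<lambda>_. borel"] by (simp add: measurable_cong_sets[OF sets_lim refl])
  show "emeasure (distr lim (PiM J (\<lambda>_. borel)) (\<lambda>\<omega>. restrict \<omega> J)) A = emeasure (P J) A"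
   unfolding emeasure_distr[OF m A] using emeasure_lim_emb[OF J(2,1) A] by (simp add: prod_emb_def space_PiM vimage_def Int_def conj_commute)
 qed
 have comp_lim: "(\<lambda>\<omega>. \<omega> i) \<in> borel_measurable lim" if "i \<in> V" for i
  using measurable_component_singleton[OF that, of "\<lambda>_. borel"] by (simp add: measurable_cong_sets[OF sets_lim refl])
 have cf: "(\<integral>\<omega>. cis (\<Sum>i\<in>J. t i * \<omega> i) \<partial>lim) = complex_of_real (exp (- (\<Sum>i\<in>J. \<Sum>j\<in>J. t i * t j * C i j) / 2))"
  if J: "finite J" "J \<subseteq> V" for J t
 proof -
  have m: "(\<lambda>\<omega>. restrict \<omega> J) \<in> measurable lim (PiM J (\<lambda>_. borel))"
   using measurable_restrict_subset[OF J(2), of "\<lambda>_. borel"] by (simp add: measurable_cong_sets[OF sets_lim refl])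
  have mc: "(\<lambda>\<omega>. cis (\<Sum>i\<in>J. t i * \<omega> i)) \<in> borel_measurable (PiM J (\<lambda>_. borel))"
   unfolding cis_conv_exp by measurable
  have "(\<integral>\<omega>. cis (\<Sum>i\<in>J. t i * \<omega> i) \<partial>P J) = (\<integral>\<omega>. cis (\<Sum>i\<in>J. t i * \<omega> i) \<partial>lim)"
   unfolding lim_eq[OF J, symmetric] integral_distr[OF m mc] by (simp cong: sum.cong)
  then show ?thesis using sub[OF order_refl J] by simp
 qed
 \<comment> \<open>The marginal on the empty index set is a probability measure, and total mass is
   the same for an image measure.\<close>
 have plim: "prob_space lim"
 proof -
  have "(\<lambda>\<omega>. restrict \<omega> {}) \<in> measurable lim (PiM {} (\<lambda>_. borel :: real measure))"
   using measurable_restrict_subset[of "{}" V "\<lambda>_. borel :: real measure"] by (simp add: measurable_cong_sets[OF sets_lim refl])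
  moreover have "prob_space (distr lim (PiM {} (\<lambda>_. borel)) (\<lambda>\<omega>. restrict \<omega> {}))"
   using lim_eq[of "{}"] goodP[of "{}"] by (simp add: good_def)
  ultimately show ?thesis by (rule prob_space_distrD)
 qed
 interpret lim: prob_space lim by (rule plim)
 have gauss: "distr lim borel (\<lambda>\<omega>. \<Sum>i\<in>J. c i * \<omega> i) =
   distr std_normal_distribution borel (\<lambda>z. sqrt (\<Sum>i\<in>J. \<Sum>j\<in>J. c i * c j * C i j) * z)" if J: "finite J" "J \<subseteq> V" for J c
  by (rule gaussian_linear_combination[OF plim comp_lim J(1) CJ[OF J(2)] cf[OF J]]) (use J in auto)
 have sumC: "(\<lambda>\<omega>. \<Sum>i\<in>J. c i * \<omega> i) \<in> borel_measurable lim" if "J \<subseteq> V" for J c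
  using comp_lim that by (intro borel_measurable_sum) auto
 have nonneg: "0 \<le> C i i" if "i \<in> V" for i using pos_semidefD[OF C, of "{i}" "\<lambda>_. 1"] that by simp
 have mom: "integrable lim (\<lambda>\<omega>. (\<omega> i)^2)" "(\<integral>\<omega>. \<omega> i \<partial>lim) = 0" "(\<integral>\<omega>. (\<omega> i)^2 \<partial>lim) = C i i" if i: "i \<in> V" for i
  using centered_gaussian_moments[OF sumC gauss, of "{i}" "\<lambda>_. 1"] i nonneg[OF i] by simp_all
 \<comment> \<open>Polarization, from the second moment of the Gaussian sum.\<close>
 have cov: "(\<integral>\<omega>. \<omega> H * \<omega> G \<partial>lim) = C H G" if HG: "H \<in> V" "G \<in> V" for H G
 proof (cases "H = G")
  case True then show ?thesis using mom(3)[OF HG(1)] by (simp add: power2_eq_square)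
 next
  case False
  have sym: "C G H = C H G" using C HG unfolding pos_semidef_def by blast
  have "0 \<le> C H H + C G G + 2 * C H G"
   using pos_semidefD[OF C, of "{H,G}" "\<lambda>_. 1"] HG False sym by simp
  then have sq: "integrable lim (\<lambda>\<omega>. (\<omega> H + \<omega> G)^2)" "(\<integral>\<omega>. (\<omega> H + \<omega> G)^2 \<partial>lim) = C H H + C G G + 2 * C H G"
   using centered_gaussian_moments(2,4)[OF sumC gauss, of "{H,G}" "\<lambda>_. 1"] HG False sym by (simp_all add: algebra_simps)
  have "(\<integral>\<omega>. \<omega> H * \<omega> G \<partial>lim) = (\<integral>\<omega>. ((\<omega> H + \<omega> G)^2 - (\<omega> H)^2 - (\<omega> G)^2) / 2 \<partial>lim)"
   by (intro Bochner_Integration.integral_cong refl) (simp add: power2_eq_square algebra_simps)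
  also have "... = ((\<integral>\<omega>. (\<omega> H + \<omega> G)^2 \<partial>lim) - (\<integral>\<omega>. (\<omega> H)^2 \<partial>lim) - (\<integral>\<omega>. (\<omega> G)^2 \<partial>lim)) / 2"
   using sq(1) mom(1)[OF HG(1)] mom(1)[OF HG(2)] by simp
  finally show ?thesis using sq(2) mom(3)[OF HG(1)] mom(3)[OF HG(2)] by simp
 qed
 have "centered_gaussian_field lim V (\<lambda>H \<omega>. \<omega> H) C"
  unfolding centered_gaussian_field_def gaussian_rv_def
 proof (intro conjI allI impI ballI plim)
  fix F c assume F: "finite F \<and> F \<subseteq> V"
  then show "(\<lambda>\<omega>. \<Sum>H\<in>F. c H * \<omega> H) \<in> borel_measurable lim" using sumC by blast
  show "\<exists>m s. distr lim borel (\<lambda>\<omega>. \<Sum>H\<in>F. c H * \<omega> H) = distr std_normal_distribution borel (\<lambda>z. m + s * z)"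
   unfolding gauss[OF F[THEN conjunct1] F[THEN conjunct2]]
   by (intro exI[of _ 0] exI[of _ "sqrt (\<Sum>i\<in>F. \<Sum>j\<in>F. c i * c j * C i j)"]) simp
 qed (simp_all add: mom cov)
 then show ?thesis using cf by blast
qed

section \<open>The Poisson equation\<close>

definition loc_integrable :: "(real => real) => bool" where
 "loc_integrable G \<longleftrightarrow> (\<forall>a b. set_integrable lborel {a..b} G)"

text \<open>The signed integral from 0 to \<open>x\<close>: one of the two intervals is empty or a
  point, and its integral is 0.\<close>

definition primitive :: "(real => real) => real => real" where
 "primitive G x = integral {0..x} G - integral {x..0} G"

lemma loc_integrable_integral:
 assumes "loc_integrable G"
 shows "G integrable_on {a..b}" "set_lebesgue_integral lborel {a..b} G = integral {a..b} G"
 using assms set_borel_integral_eq_integral[of "{a..b}" G] unfolding loc_integrable_def by blast+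

lemma continuous_loc_integrable: "continuous_on UNIV g ==> loc_integrable g"
 unfolding loc_integrable_def by (intro allI borel_integrable_atLeastAtMost') (rule continuous_on_subset, auto)

lemma primitive_diff:
 assumes G: "loc_integrable G" and "x \<le> y"
 shows "primitive G y - primitive G x = integral {x..y} G"
proof -
 have c: "integral {a..c} G + integral {c..b} G = integral {a..b} G" if "a \<le> c" "c \<le> b" for a b c
  using that loc_integrable_integral(1)[OF G] by (rule Henstock_Kurzweil_Integration.integral_combine)
 have e: "integral {a..b} G = 0" if "b \<le> a" for a b using that by (cases "a = b") auto
 consider "0 \<le> x" | "x \<le> 0" "0 \<le> y" | "y \<le> 0" by linarith
 then show ?thesis
 proof cases
  case 1 then show ?thesis using c[of 0 x y] e[of 0 x] e[of 0 y] \<open>x \<le> y\<close> by (simp add: primitive_def)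
 next
  case 2 then show ?thesis using c[of x 0 y] e[of x 0] e[of 0 y] \<open>x \<le> y\<close> by (simp add: primitive_def)
 next
  case 3 then show ?thesis using c[of x y 0] e[of x 0] e[of y 0] \<open>x \<le> y\<close> by (simp add: primitive_def)
 qed
qed

lemma primitive_zero [simp]: "primitive G 0 = 0"
 by (simp add: primitive_def)

lemma primitive_near:
 assumes "loc_integrable G" "x \<in> {a..b}"
 shows "primitive G x = integral {a..x} G + primitive G a"
 using primitive_diff[OF assms(1), of a x] assms(2) by simp

lemma continuous_primitive:
 assumes G: "loc_integrable G"
 shows "continuous_on UNIV (primitive G)"
proof -
 have "isCont (primitive G) x" for x
 proof -
  have "continuous_on {x-1..x+1} (\<lambda>z. integral {x-1..z} G + primitive G (x-1))"
   by (intro continuous_intros indefinite_integral_continuous_1 loc_integrable_integral(1)[OF G])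
  then have "continuous_on {x-1..x+1} (primitive G)"
   by (rule continuous_on_eq) (simp add: primitive_near[OF G])
  then show ?thesis by (rule continuous_on_interior) simp
 qed
 then show ?thesis by (simp add: continuous_on_eq_continuous_within continuous_at_imp_continuous_at_within)
qed

lemma DERIV_primitive:
 assumes g: "continuous_on UNIV g"
 shows "(primitive g has_real_derivative g x) (at x)"
proof -
 have "((\<lambda>z. integral {x-1..z} g + primitive g (x-1)) has_real_derivative g x) (at x within {x-1..x+1})"
  using DERIV_add[OF integral_has_real_derivative[OF continuous_on_subset[OF g], of "x-1" "x+1" x] DERIV_const] by simp
 then have "(primitive g has_real_derivative g x) (at x within {x-1..x+1})"
 proof (rule has_field_derivative_transform_within[where d=1])
  show "integral {x-1..z} g + primitive g (x-1) = primitive g z" if "z \<in> {x-1..x+1}" for z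
   by (rule primitive_near[OF continuous_loc_integrable[OF g] that, symmetric])
 qed auto
 moreover have "at x within {x-1..x+1} = at x" by (rule at_within_Icc_at) auto
 ultimately show ?thesis by (simp only:)
qed

lemma set_integral_shift:
 fixes G :: "real => real"
 assumes "periodic1 G"
 shows "set_lebesgue_integral lborel {a+1..b+1} G = set_lebesgue_integral lborel {a..b} G"
  and "set_integrable lborel {a..b} G ==> set_integrable lborel {a+1..b+1} G"
  and "set_integrable lborel {a..b} G ==> set_integrable lborel {a-1..b-1} G"
proof -
 have p: "G (1 + u) = G u" "G (u - 1) = G u" for u
  using assms unfolding periodic1_def by (metis add.commute, metis diff_add_cancel)
 have e: "indicator {a+1..b+1} (1 + u) *\<^sub>R G (1 + u) = indicator {a..b} u *\<^sub>R G u" for u :: real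
  by (simp add: p indicator_def)
 show "set_lebesgue_integral lborel {a+1..b+1} G = set_lebesgue_integral lborel {a..b} G"
  using lborel_integral_real_affine[of 1 "\<lambda>x. indicator {a+1..b+1} x *\<^sub>R G x" 1]
  unfolding set_lebesgue_integral_def by (simp only: mult_1 e abs_one scaleR_one)
 show "set_integrable lborel {a..b} G ==> set_integrable lborel {a+1..b+1} G"
  unfolding set_integrable_def using lborel_integrable_real_affine_iff[of 1 "\<lambda>x. indicator {a+1..b+1} x *\<^sub>R G x" 1]
  by (simp only: mult_1 e)
 have e': "indicator {a-1..b-1} ((-1) + u) *\<^sub>R G ((-1) + u) = indicator {a..b} u *\<^sub>R G u" for u :: real
  using p(2)[of u] by (simp add: indicator_def algebra_simps)
 show "set_integrable lborel {a..b} G ==> set_integrable lborel {a-1..b-1} G"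
  unfolding set_integrable_def using lborel_integrable_real_affine_iff[of 1 "\<lambda>x. indicator {a-1..b-1} x *\<^sub>R G x" "-1"]
  by (simp only: e' mult_1)
qed

lemma periodic_loc_integrable:
 assumes p: "periodic1 G" and i: "set_integrable lborel {0..1} G"
 shows "loc_integrable G"
proof -
 have up: "set_integrable lborel {real N..real N + 1} G" for N
 proof (induction N)
  case (Suc N)
  have "{real (Suc N)..real (Suc N) + 1} = {real N + 1..(real N + 1) + 1}" by simp
  then show ?case using set_integral_shift(2)[OF p Suc] by (simp only:)
 qed (use i in simp)
 have dn: "set_integrable lborel {- real N..1 - real N} G" for N
 proof (induction N)
  case (Suc N)
  have "{- real (Suc N)..1 - real (Suc N)} = {- real N - 1..(1 - real N) - 1}" by simp
  then show ?case using set_integral_shift(3)[OF p Suc] by (simp only:)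
 qed (use i in simp)
 have N: "set_integrable lborel {- real N..real N + 1} G" for N
 proof (induction N)
  case 0 then show ?case using i by simp
 next
  case (Suc N)
  have "{- real (Suc N)..real (Suc N) + 1} = ({- real (Suc N)..1 - real (Suc N)} \<union> {- real N..real N + 1}) \<union> {real (Suc N)..real (Suc N) + 1}"
   by auto
  then show ?case using set_integrable_Un[OF set_integrable_Un[OF dn[of "Suc N"] Suc] up[of "Suc N"]] by simp
 qed
 show ?thesis unfolding loc_integrable_def
 proof (intro allI)
  fix a b :: real
  obtain N :: nat where "max \<bar>a\<bar> \<bar>b\<bar> < real N" using reals_Archimedean2 by blast
  then show "set_integrable lborel {a..b} G" by (intro set_integrable_subset[OF N[of N]]) auto
 qed
qed

lemma L2_product_integrable:
 assumes H: "H \<in> borel_measurable borel" "set_integrable lborel {0..1} (\<lambda>u. (H u)^2)"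
  and G: "G \<in> borel_measurable borel" "set_integrable lborel {0..1} (\<lambda>u. (G u)^2)"
 shows "set_integrable lborel {0..1::real} (\<lambda>u. H u * G u :: real)"
proof (rule set_integrable_bound[OF set_integral_add(1)[OF H(2) G(2)]])
 show "set_borel_measurable lborel {0..1} (\<lambda>u. H u * G u)" using H G by (simp add: set_borel_measurable_def)
 have "\<bar>x * y\<bar> \<le> \<bar>x^2 + y^2\<bar>" for x y :: real
 proof -
  have "0 \<le> \<bar>x\<bar> * \<bar>y\<bar>" by simp
  then have "\<bar>x\<bar> * \<bar>y\<bar> \<le> x^2 + y^2" using sum_squares_bound[of "\<bar>x\<bar>" "\<bar>y\<bar>"] unfolding power2_abs by linarith
  then show ?thesis by (simp add: abs_mult)
 qed
 then show "AE u in lborel. u \<in> {0..1} \<longrightarrow> norm (H u * G u) \<le> norm ((H u)^2 + (G u)^2)" by simp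
qed

lemma L2_mean_zeroD:
 assumes "H \<in> L2_mean_zero"
 shows "H \<in> borel_measurable borel" "periodic1 H" "set_integrable lborel {0..1} (\<lambda>u. (H u)^2)" "torus_mean H = 0"
  "loc_integrable H" "integral {0..1} H = 0"
proof -
 show m: "H \<in> borel_measurable borel" and p: "periodic1 H" and i: "set_integrable lborel {0..1} (\<lambda>u. (H u)^2)" and z: "torus_mean H = 0"
  using assms by (auto simp: L2_mean_zero_def)
 have one: "set_integrable lborel {0..1} (\<lambda>u :: real. 1 :: real)" by (intro borel_integrable_atLeastAtMost' continuous_intros)
 have "set_integrable lborel {0..1} (\<lambda>u. H u * 1)"
  using one by (intro L2_product_integrable m i) auto
 then show loc: "loc_integrable H" using p by (intro periodic_loc_integrable) auto
 show "integral {0..1} H = 0" using z loc_integrable_integral(2)[OF loc, of 0 1] by (simp add: torus_mean_def)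
qed

lemma periodic_primitive:
 assumes p: "periodic1 G" and l: "loc_integrable G" and z: "integral {0..1} G = 0"
 shows "periodic1 (primitive G)"
 unfolding periodic1_def
proof
 fix x
 have "primitive G (x + 1) - primitive G 1 = primitive G x - primitive G 0"
 proof (cases "0 \<le> x")
  case True
  then show ?thesis using primitive_diff[OF l, of 1 "x+1"] primitive_diff[OF l, of 0 x] set_integral_shift(1)[OF p, of 0 x]
   by (simp add: loc_integrable_integral(2)[OF l])
 next
  case False
  then show ?thesis using primitive_diff[OF l, of "x+1" 1] primitive_diff[OF l, of x 0] set_integral_shift(1)[OF p, of x 0]
   by (simp add: loc_integrable_integral(2)[OF l])
 qed
 moreover have "primitive G 1 = 0" using z primitive_diff[OF l, of 0 1] by simp
 ultimately show "primitive G (x + 1) = primitive G x" by simp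
qed

text \<open>The potential of the overview: for G = p' with p periodic of mean 0 it is p.\<close>

definition antideriv :: "(real => real) => real => real" where
 "antideriv G x = primitive G x - integral {0..1} (primitive G)"

lemma antideriv_props:
 assumes p: "periodic1 G" and l: "loc_integrable G" and z: "integral {0..1} G = 0"
 shows "periodic1 (antideriv G)" "continuous_on UNIV (antideriv G)" "loc_integrable (antideriv G)" "integral {0..1} (antideriv G) = 0"
proof -
 show "periodic1 (antideriv G)" using periodic_primitive[OF assms] by (simp add: periodic1_def antideriv_def)
 show c: "continuous_on UNIV (antideriv G)" unfolding antideriv_def by (intro continuous_intros continuous_primitive l)
 then show "loc_integrable (antideriv G)" by (rule continuous_loc_integrable)
 have "primitive G integrable_on {0..1}" by (rule loc_integrable_integral(1)[OF continuous_loc_integrable[OF continuous_primitive[OF l]]])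
 then show "integral {0..1} (antideriv G) = 0" unfolding antideriv_def by (subst Henstock_Kurzweil_Integration.integral_diff) auto
qed

text \<open>Minus the twice iterated \<open>antideriv\<close>: the inner normalization makes the
  second primitive periodic, the outer one gives mean 0.\<close>

definition poisson :: "(real => real) => real => real" where
 "poisson G x = integral {0..1} (primitive (antideriv G)) - primitive (antideriv G) x"

lemma solves_poisson_poisson:
 assumes G: "G \<in> L2_mean_zero"
 shows "solves_poisson G (poisson G)"
proof -
 note g = L2_mean_zeroD[OF G]
 note A = antideriv_props[OF g(2,5,6)]
 have D: "(poisson G has_real_derivative - antideriv G x) (at x)" for x
  unfolding poisson_def by (rule derivative_eq_intros DERIV_primitive[OF A(2)] refl)+ simp
 have c: "continuous_on UNIV (primitive (antideriv G))" by (rule continuous_primitive[OF A(3)])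
 have cp: "continuous_on UNIV (poisson G)" unfolding poisson_def by (intro continuous_intros c)
 have i: "primitive (antideriv G) integrable_on {0..1}" by (rule loc_integrable_integral(1)[OF continuous_loc_integrable[OF c]])
 show ?thesis unfolding solves_poisson_def
 proof (intro conjI allI impI)
  show "periodic1 (poisson G)" using periodic_primitive[OF A(1,3,4)] by (simp add: periodic1_def poisson_def)
  have "integral {0..1} (poisson G) = 0"
   unfolding poisson_def using i by (subst Henstock_Kurzweil_Integration.integral_diff) auto
  then show "torus_mean (poisson G) = 0"
   unfolding torus_mean_def by (simp add: loc_integrable_integral(2)[OF continuous_loc_integrable[OF cp]])
  show "poisson G differentiable at x" for x using D by (auto simp: real_differentiable_def)
  fix x y :: real assume "x \<le> y"
  have "deriv (poisson G) = (\<lambda>x. - antideriv G x)" using D by (auto intro: DERIV_imp_deriv)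
  then have "deriv (poisson G) y - deriv (poisson G) x = - integral {x..y} G"
   using primitive_diff[OF g(5) \<open>x \<le> y\<close>] by (simp add: antideriv_def)
  also have "... = set_lebesgue_integral lborel {x..y} (\<lambda>u. - G u)"
   using loc_integrable_integral(2)[OF g(5), of x y] by (simp add: set_lebesgue_integral_def)
  finally show "deriv (poisson G) y - deriv (poisson G) x = set_lebesgue_integral lborel {x..y} (\<lambda>u. - G u)" .
 qed
qed

text \<open>The difference of two solutions has constant derivative; periodicity makes this constant
  0, and the mean then makes the difference 0.\<close>

lemma solves_poisson_unique:
 assumes F: "solves_poisson G F" and F': "solves_poisson G F'"
 shows "F = F'"
proof -
 define D where "D x = F x - F' x" for x
 have dF: "(F has_real_derivative deriv F x) (at x)" "(F' has_real_derivative deriv F' x) (at x)" for x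
  using F F' DERIV_deriv_iff_real_differentiable unfolding solves_poisson_def by blast+
 define c where "c = deriv F 0 - deriv F' 0"
 have "deriv F x - deriv F' x = c" for x
 proof -
  have "deriv F y - deriv F x = deriv F' y - deriv F' x" if "x \<le> y" for x y
   using F F' that unfolding solves_poisson_def by metis
  from this[of 0 x] this[of x 0] show ?thesis unfolding c_def by (cases "0 \<le> x") auto
 qed
 then have dD: "(D has_real_derivative c) (at x)" for x
  unfolding D_def using DERIV_diff[OF dF(1)[of x] dF(2)[of x]] by simp
 have "((\<lambda>x. D x - c * x) has_real_derivative 0) (at x)" for x
  using dD by (auto intro!: derivative_eq_intros)
 then have lin: "D x - c * x = D 0 - c * 0" for x by (rule DERIV_isconst_all[rule_format])
 have "D 1 = D 0" using F F' unfolding solves_poisson_def periodic1_def D_def by (metis add_0)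
 then have "c = 0" using lin[of 1] by simp
 then have const: "D x = D 0" for x using lin[of x] by simp
 have cF: "continuous_on UNIV F" "continuous_on UNIV F'"
  using dF by (auto intro!: continuous_at_imp_continuous_on DERIV_isCont)
 have "integral {0..1} F = 0" "integral {0..1} F' = 0"
  using F F' loc_integrable_integral(2)[OF continuous_loc_integrable] cF unfolding solves_poisson_def torus_mean_def by metis+
 moreover have "integral {0..1} D = integral {0..1} F - integral {0..1} F'"
  unfolding D_def by (intro Henstock_Kurzweil_Integration.integral_diff loc_integrable_integral(1) continuous_loc_integrable cF)
 moreover have "integral {0..1} D = D 0"
 proof -
  have "D = (\<lambda>_. D 0)" using const by blast
  then have "integral {0..1} D = integral {0..1} (\<lambda>_ :: real. D 0)" by (rule arg_cong)
  then show ?thesis by simp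
 qed
 ultimately have "D 0 = 0" by simp
 then show ?thesis using const unfolding D_def by (metis eq_iff_diff_eq_0 ext)
qed

lemma inv_neg_laplacian_eq: "G \<in> L2_mean_zero ==> inv_neg_laplacian G = poisson G"
 unfolding inv_neg_laplacian_def using solves_poisson_poisson solves_poisson_unique by (intro the_equality) auto

text \<open>\<open>H\<close> is merely integrable, so its primitive need not be differentiable
  everywhere; the integration by parts is Fubini on the triangle u <= x.\<close>

lemma integration_by_parts_fubini:
 assumes H: "loc_integrable H" "H \<in> borel_measurable borel" and A: "continuous_on UNIV A"
 shows "set_lebesgue_integral lborel {0..1} (\<lambda>x. H x * primitive A x) =
  set_lebesgue_integral lborel {0..1} (\<lambda>u. A u * (primitive H 1 - primitive H u))"
proof -
 define I :: "real => real" where "I = indicator {0..1}"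
 have mI: "I \<in> borel_measurable borel" by (simp add: I_def)
 have mA: "A \<in> borel_measurable borel" using A by (rule borel_measurable_continuous_onI)
 have lA: "loc_integrable A" by (rule continuous_loc_integrable[OF A])
 define f where "f x u = (I x * H x) * (I u * A u) * indicator {(x, u). u \<le> x} (x, u)" for x u :: real
 have mf: "case_prod f \<in> borel_measurable (lborel \<Otimes>\<^sub>M lborel)"
 proof -
  have "closed {p :: real \<times> real. snd p \<le> fst p}" by (intro closed_Collect_le continuous_intros)
  moreover have "{p :: real \<times> real. snd p \<le> fst p} = {(x, u). u \<le> x}" by auto
  ultimately have "{(x, u). u \<le> x} \<in> sets (borel \<Otimes>\<^sub>M borel :: (real \<times> real) measure)" unfolding borel_prod by simp
  then have "indicator {(x, u). u \<le> x} \<in> borel_measurable (borel \<Otimes>\<^sub>M borel :: (real \<times> real) measure)" by simp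
  then show ?thesis unfolding f_def using mI mA H(2) by (simp add: case_prod_beta' cong: measurable_cong_sets sets_pair_measure_cong)
 qed
 have iH: "integrable lborel (\<lambda>x. I x * H x)" using H(1) by (simp add: loc_integrable_def set_integrable_def I_def)
 have iA: "integrable lborel (\<lambda>x. I x * A x)" using lA by (simp add: loc_integrable_def set_integrable_def I_def)
 have bf: "norm (f x u) \<le> \<bar>I x * H x\<bar> * \<bar>I u * A u\<bar>" for x u
  unfolding f_def by (auto simp: indicator_def abs_mult)
 have sec: "integrable lborel (f x)" for x
 proof (rule Bochner_Integration.integrable_bound[where f="\<lambda>u. (I x * H x) * (I u * A u)"])
  show "integrable lborel (\<lambda>u. (I x * H x) * (I u * A u))" by (rule integrable_mult_right[OF iA])
  show "f x \<in> borel_measurable lborel" using measurable_Pair2[OF mf, of x] by simp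
  show "AE u in lborel. norm (f x u) \<le> norm ((I x * H x) * (I u * A u))" using bf by (simp add: abs_mult)
 qed
 have int: "integrable (lborel \<Otimes>\<^sub>M lborel) (case_prod f)"
 proof (rule lborel_pair.Fubini_integrable[OF mf])
  show "integrable lborel (\<lambda>x. \<integral>u. norm (case_prod f (x, u)) \<partial>lborel)"
  proof (rule Bochner_Integration.integrable_bound[where f="\<lambda>x. (I x * H x) * (\<integral>u. \<bar>I u * A u\<bar> \<partial>lborel)"])
   show "integrable lborel (\<lambda>x. (I x * H x) * (\<integral>u. \<bar>I u * A u\<bar> \<partial>lborel))" by (rule integrable_mult_left[OF iH])
   show "(\<lambda>x. \<integral>u. norm (case_prod f (x, u)) \<partial>lborel) \<in> borel_measurable lborel"
    using mf by (intro lborel.borel_measurable_lebesgue_integral) (simp add: case_prod_beta')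
   have "(\<integral>u. norm (f x u) \<partial>lborel) \<le> \<bar>I x * H x\<bar> * (\<integral>u. \<bar>I u * A u\<bar> \<partial>lborel)" for x
   proof -
    have "(\<integral>u. norm (f x u) \<partial>lborel) \<le> (\<integral>u. \<bar>I x * H x\<bar> * \<bar>I u * A u\<bar> \<partial>lborel)"
     using sec iA by (intro integral_mono bf integrable_norm integrable_mult_right) auto
    then show ?thesis by simp
   qed
   then show "AE x in lborel. norm (\<integral>u. norm (case_prod f (x, u)) \<partial>lborel) \<le> norm ((I x * H x) * (\<integral>u. \<bar>I u * A u\<bar> \<partial>lborel))"
    by (simp add: abs_mult)
  qed
 qed (use sec in simp)
 have L: "(\<integral>u. f x u \<partial>lborel) = I x * (H x * primitive A x)" for x
 proof (cases "x \<in> {0..1}")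
  case True
  then have "f x u = H x * (indicator {0..x} u *\<^sub>R A u)" for u by (auto simp: f_def I_def indicator_def)
  then have "(\<integral>u. f x u \<partial>lborel) = H x * set_lebesgue_integral lborel {0..x} A" by (simp add: set_lebesgue_integral_def)
  then show ?thesis using True primitive_diff[OF lA, of 0 x] loc_integrable_integral(2)[OF lA, of 0 x] by (simp add: I_def)
 qed (simp add: f_def I_def)
 have R: "(\<integral>x. f x u \<partial>lborel) = I u * (A u * (primitive H 1 - primitive H u))" for u
 proof (cases "u \<in> {0..1}")
  case True
  then have "f x u = A u * (indicator {u..1} x *\<^sub>R H x)" for x by (auto simp: f_def I_def indicator_def)
  then have "(\<integral>x. f x u \<partial>lborel) = A u * set_lebesgue_integral lborel {u..1} H" by (simp add: set_lebesgue_integral_def)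
  then show ?thesis using True primitive_diff[OF H(1), of u 1] loc_integrable_integral(2)[OF H(1), of u 1] by (simp add: I_def)
 qed (simp add: f_def I_def)
 have "(\<integral>u. (\<integral>x. f x u \<partial>lborel) \<partial>lborel) = (\<integral>x. (\<integral>u. f x u \<partial>lborel) \<partial>lborel)"
  by (rule lborel_pair.Fubini_integral[OF int])
 then show ?thesis unfolding L R set_lebesgue_integral_def I_def by simp
qed

text \<open>In this form the covariance is visibly symmetric and positive semidefinite, and for H =
  G it is the limit of \<open>cov_form\<close>.\<close>

lemma limit_cov_eq:
 assumes H: "H \<in> L2_mean_zero" and G: "G \<in> L2_mean_zero"
 shows "limit_cov a H G = 1/4 * set_lebesgue_integral lborel {0..1} (\<lambda>u. H u * G u) +
  a/2 * set_lebesgue_integral lborel {0..1} (\<lambda>u. antideriv H u * antideriv G u)"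
proof -
 note h = L2_mean_zeroD[OF H] and g = L2_mean_zeroD[OF G]
 note A = antideriv_props[OF g(2,5,6)]
 define B where "B = antideriv G"
 have B: "continuous_on UNIV B" "loc_integrable B" "integral {0..1} B = 0" using A by (auto simp: B_def)
 have mB: "B \<in> borel_measurable borel" using B(1) by (rule borel_measurable_continuous_onI)
 define c where "c = integral {0..1} (primitive B)"
 define d where "d = integral {0..1} (primitive H)"
 have pH1: "primitive H 1 = 0" using primitive_diff[OF h(5), of 0 1] h(6) by simp
 have iH: "set_integrable lborel {0..1} H" "set_integrable lborel {0..1} B" using h(5) B(2) by (auto simp: loc_integrable_def)
 have cP: "continuous_on UNIV (primitive B)" by (rule continuous_primitive[OF B(2)])
 have i1: "set_integrable lborel {0..1} (\<lambda>x. H x * primitive B x)"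
  using cP by (intro L2_product_integrable h(1,3) borel_measurable_continuous_onI borel_integrable_atLeastAtMost' continuous_intros)
    (auto intro: continuous_on_subset)
 have i2: "set_integrable lborel {0..1} (\<lambda>x. B x * antideriv H x)"
  using B(1) antideriv_props(2)[OF h(2,5,6)] by (intro borel_integrable_atLeastAtMost' continuous_intros) (auto intro: continuous_on_subset)
 have "torus_inner H (poisson G) = (LINT x:{0..1}|lborel. c * H x - H x * primitive B x)"
  unfolding torus_inner_def by (simp add: poisson_def B_def c_def algebra_simps)
 also have "... = c * (LINT x:{0..1}|lborel. H x) - (LINT x:{0..1}|lborel. H x * primitive B x)"
  using i1 iH by (subst set_integral_diff(2)) auto
 also have "(LINT x:{0..1}|lborel. H x) = 0" using h(6) loc_integrable_integral(2)[OF h(5)] by simp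
 also have "(LINT x:{0..1}|lborel. H x * primitive B x) = (LINT u:{0..1}|lborel. (- d) * B u - B u * antideriv H u)"
  unfolding integration_by_parts_fubini[OF h(5,1) B(1)] pH1 by (simp add: antideriv_def d_def algebra_simps)
 also have "... = (- d) * (LINT u:{0..1}|lborel. B u) - (LINT u:{0..1}|lborel. B u * antideriv H u)"
  unfolding set_integral_diff(2)[OF set_integrable_mult_right[OF iH(2), of "- d"] i2] set_integral_mult_right ..
 also have "(LINT u:{0..1}|lborel. B u) = 0" using B(3) loc_integrable_integral(2)[OF B(2)] by simp
 finally have "torus_inner H (poisson G) = (LINT u:{0..1}|lborel. antideriv H u * antideriv G u)"
  by (simp add: B_def mult.commute)
 then show ?thesis unfolding limit_cov_def inv_neg_laplacian_eq[OF G] torus_inner_def by simp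
qed

lemma set_integral_square_sum:
 fixes f :: "'i => real => real"
 assumes "\<And>i j. i \<in> F ==> j \<in> F ==> set_integrable M S (\<lambda>u. f i u * f j u)"
 shows "(\<Sum>i\<in>F. \<Sum>j\<in>F. c i * c j * (LINT u:S|M. f i u * f j u)) = (LINT u:S|M. (\<Sum>i\<in>F. c i * f i u)^2)"
proof -
 have "(\<Sum>i\<in>F. \<Sum>j\<in>F. c i * c j * (LINT u:S|M. f i u * f j u)) =
   (\<integral>u. (\<Sum>i\<in>F. \<Sum>j\<in>F. c i * c j * (indicator S u *\<^sub>R (f i u * f j u))) \<partial>M)"
  using assms unfolding set_lebesgue_integral_def set_integrable_def
  by (subst Bochner_Integration.integral_sum; (intro integrable_sum integrable_mult_right)?; (simp add: Bochner_Integration.integral_sum)?)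
 also have "... = (LINT u:S|M. (\<Sum>i\<in>F. c i * f i u)^2)"
  unfolding set_lebesgue_integral_def power2_eq_square sum_product
  by (intro Bochner_Integration.integral_cong refl) (simp add: sum_distrib_left mult_ac)
 finally show ?thesis .
qed

lemma limit_cov_quadratic_form:
 assumes F: "\<And>i. i \<in> F ==> H i \<in> L2_mean_zero"
 shows "(\<Sum>i\<in>F. \<Sum>j\<in>F. c i * c j * limit_cov a (H i) (H j)) =
  1/4 * (LINT u:{0..1}|lborel. (\<Sum>i\<in>F. c i * H i u)^2) + a/2 * (LINT u:{0..1}|lborel. (\<Sum>i\<in>F. c i * antideriv (H i) u)^2)"
proof -
 have i1: "set_integrable lborel {0..1} (\<lambda>u. H i u * H j u)" if "i \<in> F" "j \<in> F" for i j
  using L2_mean_zeroD[OF F[OF that(1)]] L2_mean_zeroD[OF F[OF that(2)]] by (intro L2_product_integrable)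
 have i2: "set_integrable lborel {0..1} (\<lambda>u. antideriv (H i) u * antideriv (H j) u)" if "i \<in> F" "j \<in> F" for i j
  using antideriv_props(2)[OF L2_mean_zeroD(2,5,6)[OF F[OF that(1)]]] antideriv_props(2)[OF L2_mean_zeroD(2,5,6)[OF F[OF that(2)]]]
  by (intro borel_integrable_atLeastAtMost' continuous_intros) (auto intro: continuous_on_subset)
 have "(\<Sum>i\<in>F. \<Sum>j\<in>F. c i * c j * limit_cov a (H i) (H j)) =
   (\<Sum>i\<in>F. \<Sum>j\<in>F. 1/4 * (c i * c j * (LINT u:{0..1}|lborel. H i u * H j u)) + a/2 * (c i * c j * (LINT u:{0..1}|lborel. antideriv (H i) u * antideriv (H j) u)))"
  by (intro sum.cong[OF refl]) (simp add: limit_cov_eq F algebra_simps)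
 also have "... = 1/4 * (\<Sum>i\<in>F. \<Sum>j\<in>F. c i * c j * (LINT u:{0..1}|lborel. H i u * H j u)) +
   a/2 * (\<Sum>i\<in>F. \<Sum>j\<in>F. c i * c j * (LINT u:{0..1}|lborel. antideriv (H i) u * antideriv (H j) u))"
  unfolding sum.distrib sum_distrib_left ..
 also have "(\<Sum>i\<in>F. \<Sum>j\<in>F. c i * c j * (LINT u:{0..1}|lborel. H i u * H j u)) = (LINT u:{0..1}|lborel. (\<Sum>i\<in>F. c i * H i u)^2)"
  by (rule set_integral_square_sum[OF i1])
 also have "(\<Sum>i\<in>F. \<Sum>j\<in>F. c i * c j * (LINT u:{0..1}|lborel. antideriv (H i) u * antideriv (H j) u)) = (LINT u:{0..1}|lborel. (\<Sum>i\<in>F. c i * antideriv (H i) u)^2)"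
  by (rule set_integral_square_sum[OF i2])
 finally show ?thesis .
qed

lemma pos_semidef_limit_cov:
 assumes "0 \<le> a"
 shows "pos_semidef L2_mean_zero (limit_cov a)"
 unfolding pos_semidef_def
proof (intro conjI ballI allI impI)
 show "limit_cov a H G = limit_cov a G H" if "H \<in> L2_mean_zero" "G \<in> L2_mean_zero" for H G
  using that by (simp add: limit_cov_eq mult.commute)
 fix F c assume "finite F" "F \<subseteq> L2_mean_zero"
 then have "(\<Sum>i\<in>F. \<Sum>j\<in>F. c i * c j * limit_cov a i j) =
  1/4 * (LINT u:{0..1}|lborel. (\<Sum>i\<in>F. c i * i u)^2) + a/2 * (LINT u:{0..1}|lborel. (\<Sum>i\<in>F. c i * antideriv i u)^2)"
  by (intro limit_cov_quadratic_form[of F "\<lambda>i. i"]) auto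
 moreover have "0 \<le> (LINT u:{0..1}|lborel. (f u)^2)" for f :: "real => real"
  unfolding set_lebesgue_integral_def by (intro integral_nonneg_AE) auto
 ultimately show "0 \<le> (\<Sum>i\<in>F. \<Sum>j\<in>F. c i * c j * limit_cov a i j)" using assms by simp
qed

section \<open>The scaling limit\<close>

text \<open>\<Psi> is the potential and \<open>h\<close> its derivative, the test function.
  \<open>B\<close> bounds \<Psi> and three derivatives, as \<open>tame\<close> requires on the
  grid.\<close>

definition profile :: "real => (real => real) => (real => real) => bool" where
 "profile B \<Psi> h \<longleftrightarrow> periodic1 \<Psi> \<and> (\<exists>h1 h2. \<forall>x.
   (\<Psi> has_real_derivative h x) (at x) \<and> (h has_real_derivative h1 x) (at x) \<and> (h1 has_real_derivative h2 x) (at x) \<and>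
   \<bar>\<Psi> x\<bar> \<le> B \<and> \<bar>h x\<bar> \<le> B \<and> \<bar>h1 x\<bar> \<le> B \<and> \<bar>h2 x\<bar> \<le> B)"

definition dquot :: "nat => (real => real) => real => real" where
 "dquot n u y = real n * (u (y + 1 / real n) - u y)"

lemma dquot_bound:
 assumes n: "n > 0" and d: "\<And>x. (u has_real_derivative u' x) (at x)" and b: "\<And>x. \<bar>u' x\<bar> \<le> B"
 shows "\<bar>dquot n u y\<bar> \<le> B"
proof -
 obtain z where "u (y + 1 / real n) - u y = (1 / real n) * u' z"
  using MVT2[of y "y + 1 / real n" u u'] d n by auto
 then show ?thesis using b[of z] n by (simp add: dquot_def)
qed

lemma dquot_near_derivative:
 assumes n: "n > 0" and d: "\<And>x. (u has_real_derivative u' x) (at x)"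
  and d': "\<And>x. (u' has_real_derivative u'' x) (at x)" and b: "\<And>x. \<bar>u'' x\<bar> \<le> B"
 shows "\<bar>dquot n u y - u' y\<bar> \<le> B / real n"
proof -
 obtain z where z: "y < z" "z < y + 1 / real n" "u (y + 1 / real n) - u y = (1 / real n) * u' z"
  using MVT2[of y "y + 1 / real n" u u'] d n by auto
 obtain w where w: "u' z - u' y = (z - y) * u'' w" using MVT2[of y z u' u''] d' z(1) by auto
 have "dquot n u y - u' y = (z - y) * u'' w" using z(3) w n by (simp add: dquot_def)
 moreover have "\<bar>(z - y) * u'' w\<bar> \<le> (1 / real n) * B"
  unfolding abs_mult using z b[of w] by (intro mult_mono) auto
 ultimately show ?thesis by simp
qed

lemma DERIV_dquot:
 assumes "\<And>x. (u has_real_derivative u' x) (at x)"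
 shows "(dquot n u has_real_derivative dquot n u' x) (at x)"
proof -
 have "((\<lambda>y. u (y + 1 / real n)) has_real_derivative u' (x + 1 / real n)) (at x)"
  using assms[of "x + 1 / real n"] by (simp add: DERIV_shift)
 then show ?thesis unfolding dquot_def[abs_def] by (intro DERIV_cmult DERIV_diff assms)
qed

lemma fdiff_dquot: "fdiff n (\<lambda>x. u (real_of_int x / real n) + c) = (\<lambda>x. dquot n u (real_of_int x / real n))"
 by (rule ext) (simp add: fdiff_def dquot_def add_divide_distrib)

text \<open>The difference quotients of a primitive of \<open>u\<close> telescope to the integral,
  and each differs from the sampled value of \<open>u\<close> by at most B / n.\<close>

lemma riemann_sum_bound:
 assumes n: "n > 0" and d: "\<And>x. (u has_real_derivative u' x) (at x)" and b: "\<And>x. \<bar>u' x\<bar> \<le> B"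
 shows "\<bar>(\<Sum>x\<in>torus n. u (real_of_int x / real n)) / real n - integral {0..1} u\<bar> \<le> B / real n"
proof -
 have c: "continuous_on UNIV u" using d by (auto intro!: continuous_at_imp_continuous_on DERIV_isCont)
 let ?U = "primitive u"
 have D: "(?U has_real_derivative u x) (at x)" for x by (rule DERIV_primitive[OF c])
 have re: "(\<Sum>x\<in>torus n. f x) = (\<Sum>j<n. f (int j))" for f :: "int => real"
  unfolding torus_def by (rule sum.reindex_bij_witness[where i=int and j=nat]) auto
 have "(\<Sum>x\<in>torus n. dquot n ?U (real_of_int x / real n)) = real n * (\<Sum>j<n. ?U (real (Suc j) / real n) - ?U (real j / real n))"
  unfolding re dquot_def sum_distrib_left by (intro sum.cong refl) (simp add: add_divide_distrib add.commute)
 also have "... = real n * ?U 1" unfolding sum_lessThan_telescope[of "\<lambda>j. ?U (real j / real n)"] using n by simp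
 finally have e: "integral {0..1} u = (\<Sum>x\<in>torus n. dquot n ?U (real_of_int x / real n)) / real n"
  using primitive_diff[OF continuous_loc_integrable[OF c], of 0 1] n by simp
 have "\<bar>\<Sum>x\<in>torus n. (u (real_of_int x / real n) - dquot n ?U (real_of_int x / real n))\<bar> \<le> (\<Sum>x\<in>torus n. B / real n)"
  using dquot_near_derivative[OF n D d b] by (intro order_trans[OF sum_abs] sum_mono) (simp add: abs_minus_commute)
 also have "... = B" using n by (simp add: torus_def)
 finally show ?thesis unfolding e diff_divide_distrib[symmetric] sum_subtractf[symmetric] abs_divide
  using n by (simp add: divide_right_mono)
qed

text \<open>Sampling does not preserve the vanishing mean, which \<open>tame\<close> demands
  exactly; subtracting the discrete mean leaves \<open>fdiff\<close> unchanged.\<close>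

definition grid_profile :: "nat => (real => real) => int => real" where
 "grid_profile n \<Psi> x = \<Psi> (real_of_int x / real n) + - ((\<Sum>y\<in>torus n. \<Psi> (real_of_int y / real n)) / real n)"

lemma fdiff_grid_profile: "fdiff n (grid_profile n \<Psi>) = (\<lambda>x. dquot n \<Psi> (real_of_int x / real n))"
 unfolding grid_profile_def[abs_def] by (rule fdiff_dquot)

lemma tame_grid_profile:
 assumes n: "n > 0" and p: "profile B \<Psi> h"
 shows "tame n (2 * B) (grid_profile n \<Psi>)"
proof -
 obtain h1 h2 where d: "\<And>x. (\<Psi> has_real_derivative h x) (at x)" "\<And>x. (h has_real_derivative h1 x) (at x)" "\<And>x. (h1 has_real_derivative h2 x) (at x)"
  and b: "\<And>x. \<bar>\<Psi> x\<bar> \<le> B" "\<And>x. \<bar>h x\<bar> \<le> B" "\<And>x. \<bar>h1 x\<bar> \<le> B" "\<And>x. \<bar>h2 x\<bar> \<le> B"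
  and per: "periodic1 \<Psi>" using p unfolding profile_def by blast
 have B0: "0 \<le> B" using b(1)[of 0] by linarith
 have f2: "fdiff n (fdiff n (grid_profile n \<Psi>)) = (\<lambda>x. dquot n (dquot n \<Psi>) (real_of_int x / real n))"
  unfolding fdiff_grid_profile using fdiff_dquot[of n "dquot n \<Psi>" 0] by simp
 have f3: "fdiff n (fdiff n (fdiff n (grid_profile n \<Psi>))) = (\<lambda>x. dquot n (dquot n (dquot n \<Psi>)) (real_of_int x / real n))"
  unfolding f2 using fdiff_dquot[of n "dquot n (dquot n \<Psi>)" 0] by simp
 have q1: "\<bar>dquot n \<Psi> y\<bar> \<le> B" for y by (rule dquot_bound[OF n d(1) b(2)])
 have q2: "\<bar>dquot n (dquot n \<Psi>) y\<bar> \<le> B" for y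
  by (rule dquot_bound[OF n DERIV_dquot[OF d(1)]]) (rule dquot_bound[OF n d(2) b(3)])
 have q3: "\<bar>dquot n (dquot n (dquot n \<Psi>)) y\<bar> \<le> B" for y
  by (rule dquot_bound[OF n DERIV_dquot[OF DERIV_dquot[OF d(1)]]])
    (rule dquot_bound[OF n DERIV_dquot[OF d(2)]], rule dquot_bound[OF n d(3) b(4)])
 have card: "card (torus n) = n" by (simp add: torus_def)
 have avg: "\<bar>(\<Sum>y\<in>torus n. \<Psi> (real_of_int y / real n)) / real n\<bar> \<le> B"
 proof -
  have "\<bar>\<Sum>y\<in>torus n. \<Psi> (real_of_int y / real n)\<bar> \<le> (\<Sum>y\<in>torus n. B)" by (intro order_trans[OF sum_abs] sum_mono b)
  then show ?thesis using n by (simp add: card divide_le_eq mult.commute)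
 qed
 have "\<bar>grid_profile n \<Psi> x\<bar> \<le> 2 * B" for x
  unfolding grid_profile_def using b(1)[of "real_of_int x / real n"] avg by linarith
 moreover have "(\<Sum>x\<in>torus n. grid_profile n \<Psi> x) = 0"
  unfolding grid_profile_def sum.distrib using n by (simp add: card)
 moreover have "periodic_mod n (grid_profile n \<Psi>)"
 proof -
  have "\<Psi> (u + real m) = \<Psi> u" for u m
  proof (induction m)
   case (Suc m) then show ?case using per unfolding periodic1_def by (metis add.assoc add.commute of_nat_Suc)
  qed simp
  then have z: "\<Psi> (u + real_of_int k) = \<Psi> u" for u k
   by (cases k rule: int_cases2) (auto, metis add.commute diff_add_cancel)
  have "\<Psi> (real_of_int (x mod int n) / real n) = \<Psi> (real_of_int x / real n)" for x
  proof -
   have "real_of_int x = real_of_int (x div int n) * real n + real_of_int (x mod int n)"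
    by (metis div_mult_mod_eq of_int_add of_int_mult of_int_of_nat_eq)
   then have "real_of_int x / real n = real_of_int (x mod int n) / real n + real_of_int (x div int n)" using n by (simp add: field_simps)
   then show ?thesis by (simp add: z)
  qed
  then show ?thesis by (simp add: periodic_mod_def grid_profile_def)
 qed
 moreover have "\<bar>fdiff n (grid_profile n \<Psi>) x\<bar> \<le> 2 * B" for x
  unfolding fdiff_grid_profile using q1[of "real_of_int x / real n"] B0 by linarith
 moreover have "\<bar>fdiff n (fdiff n (grid_profile n \<Psi>)) x\<bar> \<le> 2 * B" for x
  unfolding f2 using q2[of "real_of_int x / real n"] B0 by linarith
 moreover have "\<bar>fdiff n (fdiff n (fdiff n (grid_profile n \<Psi>))) x\<bar> \<le> 2 * B" for x
  unfolding f3 using q3[of "real_of_int x / real n"] B0 by linarith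
 ultimately show ?thesis unfolding tame_def by blast
qed

text \<open>The sampled \<open>h\<close> and the difference quotient of \<Psi> are B / n apart at
  each site, and a field is at most sqrt n / 2 times the sup norm of its test function.\<close>

lemma fluct_field_near_lfield:
 assumes n: "n > 0" and p: "profile B \<Psi> h" and s: "s \<in> Omega n"
 shows "\<bar>fluct_field n h s - lfield n (fdiff n (grid_profile n \<Psi>)) s\<bar> \<le> B / sqrt (real n)"
proof -
 obtain h1 h2 where d: "\<And>x. (\<Psi> has_real_derivative h x) (at x)" "\<And>x. (h has_real_derivative h1 x) (at x)"
  and b: "\<And>x. \<bar>h1 x\<bar> \<le> B" using p unfolding profile_def by blast
 have B0: "0 \<le> B" using b[of 0] by linarith
 let ?f = "\<lambda>x. h (real_of_int x / real n) - fdiff n (grid_profile n \<Psi>) x"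
 have "fluct_field n h s = lfield n (\<lambda>x. h (real_of_int x / real n)) s"
  unfolding fluct_field_def lfield_def sum_distrib_left sum_divide_distrib
  by (intro sum.cong refl) (auto simp: spin_def torus_def field_simps)
 then have e: "fluct_field n h s - lfield n (fdiff n (grid_profile n \<Psi>)) s = lfield n ?f s"
  by (simp add: lfield_def diff_divide_distrib sum_subtractf left_diff_distrib)
 have "\<bar>?f x\<bar> \<le> B / real n" for x
  using dquot_near_derivative[OF n d b, of "real_of_int x / real n"] unfolding fdiff_grid_profile by (simp add: abs_minus_commute)
 then have "\<bar>lfield n ?f s\<bar> \<le> B / real n * sqrt (real n) / 2" by (rule abs_lfield_le[OF s n])
 also have "... = B / (2 * sqrt (real n))" using n by (simp add: field_simps)
 also have "... \<le> B / sqrt (real n)" using B0 n by (intro divide_left_mono) auto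
 finally show ?thesis unfolding e .
qed

lemma riemann_sum_tendsto:
 assumes d: "\<And>x. (u has_real_derivative u' x) (at x)" and b: "\<And>x. \<bar>u' x\<bar> \<le> B"
 shows "(\<lambda>n. (\<Sum>x\<in>torus n. u (real_of_int x / real n)) / real n) \<longlonglongrightarrow> integral {0..1} u"
proof -
 have "(\<lambda>n. (\<Sum>x\<in>torus n. u (real_of_int x / real n)) / real n - integral {0..1} u) \<longlonglongrightarrow> 0"
  by (rule Lim_null_comparison[OF _ lim_const_over_n[of B]])
    (use riemann_sum_bound[OF _ d b] in \<open>auto intro!: eventually_sequentiallyI[of 1]\<close>)
 then show ?thesis by (simp add: LIM_zero_iff)
qed

lemma cov_form_tendsto:
 assumes p: "profile B \<Psi> h" and z: "integral {0..1} \<Psi> = 0"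
 shows "(\<lambda>n. cov_form a n (grid_profile n \<Psi>)) \<longlonglongrightarrow> 1/4 * integral {0..1} (\<lambda>u. (h u)^2) + a/2 * integral {0..1} (\<lambda>u. (\<Psi> u)^2)"
proof -
 obtain h1 h2 where d: "\<And>x. (\<Psi> has_real_derivative h x) (at x)" "\<And>x. (h has_real_derivative h1 x) (at x)"
  and b: "\<And>x. \<bar>\<Psi> x\<bar> \<le> B" "\<And>x. \<bar>h x\<bar> \<le> B" "\<And>x. \<bar>h1 x\<bar> \<le> B" using p unfolding profile_def by blast
 have B0: "0 \<le> B" using b(1)[of 0] by linarith
 have d2: "((\<lambda>x. (\<Psi> x)^2) has_real_derivative 2 * (\<Psi> x * h x)) (at x)" "((\<lambda>x. (h x)^2) has_real_derivative 2 * (h x * h1 x)) (at x)" for x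
  using d by (auto intro!: derivative_eq_intros)
 have b2: "\<bar>2 * (\<Psi> x * h x)\<bar> \<le> 2 * (B * B)" "\<bar>2 * (h x * h1 x)\<bar> \<le> 2 * (B * B)" for x
  unfolding abs_mult using b B0 by (auto intro!: mult_mono)
 let ?S = "\<lambda>u n. (\<Sum>x\<in>torus n. u (real_of_int x / real n)) / real n"
 have L1: "?S (\<lambda>x. (\<Psi> x)^2) \<longlonglongrightarrow> integral {0..1} (\<lambda>u. (\<Psi> u)^2)" by (rule riemann_sum_tendsto[OF d2(1) b2(1)])
 have L2: "?S (\<lambda>x. (h x)^2) \<longlonglongrightarrow> integral {0..1} (\<lambda>u. (h u)^2)" by (rule riemann_sum_tendsto[OF d2(2) b2(2)])
 have L0: "?S \<Psi> \<longlonglongrightarrow> 0" using riemann_sum_tendsto[OF d(1) b(2)] z by simp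
 have e1: "(\<Sum>x\<in>torus n. (grid_profile n \<Psi> x)^2) / real n = ?S (\<lambda>x. (\<Psi> x)^2) n - (?S \<Psi> n)^2" if n: "n > 0" for n
 proof -
  define m where "m = ?S \<Psi> n"
  have s: "(\<Sum>x\<in>torus n. \<Psi> (real_of_int x / real n)) = real n * m" using n by (simp add: m_def)
  have "(\<Sum>x\<in>torus n. (grid_profile n \<Psi> x)^2) = (\<Sum>x\<in>torus n. (\<Psi> (real_of_int x / real n))^2 - 2 * m * \<Psi> (real_of_int x / real n) + m^2)"
   by (intro sum.cong refl) (simp add: grid_profile_def m_def[symmetric] power2_eq_square algebra_simps)
  also have "... = (\<Sum>x\<in>torus n. (\<Psi> (real_of_int x / real n))^2) - real n * m^2"
   unfolding sum.distrib sum_subtractf sum_distrib_left[symmetric] s by (simp add: torus_def power2_eq_square)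
  finally show ?thesis using n by (simp add: m_def[symmetric] diff_divide_distrib)
 qed
 have e2: "\<bar>(\<Sum>x\<in>torus n. (fdiff n (grid_profile n \<Psi>) x)^2) / real n - ?S (\<lambda>x. (h x)^2) n\<bar> \<le> 2 * B * B / real n" if n: "n > 0" for n
 proof -
  have "\<bar>(fdiff n (grid_profile n \<Psi>) x)^2 - (h (real_of_int x / real n))^2\<bar> \<le> 2 * B * B / real n" for x
  proof -
   let ?y = "real_of_int x / real n"
   have "(dquot n \<Psi> ?y)^2 - (h ?y)^2 = (dquot n \<Psi> ?y + h ?y) * (dquot n \<Psi> ?y - h ?y)"
    by (simp add: power2_eq_square algebra_simps)
   moreover have "\<bar>dquot n \<Psi> ?y + h ?y\<bar> \<le> 2 * B" using dquot_bound[OF n d(1) b(2), of ?y] b(2)[of ?y] by linarith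
   ultimately have "\<bar>(dquot n \<Psi> ?y)^2 - (h ?y)^2\<bar> \<le> (2 * B) * (B / real n)"
    using dquot_near_derivative[OF n d b(3), of ?y] B0 unfolding abs_mult by (auto intro!: mult_mono simp only: abs_mult)
   then show ?thesis unfolding fdiff_grid_profile by simp
  qed
  then have "\<bar>\<Sum>x\<in>torus n. ((fdiff n (grid_profile n \<Psi>) x)^2 - (h (real_of_int x / real n))^2)\<bar> \<le> (\<Sum>x\<in>torus n. 2 * B * B / real n)"
   by (intro order_trans[OF sum_abs] sum_mono)
  also have "... = 2 * B * B" using n by (simp add: torus_def)
  finally show ?thesis unfolding diff_divide_distrib[symmetric] sum_subtractf[symmetric] abs_divide
   using n by (simp add: divide_right_mono)
 qed
 have "(\<lambda>n. (\<Sum>x\<in>torus n. (fdiff n (grid_profile n \<Psi>) x)^2) / real n - ?S (\<lambda>x. (h x)^2) n) \<longlonglongrightarrow> 0"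
  by (rule Lim_null_comparison[OF _ lim_const_over_n[of "2 * B * B"]])
    (use e2 in \<open>auto intro!: eventually_sequentiallyI[of 1]\<close>)
 from tendsto_add[OF this L2] have M2: "(\<lambda>n. (\<Sum>x\<in>torus n. (fdiff n (grid_profile n \<Psi>) x)^2) / real n) \<longlonglongrightarrow> integral {0..1} (\<lambda>u. (h u)^2)" by simp
 have "(\<lambda>n. ?S (\<lambda>x. (\<Psi> x)^2) n - (?S \<Psi> n)^2) \<longlonglongrightarrow> integral {0..1} (\<lambda>u. (\<Psi> u)^2) - 0^2" by (intro tendsto_intros L1 L0)
 then have "(\<lambda>n. (\<Sum>x\<in>torus n. (grid_profile n \<Psi> x)^2) / real n) \<longlonglongrightarrow> integral {0..1} (\<lambda>u. (\<Psi> u)^2) - 0^2"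
  by (rule Lim_transform_eventually) (use e1 in \<open>auto intro!: eventually_sequentiallyI[of 1]\<close>)
 then show ?thesis unfolding cov_form_def using M2 by (intro tendsto_intros) auto
qed

lemma integral_mu_ss:
 fixes f :: "(int => nat) => 'b :: {banach, second_countable_topology}"
 assumes "set_pmf \<mu> \<subseteq> Omega n"
 shows "(\<integral>s. f s \<partial>measure_pmf \<mu>) = expect n (pmf \<mu>) f"
 unfolding expect_def by (rule integral_measure_pmf) (use assms finite_Omega in auto)

text \<open>The second hypothesis says a * rate_const <= 1/2, which turns
  \<open>dirichlet_apriori\<close> into D <= (D + 1) / 2, that is D <= 1. The bound on the fourth
  moment is \<open>moment_bound\<close> at D = 1.\<close>

lemma mu_ss_controlled:
 assumes a: "a > 0" "a * (1000000000 + 100000 * (16 * \<bar>\<theta>\<bar> + 560)^2) \<le> 1/2"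
  and n: "n \<ge> 10000" "2 * \<bar>\<theta>\<bar> \<le> sqrt (real n)"
 shows "set_pmf (mu_ss \<theta> a n) \<subseteq> Omega n"
  and "\<exists>l. controlled_weight n (pmf (mu_ss \<theta> a n)) \<theta> a (2 * (3900 + (16 * \<bar>\<theta>\<bar> + 560)^2)) l"
proof -
 have n0: "n > 0" using n by simp
 have g: "\<bar>gam \<theta> n\<bar> < 1"
 proof -
  have "\<bar>\<theta> / sqrt (real n)\<bar> \<le> 1 / 2" using n n0 by (simp add: divide_le_eq)
  moreover have "\<bar>(1 - t) / 2\<bar> < 1" if "\<bar>t\<bar> \<le> 1 / 2" for t :: real using that by (simp add: abs_le_iff abs_less_iff field_simps)
  ultimately show ?thesis unfolding gam_def by blast
 qed
 note st = mu_ss_stationary[OF n0 g a(1)]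
 show sub: "set_pmf (mu_ss \<theta> a n) \<subseteq> Omega n" by (rule st(1))
 interpret W: stationary_weight n "pmf (mu_ss \<theta> a n)" \<theta> a
 proof
  show "(\<Sum>s\<in>Omega n. pmf (mu_ss \<theta> a n) s) = 1" using sub finite_Omega by (intro sum_pmf_eq_1)
 qed (use a n st in auto)
 let ?D = "dirichlet n (pmf (mu_ss \<theta> a n))"
 let ?X = "(16 * \<bar>\<theta>\<bar> + 560)^2"
 have "?D \<le> (a * (1000000000 + 100000 * ?X)) * (?D + 1)"
  using W.dirichlet_apriori unfolding W.rate_const_def by (simp only: mult.assoc)
 also have "... \<le> 1/2 * (?D + 1)" using a(2) dirichlet_nonneg[of n] by (intro mult_right_mono) (auto intro: add_nonneg_nonneg)
 finally have D: "?D \<le> 1" by simp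
 obtain l where l: "l \<ge> 1" "2 * l + 2 \<le> n" "(real l)^2 / real n \<le> 4 * sqrt (real n)" "real n / real l \<le> sqrt (sqrt (real n))"
  using window_exists[OF n(1)] by blast
 have "controlled_weight n (pmf (mu_ss \<theta> a n)) \<theta> a (2 * (3900 + ?X)) l"
 proof
  show "real n * expect n (pmf (mu_ss \<theta> a n)) (\<lambda>s. mag n s ^ 4) \<le> 2 * (3900 + ?X)"
   using W.moment_bound D by simp
  show "1 \<le> 2 * (3900 + ?X)" by (rule order_trans[of _ "2 * (3900 + 0)"]) (auto intro!: mult_left_mono add_left_mono)
 qed (use D l in auto)
 then show "\<exists>l. controlled_weight n (pmf (mu_ss \<theta> a n)) \<theta> a (2 * (3900 + ?X)) l" ..
qed

lemma tame_mono: "tame n C p ==> C \<le> C' ==> tame n C' p"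
 unfolding tame_def by (meson order_trans)

lemma root_reciprocal_tendsto: "(\<lambda>n. c / sqrt (sqrt (sqrt (real n)))) \<longlonglongrightarrow> 0"
 by (intro tendsto_divide_0[OF tendsto_const] filterlim_at_top_imp_at_infinity
   filterlim_compose[OF sqrt_at_top] filterlim_real_sequentially)

lemma sqrt_reciprocal_tendsto: "(\<lambda>n. c / sqrt (real n)) \<longlonglongrightarrow> 0"
 by (intro tendsto_divide_0[OF tendsto_const] filterlim_at_top_imp_at_infinity
   filterlim_compose[OF sqrt_at_top] filterlim_real_sequentially)

text \<open>The time T = 8 ln (C / e) is what a decay like exp (- k / (8 n^2)) needs to bring
  \<open>C\<close> down to \<open>e\<close>; the extra 1 pays for rounding T n^2 up to an
  integer.\<close>

lemma (in controlled_weight) Fint_near_1: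
 assumes t: "tame n C p" and C: "C \<ge> 1" and nC: "real n \<ge> 2 * ((1 + a) * C^2)" and e: "0 < e" "e \<le> 1"
 shows "cmod (Fint p - 1) \<le> (8 * ln (C / e) + 1) * (exp ((1 + a) * C^2) * (err C + 13 * ((1 + a) * C^2)^2 / real n))
  + (exp ((1 + a) * C^2) * sqrt (20 * C * e) + (exp ((1 + a) * e^2) - 1))"
proof -
 define T where "T = 8 * ln (C / e)"
 define s where "s = exp ((1 + a) * C^2) * (err C + 13 * ((1 + a) * C^2)^2 / real n)"
 have T0: "0 \<le> T" unfolding T_def using C e by (simp add: ln_ge_zero)
 have n2: "(real n)^2 \<ge> 1" using n_pos by simp
 define k where "k = nat \<lceil>T * (real n)^2\<rceil>"
 have k1: "T * (real n)^2 \<le> real k" unfolding k_def by linarith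
 have k2: "real k \<le> T * (real n)^2 + 1" unfolding k_def using T0 n2 by (simp add: of_nat_nat)
 have npos: "0 < (real n)^2" using n2 by linarith
 have kT: "T \<le> real k / (real n)^2" using k1 unfolding pos_le_divide_eq[OF npos] .
 have kT1: "real k / (real n)^2 \<le> T + 1"
 proof -
  have "real k \<le> (T + 1) * (real n)^2" using k2 n2 by (simp add: distrib_right)
  then show ?thesis unfolding pos_divide_le_eq[OF npos] .
 qed
 have "C * exp (- real k / (8 * (real n)^2)) \<le> C * exp (- T / 8)"
 proof -
  have "- real k / (8 * (real n)^2) = - (real k / (real n)^2) / 8" by simp
  then show ?thesis using kT C by simp
 qed
 also have "- T / 8 = ln (e / C)" using C e by (simp add: T_def ln_div)
 also have "C * exp (ln (e / C)) = e" using C e by simp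
 finally have ke: "C * exp (- real k / (8 * (real n)^2)) \<le> e" .
 have s0: "0 \<le> s"
  using C K_ge a_pos r_facts(1) unfolding s_def err_def by (intro mult_nonneg_nonneg add_nonneg_nonneg divide_nonneg_nonneg) auto
 have "cmod (Fint p - 1) \<le> cmod (Fint (flow p k) - Fint p) + cmod (Fint (flow p k) - 1)"
  using norm_triangle_ineq4[of "Fint (flow p k) - 1" "Fint (flow p k) - Fint p"] by (simp add: algebra_simps)
 also have "... \<le> (T + 1) * s + (exp ((1 + a) * C^2) * sqrt (20 * C * e) + (exp ((1 + a) * e^2) - 1))"
 proof (rule add_mono)
  show "cmod (Fint (flow p k) - Fint p) \<le> (T + 1) * s"
   using interpolation[OF t C nC, of k, folded s_def] mult_right_mono[OF kT1 s0] by (rule order_trans)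
 qed (rule Fint_flow_near_1[OF t C ke e])
 finally show ?thesis unfolding T_def s_def .
qed

locale stationary_sequence =
 fixes \<theta> a :: real
 assumes a_pos: "a > 0" and a_small: "a * (1000000000 + 100000 * (16 * \<bar>\<theta>\<bar> + 560)^2) \<le> 1/2"
begin

abbreviation "\<mu> n \<equiv> mu_ss \<theta> a n"

definition n0 :: nat where "n0 = max 10000 (nat \<lceil>4 * \<theta>^2\<rceil>)"

lemma n0_large: "n \<ge> n0 ==> n \<ge> 10000 \<and> 2 * \<bar>\<theta>\<bar> \<le> sqrt (real n)"
proof
 assume n: "n \<ge> n0"
 then show "n \<ge> 10000" by (simp add: n0_def)
 have "4 * \<theta>^2 \<le> real n" using n unfolding n0_def by linarith
 then have "(2 * \<bar>\<theta>\<bar>)^2 \<le> real n" by (simp add: power_mult_distrib)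
 then show "2 * \<bar>\<theta>\<bar> \<le> sqrt (real n)" by (rule real_le_rsqrt)
qed

lemma support: "n \<ge> n0 ==> set_pmf (\<mu> n) \<subseteq> Omega n"
 using mu_ss_controlled(1)[OF a_pos a_small] n0_large by blast

lemma finite_support: "n \<ge> n0 ==> finite (set_pmf (\<mu> n))"
 using support finite_Omega finite_subset by blast

lemma controlled: "n \<ge> n0 ==> \<exists>l. controlled_weight n (pmf (\<mu> n)) \<theta> a (2 * (3900 + (16 * \<bar>\<theta>\<bar> + 560)^2)) l"
 using mu_ss_controlled(2)[OF a_pos a_small] n0_large by blast

context
 fixes B \<Psi> h
 assumes prof: "profile B \<Psi> h" and mean0: "integral {0..1} \<Psi> = 0"
begin

definition "limit_var = 1/4 * integral {0..1} (\<lambda>u. (h u)^2) + a/2 * integral {0..1} (\<lambda>u. (\<Psi> u)^2)"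

abbreviation "X n s \<equiv> lfield n (fdiff n (grid_profile n \<Psi>)) s"

lemma B_nonneg: "0 \<le> B"
proof -
 obtain h1 h2 where "\<forall>x. \<bar>\<Psi> x\<bar> \<le> B" using prof unfolding profile_def by blast
 then have "\<bar>\<Psi> 0\<bar> \<le> B" by blast
 then show ?thesis by linarith
qed

lemma lfield_cf_tendsto:
 "(\<lambda>n. \<integral>s. cis (X n s) \<partial>\<mu> n) \<longlonglongrightarrow> complex_of_real (exp (- limit_var / 2))"
proof -
 define C where "C = max 1 (2 * B)"
 have C: "C \<ge> 1" by (simp add: C_def)
 define K where "K = 2 * (3900 + (16 * \<bar>\<theta>\<bar> + 560)^2)"
 define c where "c = (1 + a) * C^2"
 define cv where "cv n = cov_form a n (grid_profile n \<Psi>)" for n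
 define G where "G n = (\<integral>s. cis (X n s) \<partial>\<mu> n) * complex_of_real (exp (cv n / 2))" for n
 define er where "er n = C ^ 6 / sqrt (sqrt (sqrt (real n))) * ((1 + a) * (40 * \<bar>\<theta>\<bar> + 405 + 5 * K))" for n :: nat
 define N where "N = max n0 (nat \<lceil>2 * c\<rceil>)"
 have bound: "cmod (G n - 1) \<le> (8 * ln (C / e) + 1) * (exp c * (er n + 13 * c^2 / real n)) + (exp c * sqrt (20 * C * e) + (exp ((1 + a) * e^2) - 1))"
  if n: "n \<ge> N" and e: "0 < e" "e \<le> 1" for n e
 proof -
  have nn: "n \<ge> n0" using n by (simp add: N_def)
  obtain l where "controlled_weight n (pmf (\<mu> n)) \<theta> a K l" using controlled[OF nn] unfolding K_def by blast
  then interpret controlled_weight n "pmf (\<mu> n)" \<theta> a K l .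
  have t: "tame n C (grid_profile n \<Psi>)" by (rule tame_mono[OF tame_grid_profile[OF n_pos prof]]) (simp add: C_def)
  have nC: "real n \<ge> 2 * ((1 + a) * C^2)" using n unfolding N_def c_def by linarith
  have "Fint (grid_profile n \<Psi>) = G n" unfolding Fint_def G_def cv_def integral_mu_ss[OF support[OF nn]] ..
  moreover have "err C = er n" unfolding err_def er_def r_def ..
  ultimately show ?thesis using Fint_near_1[OF t C nC e] unfolding c_def by simp
 qed
 have G: "G \<longlonglongrightarrow> 1"
 proof (rule LIMSEQ_I)
  fix \<epsilon> :: real assume \<epsilon>: "0 < \<epsilon>"
  have "(\<lambda>m. exp c * sqrt (20 * C * inverse (real (Suc m))) + (exp ((1 + a) * (inverse (real (Suc m)))^2) - 1))
    \<longlonglongrightarrow> exp c * sqrt (20 * C * 0) + (exp ((1 + a) * 0^2) - 1)"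
   by (intro tendsto_intros LIMSEQ_inverse_real_of_nat)
  then have "(\<lambda>m. exp c * sqrt (20 * C * inverse (real (Suc m))) + (exp ((1 + a) * (inverse (real (Suc m)))^2) - 1)) \<longlonglongrightarrow> 0" by simp
  from order_tendstoD(2)[OF this, of "\<epsilon> / 2"] \<epsilon>
  obtain m where m: "exp c * sqrt (20 * C * inverse (real (Suc m))) + (exp ((1 + a) * (inverse (real (Suc m)))^2) - 1) < \<epsilon> / 2"
   using eventually_happens by fastforce
  \<comment> \<open>The order of limits matters: \<open>e\<close> is fixed first, by the terms free
    of n, and only then does n grow to beat the factor ln (C / e).\<close>
  define e where "e = inverse (real (Suc m))"
  have e: "0 < e" "e \<le> 1" by (auto simp: e_def inverse_le_1_iff)
  have er: "er \<longlonglongrightarrow> 0" unfolding er_def by (rule tendsto_mult_left_zero[OF root_reciprocal_tendsto])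
  have "(\<lambda>n. (8 * ln (C / e) + 1) * (exp c * (er n + 13 * c^2 / real n))) \<longlonglongrightarrow> (8 * ln (C / e) + 1) * (exp c * (0 + 0))"
   by (intro tendsto_intros er lim_const_over_n)
  then have "(\<lambda>n. (8 * ln (C / e) + 1) * (exp c * (er n + 13 * c^2 / real n))) \<longlonglongrightarrow> 0" by simp
  from order_tendstoD(2)[OF this, of "\<epsilon> / 2"] \<epsilon>
  obtain n1 where n1: "\<And>n. n \<ge> n1 ==> (8 * ln (C / e) + 1) * (exp c * (er n + 13 * c^2 / real n)) < \<epsilon> / 2"
   by (auto simp: eventually_sequentially)
  have "norm (G n - 1) < \<epsilon>" if "n \<ge> max N n1" for n
   using bound[of n e] n1[of n] m[folded e_def] e that by simp argo
  then show "\<exists>no. \<forall>n\<ge>no. norm (G n - 1) < \<epsilon>" by blast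
 qed
 have cv: "cv \<longlonglongrightarrow> limit_var" unfolding cv_def limit_var_def by (rule cov_form_tendsto[OF prof mean0])
 have "(\<lambda>n. G n * complex_of_real (exp (- cv n / 2))) \<longlonglongrightarrow> 1 * complex_of_real (exp (- limit_var / 2))"
  by (intro tendsto_intros G cv) auto
 moreover have "G n * complex_of_real (exp (- cv n / 2)) = (\<integral>s. cis (X n s) \<partial>\<mu> n)" for n
  unfolding G_def mult.assoc of_real_mult[symmetric] exp_add[symmetric] by simp
 ultimately show ?thesis by simp
qed

lemma fluct_field_near:
 assumes "n \<ge> n0" "s \<in> set_pmf (\<mu> n)"
 shows "\<bar>fluct_field n h s - X n s\<bar> \<le> B / sqrt (real n)"
 using fluct_field_near_lfield[OF _ prof, of n s] support[OF assms(1)] assms n0_large[OF assms(1)] by auto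

lemma fluct_cf_tendsto:
 "(\<lambda>n. \<integral>s. cis (fluct_field n h s) \<partial>\<mu> n) \<longlonglongrightarrow> complex_of_real (exp (- limit_var / 2))"
proof -
 have "cmod ((\<integral>s. cis (fluct_field n h s) \<partial>\<mu> n) - (\<integral>s. cis (X n s) \<partial>\<mu> n)) \<le> B / sqrt (real n)" if n: "n \<ge> n0" for n
 proof -
  note fs = integrable_measure_pmf_finite[OF finite_support[OF n]]
  have "(\<integral>s. cis (fluct_field n h s) \<partial>\<mu> n) - (\<integral>s. cis (X n s) \<partial>\<mu> n) = (\<integral>s. cis (fluct_field n h s) - cis (X n s) \<partial>\<mu> n)"
   by (simp add: fs)
  also have "cmod ... \<le> (\<integral>s. cmod (cis (fluct_field n h s) - cis (X n s)) \<partial>\<mu> n)" by (rule integral_norm_bound)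
  also have "... \<le> (\<integral>s. B / sqrt (real n) \<partial>\<mu> n)"
  proof (rule integral_mono_AE)
   show "AE s in measure_pmf (\<mu> n). cmod (cis (fluct_field n h s) - cis (X n s)) \<le> B / sqrt (real n)"
    unfolding AE_measure_pmf_iff using fluct_field_near[OF n] cis_diff_le order_trans by blast
  qed (simp_all add: fs)
  finally show ?thesis by simp
 qed
 then have "(\<lambda>n. (\<integral>s. cis (fluct_field n h s) \<partial>\<mu> n) - (\<integral>s. cis (X n s) \<partial>\<mu> n)) \<longlonglongrightarrow> 0"
  by (intro Lim_null_comparison[OF _ sqrt_reciprocal_tendsto[of B]] eventually_sequentiallyI[of n0])
 from tendsto_add[OF this lfield_cf_tendsto] show ?thesis by simp
qed

lemma fluct_second_moment:
 assumes n: "n \<ge> n0"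
 shows "(\<integral>s. (fluct_field n h s)^2 \<partial>\<mu> n) \<le> 40 * (max 1 (2 * B))^2 + 2 * B^2"
proof -
 define C where "C = max 1 (2 * B)"
 have C: "C \<ge> 1" by (simp add: C_def)
 obtain K l where "controlled_weight n (pmf (\<mu> n)) \<theta> a K l" using controlled[OF n] by blast
 then interpret controlled_weight n "pmf (\<mu> n)" \<theta> a K l .
 have t: "tame n C (grid_profile n \<Psi>)" by (rule tame_mono[OF tame_grid_profile[OF n_pos prof]]) (simp add: C_def)
 note fs = integrable_measure_pmf_finite[OF finite_support[OF n]]
 have Bn: "B / sqrt (real n) \<le> B" using B_nonneg n_pos mult_left_mono[of 1 "sqrt (real n)" B] by (simp add: divide_le_eq)
 have "(\<integral>s. (fluct_field n h s)^2 \<partial>\<mu> n) \<le> (\<integral>s. 2 * (X n s)^2 + 2 * B^2 \<partial>\<mu> n)"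
 proof (rule integral_mono_AE)
  show "AE s in measure_pmf (\<mu> n). (fluct_field n h s)^2 \<le> 2 * (X n s)^2 + 2 * B^2"
   unfolding AE_measure_pmf_iff
  proof
   fix s assume s: "s \<in> set_pmf (\<mu> n)"
   have "\<bar>fluct_field n h s - X n s\<bar> \<le> B" using fluct_field_near[OF n s] Bn by linarith
   then have "(fluct_field n h s - X n s)^2 \<le> B^2" using B_nonneg by (metis abs_le_square_iff abs_of_nonneg)
   moreover have "u^2 \<le> 2 * v^2 + 2 * (u - v)^2" for u v :: real
    using zero_le_power2[of "u - 2 * v"] by (simp add: power2_eq_square algebra_simps)
   ultimately show "(fluct_field n h s)^2 \<le> 2 * (X n s)^2 + 2 * B^2"
    by (smt (verit, best))
  qed
 qed (simp_all add: fs)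
 also have "... = 2 * (\<integral>s. (X n s)^2 \<partial>\<mu> n) + 2 * B^2" by (simp add: fs)
 also have "(\<integral>s. (X n s)^2 \<partial>\<mu> n) \<le> 20 * C^2"
  using variance_bound[OF t C] unfolding integral_mu_ss[OF support[OF n]] .
 finally show ?thesis unfolding C_def by simp
qed

end

end

section \<open>Smooth test functions and joint convergence\<close>

lemma periodic_continuous_bounded:
 fixes f :: "real => real"
 assumes f: "continuous_on UNIV f" and p: "periodic1 f"
 shows "\<exists>B. \<forall>x. \<bar>f x\<bar> \<le> B"
proof -
 obtain B where B: "\<And>x. x \<in> {0..1} ==> \<bar>f x\<bar> \<le> B"
  using compact_imp_bounded[OF compact_continuous_image[OF continuous_on_subset[OF f] compact_Icc[of 0 1]]]
  unfolding bounded_iff by fastforce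
 have nat: "f (u + real m) = f u" for u m
 proof (induction m)
  case (Suc m) then show ?case using p unfolding periodic1_def by (metis add.assoc add.commute of_nat_Suc)
 qed simp
 have int: "f (u + real_of_int k) = f u" for u k
 proof (cases k rule: int_cases2)
  case (nonneg m) then show ?thesis using nat by simp
 next
  case (nonpos m) then show ?thesis using nat[of "u - real m" m] by simp
 qed
 have "\<bar>f x\<bar> \<le> B" for x
 proof -
  have "f x = f (frac x)" using int[of "frac x" "\<lfloor>x\<rfloor>"] by (simp add: frac_def)
  then show ?thesis using B[of "frac x"] frac_lt_1[of x] by (simp add: less_imp_le)
 qed
 then show ?thesis by blast
qed

lemma periodic_deriv: "periodic1 f ==> (\<And>x. f differentiable at x) ==> periodic1 (deriv f)"
 unfolding periodic1_def
proof
 fix x assume p: "\<forall>u. f (u + 1) = f u" and d: "\<And>x. f differentiable at x"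
 have "(f has_real_derivative deriv f (x + 1)) (at (x + 1))"
  using d DERIV_deriv_iff_real_differentiable by blast
 then have "((\<lambda>u. f (u + 1)) has_real_derivative deriv f (x + 1)) (at x)" by (simp add: DERIV_shift)
 then show "deriv f (x + 1) = deriv f x" using p by (simp add: DERIV_imp_deriv)
qed

lemma smooth_mean_zeroD:
 assumes "H \<in> smooth_mean_zero"
 shows "H \<in> L2_mean_zero" "\<exists>B. profile B (antideriv H) H" "continuous_on UNIV H"
proof -
 have p: "periodic1 H" and s: "\<And>k x. (deriv ^^ k) H differentiable at x" and z: "torus_mean H = 0"
  using assms by (auto simp: smooth_mean_zero_def)
 have d0: "H differentiable at x" for x using s[of 0] by simp
 have d1: "deriv H differentiable at x" for x using s[of 1] by simp
 have d2: "deriv (deriv H) differentiable at x" for x using s[of 2] by (simp add: numeral_2_eq_2)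
 have cont: "continuous_on UNIV f" if "\<And>x. f differentiable at x" for f :: "real => real"
  using that by (intro continuous_at_imp_continuous_on ballI differentiable_imp_continuous_within)
 show c: "continuous_on UNIV H" by (rule cont[OF d0])
 have "set_integrable lborel {0..1} (\<lambda>u. (H u)^2)"
  using c by (intro borel_integrable_atLeastAtMost' continuous_intros) (auto intro: continuous_on_subset)
 then show L2: "H \<in> L2_mean_zero" using p z c by (simp add: L2_mean_zero_def borel_measurable_continuous_onI)
 note A = antideriv_props[OF L2_mean_zeroD(2,5,6)[OF L2]]
 have p1: "periodic1 (deriv H)" by (rule periodic_deriv[OF p d0])
 have p2: "periodic1 (deriv (deriv H))" by (rule periodic_deriv[OF p1 d1])
 obtain B0 B1 B2 B3 where "\<forall>x. \<bar>antideriv H x\<bar> \<le> B0" "\<forall>x. \<bar>H x\<bar> \<le> B1" "\<forall>x. \<bar>deriv H x\<bar> \<le> B2" "\<forall>x. \<bar>deriv (deriv H) x\<bar> \<le> B3"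
  using periodic_continuous_bounded[OF A(2,1)] periodic_continuous_bounded[OF c p]
   periodic_continuous_bounded[OF cont[OF d1] p1] periodic_continuous_bounded[OF cont[OF d2] p2] by blast
 then have b: "\<bar>antideriv H x\<bar> \<le> max (max B0 B1) (max B2 B3)" "\<bar>H x\<bar> \<le> max (max B0 B1) (max B2 B3)"
  "\<bar>deriv H x\<bar> \<le> max (max B0 B1) (max B2 B3)" "\<bar>deriv (deriv H) x\<bar> \<le> max (max B0 B1) (max B2 B3)" for x
  by (auto simp: le_max_iff_disj)
 have "(antideriv H has_real_derivative H x) (at x)" for x
  unfolding antideriv_def[abs_def] using DERIV_diff[OF DERIV_primitive[OF c] DERIV_const] by simp
 then have "profile (max (max B0 B1) (max B2 B3)) (antideriv H) H"
  unfolding profile_def using A(1) b d0 d1 DERIV_deriv_iff_real_differentiable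
  by (intro conjI exI[of _ "deriv H"] exI[of _ "deriv (deriv H)"]) blast+
 then show "\<exists>B. profile B (antideriv H) H" ..
qed

lemma profile_linear_combination:
 assumes "finite F" "\<And>i. i \<in> F ==> profile (B i) (\<Psi> i) (h i)"
 shows "profile (\<Sum>i\<in>F. \<bar>t i\<bar> * B i) (\<lambda>x. \<Sum>i\<in>F. t i * \<Psi> i x) (\<lambda>x. \<Sum>i\<in>F. t i * h i x)"
proof -
 have "\<forall>i\<in>F. \<exists>h1 h2. \<forall>x. (\<Psi> i has_real_derivative h i x) (at x) \<and> (h i has_real_derivative h1 x) (at x) \<and> (h1 has_real_derivative h2 x) (at x) \<and>
   \<bar>\<Psi> i x\<bar> \<le> B i \<and> \<bar>h i x\<bar> \<le> B i \<and> \<bar>h1 x\<bar> \<le> B i \<and> \<bar>h2 x\<bar> \<le> B i"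
  using assms(2) unfolding profile_def by blast
 then obtain h1 h2 where "\<forall>i\<in>F. \<forall>x. (\<Psi> i has_real_derivative h i x) (at x) \<and> (h i has_real_derivative h1 i x) (at x) \<and> (h1 i has_real_derivative h2 i x) (at x) \<and>
   \<bar>\<Psi> i x\<bar> \<le> B i \<and> \<bar>h i x\<bar> \<le> B i \<and> \<bar>h1 i x\<bar> \<le> B i \<and> \<bar>h2 i x\<bar> \<le> B i"
  unfolding bchoice_iff by blast
 then have d: "\<And>i x. i \<in> F ==> (\<Psi> i has_real_derivative h i x) (at x)"
   "\<And>i x. i \<in> F ==> (h i has_real_derivative h1 i x) (at x)" "\<And>i x. i \<in> F ==> (h1 i has_real_derivative h2 i x) (at x)"
  and b: "\<And>i x. i \<in> F ==> \<bar>\<Psi> i x\<bar> \<le> B i" "\<And>i x. i \<in> F ==> \<bar>h i x\<bar> \<le> B i"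
   "\<And>i x. i \<in> F ==> \<bar>h1 i x\<bar> \<le> B i" "\<And>i x. i \<in> F ==> \<bar>h2 i x\<bar> \<le> B i"
  by blast+
 have D: "((\<lambda>x. \<Sum>i\<in>F. t i * f i x) has_real_derivative (\<Sum>i\<in>F. t i * f' i x)) (at x)"
  if "\<And>i x. i \<in> F ==> (f i has_real_derivative f' i x) (at x)" for f f' x
  using that by (intro DERIV_sum DERIV_cmult) auto
 have bd: "\<bar>\<Sum>i\<in>F. t i * f i x\<bar> \<le> (\<Sum>i\<in>F. \<bar>t i\<bar> * B i)" if "\<And>i x. i \<in> F ==> \<bar>f i x\<bar> \<le> B i" for f x
  by (rule order_trans[OF sum_abs], rule sum_mono) (use that in \<open>simp add: abs_mult mult_left_mono\<close>)
 have "periodic1 (\<lambda>x. \<Sum>i\<in>F. t i * \<Psi> i x)" using assms(2) by (simp add: profile_def periodic1_def)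
 then show ?thesis unfolding profile_def
  using D[of \<Psi> h] D[of h h1] D[of h1 h2] bd[of \<Psi>] bd[of h] bd[of h1] bd[of h2] d b
  by (intro conjI exI[of _ "\<lambda>x. \<Sum>i\<in>F. t i * h1 i x"] exI[of _ "\<lambda>x. \<Sum>i\<in>F. t i * h2 i x"]) auto
qed

text \<open>The moment bounds are available only from \<open>n0\<close> on, so
  \<open>cf_convergence\<close> is applied to the shifted sequence.\<close>

lemma conv_in_distrI:
 fixes M :: "nat => 's measure" and Y :: "'w => nat => real"
 assumes M: "\<And>n. prob_space (M n)" and N: "prob_space N"
  and X: "\<And>n i. i < k ==> (\<lambda>\<omega>. X n \<omega> i) \<in> borel_measurable (M n)"
  and X2: "\<And>n i. n \<ge> n0 ==> i < k ==> integrable (M n) (\<lambda>\<omega>. (X n \<omega> i)^2)" "\<And>n i. n \<ge> n0 ==> i < k ==> (\<integral>\<omega>. (X n \<omega> i)^2 \<partial>M n) \<le> V i"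
  and Y: "\<And>i. i < k ==> (\<lambda>\<omega>. Y \<omega> i) \<in> borel_measurable N"
  and Y2: "\<And>i. i < k ==> integrable N (\<lambda>\<omega>. (Y \<omega> i)^2)"
  and cf: "\<And>t. (\<lambda>n. \<integral>\<omega>. cis (\<Sum>i<k. t i * X n \<omega> i) \<partial>M n) \<longlonglongrightarrow> (\<integral>\<omega>. cis (\<Sum>i<k. t i * Y \<omega> i) \<partial>N)"
 shows "conv_in_distr k M X N Y"
 unfolding conv_in_distr_def
proof (intro allI impI)
 fix \<phi> :: "(nat => real) => real"
 assume \<phi>: "continuous_map (Euclidean_space k) euclideanreal \<phi> \<and> bounded (\<phi> ` topspace (Euclidean_space k))"
 have dom: "{x :: nat => real. \<forall>i\<ge>k. x i = 0} = {x. \<forall>i. i \<notin> {..<k} \<longrightarrow> x i = 0}" by (auto simp: not_less)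
 have cont: "continuous_on {x. \<forall>i. i \<notin> {..<k} \<longrightarrow> x i = 0} \<phi>"
  using \<phi> unfolding Euclidean_space_def euclidean_product_topology dom by simp
 obtain B where B: "\<And>x. (\<forall>i. i \<notin> {..<k} \<longrightarrow> x i = 0) ==> \<bar>\<phi> x\<bar> \<le> B"
  using \<phi> unfolding topspace_Euclidean_space dom bounded_iff by auto
 define W where "W = (\<Sum>i<k. max (V i) (\<integral>\<omega>. (Y \<omega> i)^2 \<partial>N))"
 have nn: "0 \<le> max (V i) (\<integral>\<omega>. (Y \<omega> i)^2 \<partial>N)" for i by (simp add: le_max_iff_disj)
 have W: "max (V i) (\<integral>\<omega>. (Y \<omega> i)^2 \<partial>N) \<le> W" if "i < k" for i
  unfolding W_def using that nn by (intro member_le_sum) auto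
 have VW: "V i \<le> W" "(\<integral>\<omega>. (Y \<omega> i)^2 \<partial>N) \<le> W" if "i < k" for i using W[OF that] by auto
 have VX: "(\<integral>\<omega>. (X (n + n0) \<omega> i)^2 \<partial>M (n + n0)) \<le> W" if "i < k" for i n
  using X2(2)[OF _ that, of "n + n0"] VW(1)[OF that] by simp
 have vec: "vec k v = zero_outside {..<k} v" for v by (simp add: vec_def zero_outside_def fun_eq_iff)
 have "(\<lambda>n. \<integral>\<omega>. \<phi> (zero_outside {..<k} (X (n + n0) \<omega>)) \<partial>M (n + n0)) \<longlonglongrightarrow> (\<integral>\<omega>. \<phi> (zero_outside {..<k} (Y \<omega>)) \<partial>N)"
 proof (rule cf_convergence[where V=W and B=B])
  show "(\<lambda>n. \<integral>\<omega>. cis (\<Sum>i<k. t i * X (n + n0) \<omega> i) \<partial>M (n + n0)) \<longlonglongrightarrow> (\<integral>\<omega>. cis (\<Sum>i<k. t i * Y \<omega> i) \<partial>N)" for t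
   by (rule LIMSEQ_ignore_initial_segment[OF cf])
 qed (use M N X X2(1) Y Y2 VW VX cont B in auto)
 then show "(\<lambda>n. \<integral>\<omega>. \<phi> (vec k (X n \<omega>)) \<partial>M n) \<longlonglongrightarrow> (\<integral>\<omega>. \<phi> (vec k (Y \<omega>)) \<partial>N)"
  unfolding vec by (rule LIMSEQ_offset)
qed

context stationary_sequence
begin

text \<open>Cramer-Wold: a linear combination of test functions is again one, and the field is
  linear, so the result for a single profile gives the joint characteristic function.\<close>

lemma smooth_fluct_cf_tendsto:
 fixes k :: nat
 assumes H: "\<And>i. i < k ==> H i \<in> smooth_mean_zero"
 shows "(\<lambda>n. \<integral>s. cis (\<Sum>i<k. t i * fluct_field n (H i) s) \<partial>\<mu> n) \<longlonglongrightarrow>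
  complex_of_real (exp (- (\<Sum>i<k. \<Sum>j<k. t i * t j * limit_cov a (H i) (H j)) / 2))"
proof -
 have "\<forall>i\<in>{..<k}. \<exists>B. profile B (antideriv (H i)) (H i)" using smooth_mean_zeroD(2) H by blast
 then obtain B where B: "\<And>i. i \<in> {..<k} ==> profile (B i) (antideriv (H i)) (H i)" by metis
 let ?\<Psi> = "\<lambda>x. \<Sum>i<k. t i * antideriv (H i) x" and ?h = "\<lambda>x. \<Sum>i<k. t i * H i x"
 have prof: "profile (\<Sum>i<k. \<bar>t i\<bar> * B i) ?\<Psi> ?h" by (rule profile_linear_combination[OF _ B]) auto
 have L2: "H i \<in> L2_mean_zero" if "i < k" for i using H[OF that] by (rule smooth_mean_zeroD)
 note A = antideriv_props[OF L2_mean_zeroD(2,5,6)[OF L2]]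
 have "integral {0..1} ?\<Psi> = (\<Sum>i<k. t i * integral {0..1} (antideriv (H i)))"
  using loc_integrable_integral(1)[OF A(3)] by (subst integral_sum) (auto intro!: integrable_on_mult_right)
 then have z: "integral {0..1} ?\<Psi> = 0" using A(4) by simp
 have sq: "(LINT u:{0..1}|lborel. (f u)^2) = integral {0..1} (\<lambda>u. (f u)^2)" if "continuous_on UNIV f" for f :: "real => real"
  using that by (intro loc_integrable_integral(2) continuous_loc_integrable continuous_intros)
 have c1: "continuous_on UNIV ?h" using smooth_mean_zeroD(3)[OF H] by (intro continuous_intros) auto
 have c2: "continuous_on UNIV ?\<Psi>" using A(2) by (intro continuous_intros) auto
 have v: "limit_var ?\<Psi> ?h = (\<Sum>i<k. \<Sum>j<k. t i * t j * limit_cov a (H i) (H j))"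
  unfolding limit_var_def[OF prof z] by (subst limit_cov_quadratic_form) (use L2 in \<open>auto simp: sq[OF c1] sq[OF c2]\<close>)
 have "fluct_field n ?h s = (\<Sum>i<k. t i * fluct_field n (H i) s)" for n s
 proof -
  have "(\<Sum>x\<in>torus n. ?h (real_of_int x / real n) * (real (s x) - 1 / 2)) = (\<Sum>i<k. t i * (\<Sum>x\<in>torus n. H i (real_of_int x / real n) * (real (s x) - 1 / 2)))"
   unfolding sum_distrib_right sum_distrib_left by (subst sum.swap) (simp add: mult.assoc)
  then show ?thesis unfolding fluct_field_def by (simp add: sum_distrib_left mult.left_commute)
 qed
 then show ?thesis using fluct_cf_tendsto[OF prof z] unfolding v by simp
qed

lemma smooth_fluct_second_moment:
 assumes "H \<in> smooth_mean_zero"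
 shows "\<exists>V. \<forall>n\<ge>n0. (\<integral>s. (fluct_field n H s)^2 \<partial>\<mu> n) \<le> V"
proof -
 obtain B where B: "profile B (antideriv H) H" using smooth_mean_zeroD(2)[OF assms] by blast
 have z: "integral {0..1} (antideriv H) = 0"
  using antideriv_props(4)[OF L2_mean_zeroD(2,5,6)[OF smooth_mean_zeroD(1)[OF assms]]] .
 show ?thesis using fluct_second_moment[OF B z] by blast
qed

end

theorem theorem2p3:
  fixes \<theta> :: real
  shows "\<exists>a0>0. \<forall>a. 0 < a \<and> a < a0 \<longrightarrow>
    (\<exists>(P :: ((real \<Rightarrow> real) \<Rightarrow> real) measure) (y :: (real \<Rightarrow> real) \<Rightarrow> ((real \<Rightarrow> real) \<Rightarrow> real) \<Rightarrow> real).
       centered_gaussian_field P L2_mean_zero y (limit_cov a) \<and>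
       (\<forall>k (H :: nat \<Rightarrow> real \<Rightarrow> real). (\<forall>i<k. H i \<in> smooth_mean_zero) \<longrightarrow>
          conv_in_distr k (\<lambda>n. measure_pmf (mu_ss \<theta> a n)) (\<lambda>n \<eta> i. fluct_field n (H i) \<eta>)
            P (\<lambda>\<omega> i. y (H i) \<omega>)))"
proof -
 \<comment> \<open>The value of \<open>rate_const\<close>, so that a < 1 / (2 R) is the smallness
   that closes the Dirichlet estimate.\<close>
 define R where "R = 1000000000 + 100000 * (16 * \<bar>\<theta>\<bar> + 560)^2"
 have R: "R > 0" unfolding R_def by (rule add_pos_nonneg) auto
 show ?thesis
 proof (intro exI[of _ "1 / (2 * R)"] conjI allI impI)
  show "0 < 1 / (2 * R)" using R by simp
  fix a assume a: "0 < a \<and> a < 1 / (2 * R)"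
  have aR: "a * R \<le> 1/2" using a R by (simp add: field_simps)
  interpret stationary_sequence \<theta> a
   by unfold_locales (use a aR in \<open>auto simp only: R_def\<close>)
  have psd: "pos_semidef L2_mean_zero (limit_cov a)" using a by (intro pos_semidef_limit_cov) simp
  obtain P :: "((real => real) => real) measure"
   where P: "centered_gaussian_field P L2_mean_zero (\<lambda>H \<omega>. \<omega> H) (limit_cov a)"
    and cf: "\<And>J t. finite J ==> J \<subseteq> L2_mean_zero ==>
     (\<integral>\<omega>. cis (\<Sum>G\<in>J. t G * \<omega> G) \<partial>P) = complex_of_real (exp (- (\<Sum>G\<in>J. \<Sum>G'\<in>J. t G * t G' * limit_cov a G G') / 2))"
   using gaussian_field_exists[OF psd] by blast
  have prob: "prob_space P" using P by (simp add: centered_gaussian_field_def)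
  have meas: "(\<lambda>\<omega>. \<omega> G) \<in> borel_measurable P" if "G \<in> L2_mean_zero" for G
  proof -
   have "gaussian_rv P (\<lambda>\<omega>. \<Sum>H\<in>{G}. 1 * \<omega> H)"
    using P that unfolding centered_gaussian_field_def by (elim conjE allE[of _ "{G}"] allE[of _ "\<lambda>_. 1"]) auto
   then show ?thesis by (simp add: gaussian_rv_def)
  qed
  have "conv_in_distr k (\<lambda>n. measure_pmf (mu_ss \<theta> a n)) (\<lambda>n \<eta> i. fluct_field n (H i) \<eta>) P (\<lambda>\<omega> i. \<omega> (H i))"
   if H: "\<forall>i<k. H i \<in> smooth_mean_zero" for k and H :: "nat => real => real"
  proof -
   have L2: "H i \<in> L2_mean_zero" if "i < k" for i using H that smooth_mean_zeroD(1) by blast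
   have "\<forall>i\<in>{..<k}. \<exists>V. \<forall>n\<ge>n0. (\<integral>\<eta>. (fluct_field n (H i) \<eta>)^2 \<partial>\<mu> n) \<le> V"
    using H smooth_fluct_second_moment by blast
   then obtain V where V: "\<And>i n. i < k ==> n \<ge> n0 ==> (\<integral>\<eta>. (fluct_field n (H i) \<eta>)^2 \<partial>\<mu> n) \<le> V i" by (metis lessThan_iff)
   have cfY: "(\<integral>\<omega>. cis (\<Sum>i<k. t i * \<omega> (H i)) \<partial>P) = complex_of_real (exp (- (\<Sum>i<k. \<Sum>j<k. t i * t j * limit_cov a (H i) (H j)) / 2))" for t
   proof -
    \<comment> \<open>The functions \<open>H i\<close> need not be distinct, while the field is
      indexed by functions: coefficients of equal ones are added up.\<close>
    define c where "c G = (\<Sum>i\<in>{i \<in> {..<k}. H i = G}. t i)" for G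
    have s: "(\<Sum>G\<in>H ` {..<k}. c G * f G) = (\<Sum>i<k. t i * f (H i))" for f :: "(real => real) => real"
     unfolding c_def sum_distrib_right
     by (subst sum.image_gen[of "{..<k}" _ H]) (auto intro!: sum.cong)
    have q: "(\<Sum>G\<in>H ` {..<k}. \<Sum>G'\<in>H ` {..<k}. c G * c G' * limit_cov a G G') = (\<Sum>i<k. \<Sum>j<k. t i * t j * limit_cov a (H i) (H j))"
     unfolding mult.assoc sum_distrib_left[symmetric] s ..
    have "H ` {..<k} \<subseteq> L2_mean_zero" using L2 by auto
    from cf[OF _ this, of c] show ?thesis unfolding q s by simp
   qed
   show ?thesis
   proof (rule conv_in_distrI[where V=V and ?n0.0=n0])
    show "integrable P (\<lambda>\<omega>. (\<omega> (H i))^2)" if "i < k" for i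
     by (rule gaussian_coordinates_square_integrable[OF prob meas _ pos_semidef_subset[OF psd] cf, of "{H i}"])
       (use L2[OF that] in auto)
    show "(\<lambda>n. \<integral>\<eta>. cis (\<Sum>i<k. t i * fluct_field n (H i) \<eta>) \<partial>\<mu> n) \<longlonglongrightarrow> (\<integral>\<omega>. cis (\<Sum>i<k. t i * \<omega> (H i)) \<partial>P)" for t
     unfolding cfY by (rule smooth_fluct_cf_tendsto) (use H in blast)
   qed (use prob meas L2 V in \<open>auto intro: measure_pmf.prob_space_axioms integrable_measure_pmf_finite finite_support\<close>)
  qed
  then show "\<exists>(P :: ((real => real) => real) measure) (y :: (real => real) => ((real => real) => real) => real).
    centered_gaussian_field P L2_mean_zero y (limit_cov a) \<and>
    (\<forall>k (H :: nat => real => real). (\<forall>i<k. H i \<in> smooth_mean_zero) \<longrightarrow>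
     conv_in_distr k (\<lambda>n. measure_pmf (mu_ss \<theta> a n)) (\<lambda>n \<eta> i. fluct_field n (H i) \<eta>)
      P (\<lambda>\<omega> i. y (H i) \<omega>))"
   using P by blast
 qed
qed

end
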